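(* Let $G$ be a finite group with trivial center, and let $k$ be a field. Suppose there is a $k$-regular Galois extension $F/k(T)$ with Galois group $G$, whose corresponding cover $\pi:X\to\mathbb{P}^1_k$ has an unramified $k$-point $P$. Then given a Galois field extension $E/k$ of group $H\subset G$, there exists a geometrically Galois extension $\mathcal E/k(T)$, with group $G$, that specializes to $E^{(G:H)}/k$ at $\pi(P)\in\mathbb{P}^1(k)$, and whose constant extension in the Galois closure is $E$.
   Context: $\overline k$ is an algebraic closure of $k$. A finite separable extension $F/k(T)$ is $k$-regular if $F\cap\overline k=k$; the corresponding cover $X\to\mathbb{P}^1_k$ is the normalization of $\mathbb{P}^1_k$ in $F$. An unramified $k$-point is a point $P\in X(k)$ lying above a point $\pi(P)\in\mathbb P^1(k)$ that is not a branch point. A finite field extension $\mathcal E/k(T)$ is geometrically Galois with group $G$ if $\mathcal E\otimes_k\overline k$ is a Galois field extension of $\overline k(T)$ with Galois group $G$. The specialization of a finite $k$-regular extension $\mathcal E/k(T)$ at an unbranched point $t_0\in\mathbb P^1(k)$ is the étale $k$-algebra $U\otimes_VV/\mathfrak p_{t_0}$, where $\mathrm{Spec}(V)$ is an affine neighborhood of $t_0$, $\mathfrak p_{t_0}$ is the maximal ideal of $V$ corresponding to $t_0$ (so $V/\mathfrak p_{t_0}=k$), and $U$ is the integral closure of $V$ in $\mathcal E$. $E^{(G:H)}$ denotes the product of $(G:H)$ copies of $E$, where $(G:H)$ is the index of $H$ in $G$. The constant extension in the Galois closure of $\mathcal E/k(T)$ is $(\widehat{\mathcal E}\cap\overline k)/k$,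 where $\widehat{\mathcal E}$ is the Galois closure of $\mathcal E$ over $k(T)$. *)

theory Defs
  imports
    "HOL-Algebra.Algebra"
    "HOL-Algebra.Algebraic_Closure_Type"
    "HOL-Computational_Algebra.Computational_Algebra"
    "HOL-Library.Poly_Mapping"
begin

section \<open>Galois extensions\<close>

definition gal_group :: "('a, 'm) ring_scheme \<Rightarrow> 'a set \<Rightarrow> ('a \<Rightarrow> 'a) monoid" where
  "gal_group L K = (BijGroup (carrier L))
     \<lparr>carrier := {\<sigma> \<in> Bij (carrier L). \<sigma> \<in> ring_hom L L \<and> (\<forall>x\<in>K. \<sigma> x = x)}\<rparr>"

text \<open>A finite extension \<open>L/K\<close> is Galois if \<open>K\<close> is the fixed field of its automorphism group
  (Artin's definition).\<close>

definition galois_extension :: "('a, 'm) ring_scheme \<Rightarrow> 'a set \<Rightarrow> bool" where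
  "galois_extension L K \<longleftrightarrow>
     field L \<and> subfield K L \<and> ring.finite_dimension L K (carrier L) \<and>
     {x \<in> carrier L. \<forall>\<sigma>\<in>carrier (gal_group L K). \<sigma> x = x} = K"


section \<open>Tensor products of commutative algebras\<close>

text \<open>The integral monoid ring on the set \<open>A \<times> B\<close> with componentwise multiplication of
  basis elements; it is the free abelian group on \<open>A \<times> B\<close> as an additive group.\<close>

definition free_pair_ring ::
  "('a, 'm) ring_scheme \<Rightarrow> ('b, 'n) ring_scheme \<Rightarrow> (('a \<times> 'b) \<Rightarrow>\<^sub>0 int) ring" where
  "free_pair_ring A B =
     \<lparr>carrier = {x. Poly_Mapping.keys x \<subseteq> carrier A \<times> carrier B},
      monoid.mult = (\<lambda>x y. frag_extend (\<lambda>(a, b).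
        frag_extend (\<lambda>(a', b'). frag_of (a \<otimes>\<^bsub>A\<^esub> a', b \<otimes>\<^bsub>B\<^esub> b')) y) x),
      one = frag_of (\<one>\<^bsub>A\<^esub>, \<one>\<^bsub>B\<^esub>),
      ring.zero = 0,
      add = (+)\<rparr>"

definition tensor_ideal ::
  "('r, 'l) ring_scheme \<Rightarrow> ('a, 'm) ring_scheme \<Rightarrow> ('b, 'n) ring_scheme \<Rightarrow>
     ('r \<Rightarrow> 'a) \<Rightarrow> ('r \<Rightarrow> 'b) \<Rightarrow> (('a \<times> 'b) \<Rightarrow>\<^sub>0 int) set" where
  "tensor_ideal R A B f g = genideal (free_pair_ring A B)
     ({frag_of (a \<oplus>\<^bsub>A\<^esub> a', b) - frag_of (a, b) - frag_of (a', b) |a a' b.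
         a \<in> carrier A \<and> a' \<in> carrier A \<and> b \<in> carrier B} \<union>
      {frag_of (a, b \<oplus>\<^bsub>B\<^esub> b') - frag_of (a, b) - frag_of (a, b') |a b b'.
         a \<in> carrier A \<and> b \<in> carrier B \<and> b' \<in> carrier B} \<union>
      {frag_of (f r \<otimes>\<^bsub>A\<^esub> a, b) - frag_of (a, g r \<otimes>\<^bsub>B\<^esub> b) |r a b.
         r \<in> carrier R \<and> a \<in> carrier A \<and> b \<in> carrier B})"

text \<open>\<open>A \<otimes>\<^sub>R B\<close> for commutative \<open>R\<close>-algebras with structure maps
  \<open>f : R \<rightarrow> A\<close> and \<open>g : R \<rightarrow> B\<close>. The ideal generated by the bilinearity relations is
  already generated by them as a subgroup, since multiplying a relation by a basis element
  gives a relation again; so this is the usual tensor product.\<close>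

definition tensor_ring ::
  "('r, 'l) ring_scheme \<Rightarrow> ('a, 'm) ring_scheme \<Rightarrow> ('b, 'n) ring_scheme \<Rightarrow>
     ('r \<Rightarrow> 'a) \<Rightarrow> ('r \<Rightarrow> 'b) \<Rightarrow> (('a \<times> 'b) \<Rightarrow>\<^sub>0 int) set ring" where
  "tensor_ring R A B f g = free_pair_ring A B Quot tensor_ideal R A B f g"

definition pure_tensor ::
  "('r, 'l) ring_scheme \<Rightarrow> ('a, 'm) ring_scheme \<Rightarrow> ('b, 'n) ring_scheme \<Rightarrow>
     ('r \<Rightarrow> 'a) \<Rightarrow> ('r \<Rightarrow> 'b) \<Rightarrow> 'a \<Rightarrow> 'b \<Rightarrow> (('a \<times> 'b) \<Rightarrow>\<^sub>0 int) set" where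
  "pure_tensor R A B f g a b = tensor_ideal R A B f g +>\<^bsub>free_pair_ring A B\<^esub> frag_of (a, b)"


section \<open>The rational function field and its algebraic closure\<close>

text \<open>All finite extensions of \<open>k\<close> and of \<open>k(T)\<close> are taken inside one algebraic closure
  \<open>\<Omega>\<close> of \<open>k(T)\<close>, with \<open>k\<close> the field underlying the type \<open>'k\<close>.\<close>

type_synonym 'k ratfun_closure = "'k poly fract alg_closure"

abbreviation sub_ring :: "'k::field ratfun_closure set \<Rightarrow> 'k ratfun_closure ring" where
  "sub_ring S \<equiv> ring_of_type_algebra\<lparr>carrier := S\<rparr>"

definition const_fun :: "'k::field \<Rightarrow> 'k ratfun_closure" where
  "const_fun c = to_ac (to_fract [:c:])"

definition ratfun_var :: "'k::field ratfun_closure" where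
  "ratfun_var = to_ac (to_fract [:0, 1:])"

definition base_field :: "'k::field ratfun_closure set" where
  "base_field = range const_fun"

definition ratfun_field :: "'k::field ratfun_closure set" where
  "ratfun_field = range to_ac"

text \<open>The algebraic closure of \<open>k\<close> in \<open>\<Omega>\<close>, which is an algebraic closure of \<open>k\<close>.\<close>

definition base_closure :: "'k::field ratfun_closure set" where
  "base_closure = {x. \<exists>p. p \<noteq> 0 \<and> (\<forall>i. Polynomial.coeff p i \<in> base_field) \<and> poly p x = 0}"

text \<open>\<open>rsquarefree\<close> says that there is no multiple root in the algebraically closed \<open>\<Omega>\<close>.\<close>

definition separable_over :: "'k::field ratfun_closure set \<Rightarrow> 'k ratfun_closure \<Rightarrow> bool" where
  "separable_over K x \<longleftrightarrow>
     (\<exists>p. (\<forall>i. Polynomial.coeff p i \<in> K) \<and> Polynomial.rsquarefree p \<and> poly p x = 0)"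

definition finite_extension :: "'k::field ratfun_closure set \<Rightarrow> bool" where
  "finite_extension L \<longleftrightarrow>
     subfield L ring_of_type_algebra \<and> ratfun_field \<subseteq> L \<and>
     ring.finite_dimension (ring_of_type_algebra :: 'k ratfun_closure ring) ratfun_field L"

definition k_regular :: "'k::field ratfun_closure set \<Rightarrow> bool" where
  "k_regular L \<longleftrightarrow>
     finite_extension L \<and> (\<forall>x\<in>L. separable_over ratfun_field x) \<and> L \<inter> base_closure = base_field"

definition galois_closure :: "'k::field ratfun_closure set \<Rightarrow> 'k ratfun_closure set" where
  "galois_closure L = \<Inter>{M. L \<subseteq> M \<and> galois_extension (sub_ring M) ratfun_field}"


section \<open>Geometrically Galois extensions\<close>

definition geometric_ring ::
  "'k::field ratfun_closure set \<Rightarrow> (('k ratfun_closure \<times> 'k ratfun_closure) \<Rightarrow>\<^sub>0 int) set ring" where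
  "geometric_ring L = tensor_ring (sub_ring base_field) (sub_ring L) (sub_ring base_closure) id id"

abbreviation geometric_tensor ::
  "'k::field ratfun_closure set \<Rightarrow> 'k ratfun_closure \<Rightarrow> 'k ratfun_closure \<Rightarrow>
     (('k ratfun_closure \<times> 'k ratfun_closure) \<Rightarrow>\<^sub>0 int) set" where
  "geometric_tensor L \<equiv> pure_tensor (sub_ring base_field) (sub_ring L) (sub_ring base_closure) id id"

text \<open>The copy of \<open>kbar(T)\<close> in \<open>L \<otimes>\<^sub>k kbar\<close>, generated by \<open>T \<otimes> 1\<close> and \<open>1 \<otimes> kbar\<close>.\<close>

definition geometric_base ::
  "'k::field ratfun_closure set \<Rightarrow> (('k ratfun_closure \<times> 'k ratfun_closure) \<Rightarrow>\<^sub>0 int) set set" where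
  "geometric_base L = generate_field (geometric_ring L)
     (insert (geometric_tensor L ratfun_var 1) (geometric_tensor L 1 ` base_closure))"

definition geometrically_galois ::
  "'k::field ratfun_closure set \<Rightarrow> ('g, 'm) monoid_scheme \<Rightarrow> bool" where
  "geometrically_galois L G \<longleftrightarrow>
     finite_extension L \<and>
     galois_extension (geometric_ring L) (geometric_base L) \<and>
     gal_group (geometric_ring L) (geometric_base L) \<cong> G"


section \<open>Points of the normalization of the projective line\<close>

datatype 'k proj_line = Affine 'k | Infinity

text \<open>For a constant field \<open>C\<close> (either \<open>k\<close> or \<open>kbar\<close>), the coordinate ring of the standard
  affine line containing \<open>t\<close> (\<open>C[T]\<close>, or \<open>C[1/T]\<close> for \<open>t = \<infinity>\<close>) and the maximal ideal of \<open>t\<close>.\<close>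

fun coordinate :: "'k::field proj_line \<Rightarrow> 'k ratfun_closure" where
  "coordinate (Affine a) = ratfun_var"
| "coordinate Infinity = inverse ratfun_var"

fun uniformizer :: "'k::field proj_line \<Rightarrow> 'k ratfun_closure" where
  "uniformizer (Affine a) = ratfun_var - const_fun a"
| "uniformizer Infinity = inverse ratfun_var"

definition chart :: "'k::field ratfun_closure set \<Rightarrow> 'k proj_line \<Rightarrow> 'k ratfun_closure set" where
  "chart C t = {poly p (coordinate t) |p. \<forall>i. Polynomial.coeff p i \<in> C}"

definition point_ideal :: "'k::field ratfun_closure set \<Rightarrow> 'k proj_line \<Rightarrow> 'k ratfun_closure set" where
  "point_ideal C t = cgenideal (sub_ring (chart C t)) (uniformizer t)"

definition integral_closure ::
  "'k::field ratfun_closure set \<Rightarrow> 'k ratfun_closure set \<Rightarrow> 'k ratfun_closure set" where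
  "integral_closure V L =
     {x \<in> L. \<exists>p. Polynomial.lead_coeff p = 1 \<and> (\<forall>i. Polynomial.coeff p i \<in> V) \<and> poly p x = 0}"

definition cover_chart ::
  "'k::field ratfun_closure set \<Rightarrow> 'k ratfun_closure set \<Rightarrow> 'k proj_line \<Rightarrow> 'k ratfun_closure set" where
  "cover_chart C L t = integral_closure (chart C t) L"

definition points_above ::
  "'k::field ratfun_closure set \<Rightarrow> 'k ratfun_closure set \<Rightarrow> 'k proj_line \<Rightarrow>
     'k ratfun_closure set set" where
  "points_above C L t =
     {P. primeideal P (sub_ring (cover_chart C L t)) \<and> P \<inter> chart C t = point_ideal C t}"

text \<open>\<open>X(k)\<close> for the cover \<open>X\<close> belonging to \<open>L/k(T)\<close>. A point is given by its image in the
  projective line together with a prime ideal of the corresponding chart of \<open>X\<close>, whose residue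
  field has to be \<open>k\<close>.\<close>

type_synonym 'k cover_point = "'k proj_line \<times> 'k ratfun_closure set"

definition rational_points :: "'k::field ratfun_closure set \<Rightarrow> 'k cover_point set" where
  "rational_points L =
     {(t, P). P \<in> points_above base_field L t \<and>
        (\<forall>u\<in>cover_chart base_field L t. \<exists>c\<in>base_field. u - c \<in> P)}"

definition cover_map :: "'k cover_point \<Rightarrow> 'k proj_line" where
  "cover_map = fst"

text \<open>Branch points are geometric: \<open>t\<close> is one if some point above \<open>t\<close> of the normalization of
  the projective line over \<open>kbar\<close> in the compositum of \<open>L\<close> and \<open>kbar\<close> has ramification index
  at least 2, i.e. if the square of its prime ideal contains the ideal of \<open>t\<close>.\<close>

definition branch_point :: "'k::field ratfun_closure set \<Rightarrow> 'k proj_line \<Rightarrow> bool" where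
  "branch_point L t \<longleftrightarrow>
     (let L' = generate_field ring_of_type_algebra (L \<union> base_closure) in
      \<exists>P\<in>points_above base_closure L' t.
        point_ideal base_closure t \<subseteq> ideal_prod (sub_ring (cover_chart base_closure L' t)) P P)"

definition unramified_rational_points :: "'k::field ratfun_closure set \<Rightarrow> 'k cover_point set" where
  "unramified_rational_points L = {P \<in> rational_points L. \<not> branch_point L (cover_map P)}"


section \<open>Specialization\<close>

definition residue_map ::
  "'k::field proj_line \<Rightarrow> 'k ratfun_closure \<Rightarrow> 'k ratfun_closure set" where
  "residue_map t v = point_ideal base_field t +>\<^bsub>sub_ring (chart base_field t)\<^esub> v"

definition residue_ring :: "'k::field proj_line \<Rightarrow> 'k ratfun_closure set ring" where
  "residue_ring t = sub_ring (chart base_field t) Quot point_ideal base_field t"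

definition specialization ::
  "'k::field ratfun_closure set \<Rightarrow> 'k proj_line \<Rightarrow>
     (('k ratfun_closure \<times> 'k ratfun_closure set) \<Rightarrow>\<^sub>0 int) set ring" where
  "specialization L t =
     tensor_ring (sub_ring (chart base_field t)) (sub_ring (cover_chart base_field L t))
       (residue_ring t) id (residue_map t)"

definition specialization_scalar ::
  "'k::field ratfun_closure set \<Rightarrow> 'k proj_line \<Rightarrow> 'k ratfun_closure \<Rightarrow>
     (('k ratfun_closure \<times> 'k ratfun_closure set) \<Rightarrow>\<^sub>0 int) set" where
  "specialization_scalar L t c =
     pure_tensor (sub_ring (chart base_field t)) (sub_ring (cover_chart base_field L t))
       (residue_ring t) id (residue_map t) c \<one>\<^bsub>residue_ring t\<^esub>"

text \<open>\<open>L/k(T)\<close> is \<open>k\<close>-regular, \<open>t\<close> is not a branch point, and the specialization at \<open>t\<close> is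
  isomorphic, as a \<open>k\<close>-algebra, to the product of \<open>n\<close> copies of \<open>E\<close>.\<close>

definition specializes_to_power ::
  "'k::field ratfun_closure set \<Rightarrow> 'k proj_line \<Rightarrow> 'k ratfun_closure set \<Rightarrow> nat \<Rightarrow> bool" where
  "specializes_to_power L t E n \<longleftrightarrow>
     k_regular L \<and> \<not> branch_point L t \<and>
     (\<exists>h\<in>ring_iso (specialization L t) (RDirProd_list (replicate n (sub_ring E))).
        \<forall>c\<in>base_field. h (specialization_scalar L t c) = replicate n c)"

end

theory Submission
  imports Defs
begin

text \<open>\<open>H\<close> acts on \<open>F\<close> through \<open>G = Gal(F/k(T))\<close> and on \<open>E\<close> as \<open>Gal(E/k)\<close>; the extension
  \<open>\<E>\<close> is the fixed field of the diagonal of \<open>H \<times> H \<subseteq> G \<times> H\<close> acting on the compositum \<open>F E\<close>.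
  Since \<open>\<E> kbar = F kbar\<close>, it is geometrically Galois with group \<open>G\<close> and has the branch points
  of \<open>F\<close>.

  The local ring of \<open>P\<close> is a valuation ring with residue field \<open>k\<close>. Scaling the coefficients of a
  linear relation into it and reducing shows that \<open>F\<close> and \<open>kbar\<close> are linearly disjoint over \<open>k\<close>,
  so that \<open>G \<times> H\<close> does act on \<open>F E\<close> and \<open>F E \<inter> kbar = E\<close>. As \<open>P\<close> is unramified, the \<open>k\<close>-points
  above \<open>\<pi>(P)\<close> are the distinct points \<open>g P\<close>, so the residue map \<open>\<Phi>\<close> of \<open>F E\<close> at \<open>P\<close> with values in
  \<open>E\<close> gives residue maps \<open>\<Phi> \<circ> g\<close> of \<open>\<E>\<close>. These depend only on \<open>H g\<close>, up to \<open>Gal(E/k)\<close>, and together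
  identify the specialization of \<open>\<E>\<close> with \<open>E\<^bsup>(G:H)\<^esup>\<close>.

  A Galois extension of \<open>k(T)\<close> containing \<open>\<E>\<close> meets \<open>F E\<close> in a field belonging to a normal subgroup
  of \<open>G \<times> H\<close> inside the diagonal of \<open>H\<close>. Such a subgroup commutes with \<open>G \<times> 1\<close> because it meets it
  trivially, so its first components are central in \<open>G\<close> and it is trivial. Hence \<open>F E\<close> is the
  Galois closure of \<open>\<E>\<close>.\<close>


section \<open>Subrings and integral elements\<close>

text \<open>The integral closure of V in F E is not known in advance to be free or etale over V, and
  the points above pi(P) are not given as a list. One construction closes both gaps. A list of pairs
  (z, u) is read as the sum of the tensors of z and u, and \<open>pairing\<close> gives its
  coordinates, the sums of z g(u), one for each group element g. A product of differences over all g
  other than 1 kills every coordinate except the one at 1; if d is that last coordinate, then d x is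
  the sum of the tr(x z) u. Over a field d can be scaled to 1, which yields dual bases, elements of
  trace 1 and the independence of automorphisms. Over the integral closure it cannot, but the
  factors can be chosen with nonzero residue at P, because distinct group elements give distinct
  residue maps, and this is what the absence of ramification provides. An element all of whose
  residues vanish is then divisible by the uniformizer, so the specialization has neither further
  points nor nilpotents.\<close>

definition subring_set :: "'a::comm_ring_1 set \<Rightarrow> bool" where
  "subring_set S \<longleftrightarrow> 1 \<in> S \<and> (\<forall>x\<in>S. \<forall>y\<in>S. x - y \<in> S \<and> x * y \<in> S)"

definition subfield_set :: "'a::field set \<Rightarrow> bool" where
  "subfield_set S \<longleftrightarrow> subring_set S \<and> (\<forall>x\<in>S. inverse x \<in> S)"

lemma subfield_imp_subring: "subfield_set S \<Longrightarrow> subring_set S"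
  by (simp add: subfield_set_def)

context
  fixes S :: "'a::comm_ring_1 set"
  assumes S: "subring_set S"
begin

lemma subring_1: "1 \<in> S"
  using S by (simp add: subring_set_def)

lemma subring_diff: "x \<in> S \<Longrightarrow> y \<in> S \<Longrightarrow> x - y \<in> S"
  using S by (simp add: subring_set_def)

lemma subring_mult: "x \<in> S \<Longrightarrow> y \<in> S \<Longrightarrow> x * y \<in> S"
  using S by (simp add: subring_set_def)

lemma subring_0: "0 \<in> S"
  using subring_diff[OF subring_1 subring_1] by simp

lemma subring_uminus: "x \<in> S \<Longrightarrow> - x \<in> S"
  using subring_diff[OF subring_0] by simp

lemma subring_add: "x \<in> S \<Longrightarrow> y \<in> S \<Longrightarrow> x + y \<in> S"
  using subring_diff[OF _ subring_uminus] by fastforce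

lemma subring_power: "x \<in> S \<Longrightarrow> x ^ n \<in> S"
  by (induction n) (auto intro: subring_1 subring_mult)

lemma subring_sum: "(\<And>i. i \<in> I \<Longrightarrow> f i \<in> S) \<Longrightarrow> sum f I \<in> S"
  by (induction I rule: infinite_finite_induct) (auto intro: subring_0 subring_add)

lemma subring_prod: "(\<And>i. i \<in> I \<Longrightarrow> f i \<in> S) \<Longrightarrow> prod f I \<in> S"
  by (induction I rule: infinite_finite_induct) (auto intro: subring_1 subring_mult)

lemma subring_sum_list: "(\<And>i. i \<in> set xs \<Longrightarrow> f i \<in> S) \<Longrightarrow> sum_list (map f xs) \<in> S"
  by (induction xs) (auto intro: subring_0 subring_add)

lemmas subring_closed =
  subring_0 subring_1 subring_diff subring_mult subring_uminus subring_add subring_power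

end

lemma subfield_inverse: "subfield_set S \<Longrightarrow> x \<in> S \<Longrightarrow> inverse x \<in> S"
  by (simp add: subfield_set_def)

lemma subfield_divide: "subfield_set S \<Longrightarrow> x \<in> S \<Longrightarrow> y \<in> S \<Longrightarrow> x / y \<in> S"
  by (simp add: subfield_set_def subring_set_def field_class.field_divide_inverse)

lemma subring_set_Int: "subring_set A \<Longrightarrow> subring_set B \<Longrightarrow> subring_set (A \<inter> B)"
  by (simp add: subring_set_def)

section \<open>Polynomials over a subring and integral elements\<close>

definition coeffs_in :: "'a::zero set \<Rightarrow> 'a poly \<Rightarrow> bool" where
  "coeffs_in V p \<longleftrightarrow> (\<forall>i. Polynomial.coeff p i \<in> V)"

lemma coeffs_in_mono: "coeffs_in V p \<Longrightarrow> V \<subseteq> W \<Longrightarrow> coeffs_in W p"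
  by (auto simp: coeffs_in_def)

context
  fixes V :: "'a::comm_ring_1 set"
  assumes V: "subring_set V"
begin

lemma coeffs_in_diff: "coeffs_in V p \<Longrightarrow> coeffs_in V q \<Longrightarrow> coeffs_in V (p - q)"
  using V by (auto simp: coeffs_in_def intro: subring_diff)

lemma coeffs_in_mult: "coeffs_in V p \<Longrightarrow> coeffs_in V q \<Longrightarrow> coeffs_in V (p * q)"
  using V by (auto simp: coeffs_in_def Polynomial.coeff_mult intro!: subring_sum subring_mult)

lemma coeffs_in_0: "coeffs_in V 0"
  using V by (auto simp: coeffs_in_def intro: subring_0)

lemma coeffs_in_pCons: "c \<in> V \<Longrightarrow> coeffs_in V p \<Longrightarrow> coeffs_in V (pCons c p)"
  by (auto simp: coeffs_in_def coeff_pCons split: nat.split)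

lemma coeffs_in_1: "coeffs_in V 1"
  unfolding one_pCons using V by (intro coeffs_in_pCons coeffs_in_0 subring_1)

lemma coeffs_in_smult: "c \<in> V \<Longrightarrow> coeffs_in V p \<Longrightarrow> coeffs_in V (smult c p)"
  using V by (auto simp: coeffs_in_def intro: subring_mult)

lemma poly_in_subring: "coeffs_in V p \<Longrightarrow> x \<in> V \<Longrightarrow> poly p x \<in> V"
  using V by (auto simp: poly_altdef coeffs_in_def intro!: subring_sum subring_mult subring_power)

end

definition integral_over :: "'a::comm_ring_1 set \<Rightarrow> 'a \<Rightarrow> bool" where
  "integral_over V x \<longleftrightarrow> (\<exists>p. lead_coeff p = 1 \<and> coeffs_in V p \<and> poly p x = 0)"

lemma integral_over_mono: "integral_over V x \<Longrightarrow> V \<subseteq> W \<Longrightarrow> integral_over W x"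
  unfolding integral_over_def using coeffs_in_mono by blast

lemma integral_over_self:
  assumes "subring_set V" "x \<in> V" shows "integral_over V x"
  unfolding integral_over_def
  by (rule exI[of _ "[:-x, 1:]"]) (use assms in \<open>auto intro!: coeffs_in_pCons coeffs_in_0 subring_closed\<close>)

lemma lead_coeff_add_lower:
  fixes p q :: "'a::comm_ring_1 poly"
  assumes "lead_coeff p = 1" "Polynomial.degree q < Polynomial.degree p"
  shows "lead_coeff (p - q) = 1 \<and> Polynomial.degree (p - q) = Polynomial.degree p"
proof -
  have "Polynomial.degree (p - q) = Polynomial.degree p"
    using degree_add_eq_left[of "- q" p] assms by simp
  thus ?thesis using assms by (simp add: coeff_eq_0)
qed

text \<open>Fraction-free Gaussian elimination, keeping the diagonal monic of degree \<open>d\<close> and dominant.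
  It replaces the determinant in the usual proof that a module criterion implies integrality.\<close>

lemma integral_by_elimination:
  fixes x :: "'a::idom"
  assumes V: "subring_set V" and "finite I"
    and "\<forall>i\<in>I. lead_coeff (M i i) = 1 \<and> Polynomial.degree (M i i) = d"
    and "\<forall>i\<in>I. \<forall>j\<in>I. coeffs_in V (M i j)"
    and "\<forall>i\<in>I. \<forall>j\<in>I. i \<noteq> j \<longrightarrow> Polynomial.degree (M i j) < d"
    and "\<forall>i\<in>I. (\<Sum>j\<in>I. poly (M i j) x * e j) = 0"
    and "\<exists>i\<in>I. e i \<noteq> 0"
  shows "integral_over V x"
  using assms(2-)
proof (induction I arbitrary: M d rule: finite_induct)
  case empty
  then show ?case by simp
next
  case (insert n I)
  show ?case
  proof (cases "\<exists>i\<in>I. e i \<noteq> 0")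
    case False
    \<comment> \<open>If only \<open>e n\<close> can be nonzero, row n already says that
      \<open>M n n\<close> vanishes at x.\<close>
    then have "e n \<noteq> 0" "(\<Sum>j\<in>I. poly (M n j) x * e j) = 0"
      using insert.prems(5) by auto
    then have "poly (M n n) x = 0"
      using insert.prems(4) insert.hyps by auto
    then show ?thesis
      using insert.prems(1,2) unfolding integral_over_def by auto
  next
    case True
    \<comment> \<open>Row i times the pivot minus a multiple of row n clears column n without
      division. The degree of the diagonal doubles, and the subtracted products stay strictly below
      it.\<close>
    define M' where "M' = (\<lambda>i j. M n n * M i j - M i n * M n j)"
    have nI: "i \<noteq> n" if "i \<in> I" for i using that insert.hyps by auto
    have low: "Polynomial.degree (M i n * M n j) < d + d" if "i \<in> I" "j \<in> I" for i j
      using insert.prems(3) that nI degree_mult_le[of "M i n" "M n j"]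
      by (smt (verit) add_strict_mono insertCI le_less_trans)
    have diag: "lead_coeff (M n n * M i i) = 1 \<and> Polynomial.degree (M n n * M i i) = d + d" if "i \<in> I" for i
    proof -
      have nz: "M n n \<noteq> 0" "M i i \<noteq> 0" using insert.prems(1) that by auto
      have "lead_coeff (M n n) = 1" "lead_coeff (M i i) = 1" using insert.prems(1) that by auto
      then have "lead_coeff (M n n * M i i) = 1" unfolding lead_coeff_mult by simp
      moreover have "Polynomial.degree (M n n * M i i) = d + d"
        using insert.prems(1) that nz by (simp add: degree_mult_eq)
      ultimately show ?thesis by blast
    qed
    show ?thesis
    proof (rule insert.IH[of M' "d + d"])
      show "\<forall>i\<in>I. lead_coeff (M' i i) = 1 \<and> Polynomial.degree (M' i i) = d + d"
        unfolding M'_def using lead_coeff_add_lower diag low by metis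
      show "\<forall>i\<in>I. \<forall>j\<in>I. coeffs_in V (M' i j)"
        unfolding M'_def using insert.prems(2)
        by (auto intro!: coeffs_in_diff[OF V] coeffs_in_mult[OF V])
      show "\<forall>i\<in>I. \<forall>j\<in>I. i \<noteq> j \<longrightarrow> Polynomial.degree (M' i j) < d + d"
      proof (intro ballI impI)
        fix i j assume ij: "i \<in> I" "j \<in> I" "i \<noteq> j"
        have "Polynomial.degree (M n n * M i j) < d + d"
          using degree_mult_le[of "M n n" "M i j"] insert.prems(1,3) ij
          by (smt (verit) add_strict_left_mono insertCI le_less_trans)
        then show "Polynomial.degree (M' i j) < d + d"
          unfolding M'_def using low[OF ij(1,2)] by (rule degree_diff_less)
      qed
      show "\<forall>i\<in>I. (\<Sum>j\<in>I. poly (M' i j) x * e j) = 0"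
      proof
        fix i assume i: "i \<in> I"
        have a: "(\<Sum>j\<in>I. poly (M i j) x * e j) = - (poly (M i n) x * e n)"
          using insert.prems(4) insert.hyps i by (auto simp: add_eq_0_iff)
        have b: "(\<Sum>j\<in>I. poly (M n j) x * e j) = - (poly (M n n) x * e n)"
          using insert.prems(4) insert.hyps by (auto simp: add_eq_0_iff)
        have "(\<Sum>j\<in>I. poly (M' i j) x * e j) =
              poly (M n n) x * (\<Sum>j\<in>I. poly (M i j) x * e j) - poly (M i n) x * (\<Sum>j\<in>I. poly (M n j) x * e j)"
          by (simp add: M'_def sum_distrib_left sum_subtractf algebra_simps)
        then show "(\<Sum>j\<in>I. poly (M' i j) x * e j) = 0"
          unfolding a b by (simp add: algebra_simps)
      qed
    qed (use True in auto)
  qed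
qed

section \<open>Finitely generated modules as a criterion for integrality\<close>

definition vspan :: "'a::comm_ring_1 set \<Rightarrow> 'a set \<Rightarrow> 'a set" where
  "vspan V S = {\<Sum>s\<in>S. a s * s | a. \<forall>s\<in>S. a s \<in> V}"

lemma vspan_I: "(\<And>s. s \<in> S \<Longrightarrow> a s \<in> V) \<Longrightarrow> (\<Sum>s\<in>S. a s * s) \<in> vspan V S"
  unfolding vspan_def by blast

lemma vspan_E:
  assumes "x \<in> vspan V S"
  obtains a where "\<And>s. s \<in> S \<Longrightarrow> a s \<in> V" "x = (\<Sum>s\<in>S. a s * s)"
  using assms unfolding vspan_def by blast

context
  fixes V :: "'a::comm_ring_1 set"
  assumes V: "subring_set V"
begin

lemma vspan_add: "x \<in> vspan V S \<Longrightarrow> y \<in> vspan V S \<Longrightarrow> x + y \<in> vspan V S"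
proof (elim vspan_E)
  fix a b assume "\<And>s. s \<in> S \<Longrightarrow> a s \<in> V" "\<And>s. s \<in> S \<Longrightarrow> b s \<in> V"
    "x = (\<Sum>s\<in>S. a s * s)" "y = (\<Sum>s\<in>S. b s * s)"
  then show ?thesis
    using vspan_I[of S "\<lambda>s. a s + b s" V] by (simp add: subring_add[OF V] sum.distrib algebra_simps)
qed

lemma vspan_scale: "c \<in> V \<Longrightarrow> x \<in> vspan V S \<Longrightarrow> c * x \<in> vspan V S"
proof (elim vspan_E)
  fix a assume "c \<in> V" "\<And>s. s \<in> S \<Longrightarrow> a s \<in> V" "x = (\<Sum>s\<in>S. a s * s)"
  then show ?thesis
    using vspan_I[of S "\<lambda>s. c * a s" V] by (simp add: subring_mult[OF V] sum_distrib_left algebra_simps)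
qed

lemma vspan_0: "0 \<in> vspan V S"
  using vspan_I[of S "\<lambda>s. 0" V] subring_0[OF V] by simp

lemma vspan_sum: "(\<And>i. i \<in> I \<Longrightarrow> f i \<in> vspan V S) \<Longrightarrow> sum f I \<in> vspan V S"
  by (induction I rule: infinite_finite_induct) (auto intro: vspan_0 vspan_add)

lemma vspan_base:
  assumes "finite S" "s \<in> S" shows "s \<in> vspan V S"
  using vspan_I[of S "\<lambda>t. if t = s then 1 else 0" V] assms
  by (auto simp: if_distrib[of "\<lambda>x. x * _"] sum.delta' subring_0[OF V] subring_1[OF V] cong: if_cong)

lemma vspan_mult_stable:
  assumes "\<And>s. s \<in> S \<Longrightarrow> z * s \<in> vspan V T" "x \<in> vspan V S"
  shows "z * x \<in> vspan V T"
  using assms(2)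
proof (rule vspan_E)
  fix a assume a: "\<And>s. s \<in> S \<Longrightarrow> a s \<in> V" "x = (\<Sum>s\<in>S. a s * s)"
  then have "z * x = (\<Sum>s\<in>S. a s * (z * s))" by (simp add: sum_distrib_left algebra_simps)
  also have "\<dots> \<in> vspan V T" using a(1) assms(1) by (blast intro: vspan_sum vspan_scale)
  finally show ?thesis .
qed

text \<open>A module stable under two elements is stable under the ring that they generate. This
  handles differences and products of integral elements without computing their equations.\<close>

lemma subring_stabilizer:
  assumes "finite S"
  shows "subring_set {z. \<forall>s\<in>S. z * s \<in> vspan V S}"
  unfolding subring_set_def
proof (intro conjI ballI; (elim CollectE)?)
  show "1 \<in> {z. \<forall>s\<in>S. z * s \<in> vspan V S}" using vspan_base[OF assms] by auto
  fix x y assume x: "\<forall>s\<in>S. x * s \<in> vspan V S" and y: "\<forall>s\<in>S. y * s \<in> vspan V S"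
  have "x * s - y * s \<in> vspan V S" if "s \<in> S" for s
    using vspan_add[of "x * s" S "(-1) * (y * s)"] vspan_scale[of "-1" "y * s" S] that x y
    by (simp add: subring_uminus[OF V] subring_1[OF V])
  then show "x - y \<in> {z. \<forall>s\<in>S. z * s \<in> vspan V S}" by (simp add: left_diff_distrib)
  have "x * (y * s) \<in> vspan V S" if "s \<in> S" for s
    using vspan_mult_stable[of S x S "y * s"] that x y by auto
  then show "x * y \<in> {z. \<forall>s\<in>S. z * s \<in> vspan V S}" by (simp add: mult.assoc)
qed

end

text \<open>If a is the matrix of multiplication by x on the generators, then x - a annihilates the
  vector of generators. Its entries are monic linear on the diagonal and constant elsewhere, which
  starts the elimination at degree 1. In a domain one nonzero generator makes the module
  faithful.\<close>

lemma integral_by_stable_module: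
  fixes x :: "'a::idom"
  assumes V: "subring_set V" and "finite S" and "s0 \<in> S" "s0 \<noteq> 0"
    and stab: "\<And>s. s \<in> S \<Longrightarrow> x * s \<in> vspan V S"
  shows "integral_over V x"
proof -
  have "\<exists>a. \<forall>s\<in>S. (\<forall>t\<in>S. a s t \<in> V) \<and> x * s = (\<Sum>t\<in>S. a s t * t)"
    using stab unfolding vspan_def by (intro bchoice) auto
  then obtain a where a: "\<And>s t. s \<in> S \<Longrightarrow> t \<in> S \<Longrightarrow> a s t \<in> V"
    "\<And>s. s \<in> S \<Longrightarrow> x * s = (\<Sum>t\<in>S. a s t * t)"
    by metis
  define M where "M = (\<lambda>s t. if s = t then [:- a s t, 1:] else [:- a s t:])"
  show ?thesis
  proof (rule integral_by_elimination[OF V \<open>finite S\<close>, of M 1 x "\<lambda>s. s"])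
    show "\<forall>i\<in>S. \<forall>j\<in>S. coeffs_in V (M i j)"
      using a(1) V by (auto simp: M_def intro!: coeffs_in_pCons[OF V] coeffs_in_0[OF V] subring_uminus subring_1)
    show "\<forall>s\<in>S. (\<Sum>t\<in>S. poly (M s t) x * t) = 0"
    proof
      fix s assume s: "s \<in> S"
      have "poly (M s t) x * t = (if s = t then x * t else 0) - a s t * t" for t
        by (simp add: M_def algebra_simps)
      then show "(\<Sum>t\<in>S. poly (M s t) x * t) = 0"
        using s \<open>finite S\<close> a(2)[OF s] by (simp add: sum_subtractf sum.delta)
    qed
  qed (use assms in \<open>auto simp: M_def\<close>)
qed

lemma stable_module_adjoin:
  assumes V: "subring_set V" and S: "finite S" "1 \<in> S" and y: "integral_over V y"
  shows "\<exists>T. finite T \<and> 1 \<in> T \<and> (\<forall>t\<in>T. y * t \<in> vspan V T) \<and>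
    (\<forall>x. (\<forall>s\<in>S. x * s \<in> vspan V S) \<longrightarrow> (\<forall>t\<in>T. x * t \<in> vspan V T))"
proof -
  obtain p where p: "lead_coeff p = 1" "coeffs_in V p" "poly p y = 0"
    using y unfolding integral_over_def by blast
  define m where "m = Polynomial.degree p"
  define T where "T = (\<lambda>(s, i). s * y ^ i) ` (S \<times> {..m})"
  have fin: "finite T" using S by (simp add: T_def)
  have base: "s * y ^ i \<in> vspan V T" if "s \<in> S" "i \<le> m" for s i
    by (rule vspan_base[OF V fin]) (use that in \<open>auto simp: T_def\<close>)
  have ym: "y ^ m = (\<Sum>i<m. (- Polynomial.coeff p i) * y ^ i)"
  proof -
    have "0 = (\<Sum>i\<le>m. Polynomial.coeff p i * y ^ i)" using p(3) by (simp add: poly_altdef m_def)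
    also have "\<dots> = (\<Sum>i<m. Polynomial.coeff p i * y ^ i) + y ^ m"
      using p(1) by (simp add: lessThan_Suc_atMost[symmetric] m_def)
    finally show ?thesis by (simp add: sum_negf eq_neg_iff_add_eq_0 add.commute)
  qed
  have step: "y * (s * y ^ i) \<in> vspan V T" if "s \<in> S" "i \<le> m" for s i
  proof (cases "i = m")
    case False
    then show ?thesis using base[of s "Suc i"] that by (simp add: algebra_simps)
  next
    case True
    have "y * (s * y ^ i) = (\<Sum>i<m. (- Polynomial.coeff p i) * (s * y ^ Suc i))"
      unfolding True by (subst ym) (simp add: sum_distrib_left sum_distrib_right algebra_simps)
    also have "\<dots> \<in> vspan V T"
    proof (rule vspan_sum[OF V], rule vspan_scale[OF V])
      show "- Polynomial.coeff p i \<in> V" for i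
        using p(2) subring_uminus[OF V] by (auto simp: coeffs_in_def)
      show "s * y ^ Suc i \<in> vspan V T" if "i \<in> {..<m}" for i
        using base[of s "Suc i"] \<open>s \<in> S\<close> that by simp
    qed
    finally show ?thesis .
  qed
  have "1 \<in> T" unfolding T_def by (rule image_eqI[of _ _ "(1, 0)"]) (use S in auto)
  moreover have "y * t \<in> vspan V T" if "t \<in> T" for t using that step by (auto simp: T_def)
  moreover have "x * t \<in> vspan V T" if x: "\<And>s. s \<in> S \<Longrightarrow> x * s \<in> vspan V S" and t: "t \<in> T" for x t
  proof -
    obtain s i where si: "s \<in> S" "i \<le> m" "t = s * y ^ i" using t by (auto simp: T_def)
    have "y ^ i * (x * s) \<in> vspan V T"
      by (rule vspan_mult_stable[OF V _ x[OF si(1)]]) (use base si in \<open>simp add: mult.commute\<close>)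
    then show ?thesis using si by (simp add: algebra_simps)
  qed
  ultimately show ?thesis using fin by (intro exI[of _ T]) auto
qed

lemma stable_module_exists:
  assumes V: "subring_set V" and "finite Z" "\<forall>z\<in>Z. integral_over V z"
  shows "\<exists>S. finite S \<and> 1 \<in> S \<and> (\<forall>z\<in>Z. \<forall>s\<in>S. z * s \<in> vspan V S)"
  using assms(2,3)
proof (induction Z rule: finite_induct)
  case empty
  then show ?case by (intro exI[of _ "{1}"]) auto
next
  case (insert y Z)
  then obtain S where S: "finite S" "1 \<in> S" "\<forall>z\<in>Z. \<forall>s\<in>S. z * s \<in> vspan V S"
    by auto
  obtain T where "finite T" "1 \<in> T" "\<forall>t\<in>T. y * t \<in> vspan V T"
    "\<forall>x. (\<forall>s\<in>S. x * s \<in> vspan V S) \<longrightarrow> (\<forall>t\<in>T. x * t \<in> vspan V T)"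
    using stable_module_adjoin[OF V S(1,2), of y] insert.prems by auto
  then show ?case using S(3) by (intro exI[of _ T]) simp
qed

lemma subring_integral:
  fixes V :: "'a::idom set"
  assumes V: "subring_set V"
  shows "subring_set {x. integral_over V x}"
proof -
  have "integral_over V (x - y) \<and> integral_over V (x * y)" if "integral_over V x" "integral_over V y" for x y
  proof -
    have "\<exists>S. finite S \<and> 1 \<in> S \<and> (\<forall>z\<in>{x, y}. \<forall>s\<in>S. z * s \<in> vspan V S)"
      by (rule stable_module_exists[OF V]) (use that in auto)
    then obtain S where S: "finite S" "1 \<in> S" "\<forall>z\<in>{x, y}. \<forall>s\<in>S. z * s \<in> vspan V S"
      by blast
    note stab = subring_stabilizer[OF V S(1)]
    have "x - y \<in> {z. \<forall>s\<in>S. z * s \<in> vspan V S}" "x * y \<in> {z. \<forall>s\<in>S. z * s \<in> vspan V S}"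
      using S(3) by (intro subring_diff[OF stab] subring_mult[OF stab]; blast)+
    then show ?thesis using integral_by_stable_module[OF V S(1,2)] by auto
  qed
  then show ?thesis
    using integral_over_self[OF V subring_1[OF V]] by (auto simp: subring_set_def)
qed


section \<open>Linear disjointness\<close>

text \<open>Elements of C that are independent over k stay independent over A, in contrapositive
  form. The definition treats A and C differently; \<open>lin_disjoint_sym\<close> exchanges them
  when A is a ring containing k.\<close>

definition lin_disjoint :: "'a::field set \<Rightarrow> 'a set \<Rightarrow> 'a set \<Rightarrow> bool" where
  "lin_disjoint k A C \<longleftrightarrow> (\<forall>S x. finite S \<longrightarrow> S \<subseteq> C \<longrightarrow> (\<forall>c\<in>S. x c \<in> A) \<longrightarrow>
     (\<Sum>c\<in>S. x c * c) = 0 \<longrightarrow> (\<exists>c\<in>S. x c \<noteq> 0) \<longrightarrow>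
     (\<exists>l. (\<forall>c\<in>S. l c \<in> k) \<and> (\<exists>c\<in>S. l c \<noteq> 0) \<and> (\<Sum>c\<in>S. l c * c) = 0))"

lemma lin_disjoint_mono: "lin_disjoint k A C \<Longrightarrow> A' \<subseteq> A \<Longrightarrow> C' \<subseteq> C \<Longrightarrow> lin_disjoint k A' C'"
  unfolding lin_disjoint_def
proof (intro allI impI, goal_cases)
  case (1 S x)
  from 1(1)[rule_format, of S x] 1(2-) show ?case by blast
qed

text \<open>The definition speaks of finite sets, while the inductions below use indexed families
  with repetitions. A repeated member satisfies the relation with coefficients 1 and -1.\<close>

lemma lin_disjoint_family:
  fixes a c :: "'i \<Rightarrow> 'a::field"
  assumes k: "subfield_set k" and ld: "lin_disjoint k A C" and I: "finite I"
    and ac: "\<forall>i\<in>I. a i \<in> A \<and> c i \<in> C"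
    and sum0: "(\<Sum>i\<in>I. a i * c i) = 0" and nz: "\<exists>i\<in>I. a i \<noteq> 0"
  shows "\<exists>l. (\<forall>i\<in>I. l i \<in> k) \<and> (\<exists>i\<in>I. l i \<noteq> 0) \<and> (\<Sum>i\<in>I. l i * c i) = 0"
proof (cases "inj_on c I")
  case True
  define x where "x = (\<lambda>d. a (the_inv_into I c d))"
  have x: "x (c i) = a i" if "i \<in> I" for i
    using True that by (simp add: x_def the_inv_into_f_f)
  have "(\<Sum>d\<in>c ` I. x d * d) = (\<Sum>i\<in>I. a i * c i)"
    using True by (simp add: sum.reindex x)
  then have "\<exists>l. (\<forall>d\<in>c ` I. l d \<in> k) \<and> (\<exists>d\<in>c ` I. l d \<noteq> 0) \<and> (\<Sum>d\<in>c ` I. l d * d) = 0"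
    by (intro ld[unfolded lin_disjoint_def, rule_format]) (use I ac sum0 nz x in auto)
  then obtain l where l: "\<forall>d\<in>c ` I. l d \<in> k" "\<exists>d\<in>c ` I. l d \<noteq> 0" "(\<Sum>d\<in>c ` I. l d * d) = 0"
    by blast
  show ?thesis
    using l True by (intro exI[of _ "l \<circ> c"]) (auto simp: sum.reindex)
next
  case False
  then obtain i j where ij: "i \<in> I" "j \<in> I" "c i = c j" "i \<noteq> j" by (auto simp: inj_on_def)
  define l where "l = (\<lambda>h. if h = i then 1 else if h = j then -1 else (0::'a))"
  have "(\<Sum>h\<in>I. l h * c h) = (\<Sum>h\<in>{i, j}. l h * c h)"
    by (rule sum.mono_neutral_right) (use I ij in \<open>auto simp: l_def\<close>)
  also have "\<dots> = 0" using ij by (simp add: l_def)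
  finally show ?thesis
    using ij subfield_imp_subring[OF k]
    by (intro exI[of _ l]) (auto simp: l_def subring_closed)
qed

text \<open>Solving the k-relation for one \<open>c d\<close> and substituting yields a relation
  over a smaller index set. This is the step of the two inductions that follow.\<close>

lemma lin_disjoint_eliminate:
  fixes a c :: "'i \<Rightarrow> 'a::field"
  assumes k: "subfield_set k" and ld: "lin_disjoint k A C" and I: "finite I"
    and ac: "\<forall>i\<in>I. a i \<in> A \<and> c i \<in> C"
    and sum0: "(\<Sum>i\<in>I. a i * c i) = 0" and nz: "\<exists>i\<in>I. a i \<noteq> 0"
  obtains d m where "d \<in> I" "\<forall>i\<in>I. m i \<in> k" "c d = (\<Sum>i\<in>I - {d}. m i * c i)"
    "(\<Sum>i\<in>I - {d}. (a i + m i * a d) * c i) = 0"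
proof -
  obtain l d where l: "\<forall>i\<in>I. l i \<in> k" "d \<in> I" "l d \<noteq> 0" "(\<Sum>i\<in>I. l i * c i) = 0"
    using lin_disjoint_family[OF assms] by blast
  define m where "m = (\<lambda>i. - (l i / l d))"
  have mk: "\<forall>i\<in>I. m i \<in> k"
    using l subfield_divide[OF k] subring_uminus[OF subfield_imp_subring[OF k]] by (auto simp: m_def)
  have cd: "c d = (\<Sum>i\<in>I - {d}. m i * c i)"
  proof -
    have "l d * c d + (\<Sum>i\<in>I - {d}. l i * c i) = 0"
      using l I by (simp add: sum.remove)
    then have "c d = - (\<Sum>i\<in>I - {d}. l i * c i) / l d"
      using l(3) by (simp add: field_simps add_eq_0_iff2)
    also have "\<dots> = (\<Sum>i\<in>I - {d}. m i * c i)"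
      by (simp add: m_def sum_negf[symmetric] sum_divide_distrib)
    finally show ?thesis .
  qed
  have "(\<Sum>i\<in>I - {d}. (a i + m i * a d) * c i) =
      (\<Sum>i\<in>I - {d}. a i * c i) + a d * (\<Sum>i\<in>I - {d}. m i * c i)"
    by (simp add: sum.distrib sum_distrib_left algebra_simps)
  also have "\<dots> = (\<Sum>i\<in>I. a i * c i)"
    using l(2) I cd by (simp add: sum.remove)
  finally show ?thesis
    using that l(2) mk cd sum0 by presburger
qed

lemma lin_disjoint_sym_family:
  fixes a c :: "'i \<Rightarrow> 'a::field"
  assumes k: "subfield_set k" and ld: "lin_disjoint k A C" and A: "subring_set A" "k \<subseteq> A"
    and "finite I" "\<forall>i\<in>I. a i \<in> A \<and> c i \<in> C" "(\<Sum>i\<in>I. a i * c i) = 0" "\<exists>i\<in>I. c i \<noteq> 0"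
  shows "\<exists>l. (\<forall>i\<in>I. l i \<in> k) \<and> (\<exists>i\<in>I. l i \<noteq> 0) \<and> (\<Sum>i\<in>I. l i * a i) = 0"
  using assms(5-)
proof (induction "card I" arbitrary: I a)
  case 0
  then show ?case by auto
next
  case (Suc n)
  note kr = subfield_imp_subring[OF k]
  show ?case
  proof (cases "\<exists>i\<in>I. a i \<noteq> 0")
    case False
    then show ?thesis
      using Suc.prems(4) subring_1[OF kr] by (intro exI[of _ "\<lambda>_. 1"]) auto
  next
    case True
    obtain d m where d: "d \<in> I" "\<forall>i\<in>I. m i \<in> k" "c d = (\<Sum>i\<in>I - {d}. m i * c i)"
      "(\<Sum>i\<in>I - {d}. (a i + m i * a d) * c i) = 0"
      by (rule lin_disjoint_eliminate[OF k ld Suc.prems(1-3) True])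
    \<comment> \<open>The induction hypothesis asks for a nonzero \<open>c i\<close> among the
      remaining ones; if all were 0, their combination \<open>c d\<close> would be 0 as
      well.\<close>
    have nz: "\<exists>i\<in>I - {d}. c i \<noteq> 0"
    proof (rule ccontr)
      assume *: "\<not> ?thesis"
      then have "c d = 0" using d(3) by simp
      then show False using * Suc.prems(4) by auto
    qed
    have aA: "\<forall>i\<in>I - {d}. a i + m i * a d \<in> A \<and> c i \<in> C"
      using Suc.prems(2) d(1,2) A by (auto intro!: subring_add[OF A(1)] subring_mult[OF A(1)])
    have "n = card (I - {d})" using Suc.hyps(2) Suc.prems(1) d(1) by simp
    then obtain l where l: "\<forall>i\<in>I - {d}. l i \<in> k" "\<exists>i\<in>I - {d}. l i \<noteq> 0"
      "(\<Sum>i\<in>I - {d}. l i * (a i + m i * a d)) = 0"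
      using Suc.hyps(1)[of "I - {d}" "\<lambda>i. a i + m i * a d", OF _ _ aA d(4) nz] Suc.prems(1) by auto
    \<comment> \<open>The coefficient at d collects the parts \<open>m i * a d\<close> of the
      shorter relation.\<close>
    define l' where "l' = l(d := \<Sum>i\<in>I - {d}. l i * m i)"
    have "(\<Sum>i\<in>I. l' i * a i) = (\<Sum>i\<in>I - {d}. l i * m i) * a d + (\<Sum>i\<in>I - {d}. l i * a i)"
      using Suc.prems(1) d(1) by (simp add: sum.remove l'_def)
    also have "\<dots> = (\<Sum>i\<in>I - {d}. l i * (a i + m i * a d))"
      by (simp add: sum_distrib_right sum_distrib_left sum.distrib algebra_simps)
    finally have "(\<Sum>i\<in>I. l' i * a i) = 0" using l(3) by simp
    moreover have "\<forall>i\<in>I. l' i \<in> k"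
      using l(1) d(2) by (auto simp: l'_def intro!: subring_sum[OF kr] subring_mult[OF kr])
    moreover have "\<exists>i\<in>I. l' i \<noteq> 0" using l(2) by (auto simp: l'_def)
    ultimately show ?thesis by blast
  qed
qed

lemma lin_disjoint_sym:
  assumes "subfield_set k" "lin_disjoint k A C" "subring_set A" "k \<subseteq> A"
  shows "lin_disjoint k C A"
  unfolding lin_disjoint_def
proof (intro allI impI)
  fix S x assume *: "finite S" "S \<subseteq> A" "\<forall>c\<in>S. x c \<in> C" "(\<Sum>c\<in>S. x c * c) = 0" "\<exists>c\<in>S. x c \<noteq> 0"
  show "\<exists>l. (\<forall>c\<in>S. l c \<in> k) \<and> (\<exists>c\<in>S. l c \<noteq> 0) \<and> (\<Sum>c\<in>S. l c * c) = 0"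
    using lin_disjoint_sym_family[OF assms *(1), of "\<lambda>c. c" x] * by (auto simp: mult.commute)
qed

text \<open>The universal property of the tensor product, for a biadditive map that is balanced
  only modulo the subgroup \<open>J\<close>.\<close>

lemma lin_disjoint_balanced:
  fixes a c :: "'i \<Rightarrow> 'a::field" and \<beta> :: "'a \<Rightarrow> 'a \<Rightarrow> 'b::ab_group_add"
  assumes k: "subfield_set k" and ld: "lin_disjoint k A C"
    and A: "subring_set A" "k \<subseteq> A" and C: "subring_set C" "k \<subseteq> C"
    and J: "0 \<in> J" "\<And>x y. x \<in> J \<Longrightarrow> y \<in> J \<Longrightarrow> x - y \<in> J"
    and add1: "\<And>a a' c. a \<in> A \<Longrightarrow> a' \<in> A \<Longrightarrow> c \<in> C \<Longrightarrow> \<beta> (a + a') c - \<beta> a c - \<beta> a' c \<in> J"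
    and add2: "\<And>a c c'. a \<in> A \<Longrightarrow> c \<in> C \<Longrightarrow> c' \<in> C \<Longrightarrow> \<beta> a (c + c') - \<beta> a c - \<beta> a c' \<in> J"
    and bal: "\<And>l a c. l \<in> k \<Longrightarrow> a \<in> A \<Longrightarrow> c \<in> C \<Longrightarrow> \<beta> (l * a) c - \<beta> a (l * c) \<in> J"
    and "finite I" "\<forall>i\<in>I. a i \<in> A \<and> c i \<in> C" "(\<Sum>i\<in>I. a i * c i) = 0"
  shows "(\<Sum>i\<in>I. \<beta> (a i) (c i)) \<in> J"
proof -
  have Jm: "- x \<in> J" if "x \<in> J" for x using J(2)[OF J(1) that] by simp
  have Ja: "x + y \<in> J" if "x \<in> J" "y \<in> J" for x y using J(2)[OF that(1) Jm[OF that(2)]] by simp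
  have Js: "sum f T \<in> J" if "\<And>i. i \<in> T \<Longrightarrow> f i \<in> J" for f :: "'i \<Rightarrow> 'b" and T
    using that by (induction T rule: infinite_finite_induct) (auto intro: J(1) Ja)
  have z1: "\<beta> 0 c \<in> J" if "c \<in> C" for c
    using Jm[OF add1[OF subring_0[OF A(1)] subring_0[OF A(1)] that]] by simp
  have z2: "\<beta> a 0 \<in> J" if "a \<in> A" for a
    using Jm[OF add2[OF that subring_0[OF C(1)] subring_0[OF C(1)]]] by simp
  have sum2: "\<beta> a (sum f T) - (\<Sum>i\<in>T. \<beta> a (f i)) \<in> J"
    if "finite T" "a \<in> A" "\<forall>i\<in>T. f i \<in> C" for a f and T :: "'i set"
    using that
  proof (induction T rule: finite_induct)
    case empty
    then show ?case using z2 by simp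
  next
    case (insert i T)
    have "\<beta> a (f i + sum f T) - \<beta> a (f i) - \<beta> a (sum f T) \<in> J"
      using insert.prems by (intro add2 subring_sum[OF C(1)]) auto
    moreover have "\<beta> a (sum f T) - (\<Sum>i\<in>T. \<beta> a (f i)) \<in> J" using insert by auto
    ultimately show ?case using insert.hyps Ja by (fastforce simp: algebra_simps)
  qed
  show ?thesis
    using assms(12-)
  proof (induction "card I" arbitrary: I a)
    case 0
    then show ?case using J(1) by auto
  next
    case (Suc n)
    show ?case
    proof (cases "\<exists>i\<in>I. a i \<noteq> 0")
      case False
      then show ?thesis using Suc.prems(2) by (intro Js) (auto intro: z1)
    next
      case True
      obtain d m where d: "d \<in> I" "\<forall>i\<in>I. m i \<in> k" "c d = (\<Sum>i\<in>I - {d}. m i * c i)"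
        "(\<Sum>i\<in>I - {d}. (a i + m i * a d) * c i) = 0"
        by (rule lin_disjoint_eliminate[OF k ld Suc.prems(1-3) True])
      have mem: "a i \<in> A" "c i \<in> C" "m i * a d \<in> A" "m i * c i \<in> C" "m i \<in> k" if "i \<in> I" for i
        using Suc.prems(2) d(1,2) A C that
        by (auto intro!: subring_mult[OF A(1)] subring_mult[OF C(1)])
      have "n = card (I - {d})" using Suc.hyps(2) Suc.prems(1) d(1) by simp
      then have ih: "(\<Sum>i\<in>I - {d}. \<beta> (a i + m i * a d) (c i)) \<in> J"
        using Suc.prems(1) d(4) mem by (intro Suc.hyps(1)) (auto intro!: subring_add[OF A(1)])
      have "\<beta> (a d) (c d) - (\<Sum>i\<in>I - {d}. \<beta> (a d) (m i * c i)) \<in> J"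
        unfolding d(3) using Suc.prems(1) mem d(1) by (intro sum2) auto
      moreover have "(\<Sum>i\<in>I - {d}. \<beta> (m i * a d) (c i) - \<beta> (a d) (m i * c i)) \<in> J"
        using mem d(1) by (intro Js bal) auto
      moreover have "(\<Sum>i\<in>I - {d}. \<beta> (a i + m i * a d) (c i) - \<beta> (a i) (c i) - \<beta> (m i * a d) (c i)) \<in> J"
        using mem by (intro Js add1) auto
      \<comment> \<open>Modulo J the removed term \<open>\<beta> (a d) (c d)\<close> becomes the sum
        of the \<open>\<beta> (a d) (m i * c i)\<close>, then of the
        \<open>\<beta> (m i * a d) (c i)\<close>. These merge with the
        \<open>\<beta> (a i) (c i)\<close> into the shorter sum, which lies in J by
        induction.\<close>
      ultimately have "(\<beta> (a d) (c d) - (\<Sum>i\<in>I - {d}. \<beta> (a d) (m i * c i)))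
          - (\<Sum>i\<in>I - {d}. \<beta> (m i * a d) (c i) - \<beta> (a d) (m i * c i))
          - (\<Sum>i\<in>I - {d}. \<beta> (a i + m i * a d) (c i) - \<beta> (a i) (c i) - \<beta> (m i * a d) (c i))
          + (\<Sum>i\<in>I - {d}. \<beta> (a i + m i * a d) (c i)) \<in> J"
        using ih by (blast intro: J(2) Ja)
      also have "(\<beta> (a d) (c d) - (\<Sum>i\<in>I - {d}. \<beta> (a d) (m i * c i)))
          - (\<Sum>i\<in>I - {d}. \<beta> (m i * a d) (c i) - \<beta> (a d) (m i * c i))
          - (\<Sum>i\<in>I - {d}. \<beta> (a i + m i * a d) (c i) - \<beta> (a i) (c i) - \<beta> (m i * a d) (c i))
          + (\<Sum>i\<in>I - {d}. \<beta> (a i + m i * a d) (c i)) = \<beta> (a d) (c d) + (\<Sum>i\<in>I - {d}. \<beta> (a i) (c i))"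
        by (simp add: sum_subtractf)
      also have "\<dots> = (\<Sum>i\<in>I. \<beta> (a i) (c i))"
        using Suc.prems(1) d(1) by (simp add: sum.remove)
      finally show ?thesis .
    qed
  qed
qed


section \<open>Composita and extension of homomorphisms\<close>

text \<open>For rings A and C this is the ring that they generate. Adding one product at a time
  gives the induction rule by which maps on a compositum are checked on products.\<close>

inductive_set comp_ring :: "'a::comm_ring_1 set \<Rightarrow> 'a set \<Rightarrow> 'a set" for A C where
  zero: "0 \<in> comp_ring A C"
| step: "a \<in> A \<Longrightarrow> c \<in> C \<Longrightarrow> x \<in> comp_ring A C \<Longrightarrow> a * c + x \<in> comp_ring A C"

lemma comp_ring_prod: "a \<in> A \<Longrightarrow> c \<in> C \<Longrightarrow> a * c \<in> comp_ring A C"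
  using comp_ring.step[OF _ _ comp_ring.zero] by fastforce

lemma comp_ring_add: "x \<in> comp_ring A C \<Longrightarrow> y \<in> comp_ring A C \<Longrightarrow> x + y \<in> comp_ring A C"
  by (induction x rule: comp_ring.induct) (auto simp: add.assoc intro: comp_ring.step)

lemma comp_ring_sum: "(\<And>i. i \<in> I \<Longrightarrow> f i \<in> comp_ring A C) \<Longrightarrow> sum f I \<in> comp_ring A C"
  by (induction I rule: infinite_finite_induct) (auto intro: comp_ring.zero comp_ring_add)

lemma comp_ring_mono: "A \<subseteq> A' \<Longrightarrow> C \<subseteq> C' \<Longrightarrow> comp_ring A C \<subseteq> comp_ring A' C'"
proof
  fix x assume "A \<subseteq> A'" "C \<subseteq> C'" "x \<in> comp_ring A C"
  from this(3,1,2) show "x \<in> comp_ring A' C'"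
    by (induction x rule: comp_ring.induct) (auto intro: comp_ring.intros)
qed

lemma comp_ring_subset:
  assumes "subring_set R" "A \<subseteq> R" "C \<subseteq> R" shows "comp_ring A C \<subseteq> R"
proof
  fix x assume "x \<in> comp_ring A C"
  then show "x \<in> R"
    by induction (use assms in \<open>auto intro!: subring_0 subring_add subring_mult\<close>)
qed

lemma comp_ring_family:
  assumes "x \<in> comp_ring A C"
  obtains n :: nat and a c where "\<forall>i<n. a i \<in> A \<and> c i \<in> C" "x = (\<Sum>i<n. a i * c i)"
proof -
  have "\<exists>(n::nat) a c. (\<forall>i<n. a i \<in> A \<and> c i \<in> C) \<and> x = (\<Sum>i<n. a i * c i)"
    using assms
  proof induction
    case zero
    show ?case by (rule exI[of _ 0]) simp
  next
    case (step a0 c0 x)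
    then obtain n a c where *: "\<forall>i<n. a i \<in> A \<and> c i \<in> C" "x = (\<Sum>i<(n::nat). a i * c i)" by blast
    show ?case
      by (rule exI[of _ "Suc n"], rule exI[of _ "case_nat a0 a"], rule exI[of _ "case_nat c0 c"])
        (use * step in \<open>auto simp: sum.lessThan_Suc_shift simp del: sum.lessThan_Suc split: nat.split\<close>)
  qed
  then show ?thesis using that by blast
qed

context
  fixes A C :: "'a::comm_ring_1 set"
  assumes A: "subring_set A" and C: "subring_set C"
begin

lemma comp_ring_left: "A \<subseteq> comp_ring A C"
  using comp_ring_prod[OF _ subring_1[OF C]] by fastforce

lemma comp_ring_right: "C \<subseteq> comp_ring A C"
  using comp_ring_prod[OF subring_1[OF A]] by fastforce

lemma subring_comp_ring: "subring_set (comp_ring A C)"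
proof -
  have m: "a * c * x \<in> comp_ring A C" if "x \<in> comp_ring A C" "a \<in> A" "c \<in> C" for a c x
    using that
  proof induction
    case zero
    then show ?case by (simp add: comp_ring.zero)
  next
    case (step a' c' x)
    have "(a * a') * (c * c') + a * c * x \<in> comp_ring A C"
      using step by (intro comp_ring.step subring_mult[OF A] subring_mult[OF C]) auto
    then show ?case by (simp add: algebra_simps)
  qed
  have "y * x \<in> comp_ring A C" if "x \<in> comp_ring A C" "y \<in> comp_ring A C" for x y
    using that(2) by induction (auto simp: distrib_right intro!: comp_ring.zero comp_ring_add m that)
  moreover have "- x \<in> comp_ring A C" if "x \<in> comp_ring A C" for x
    using m[OF that subring_uminus[OF A subring_1[OF A]] subring_1[OF C]] by simp
  ultimately show ?thesis
    using comp_ring_left subring_1[OF A] unfolding subring_set_def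
    by (metis subsetD add_uminus_conv_diff comp_ring_add)
qed

end

text \<open>Linear disjointness makes the compositum a copy of the tensor product over k, so two
  homomorphisms that are the identity on k can be glued.\<close>

locale hom_pair =
  fixes k A C :: "'a::field set" and lam mu :: "'a \<Rightarrow> 'a"
  assumes k: "subfield_set k" and ld: "lin_disjoint k A C"
    and A: "subring_set A" "k \<subseteq> A" and C: "subring_set C" "k \<subseteq> C"
    and lam_add: "\<And>a b. a \<in> A \<Longrightarrow> b \<in> A \<Longrightarrow> lam (a + b) = lam a + lam b"
    and lam_mult: "\<And>a b. a \<in> A \<Longrightarrow> b \<in> A \<Longrightarrow> lam (a * b) = lam a * lam b"
    and lam_k: "\<And>a. a \<in> k \<Longrightarrow> lam a = a"
    and mu_add: "\<And>a b. a \<in> C \<Longrightarrow> b \<in> C \<Longrightarrow> mu (a + b) = mu a + mu b"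
    and mu_mult: "\<And>a b. a \<in> C \<Longrightarrow> b \<in> C \<Longrightarrow> mu (a * b) = mu a * mu b"
    and mu_k: "\<And>a. a \<in> k \<Longrightarrow> mu a = a"
begin

text \<open>The glued map starts as a relation that follows every representation as a sum of
  products; that it is a function is the content of \<open>ext_rel_0\<close>.\<close>

inductive ext_rel where
  zero: "ext_rel 0 0"
| step: "a \<in> A \<Longrightarrow> c \<in> C \<Longrightarrow> ext_rel x y \<Longrightarrow> ext_rel (a * c + x) (lam a * mu c + y)"

definition ext where "ext x = (THE y. ext_rel x y)"

lemma ext_rel_add: "ext_rel x y \<Longrightarrow> ext_rel x' y' \<Longrightarrow> ext_rel (x + x') (y + y')"
  by (induction rule: ext_rel.induct) (auto simp: add.assoc intro: ext_rel.step)

lemma lam_uminus: "a \<in> A \<Longrightarrow> lam (- a) = - lam a"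
  using lam_add[of a "- a"] lam_k[of 0] subring_0[OF subfield_imp_subring[OF k]] subring_uminus[OF A(1)]
  by (simp add: add_eq_0_iff)

lemma ext_rel_uminus: "ext_rel x y \<Longrightarrow> ext_rel (- x) (- y)"
proof (induction rule: ext_rel.induct)
  case zero
  then show ?case using ext_rel.zero by simp
next
  case (step a c x y)
  then show ?case
    using ext_rel.step[of "- a" c "- x" "- y"] subring_uminus[OF A(1)] by (simp add: lam_uminus)
qed

text \<open>The expression \<open>lam a * mu c\<close> is biadditive and balanced over k, so the
  universal property applies with J = {0}.\<close>

lemma ext_rel_0:
  assumes "ext_rel 0 y" shows "y = 0"
proof -
  have "\<exists>(n::nat) a c. (\<forall>i<n. a i \<in> A \<and> c i \<in> C) \<and> x = (\<Sum>i<n. a i * c i) \<and> y = (\<Sum>i<n. lam (a i) * mu (c i))"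
    if "ext_rel x y" for x y
    using that
  proof induction
    case zero
    show ?case by (rule exI[of _ 0]) simp
  next
    case (step a0 c0 x y)
    then obtain n a c where *: "\<forall>i<n. a i \<in> A \<and> c i \<in> C" "x = (\<Sum>i<(n::nat). a i * c i)"
      "y = (\<Sum>i<(n::nat). lam (a i) * mu (c i))" by blast
    show ?case
      by (rule exI[of _ "Suc n"], rule exI[of _ "case_nat a0 a"], rule exI[of _ "case_nat c0 c"])
        (use * step in \<open>auto simp: sum.lessThan_Suc_shift simp del: sum.lessThan_Suc split: nat.split\<close>)
  qed
  from this[OF assms] obtain n a c where *: "\<forall>i<n. a i \<in> A \<and> c i \<in> C" "0 = (\<Sum>i<(n::nat). a i * c i)"
    "y = (\<Sum>i<(n::nat). lam (a i) * mu (c i))" by blast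
  have "(\<Sum>i<n. lam (a i) * mu (c i)) \<in> {0}"
  proof (rule lin_disjoint_balanced[OF k ld A C, where \<beta> = "\<lambda>a c. lam a * mu c"])
    fix l a c assume "l \<in> k" "a \<in> A" "c \<in> C"
    then show "lam (l * a) * mu c - lam a * mu (l * c) \<in> {0}"
      using lam_mult[of l a] mu_mult[of l c] lam_k mu_k A C by (auto simp: subset_iff)
  qed (use * lam_add mu_add in \<open>auto simp: algebra_simps\<close>)
  then show ?thesis using * by simp
qed

lemma ext_rel_unique: "ext_rel x y \<Longrightarrow> ext_rel x y' \<Longrightarrow> y = y'"
  using ext_rel_0[of "y - y'"] ext_rel_add[of x y "- x" "- y'"] ext_rel_uminus[of x y'] by simp

lemma ext_eqI: "ext_rel x y \<Longrightarrow> ext x = y"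
  unfolding ext_def using ext_rel_unique by blast

lemma ext_rel_ext: "x \<in> comp_ring A C \<Longrightarrow> ext_rel x (ext x)"
proof -
  assume "x \<in> comp_ring A C"
  then have "\<exists>y. ext_rel x y" by induction (auto intro: ext_rel.intros)
  then show ?thesis using ext_eqI by blast
qed

lemma ext_prod: "a \<in> A \<Longrightarrow> c \<in> C \<Longrightarrow> ext (a * c) = lam a * mu c"
  using ext_eqI[OF ext_rel.step[OF _ _ ext_rel.zero, of a c]] by simp

lemma ext_left: "a \<in> A \<Longrightarrow> ext a = lam a"
  using ext_prod[OF _ subring_1[OF C(1)], of a] mu_k subring_1[OF subfield_imp_subring[OF k]] by simp

lemma ext_right: "c \<in> C \<Longrightarrow> ext c = mu c"
  using ext_prod[OF subring_1[OF A(1)], of c] lam_k subring_1[OF subfield_imp_subring[OF k]] by simp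

lemma ext_add: "x \<in> comp_ring A C \<Longrightarrow> y \<in> comp_ring A C \<Longrightarrow> ext (x + y) = ext x + ext y"
  by (intro ext_eqI ext_rel_add ext_rel_ext)

lemma ext_0 [simp]: "ext 0 = 0"
  by (rule ext_eqI) (rule ext_rel.zero)

lemma ext_1 [simp]: "ext 1 = 1"
  using ext_left[OF subring_1[OF A(1)]] lam_k subring_1[OF subfield_imp_subring[OF k]] by simp

lemma ext_sum: "(\<And>i. i \<in> I \<Longrightarrow> f i \<in> comp_ring A C) \<Longrightarrow> ext (sum f I) = (\<Sum>i\<in>I. ext (f i))"
  by (induction I rule: infinite_finite_induct) (auto simp: ext_add comp_ring_sum)

lemma ext_mult:
  assumes "x \<in> comp_ring A C" "y \<in> comp_ring A C" shows "ext (x * y) = ext x * ext y"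
proof -
  have R: "subring_set (comp_ring A C)" by (rule subring_comp_ring[OF A(1) C(1)])
  have m: "ext (a * c * x) = lam a * mu c * ext x" if "x \<in> comp_ring A C" "a \<in> A" "c \<in> C" for a c x
    using that
  proof induction
    case zero
    then show ?case by simp
  next
    case (step a' c' x)
    have mem: "a * a' \<in> A" "c * c' \<in> C"
      using step by (auto intro!: subring_mult[OF A(1)] subring_mult[OF C(1)])
    have mem2: "a * c * x \<in> comp_ring A C"
      by (rule subring_mult[OF R comp_ring_prod]) (use step in auto)
    have "ext (a * c * (a' * c' + x)) = ext ((a * a') * (c * c') + a * c * x)"
      by (simp add: algebra_simps)
    also have "\<dots> = lam (a * a') * mu (c * c') + ext (a * c * x)"
      using mem mem2 by (simp add: ext_add ext_prod comp_ring_prod)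
    also have "\<dots> = lam a * mu c * ext (a' * c' + x)"
      using step by (simp add: lam_mult mu_mult ext_add comp_ring_prod ext_prod algebra_simps)
    finally show ?case .
  qed
  show ?thesis
    using assms(1)
  proof induction
    case zero
    then show ?case by simp
  next
    case (step a c x)
    then show ?case
      using assms(2)
      by (simp add: distrib_right ext_add ext_prod m comp_ring_prod subring_mult[OF R])
  qed
qed

lemma ext_uminus: "x \<in> comp_ring A C \<Longrightarrow> ext (- x) = - ext x"
  by (intro ext_eqI ext_rel_uminus ext_rel_ext)

lemma ext_diff: "x \<in> comp_ring A C \<Longrightarrow> y \<in> comp_ring A C \<Longrightarrow> ext (x - y) = ext x - ext y"
  using ext_rel_add[OF ext_rel_ext ext_rel_uminus[OF ext_rel_ext]] ext_eqI by fastforce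

lemma ext_in:
  assumes "lam ` A \<subseteq> A'" "mu ` C \<subseteq> C'" "x \<in> comp_ring A C"
  shows "ext x \<in> comp_ring A' C'"
  using ext_rel_ext[OF assms(3)]
  by induction (use assms(1,2) in \<open>auto intro!: comp_ring.intros\<close>)

end


section \<open>Finite groups acting on fields\<close>

definition ring_endo :: "'a::field set \<Rightarrow> ('a \<Rightarrow> 'a) \<Rightarrow> bool" where
  "ring_endo L \<sigma> \<longleftrightarrow> (\<forall>x\<in>L. \<sigma> x \<in> L) \<and> \<sigma> 1 = 1 \<and>
     (\<forall>x\<in>L. \<forall>y\<in>L. \<sigma> (x + y) = \<sigma> x + \<sigma> y \<and> \<sigma> (x * y) = \<sigma> x * \<sigma> y)"

context
  fixes L :: "'a::field set" and \<sigma>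
  assumes L: "subring_set L" and \<sigma>: "ring_endo L \<sigma>"
begin

lemma endo_in: "x \<in> L \<Longrightarrow> \<sigma> x \<in> L"
  and endo_1: "\<sigma> 1 = 1"
  and endo_add: "x \<in> L \<Longrightarrow> y \<in> L \<Longrightarrow> \<sigma> (x + y) = \<sigma> x + \<sigma> y"
  and endo_mult: "x \<in> L \<Longrightarrow> y \<in> L \<Longrightarrow> \<sigma> (x * y) = \<sigma> x * \<sigma> y"
  using \<sigma> by (simp_all add: ring_endo_def)

lemma endo_0: "\<sigma> 0 = 0"
proof -
  have "\<sigma> (0 + 0) = \<sigma> 0 + \<sigma> 0" by (intro endo_add subring_0[OF L])
  then have "\<sigma> 0 + 0 = \<sigma> 0 + \<sigma> 0" by (simp only: add_0_right)
  then show ?thesis by (simp only: add_left_cancel)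
qed

lemma endo_uminus: "x \<in> L \<Longrightarrow> \<sigma> (- x) = - \<sigma> x"
  using endo_add[OF _ subring_uminus[OF L], of x x] endo_0 by (simp add: eq_neg_iff_add_eq_0 add.commute)

lemma endo_diff: "x \<in> L \<Longrightarrow> y \<in> L \<Longrightarrow> \<sigma> (x - y) = \<sigma> x - \<sigma> y"
  using endo_add[OF _ subring_uminus[OF L], of x y] endo_uminus by simp

lemma endo_sum: "(\<And>i. i \<in> I \<Longrightarrow> f i \<in> L) \<Longrightarrow> \<sigma> (sum f I) = (\<Sum>i\<in>I. \<sigma> (f i))"
  by (induction I rule: infinite_finite_induct) (auto simp: endo_0 endo_add subring_sum[OF L])

lemma endo_power: "x \<in> L \<Longrightarrow> \<sigma> (x ^ n) = \<sigma> x ^ n"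
  by (induction n) (auto simp: endo_1 endo_mult subring_power[OF L])

lemma endo_inverse: "subfield_set L \<Longrightarrow> x \<in> L \<Longrightarrow> \<sigma> (inverse x) = inverse (\<sigma> x)"
  using endo_mult[of x "inverse x"] subfield_inverse[of L x] endo_1 endo_0
  by (cases "x = 0") (auto intro: inverse_unique[symmetric])

lemma endo_poly:
  assumes "coeffs_in L p" "x \<in> L"
  shows "\<sigma> (poly p x) = (\<Sum>i\<le>Polynomial.degree p. \<sigma> (Polynomial.coeff p i) * \<sigma> x ^ i)"
proof -
  have m: "Polynomial.coeff p i \<in> L" "x ^ i \<in> L" for i
    using assms subring_power[OF L] by (auto simp: coeffs_in_def)
  show ?thesis
    unfolding poly_altdef using m assms(2)
    by (subst endo_sum) (simp_all add: endo_mult endo_power subring_mult[OF L])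
qed

lemma endo_poly_fixed:
  assumes "coeffs_in L p" "x \<in> L" "\<And>i. \<sigma> (Polynomial.coeff p i) = Polynomial.coeff p i"
  shows "\<sigma> (poly p x) = poly p (\<sigma> x)"
  using endo_poly[OF assms(1,2)] assms(3) by (simp add: poly_altdef)

text \<open>Since \<sigma> is a homomorphism on L only, its effect on polynomials is expressed
  coefficient by coefficient.\<close>

lemma endo_root_poly:
  assumes "finite R" "R \<subseteq> L"
  shows "coeffs_in L (\<Prod>y\<in>R. [:- y, 1:]) \<and>
    \<sigma> (Polynomial.coeff (\<Prod>y\<in>R. [:- y, 1:]) i) = Polynomial.coeff (\<Prod>y\<in>R. [:- \<sigma> y, 1:]) i"
  using assms
proof (induction R arbitrary: i rule: finite_induct)
  case empty
  then show ?case using coeffs_in_1[OF L] by (auto simp: endo_0 endo_1 Polynomial.coeff_1)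
next
  case (insert r R)
  let ?p = "\<Prod>y\<in>R. [:- y, 1:]" and ?q = "\<Prod>y\<in>R. [:- \<sigma> y, 1:]"
  have ih: "coeffs_in L ?p" "\<And>i. \<sigma> (Polynomial.coeff ?p i) = Polynomial.coeff ?q i" and r: "r \<in> L"
    using insert by auto
  have "coeffs_in L ([:- r, 1:] * ?p)"
    by (intro coeffs_in_mult[OF L] coeffs_in_pCons[OF L] coeffs_in_0[OF L] ih subring_uminus[OF L] subring_1[OF L] r)
  moreover have c: "Polynomial.coeff ([:- a, 1:] * p) i =
      - a * Polynomial.coeff p i + (case i of 0 \<Rightarrow> 0 | Suc j \<Rightarrow> Polynomial.coeff p j)" for a :: 'a and p
    by (simp add: coeff_pCons split: nat.split)
  have "\<sigma> (Polynomial.coeff ([:- r, 1:] * ?p) i) = Polynomial.coeff ([:- \<sigma> r, 1:] * ?q) i"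
    unfolding c using ih r
    by (cases i) (auto simp: coeffs_in_def endo_diff endo_mult endo_uminus endo_add subring_mult[OF L] subring_uminus[OF L])
  ultimately show ?case using insert.hyps by simp
qed

lemma endo_root_poly_fixed:
  assumes "finite R" "R \<subseteq> L" "\<sigma> ` R = R" "inj_on \<sigma> R"
  shows "\<sigma> (Polynomial.coeff (\<Prod>y\<in>R. [:- y, 1:]) i) = Polynomial.coeff (\<Prod>y\<in>R. [:- y, 1:]) i"
proof -
  have "(\<Prod>y\<in>R. [:- \<sigma> y, 1:]) = (\<Prod>y\<in>\<sigma> ` R. [:- y, 1:])"
    using assms(4) by (simp add: prod.reindex)
  then show ?thesis using endo_root_poly[OF assms(1,2), of i] assms(3) by simp
qed

end

lemma poly_root_poly: "finite R \<Longrightarrow> poly (\<Prod>y\<in>R. [:- y, 1:]) x = 0 \<longleftrightarrow> (x::'a::field) \<in> R"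
  by (auto simp: poly_prod)

lemma rsquarefree_root_poly:
  fixes R :: "'a::field set"
  assumes "finite R" shows "Polynomial.rsquarefree (\<Prod>y\<in>R. [:- y, 1:])"
proof -
  have nz: "(\<Prod>y\<in>R. [:- y, 1:]) \<noteq> 0" using assms by auto
  have "order a (\<Prod>y\<in>R. [:- y, 1:]) \<le> 1" for a
  proof (cases "a \<in> R")
    case True
    have "(\<Prod>y\<in>R. [:- y, 1:]) = [:- a, 1:] * (\<Prod>y\<in>R - {a}. [:- y, 1:])"
      using True assms by (simp only: prod.remove)
    moreover have "order a (\<Prod>y\<in>R - {a}. [:- y, 1:]) = 0"
      using poly_root_poly[of "R - {a}" a] assms by (intro order_0I) auto
    moreover have "order a [:- a, 1:] = 1" using order_power_n_n[of a 1] by simp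
    ultimately show ?thesis using nz by (metis order_mult add.right_neutral order_refl)
  next
    case False
    then show ?thesis using poly_root_poly[OF assms, of a] by (simp add: order_0I)
  qed
  then show ?thesis using nz unfolding Polynomial.rsquarefree_def
    by (metis le_SucE le_zero_eq One_nat_def)
qed

lemma lead_coeff_root_poly: "finite R \<Longrightarrow> lead_coeff (\<Prod>y\<in>R. [:- y, 1:]) = (1::'a::field)"
  by (subst lead_coeff_prod) simp

text \<open>An abstract group acts, so that subgroups, products and isomorphic copies of Galois
  groups fit one pattern. As in Artin's approach, K is given as the fixed field, and the axioms
  constrain the action on L only.\<close>

locale gal_act =
  fixes G :: "('g, 'm) monoid_scheme" (structure)
    and L K :: "'a::field set" and act :: "'g \<Rightarrow> 'a \<Rightarrow> 'a"
  assumes grp: "group G" and fin: "finite (carrier G)" and L: "subfield_set L"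
    and endo: "g \<in> carrier G \<Longrightarrow> ring_endo L (act g)"
    and act_comp: "g \<in> carrier G \<Longrightarrow> h \<in> carrier G \<Longrightarrow> x \<in> L \<Longrightarrow> act (g \<otimes> h) x = act g (act h x)"
    and act_one: "x \<in> L \<Longrightarrow> act \<one> x = x"
    and fixed: "K = {x \<in> L. \<forall>g\<in>carrier G. act g x = x}"
    and faithful: "g \<in> carrier G \<Longrightarrow> g \<noteq> \<one> \<Longrightarrow> \<exists>x\<in>L. act g x \<noteq> x"
begin

sublocale group G by (rule grp)

lemmas LR = subfield_imp_subring[OF L]

lemma act_in: "g \<in> carrier G \<Longrightarrow> x \<in> L \<Longrightarrow> act g x \<in> L"
  using endo_in[OF LR endo] .

lemma act_inv: "g \<in> carrier G \<Longrightarrow> x \<in> L \<Longrightarrow> act g (act (inv g) x) = x"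
  "g \<in> carrier G \<Longrightarrow> x \<in> L \<Longrightarrow> act (inv g) (act g x) = x"
  using act_comp[of g "inv g" x] act_comp[of "inv g" g x] act_one by auto

lemma act_inj_on: "g \<in> carrier G \<Longrightarrow> inj_on (act g) L"
  by (metis act_inv(2) inj_onI)

lemma K_subset: "K \<subseteq> L" by (auto simp: fixed)

lemma act_K: "g \<in> carrier G \<Longrightarrow> x \<in> K \<Longrightarrow> act g x = x" by (auto simp: fixed)

lemma subfield_K: "subfield_set K"
  unfolding subfield_set_def subring_set_def fixed
  using subring_closed[OF LR] endo_1[OF LR endo] endo_diff[OF LR endo] endo_mult[OF LR endo]
    endo_inverse[OF LR endo L] subfield_inverse[OF L] by auto

section \<open>Traces, dual bases and independence of automorphisms\<close>

definition tr where "tr x = (\<Sum>g\<in>carrier G. act g x)"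

lemma bij_left_mult: "h \<in> carrier G \<Longrightarrow> bij_betw (\<lambda>g. h \<otimes> g) (carrier G) (carrier G)"
  by (rule bij_betwI[of _ _ _ "\<lambda>g. inv h \<otimes> g"]) (auto simp: m_assoc[symmetric])

lemma tr_in_L: "x \<in> L \<Longrightarrow> tr x \<in> L"
  unfolding tr_def by (intro subring_sum[OF LR] act_in)

lemma tr_in: assumes "x \<in> L" shows "tr x \<in> K"
proof -
  have "act h (tr x) = tr x" if h: "h \<in> carrier G" for h
  proof -
    have "act h (tr x) = (\<Sum>g\<in>carrier G. act (h \<otimes> g) x)"
      unfolding tr_def using assms h by (subst endo_sum[OF LR endo]) (auto simp: act_in act_comp)
    also have "\<dots> = tr x"
      unfolding tr_def by (rule sum.reindex_bij_betw[OF bij_left_mult[OF h]])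
    finally show ?thesis .
  qed
  then show ?thesis using tr_in_L[OF assms] by (auto simp: fixed)
qed

lemma tr_scale: "a \<in> K \<Longrightarrow> x \<in> L \<Longrightarrow> tr (a * x) = a * tr x"
  using K_subset by (simp add: tr_def endo_mult[OF LR endo] act_K subset_iff sum_distrib_left)

text \<open>The list ps stands for a sum of tensors of z and u, and \<open>pairing ps g\<close> is
  its coordinate at g under the map from the tensor square of L to functions on the group which
  sends the tensor of z and u to z g(u).\<close>

definition pairing where "pairing ps g = (\<Sum>(z, u)\<leftarrow>ps. z * act g u)"

text \<open>The tensor is the product over D of 1 tensor y - d(y) tensor 1, with y =
  \<open>y d\<close>. Its coordinate at g contains a factor 0 when g lies in D. Keeping left entries
  in B and right entries in N later keeps them integral or inside a given subring.\<close>

lemma coordinates: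
  assumes B: "subring_set B" "B \<subseteq> L" and N: "subring_set N" "N \<subseteq> B"
    and D: "finite D" "D \<subseteq> carrier G" "\<forall>d\<in>D. y d \<in> N \<and> act d (y d) \<in> B"
  shows "\<exists>ps. set ps \<subseteq> B \<times> N \<and>
    (\<forall>g\<in>carrier G. pairing ps g = (\<Prod>d\<in>D. act g (y d) - act d (y d)))"
  using D
proof (induction D rule: finite_induct)
  case empty
  then show ?case
    using subring_1[OF B(1)] subring_1[OF N(1)] endo_1[OF LR endo]
    by (intro exI[of _ "[(1, 1)]"]) (auto simp: pairing_def)
next
  case (insert d D)
  then obtain ps where ps: "set ps \<subseteq> B \<times> N"
    "\<forall>g\<in>carrier G. pairing ps g = (\<Prod>d\<in>D. act g (y d) - act d (y d))" by auto
  define b where "b = act d (y d)"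
  \<comment> \<open>Multiplication of the tensor by 1 tensor \<open>y d\<close> minus b tensor
    1.\<close>
  define ps' where "ps' = map (\<lambda>(z, u). (z, u * y d)) ps @ map (\<lambda>(z, u). (- (z * b), u)) ps"
  have yd: "y d \<in> N" "b \<in> B" "y d \<in> L" using insert.prems N B by (auto simp: b_def)
  have "set ps' \<subseteq> B \<times> N"
    using ps(1) yd by (auto simp: ps'_def intro!: subring_mult[OF N(1)] subring_mult[OF B(1)] subring_uminus[OF B(1)])
  moreover have "pairing ps' g = (act g (y d) - b) * pairing ps g" if g: "g \<in> carrier G" for g
  proof -
    have "\<forall>(z, u)\<in>set ps. u \<in> L" using ps(1) N B by auto
    then show ?thesis
      unfolding ps'_def pairing_def
      by (induction ps) (auto simp: endo_mult[OF LR endo[OF g]] yd algebra_simps)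
  qed
  ultimately show ?case
    using ps(2) insert.hyps by (intro exI[of _ ps']) (auto simp: b_def)
qed

text \<open>The sum of the g(z) u is g applied to the coordinate at g^-1. Hence the sum of the tr(x
  z) u is the sum over g of g(x) times this value, and only g = 1 survives.\<close>

lemma pairing_dual:
  assumes ps: "set ps \<subseteq> L \<times> L" and 0: "\<And>g. g \<in> carrier G \<Longrightarrow> g \<noteq> \<one> \<Longrightarrow> pairing ps g = 0"
    and x: "x \<in> L"
  shows "pairing ps \<one> * x = (\<Sum>(z, u)\<leftarrow>ps. tr (x * z) * u)"
proof -
  have a: "act g (pairing ps (inv g)) = (\<Sum>(z, u)\<leftarrow>ps. act g z * u)" if g: "g \<in> carrier G" for g
    using ps
  proof (induction ps)
    case Nil
    then show ?case using endo_0[OF LR endo[OF g]] by (simp add: pairing_def)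
  next
    case (Cons p ps)
    obtain z u where p: "p = (z, u)" by force
    have "z \<in> L" "u \<in> L" "act (inv g) u \<in> L" "pairing ps (inv g) \<in> L"
      using Cons.prems g
      by (auto simp: p pairing_def act_in intro!: subring_sum_list[OF LR] subring_mult[OF LR] act_in)
    then show ?case
      using Cons g by (auto simp: p pairing_def endo_add[OF LR endo[OF g]] endo_mult[OF LR endo[OF g]]
          subring_mult[OF LR] act_inv)
  qed
  have "(\<Sum>(z, u)\<leftarrow>ps. tr (x * z) * u) = (\<Sum>g\<in>carrier G. act g x * (\<Sum>(z, u)\<leftarrow>ps. act g z * u))"
    using ps
  proof (induction ps)
    case (Cons p ps)
    obtain z u where p: "p = (z, u)" by force
    have "tr (x * z) = (\<Sum>g\<in>carrier G. act g x * act g z)"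
      using Cons.prems x by (simp add: p tr_def endo_mult[OF LR endo])
    then show ?case
      using Cons by (simp add: p sum.distrib[symmetric] sum_distrib_right distrib_left mult.assoc)
  qed simp
  also have "\<dots> = (\<Sum>g\<in>carrier G. act g x * act g (pairing ps (inv g)))"
    using a by simp
  also have "\<dots> = (\<Sum>g\<in>{\<one>}. act g x * act g (pairing ps (inv g)))"
  proof (rule sum.mono_neutral_right)
    show "\<forall>g\<in>carrier G - {\<one>}. act g x * act g (pairing ps (inv g)) = 0"
      using 0 endo_0[OF LR endo] by (auto simp: inv_eq_1_iff)
  qed (use fin in auto)
  also have "\<dots> = pairing ps \<one> * x"
  proof -
    have "pairing ps \<one> \<in> L"
      unfolding pairing_def using ps
      by (intro subring_sum_list[OF LR]) (auto intro!: subring_mult[OF LR] act_in)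
    then show ?thesis using x by (simp add: act_one)
  qed
  finally show ?thesis by simp
qed

text \<open>Elements of N moved by g supply the factors, so the coordinate at 1 is a product of
  nonzero differences. It is divided out of the left entries, and the right entries remain in
  N.\<close>

lemma normalized_coordinates:
  assumes N: "subring_set N" "N \<subseteq> L" and sep: "\<And>g. g \<in> carrier G \<Longrightarrow> g \<noteq> \<one> \<Longrightarrow> \<exists>y\<in>N. act g y \<noteq> y"
  obtains ps where "set ps \<subseteq> L \<times> N" "\<And>g. g \<in> carrier G \<Longrightarrow> pairing ps g = (if g = \<one> then 1 else 0)"
proof -
  have "\<forall>g\<in>carrier G - {\<one>}. \<exists>y. y \<in> N \<and> act g y \<noteq> y" using sep by blast
  then obtain y where "\<forall>g\<in>carrier G - {\<one>}. y g \<in> N \<and> act g (y g) \<noteq> y g"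
    by (rule bchoice[THEN exE])
  then have y: "\<And>g. g \<in> carrier G \<Longrightarrow> g \<noteq> \<one> \<Longrightarrow> y g \<in> N \<and> act g (y g) \<noteq> y g" by blast
  let ?D = "carrier G - {\<one>}"
  have "\<forall>d\<in>?D. y d \<in> N \<and> act d (y d) \<in> L" using y N by (auto intro: act_in)
  then have "\<exists>ps. set ps \<subseteq> L \<times> N \<and>
      (\<forall>g\<in>carrier G. pairing ps g = (\<Prod>d\<in>?D. act g (y d) - act d (y d)))"
    using coordinates[OF LR order_refl N, of ?D y] fin by simp
  then obtain ps where ps: "set ps \<subseteq> L \<times> N"
    "\<forall>g\<in>carrier G. pairing ps g = (\<Prod>d\<in>?D. act g (y d) - act d (y d))"
    by (elim exE conjE)
  define d where "d = pairing ps \<one>"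
  have yL: "y g \<in> L" if "g \<in> ?D" for g using y[of g] N that by auto
  have "(\<Prod>d\<in>?D. act \<one> (y d) - act d (y d)) \<noteq> 0"
  proof -
    have "act \<one> (y d) - act d (y d) \<noteq> 0" if "d \<in> ?D" for d
      using y[of d] act_one[OF yL[OF that]] that by (metis Diff_iff eq_iff_diff_eq_0 insertI1)
    then show ?thesis using fin by (simp add: prod_zero_iff)
  qed
  then have d0: "d \<noteq> 0" using ps(2) by (simp add: d_def)
  have dL: "d \<in> L"
    unfolding d_def pairing_def using ps(1) N by (auto intro!: subring_sum_list[OF LR] subring_mult[OF LR] act_in)
  define qs where "qs = map (\<lambda>(z, u). (z / d, u)) ps"
  have "set qs \<subseteq> L \<times> N" using ps(1) dL by (auto simp: qs_def intro!: subfield_divide[OF L])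
  moreover have "pairing qs g = pairing ps g / d" for g
    unfolding qs_def pairing_def by (induction ps) (auto simp: add_divide_distrib)
  moreover have "pairing ps g = 0" if "g \<in> carrier G" "g \<noteq> \<one>" for g
  proof -
    have "(\<Prod>d\<in>?D. act g (y d) - act d (y d)) = 0" using fin that by (intro prod_zero) auto
    then show ?thesis using ps(2) that by simp
  qed
  ultimately show ?thesis using that[of qs] d0 by (simp add: d_def)
qed

lemma dual_basis:
  assumes N: "subring_set N" "N \<subseteq> L" and sep: "\<And>g. g \<in> carrier G \<Longrightarrow> g \<noteq> \<one> \<Longrightarrow> \<exists>y\<in>N. act g y \<noteq> y"
  obtains ps where "set ps \<subseteq> L \<times> N" "\<And>x. x \<in> L \<Longrightarrow> x = (\<Sum>(z, u)\<leftarrow>ps. tr (x * z) * u)"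
proof -
  obtain ps where ps: "set ps \<subseteq> L \<times> N" "\<And>g. g \<in> carrier G \<Longrightarrow> pairing ps g = (if g = \<one> then 1 else 0)"
    using normalized_coordinates[OF assms] by blast
  have "x = (\<Sum>(z, u)\<leftarrow>ps. tr (x * z) * u)" if "x \<in> L" for x
    using pairing_dual[of ps x] ps that N by auto
  then show ?thesis using that ps(1) by blast
qed

text \<open>This is the part of the Galois correspondence that is used. Traces lie in K, and a dual
  basis can be chosen with its right entries in N, so the expansion of any x takes place in
  N.\<close>

lemma separating_subring_eq:
  assumes N: "subring_set N" "N \<subseteq> L" "K \<subseteq> N"
    and sep: "\<And>g. g \<in> carrier G \<Longrightarrow> g \<noteq> \<one> \<Longrightarrow> \<exists>y\<in>N. act g y \<noteq> y"
  shows "N = L"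
proof -
  obtain ps where ps: "set ps \<subseteq> L \<times> N" "\<And>x. x \<in> L \<Longrightarrow> x = (\<Sum>(z, u)\<leftarrow>ps. tr (x * z) * u)"
    using dual_basis[OF N(1,2) sep] by blast
  have "x \<in> N" if x: "x \<in> L" for x
  proof -
    have "(\<Sum>(z, u)\<leftarrow>ps. tr (x * z) * u) \<in> N"
    proof (rule subring_sum_list[OF N(1)], clarify)
      fix z u assume "(z, u) \<in> set ps"
      then have "z \<in> L" "u \<in> N" using ps(1) by auto
      then show "tr (x * z) * u \<in> N"
        using tr_in[OF subring_mult[OF LR x]] N(3) by (auto intro: subring_mult[OF N(1)])
    qed
    then show ?thesis using ps(2)[OF x] by simp
  qed
  then show ?thesis using N(2) by blast
qed

text \<open>If every trace were 0, the dual basis expansion of 1 would vanish. Elements of K can be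
  taken out of the trace to normalize it.\<close>

lemma tr_eq_1:
  obtains w where "w \<in> L" "tr w = 1"
proof -
  obtain ps where ps: "set ps \<subseteq> L \<times> L" "\<And>x. x \<in> L \<Longrightarrow> x = (\<Sum>(z, u)\<leftarrow>ps. tr (x * z) * u)"
    using dual_basis[OF LR order_refl] faithful by blast
  have "\<exists>v\<in>L. tr v \<noteq> 0"
  proof (rule ccontr)
    assume "\<not> ?thesis"
    then have "(\<Sum>(z, u)\<leftarrow>ps. tr (1 * z) * u) = 0"
      using ps(1) by (induction ps) auto
    then show False using ps(2)[OF subring_1[OF LR]] by simp
  qed
  then obtain v where v: "v \<in> L" "tr v \<noteq> 0" by blast
  have "inverse (tr v) \<in> K" using subfield_inverse[OF subfield_K tr_in[OF v(1)]] .
  then show ?thesis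
    using that[of "inverse (tr v) * v"] v K_subset tr_scale[of "inverse (tr v)" v]
    by (auto intro: subring_mult[OF LR])
qed

text \<open>Evaluating the relation at the right entries of a normalized list, weighted with the
  left entries, isolates the coefficient at the neutral element.\<close>

lemma independence_at_one:
  assumes c: "\<And>x. x \<in> L \<Longrightarrow> (\<Sum>g\<in>carrier G. c g * act g x) = 0"
  shows "c \<one> = 0"
proof -
  obtain ps where ps: "set ps \<subseteq> L \<times> L" "\<And>g. g \<in> carrier G \<Longrightarrow> pairing ps g = (if g = \<one> then 1 else 0)"
    using normalized_coordinates[OF LR order_refl] faithful by blast
  have "(\<Sum>g\<in>carrier G. c g * pairing ps g) = 0"
    using ps(1)
  proof (induction ps)
    case (Cons p ps)
    obtain z u where p: "p = (z, u)" by force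
    have "(\<Sum>g\<in>carrier G. c g * pairing (p # ps) g) =
        z * (\<Sum>g\<in>carrier G. c g * act g u) + (\<Sum>g\<in>carrier G. c g * pairing ps g)"
      by (simp add: p pairing_def sum.distrib sum_distrib_left algebra_simps)
    then show ?case using Cons c by (auto simp: p)
  qed (simp add: pairing_def)
  moreover have "(\<Sum>g\<in>carrier G. c g * pairing ps g) = (\<Sum>g\<in>carrier G. if g = \<one> then c g else 0)"
    by (rule sum.cong) (auto simp: ps(2))
  ultimately show ?thesis using fin by simp
qed

text \<open>The group permutes the orbit of x, so the product of the X - y over the orbit as a set
  has coefficients in K and simple roots.\<close>

lemma orbit_poly:
  assumes x: "x \<in> L"
  obtains p where "coeffs_in K p" "Polynomial.rsquarefree p" "lead_coeff p = 1"
    "\<And>y. poly p y = 0 \<longleftrightarrow> (\<exists>g\<in>carrier G. y = act g x)"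
proof -
  define R where "R = (\<lambda>g. act g x) ` carrier G"
  have R: "finite R" "R \<subseteq> L" using fin x by (auto simp: R_def act_in)
  have img: "act h ` R = R" if h: "h \<in> carrier G" for h
  proof -
    have "act h ` R = (\<lambda>g. act (h \<otimes> g) x) ` carrier G"
      unfolding R_def image_image using h x by (intro image_cong) (auto simp: act_comp)
    also have "\<dots> = (\<lambda>g. act g x) ` (\<lambda>g. h \<otimes> g) ` carrier G" by (simp add: image_image)
    also have "(\<lambda>g. h \<otimes> g) ` carrier G = carrier G" using bij_left_mult[OF h] by (simp add: bij_betw_def)
    finally show ?thesis by (simp add: R_def)
  qed
  let ?p = "\<Prod>y\<in>R. [:- y, 1:]"
  have "act h (Polynomial.coeff ?p i) = Polynomial.coeff ?p i" if "h \<in> carrier G" for h i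
    using endo_root_poly_fixed[OF LR endo[OF that] R img[OF that]] inj_on_subset[OF act_inj_on[OF that] R(2)] .
  moreover have "coeffs_in L ?p" using endo_root_poly[OF LR endo[OF one_closed] R] by blast
  ultimately have "coeffs_in K ?p" by (auto simp: coeffs_in_def fixed)
  then show ?thesis
    using that[of ?p] rsquarefree_root_poly[OF R(1)] lead_coeff_root_poly[OF R(1)] poly_root_poly[OF R(1)]
    by (auto simp: R_def)
qed

end


section \<open>The local ring of a rational point\<close>

text \<open>The geometry is reduced to axioms. V plays the coordinate ring of an affine line, and P
  is a prime with residue field k in the integral closure of V in F. \<open>V_order\<close> is the
  factorization of elements of V by their order of vanishing at the point.\<close>

locale rat_point =
  fixes k kb V F P :: "'a::field set" and \<pi> :: 'a
  assumes k: "subfield_set k" and kb: "subfield_set kb" "k \<subseteq> kb"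
    and kb_integral: "\<And>x. x \<in> kb \<Longrightarrow> integral_over k x"
    and F: "subfield_set F" and V: "subring_set V" "k \<subseteq> V" "V \<subseteq> F"
    and P_A: "P \<subseteq> {x \<in> F. integral_over V x}"
    and P_diff: "\<And>x y. x \<in> P \<Longrightarrow> y \<in> P \<Longrightarrow> x - y \<in> P"
    and P_mult: "\<And>x y. x \<in> F \<Longrightarrow> integral_over V x \<Longrightarrow> y \<in> P \<Longrightarrow> x * y \<in> P"
    and P_1: "1 \<notin> P"
    and P_prime: "\<And>x y. x \<in> F \<Longrightarrow> integral_over V x \<Longrightarrow> y \<in> F \<Longrightarrow> integral_over V y \<Longrightarrow>
      x * y \<in> P \<Longrightarrow> x \<in> P \<or> y \<in> P"
    and residue: "\<And>x. x \<in> F \<Longrightarrow> integral_over V x \<Longrightarrow> \<exists>c\<in>k. x - c \<in> P"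
    and \<pi>: "\<pi> \<in> V" "\<pi> \<in> P" "\<pi> \<noteq> 0"
    and V_order: "\<And>v. v \<in> V \<Longrightarrow> v \<noteq> 0 \<Longrightarrow> \<exists>n w. w \<in> V \<and> w \<notin> P \<and> v = \<pi> ^ n * w"
    and algebraic: "\<And>x. x \<in> F \<Longrightarrow> \<exists>n a. (\<forall>i. a i \<in> V) \<and> (\<Sum>i\<le>n. a i * x ^ i) = 0 \<and> (\<exists>i\<le>(n::nat). a i \<noteq> 0)"
begin

definition A where "A = {x \<in> F. integral_over V x}"

lemmas FR = subfield_imp_subring[OF F]
lemmas kR = subfield_imp_subring[OF k]
lemmas kbR = subfield_imp_subring[OF kb(1)]

lemma A: "subring_set A"
proof -
  have "A = F \<inter> {x. integral_over V x}" by (auto simp: A_def)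
  then show ?thesis using subring_set_Int[OF FR subring_integral[OF V(1)]] by simp
qed

lemma VA: "V \<subseteq> A" using V integral_over_self[OF V(1)] by (auto simp: A_def)

lemma kA: "k \<subseteq> A" using VA V by blast

lemma AF: "A \<subseteq> F" by (auto simp: A_def)

lemma PA: "P \<subseteq> A" using P_A by (simp add: A_def)

lemma P_0: "0 \<in> P" using P_diff[OF \<pi>(2) \<pi>(2)] by simp

lemma P_uminus: "x \<in> P \<Longrightarrow> - x \<in> P" using P_diff[OF P_0, of x] by simp

lemma P_add: "x \<in> P \<Longrightarrow> y \<in> P \<Longrightarrow> x + y \<in> P" using P_diff[OF _ P_uminus, of x y] by simp

lemma P_mult_left: "x \<in> A \<Longrightarrow> y \<in> P \<Longrightarrow> x * y \<in> P" using P_mult by (auto simp: A_def)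

lemma P_mult_right: "y \<in> P \<Longrightarrow> x \<in> A \<Longrightarrow> y * x \<in> P" using P_mult_left by (simp add: mult.commute)

lemma P_primeA: "x \<in> A \<Longrightarrow> y \<in> A \<Longrightarrow> x * y \<in> P \<Longrightarrow> x \<in> P \<or> y \<in> P"
  using P_prime by (auto simp: A_def)

lemma P_k: "c \<in> k \<Longrightarrow> c \<in> P \<Longrightarrow> c = 0"
  using P_mult_left[of "inverse c" c] subfield_inverse[OF k, of c] kA P_1 by (cases "c = 0") auto

text \<open>The least power of \<pi> occurring in the nonzero coefficients is divided out, so at
  least one coefficient leaves P.\<close>

lemma relation_outside_P:
  assumes "x \<in> F"
  obtains n :: nat and a m where "\<forall>i. a i \<in> V" "(\<Sum>i\<le>n. a i * x ^ i) = 0" "m \<le> n" "a m \<notin> P"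
proof -
  obtain n :: nat and a where na: "(\<forall>i. a i \<in> V) \<and> (\<Sum>i\<le>n. a i * x ^ i) = 0 \<and> (\<exists>i\<le>n. a i \<noteq> 0)"
    using algebraic[OF assms] by (elim exE) (rule that)
  note a = na[THEN conjunct1] na[THEN conjunct2, THEN conjunct1] na[THEN conjunct2, THEN conjunct2]
  have "\<forall>i. \<exists>e w. a i \<noteq> 0 \<longrightarrow> w \<in> V \<and> w \<notin> P \<and> a i = \<pi> ^ e * w"
    using V_order a(1) by blast
  then obtain e w where ew: "\<And>i. a i \<noteq> 0 \<Longrightarrow> w i \<in> V \<and> w i \<notin> P \<and> a i = \<pi> ^ e i * w i"
    by metis
  define S where "S = {i. i \<le> n \<and> a i \<noteq> 0}"
  have S: "finite S" "S \<noteq> {}" using a(3) by (auto simp: S_def)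
  obtain m where m: "m \<in> S" "\<And>i. i \<in> S \<Longrightarrow> e m \<le> e i"
    using ex_min_if_finite[of "e ` S"] S by (metis (no_types, lifting) arg_min_if_finite leI)
  define b where "b = (\<lambda>i. if i \<in> S then \<pi> ^ (e i - e m) * w i else 0)"
  have ab: "a i = \<pi> ^ e m * b i" if "i \<le> n" for i
    using that ew[of i] m(2)[of i] by (auto simp: b_def S_def power_add[symmetric] mult.assoc[symmetric])
  have "b i \<in> V" for i
    using ew[of i] \<pi>(1) subring_0[OF V(1)]
    by (auto simp: b_def S_def intro!: subring_mult[OF V(1)] subring_power[OF V(1)])
  moreover have "(\<Sum>i\<le>n. b i * x ^ i) = 0"
  proof -
    have "\<pi> ^ e m * (\<Sum>i\<le>n. b i * x ^ i) = (\<Sum>i\<le>n. a i * x ^ i)"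
      by (simp add: sum_distrib_left ab mult.assoc)
    then show ?thesis using a(2) \<pi>(3) by simp
  qed
  moreover have "m \<le> n" "b m \<notin> P" using m(1) ew[of m] by (auto simp: S_def b_def)
  ultimately show ?thesis using that by blast
qed

text \<open>Seidenberg's argument: since these partial sums are integral, \<open>x\<close> or its inverse lies in the
  local ring.\<close>

lemma horner_integral:
  assumes a: "\<forall>i. a i \<in> V" and rel: "(\<Sum>i\<le>n. a i * x ^ i) = 0" and "0 < n" and x: "x \<in> F"
  shows "(\<Sum>i\<in>{j..n}. a i * x ^ (i - j)) \<in> A"
proof -
  \<comment> \<open>The partial sum maps the V-module generated by 1, ..., x^(n-1) into itself,
    which is the criterion for integrality.\<close>
  let ?h = "\<Sum>i\<in>{j..n}. a i * x ^ (i - j)" and ?S = "(\<lambda>i. x ^ i) ` {..<n}"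
  have base: "x ^ i \<in> vspan V ?S" if "i < n" for i
    using that by (intro vspan_base[OF V(1)]) auto
  have "?h * x ^ i \<in> vspan V ?S" if i: "i < n" for i
  proof (cases "i < j")
    case True
    have "?h * x ^ i = (\<Sum>l\<in>{j..n}. a l * x ^ (l - j + i))"
      by (simp only: sum_distrib_right mult.assoc power_add)
    also have "\<dots> \<in> vspan V ?S"
    proof (rule vspan_sum[OF V(1)], rule vspan_scale[OF V(1)])
      show "x ^ (l - j + i) \<in> vspan V ?S" if "l \<in> {j..n}" for l
        using that True by (intro base) auto
    qed (use a in auto)
    finally show ?thesis .
  next
    case False
    have split: "(\<Sum>l\<le>n. a l * x ^ l) = (\<Sum>l<j. a l * x ^ l) + (\<Sum>l\<in>{j..n}. a l * x ^ l)"
    proof -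
      have "{..n} = {..<j} \<union> {j..n}" using False i by auto
      then show ?thesis by (simp add: sum.union_disjoint Int_def)
    qed
    \<comment> \<open>For i at least j the exponents in h x^i would become too large; the relation
      replaces h x^j by minus the sum of the lower terms.\<close>
    have "?h * x ^ j = (\<Sum>l\<in>{j..n}. a l * x ^ l)"
      by (simp add: sum_distrib_right mult.assoc power_add[symmetric])
    also have "\<dots> = (\<Sum>l<j. - a l * x ^ l)"
      using split rel by (simp add: sum_negf eq_neg_iff_add_eq_0 add.commute)
    finally have hj: "?h * x ^ j = (\<Sum>l<j. - a l * x ^ l)" .
    have "x ^ i = x ^ j * x ^ (i - j)" using False by (simp add: power_add[symmetric])
    then have "?h * x ^ i = (\<Sum>l<j. - a l * x ^ l) * x ^ (i - j)" using hj by (simp add: mult.assoc[symmetric])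
    also have "\<dots> = (\<Sum>l<j. - a l * x ^ (l + (i - j)))"
      by (simp add: sum_distrib_right mult.assoc power_add)
    also have "\<dots> \<in> vspan V ?S"
    proof (rule vspan_sum[OF V(1)], rule vspan_scale[OF V(1)])
      show "x ^ (l + (i - j)) \<in> vspan V ?S" if "l \<in> {..<j}" for l
        using that False i by (intro base) auto
    qed (use a subring_uminus[OF V(1)] in auto)
    finally show ?thesis .
  qed
  moreover have "1 \<in> ?S" using \<open>0 < n\<close> by (auto intro!: image_eqI[of _ _ 0])
  ultimately have "integral_over V ?h"
    by (intro integral_by_stable_module[OF V(1), of ?S 1]) auto
  moreover have "?h \<in> F"
    using a V x by (auto intro!: subring_sum[OF FR] subring_mult[OF FR] subring_power[OF FR])
  ultimately show ?thesis by (simp add: A_def)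
qed

text \<open>The graph of the residue map on fractions u / b with b outside P: the residue is the
  constant c with u congruent to c b modulo P. Thus \<open>Oc\<close> is the local ring at P and
  \<phi> its residue map.\<close>

definition val where
  "val x c \<longleftrightarrow> c \<in> k \<and> (\<exists>u b. u \<in> A \<and> b \<in> A \<and> b \<notin> P \<and> x = u / b \<and> u - c * b \<in> P)"

lemma valI: "c \<in> k \<Longrightarrow> u \<in> A \<Longrightarrow> b \<in> A \<Longrightarrow> b \<notin> P \<Longrightarrow> x = u / b \<Longrightarrow> u - c * b \<in> P \<Longrightarrow> val x c"
  unfolding val_def by blast

definition Oc where "Oc = {x. \<exists>c. val x c}"
definition \<phi> where "\<phi> x = (THE c. val x c)"

lemma val_unique: "val x c \<Longrightarrow> val x d \<Longrightarrow> c = d"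
proof -
  assume "val x c" "val x d"
  then obtain u b u' b' where c: "c \<in> k" "u \<in> A" "b \<in> A" "b \<notin> P" "x = u / b" "u - c * b \<in> P"
    and d: "d \<in> k" "u' \<in> A" "b' \<in> A" "b' \<notin> P" "x = u' / b'" "u' - d * b' \<in> P"
    unfolding val_def by (elim exE conjE)
  have "b \<noteq> 0" "b' \<noteq> 0" using c d P_0 by auto
  then have "u * b' = u' * b" using c(5) d(5) by (simp add: frac_eq_eq)
  then have "(c - d) * (b * b') = (u' - d * b') * b - (u - c * b) * b'" by (simp add: algebra_simps)
  also have "\<dots> \<in> P" by (rule P_diff[OF P_mult_right[OF d(6) c(3)] P_mult_right[OF c(6) d(3)]])
  finally have "(c - d) * (b * b') \<in> P" .
  moreover have "b * b' \<notin> P" using P_primeA c d by blast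
  moreover have "c - d \<in> k" using c d by (intro subring_diff[OF kR])
  ultimately have "c - d \<in> P" using P_primeA[of "c - d" "b * b'"] kA c d subring_mult[OF A] by blast
  then show ?thesis using P_k[OF \<open>c - d \<in> k\<close>] by simp
qed

lemma val_phi: "x \<in> Oc \<Longrightarrow> val x (\<phi> x)"
  unfolding Oc_def \<phi>_def using val_unique by (auto intro: theI2)

lemma val_eq: "val x c \<Longrightarrow> \<phi> x = c"
  unfolding \<phi>_def using val_unique by blast

lemma val_in: "val x c \<Longrightarrow> x \<in> Oc" by (auto simp: Oc_def)

lemma O_frac: assumes "u \<in> A" "b \<in> A" "b \<notin> P" shows "u / b \<in> Oc" and "u \<in> P \<Longrightarrow> \<phi> (u / b) = 0"
    and "\<phi> (u / b) = 0 \<Longrightarrow> u \<in> P"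
proof -
  obtain c1 c2 where c: "c1 \<in> k" "u - c1 \<in> P" "c2 \<in> k" "b - c2 \<in> P"
    using residue[of u] residue[of b] assms by (auto simp: A_def)
  have "c2 \<noteq> 0" using c assms by auto
  define c where "c = c1 / c2"
  have ck: "c \<in> k" using c subfield_divide[OF k] by (simp add: c_def)
  have "u - c * b = (u - c1) - c * (b - c2)" using \<open>c2 \<noteq> 0\<close> by (simp add: c_def field_simps)
  also have "\<dots> \<in> P" using c ck kA by (intro P_diff[OF c(2) P_mult_left[OF _ c(4)]]) auto
  finally have ucb: "u - c * b \<in> P" .
  then have v: "val (u / b) c" using assms ck by (intro valI) auto
  then show "u / b \<in> Oc" by (rule val_in)
  { assume "u \<in> P"
    then have "val (u / b) 0" using assms subring_0[OF kR] by (intro valI) auto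
    then show "\<phi> (u / b) = 0" by (rule val_eq) }
  { assume "\<phi> (u / b) = 0"
    then have "c = 0" using val_eq[OF v] by simp
    then show "u \<in> P" using ucb by simp }
qed

lemma O_elim:
  assumes "x \<in> Oc"
  obtains u b where "u \<in> A" "b \<in> A" "b \<notin> P" "x = u / b"
  using assms unfolding Oc_def val_def by blast

lemma AO: "A \<subseteq> Oc" using O_frac(1)[of _ 1] subring_1[OF A] P_1 by fastforce

lemma phi_A: "u \<in> A \<Longrightarrow> \<phi> u = 0 \<longleftrightarrow> u \<in> P"
  using O_frac[of u 1] subring_1[OF A] P_1 by fastforce

lemma O_sub_F: "Oc \<subseteq> F"
  using AF by (auto elim!: O_elim intro!: subfield_divide[OF F])

lemma phi_in: "x \<in> Oc \<Longrightarrow> \<phi> x \<in> k" using val_phi by (simp add: val_def)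

lemma phi_k: "c \<in> k \<Longrightarrow> \<phi> c = c"
  using kA subring_1[OF A] P_1 P_0 by (intro val_eq valI[of _ c 1]) auto

lemma kO: "k \<subseteq> Oc" using kA AO by blast

lemma val_diff_mult:
  assumes "x \<in> Oc" "y \<in> Oc"
  shows "val (x + y) (\<phi> x + \<phi> y)" "val (x * y) (\<phi> x * \<phi> y)"
proof -
  obtain u b u' b' where c: "\<phi> x \<in> k" "u \<in> A" "b \<in> A" "b \<notin> P" "x = u / b" "u - \<phi> x * b \<in> P"
    and d: "\<phi> y \<in> k" "u' \<in> A" "b' \<in> A" "b' \<notin> P" "y = u' / b'" "u' - \<phi> y * b' \<in> P"
    using val_phi[OF assms(1)] val_phi[OF assms(2)] unfolding val_def by (elim exE conjE)
  have bb: "b * b' \<notin> P" using P_primeA c d by blast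
  have nz: "b \<noteq> 0" "b' \<noteq> 0" using c d P_0 by auto
  show "val (x + y) (\<phi> x + \<phi> y)"
  proof (rule valI[of _ "u * b' + u' * b" "b * b'"])
    have "u * b' + u' * b - (\<phi> x + \<phi> y) * (b * b') = (u - \<phi> x * b) * b' + (u' - \<phi> y * b') * b"
      by (simp add: algebra_simps)
    also have "\<dots> \<in> P" by (rule P_add[OF P_mult_right[OF c(6) d(3)] P_mult_right[OF d(6) c(3)]])
    finally show "u * b' + u' * b - (\<phi> x + \<phi> y) * (b * b') \<in> P" .
  qed (use c d bb nz in \<open>auto simp: add_frac_eq intro!: subring_closed[OF A] subring_add[OF kR]\<close>)
  show "val (x * y) (\<phi> x * \<phi> y)"
  proof (rule valI[of _ "u * u'" "b * b'"])
    have "u * u' - \<phi> x * \<phi> y * (b * b') = (u - \<phi> x * b) * u' + (\<phi> x * b) * (u' - \<phi> y * b')"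
      by (simp add: algebra_simps)
    also have "\<dots> \<in> P" using c d kA by (intro P_add P_mult_right[OF c(6) d(2)] P_mult_left[OF _ d(6)] subring_mult[OF A]) auto
    finally show "u * u' - \<phi> x * \<phi> y * (b * b') \<in> P" .
  qed (use c d bb nz in \<open>auto intro!: subring_closed[OF A] subring_mult[OF kR]\<close>)
qed

lemma phi_add: "x \<in> Oc \<Longrightarrow> y \<in> Oc \<Longrightarrow> \<phi> (x + y) = \<phi> x + \<phi> y"
  and phi_mult: "x \<in> Oc \<Longrightarrow> y \<in> Oc \<Longrightarrow> \<phi> (x * y) = \<phi> x * \<phi> y"
  using val_diff_mult val_eq by blast+

lemma O_ring: "subring_set Oc"
proof -
  have "- x \<in> Oc" if "x \<in> Oc" for x
    using val_in[OF val_diff_mult(2)[of "-1" x]] that kO subring_uminus[OF kR subring_1[OF kR]] by auto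
  then show ?thesis
    using kO subring_1[OF kR] val_in[OF val_diff_mult(1)] val_in[OF val_diff_mult(2)]
    unfolding subring_set_def by (metis add_uminus_conv_diff subsetD)
qed

lemma phi_endo: "ring_endo Oc \<phi>"
  unfolding ring_endo_def using phi_add phi_mult phi_k subring_1[OF kR] phi_in kO by auto

text \<open>Let \<open>a m\<close> be outside P, so that the Horner sums satisfy h m = w x + a m
  with w = h (m + 1). If h m is outside P, the preceding recursion writes x as a fraction with
  denominator h m. Otherwise w x is outside P, and either x = (w x) / w or its inverse w / (w x)
  lies in the local ring, depending on w.\<close>

lemma O_valuation: assumes x: "x \<in> F" and "x \<notin> Oc" shows "inverse x \<in> Oc \<and> \<phi> (inverse x) = 0"
proof -
  obtain n :: nat and a m where a: "\<forall>i. a i \<in> V" "(\<Sum>i\<le>n. a i * x ^ i) = 0" "m \<le> n" "a m \<notin> P"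
    by (rule relation_outside_P[OF x])
  have n: "0 < n" using a P_0 by (cases "n = 0") auto
  define h where "h = (\<lambda>j. \<Sum>i\<in>{j..n}. a i * x ^ (i - j))"
  have hA: "h j \<in> A" for j unfolding h_def by (rule horner_integral[OF a(1,2) n x])
  have aA: "a j \<in> A" for j using a(1) VA by auto
  have hS: "h j = h (Suc j) * x + a j" if "j \<le> n" for j
  proof -
    have "h j = a j + (\<Sum>i\<in>{Suc j..n}. a i * x ^ (i - j))"
      unfolding h_def using that by (simp add: sum.atLeast_Suc_atMost)
    also have "(\<Sum>i\<in>{Suc j..n}. a i * x ^ (i - j)) = (\<Sum>i\<in>{Suc j..n}. a i * x ^ (i - Suc j)) * x"
      unfolding sum_distrib_right
    proof (rule sum.cong[OF refl])
      fix i assume "i \<in> {Suc j..n}"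
      then have "i - j = Suc (i - Suc j)" by auto
      then show "a i * x ^ (i - j) = a i * x ^ (i - Suc j) * x" by (simp only: power_Suc2 mult.assoc)
    qed
    finally show ?thesis by (simp add: h_def)
  qed
  have "h 0 = 0" using a(2) by (simp add: h_def atMost_atLeast0)
  show ?thesis
  proof (cases "h m \<in> P")
    case False
    \<comment> \<open>The index m is positive, because h 0 is the relation itself and therefore 0,
      which lies in P.\<close>
    then obtain l where l: "m = Suc l" using \<open>h 0 = 0\<close> P_0 by (cases m) auto
    have "h m \<noteq> 0" using False P_0 by auto
    then have "x = (h l - a l) / h m" using hS[of l] a(3) l by (simp add: field_simps)
    then have "x \<in> Oc" using O_frac(1)[OF subring_diff[OF A hA aA] hA False] by simp
    then show ?thesis using assms by blast
  next
    case True
    define w where "w = h (Suc m)"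
    have wx: "w * x = h m - a m" using hS[OF a(3)] by (simp add: w_def)
    have wxA: "w * x \<in> A" unfolding wx by (rule subring_diff[OF A hA aA])
    have wxP: "w * x \<notin> P"
    proof
      assume "w * x \<in> P"
      then have "h m - w * x \<in> P" using True P_diff by blast
      then show False using wx a(4) by simp
    qed
    have wA: "w \<in> A" by (simp add: w_def hA)
    have nz: "w \<noteq> 0" "x \<noteq> 0" using wxP P_0 by auto
    show ?thesis
    proof (cases "w \<in> P")
      case False
      have "x = (w * x) / w" using nz by simp
      then have "x \<in> Oc" using O_frac(1)[OF wxA wA False] by simp
      then show ?thesis using assms by blast
    next
      case True
      have "inverse x = w / (w * x)" using nz by (simp add: field_simps)
      then show ?thesis using O_frac(1,2)[OF wA wxA wxP] True by simp
    qed
  qed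
qed

lemma O_unit: assumes "x \<in> Oc" "\<phi> x \<noteq> 0" shows "inverse x \<in> Oc"
proof (rule ccontr)
  assume "inverse x \<notin> Oc"
  moreover have "inverse x \<in> F" using assms O_sub_F subfield_inverse[OF F] by blast
  ultimately show False using O_valuation[of "inverse x"] assms by auto
qed

text \<open>In a valuation ring a finite family has a member of least value, and dividing by it
  makes all members integral and one of them a unit. The induction either keeps g or replaces it by
  the inverse of the new member.\<close>

lemma scaling:
  assumes "finite I" "\<forall>i\<in>I. f i \<in> F" "\<exists>i\<in>I. f i \<noteq> 0"
  shows "\<exists>g\<in>F. g \<noteq> 0 \<and> (\<forall>i\<in>I. g * f i \<in> Oc) \<and> (\<exists>i\<in>I. \<phi> (g * f i) \<noteq> 0)"
  using assms
proof (induction I rule: finite_induct)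
  case (insert j I)
  note inv = subfield_inverse[OF F]
  have phi1: "1 \<in> Oc" "\<phi> 1 \<noteq> 0" using subring_1[OF O_ring] phi_k[OF subring_1[OF kR]] by auto
  show ?case
  proof (cases "\<exists>i\<in>I. f i \<noteq> 0")
    case False
    then have "f j \<noteq> 0" using insert.prems by auto
    then show ?thesis
      using False phi1 insert.prems inv subring_0[OF O_ring] by (intro bexI[of _ "inverse (f j)"]) auto
  next
    case True
    then obtain g where g: "g \<in> F" "g \<noteq> 0" "\<forall>i\<in>I. g * f i \<in> Oc" "\<exists>i\<in>I. \<phi> (g * f i) \<noteq> 0"
      using insert by auto
    show ?thesis
    proof (cases "g * f j \<in> Oc")
      case True
      then show ?thesis using g by (intro bexI[of _ g]) auto
    next
      case False
      have gf: "g * f j \<in> F" using g insert.prems by (auto intro: subring_mult[OF FR])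
      have fj: "f j \<noteq> 0" using False subring_0[OF O_ring] by auto
      have "inverse (f j) * f i \<in> Oc" if "i \<in> I" for i
      proof -
        have "inverse (f j) * f i = inverse (g * f j) * (g * f i)" using g fj by (simp add: field_simps)
        also have "\<dots> \<in> Oc"
          by (rule subring_mult[OF O_ring]) (use O_valuation[OF gf False] g(3) that in blast)+
        finally show ?thesis .
      qed
      then show ?thesis
        using fj phi1 insert.prems inv by (intro bexI[of _ "inverse (f j)"]) auto
    qed
  qed
qed auto

text \<open>Elimination replaces the determinant: 1 - N n n has residue 1 and is a unit of the local
  ring, so \<open>e n\<close> can be substituted away. The \<open>e i\<close> themselves may lie
  anywhere in the ambient field.\<close>

lemma nakayama:
  assumes "finite I" "\<forall>i\<in>I. \<forall>j\<in>I. N i j \<in> Oc \<and> \<phi> (N i j) = 0"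
    and "\<forall>i\<in>I. e i = (\<Sum>j\<in>I. N i j * e j)"
  shows "\<forall>i\<in>I. e i = 0"
  using assms
proof (induction I arbitrary: N rule: finite_induct)
  case (insert n I)
  define r where "r = inverse (1 - N n n)"
  have O1: "1 - N n n \<in> Oc" "\<phi> (1 - N n n) = 1"
    using insert.prems subring_1[OF O_ring] endo_diff[OF O_ring phi_endo] endo_1[OF O_ring phi_endo]
    by (auto intro: subring_diff[OF O_ring])
  then have rO: "r \<in> Oc" unfolding r_def using O_unit by simp
  have nz: "1 - N n n \<noteq> 0" using O1(2) endo_0[OF O_ring phi_endo] by auto
  have en: "e n = (\<Sum>j\<in>I. (r * N n j) * e j)"
  proof -
    have "e n = (\<Sum>j\<in>insert n I. N n j * e j)" using insert.prems(2) by blast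
    also have "\<dots> = N n n * e n + (\<Sum>j\<in>I. N n j * e j)" using insert.hyps by simp
    finally have "e n = N n n * e n + (\<Sum>j\<in>I. N n j * e j)" .
    then have "(1 - N n n) * e n = (\<Sum>j\<in>I. N n j * e j)" by (simp add: algebra_simps)
    then have "e n = r * (\<Sum>j\<in>I. N n j * e j)" using nz by (simp add: r_def field_simps)
    then show ?thesis by (simp add: sum_distrib_left mult.assoc)
  qed
  define N' where "N' = (\<lambda>i j. N i j + N i n * (r * N n j))"
  have "\<forall>i\<in>I. e i = 0"
  proof (rule insert.IH)
    show "\<forall>i\<in>I. \<forall>j\<in>I. N' i j \<in> Oc \<and> \<phi> (N' i j) = 0"
      using insert.prems rO by (simp add: N'_def phi_add phi_mult subring_add[OF O_ring] subring_mult[OF O_ring])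
    show "\<forall>i\<in>I. e i = (\<Sum>j\<in>I. N' i j * e j)"
    proof
      fix i assume i: "i \<in> I"
      have "e i = (\<Sum>j\<in>insert n I. N i j * e j)" using insert.prems(2) i by blast
      also have "\<dots> = N i n * e n + (\<Sum>j\<in>I. N i j * e j)" using insert.hyps by simp
      also have "\<dots> = (\<Sum>j\<in>I. N' i j * e j)"
        by (subst en) (simp add: N'_def sum_distrib_left distrib_right sum.distrib mult.assoc)
      finally show "e i = (\<Sum>j\<in>I. N' i j * e j)" .
    qed
  qed
  then show ?case using en by auto
qed simp

section \<open>Linear disjointness from the constants and the extended residue map\<close>

lemma phi_sum: "(\<And>i. i \<in> I \<Longrightarrow> f i \<in> Oc) \<Longrightarrow> \<phi> (sum f I) = (\<Sum>i\<in>I. \<phi> (f i))"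
  by (rule endo_sum[OF O_ring phi_endo])

text \<open>The maximal ideal of the local ring stays proper when constants are adjoined. Finitely
  many constants stabilize a finite k-module with 1 among its generators, and an expression of 1
  with coefficients in the maximal ideal would make all generators vanish by the Nakayama
  argument.\<close>

lemma lying_over:
  assumes "finite Z" "Z \<subseteq> kb" "\<forall>z\<in>Z. n z \<in> Oc \<and> \<phi> (n z) = 0"
  shows "(\<Sum>z\<in>Z. n z * z) \<noteq> 1"
proof
  assume one: "(\<Sum>z\<in>Z. n z * z) = 1"
  obtain S where S: "finite S" "1 \<in> S" "\<forall>z\<in>Z. \<forall>s\<in>S. z * s \<in> vspan k S"
    using stable_module_exists[OF kR assms(1)] kb_integral assms(2) by blast
  have "\<forall>zs\<in>Z \<times> S. \<exists>a. (\<forall>t\<in>S. a t \<in> k) \<and> fst zs * snd zs = (\<Sum>t\<in>S. a t * t)"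
  proof
    fix zs assume "zs \<in> Z \<times> S"
    then have "fst zs * snd zs \<in> vspan k S" using S(3) by auto
    then show "\<exists>a. (\<forall>t\<in>S. a t \<in> k) \<and> fst zs * snd zs = (\<Sum>t\<in>S. a t * t)"
      by (rule vspan_E) blast
  qed
  from bchoice[OF this] obtain a0 where
    a0: "\<forall>zs\<in>Z \<times> S. (\<forall>t\<in>S. a0 zs t \<in> k) \<and> fst zs * snd zs = (\<Sum>t\<in>S. a0 zs t * t)" ..
  define a where "a = (\<lambda>z s. a0 (z, s))"
  have a: "(\<forall>t\<in>S. a z s t \<in> k) \<and> z * s = (\<Sum>t\<in>S. a z s t * t)" if "z \<in> Z" "s \<in> S" for z s
    using bspec[OF a0, of "(z, s)"] that by (simp add: a_def)
  define N where "N = (\<lambda>s t. \<Sum>z\<in>Z. n z * a z s t)"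
  have "\<forall>s\<in>S. s = 0"
  proof (rule nakayama[OF S(1), of N])
    have "n z * a z s t \<in> Oc \<and> \<phi> (n z * a z s t) = 0" if "z \<in> Z" "s \<in> S" "t \<in> S" for z s t
    proof -
      have "a z s t \<in> Oc" using a that kO by blast
      then show ?thesis using assms(3) that by (simp add: phi_mult subring_mult[OF O_ring])
    qed
    then show "\<forall>i\<in>S. \<forall>j\<in>S. N i j \<in> Oc \<and> \<phi> (N i j) = 0"
      by (simp add: N_def phi_sum subring_sum[OF O_ring])
    show "\<forall>s\<in>S. s = (\<Sum>t\<in>S. N s t * t)"
    proof
      fix s assume s: "s \<in> S"
      have "s = (\<Sum>z\<in>Z. n z * z) * s" using one by simp
      also have "\<dots> = (\<Sum>z\<in>Z. n z * (z * s))" by (simp add: sum_distrib_right mult.assoc)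
      also have "\<dots> = (\<Sum>z\<in>Z. n z * (\<Sum>t\<in>S. a z s t * t))" using a s by simp
      also have "\<dots> = (\<Sum>t\<in>S. N s t * t)"
        unfolding N_def sum_distrib_left sum_distrib_right
        by (subst sum.swap) (simp add: mult.assoc)
      finally show "s = (\<Sum>t\<in>S. N s t * t)" .
    qed
  qed
  then show False using S(2) by auto
qed

lemma lin_disjoint_F_kb: "lin_disjoint k F kb"
  unfolding lin_disjoint_def
proof (intro allI impI)
  fix S x assume S: "finite S" "S \<subseteq> kb" and x: "\<forall>c\<in>S. x c \<in> F" "(\<Sum>c\<in>S. x c * c) = 0" "\<exists>c\<in>S. x c \<noteq> 0"
  obtain g where g: "\<forall>c\<in>S. g * x c \<in> Oc" "\<exists>c\<in>S. \<phi> (g * x c) \<noteq> 0"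
    using scaling[OF S(1) x(1,3)] by blast
  define l where "l = (\<lambda>c. \<phi> (g * x c))"
  define s where "s = (\<Sum>c\<in>S. l c * c)"
  have lk: "\<forall>c\<in>S. l c \<in> k" using g phi_in by (auto simp: l_def)
  have "s = 0"
  proof (rule ccontr)
    assume s0: "s \<noteq> 0"
    have skb: "s \<in> kb" unfolding s_def using lk kb S by (auto intro!: subring_sum[OF kbR] subring_mult[OF kbR])
    \<comment> \<open>If the reduced combination s were nonzero, the differences between reduced and
      original coefficients, all of residue 0, would combine with the constants c / s to 1. They are
      indexed by z = c / s, so that z s recovers c.\<close>
    define n where "n = (\<lambda>z. l (z * s) - g * x (z * s))"
    have "(\<Sum>z\<in>(\<lambda>c. c / s) ` S. n z * z) = (\<Sum>c\<in>S. (l c - g * x c) * (c / s))"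
      using s0 by (subst sum.reindex) (auto simp: inj_on_def n_def)
    also have "\<dots> = (s - g * (\<Sum>c\<in>S. x c * c)) / s"
    proof -
      have "(l c - g * x c) * (c / s) = (l c * c - g * (x c * c)) / s" for c
        by (simp add: left_diff_distrib diff_divide_distrib mult.assoc)
      then show ?thesis
        by (simp only: s_def sum_subtractf sum_distrib_left sum_divide_distrib[symmetric])
    qed
    also have "\<dots> = 1" using x(2) s0 by simp
    finally have "(\<Sum>z\<in>(\<lambda>c. c / s) ` S. n z * z) = 1" .
    moreover have "(\<Sum>z\<in>(\<lambda>c. c / s) ` S. n z * z) \<noteq> 1"
    proof (rule lying_over)
      show "(\<lambda>c. c / s) ` S \<subseteq> kb" using S skb subfield_divide[OF kb(1)] by auto
      have "l c \<in> Oc \<and> g * x c \<in> Oc \<and> \<phi> (l c) = \<phi> (g * x c)" if "c \<in> S" for c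
        using g(1) that phi_k lk kO by (auto simp: l_def)
      then show "\<forall>z\<in>(\<lambda>c. c / s) ` S. n z \<in> Oc \<and> \<phi> (n z) = 0"
        using s0 by (auto simp: n_def endo_diff[OF O_ring phi_endo] subring_diff[OF O_ring])
    qed (use S in auto)
    ultimately show False by blast
  qed
  then show "\<exists>l. (\<forall>c\<in>S. l c \<in> k) \<and> (\<exists>c\<in>S. l c \<noteq> 0) \<and> (\<Sum>c\<in>S. l c * c) = 0"
    using lk g(2) by (intro exI[of _ l]) (auto simp: s_def l_def)
qed

lemma lin_disjoint_O_kb: "lin_disjoint k Oc kb"
  using lin_disjoint_mono[OF lin_disjoint_F_kb O_sub_F] by blast

text \<open>This gives the residue map \<Phi> of the geometric point above P: it extends \<phi> by
  the identity on kb to the ring generated by the local ring and the constants.\<close>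

sublocale residue: hom_pair k Oc kb \<phi> "\<lambda>x. x"
  by unfold_locales
    (use k lin_disjoint_O_kb O_ring kO kbR kb phi_add phi_mult phi_k in auto)

abbreviation \<Phi> where "\<Phi> \<equiv> residue.ext"

lemma ext_in_subfield:
  assumes D: "subfield_set D" "k \<subseteq> D" "D \<subseteq> kb" and "x \<in> comp_ring Oc D"
  shows "\<Phi> x \<in> D"
  using assms(4)
proof induction
  case (step a c x)
  have cO: "c \<in> kb" "x \<in> comp_ring Oc kb" using step D comp_ring_mono[of Oc Oc D kb] by auto
  then have "\<Phi> (a * c + x) = \<phi> a * c + \<Phi> x"
    using step by (simp add: residue.ext_add residue.ext_prod comp_ring_prod)
  then show ?case using step D phi_in[of a] subfield_imp_subring[OF D(1)]
    by (auto intro: subring_add subring_mult)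
qed (use subring_0[OF subfield_imp_subring[OF D(1)]] in simp)

text \<open>The proof shortens a representation of x after scaling it by g. Either g is a unit; or
  the residue of g x vanishes, which is a k-relation among the \<open>d i\<close> and removes a
  term; or the integral equation, multiplied by a power of g, shows that a nonzero residue is
  nilpotent.\<close>

lemma integral_in_comp_ring:
  assumes D: "subfield_set D" "k \<subseteq> D" "D \<subseteq> kb" and x: "x \<in> comp_ring F D"
    and int: "integral_over (comp_ring Oc D) x"
  shows "x \<in> comp_ring Oc D"
proof -
  note DR = subfield_imp_subring[OF D(1)]
  have sub: "comp_ring Oc D \<subseteq> comp_ring Oc kb" using comp_ring_mono[of Oc Oc D kb] D by auto
  have R: "subring_set (comp_ring Oc D)" by (rule subring_comp_ring[OF O_ring DR])
  have "(\<Sum>i\<in>I. f i * d i) \<in> comp_ring Oc D"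
    if "finite I" "\<forall>i\<in>I. f i \<in> F \<and> d i \<in> D" "integral_over (comp_ring Oc D) (\<Sum>i\<in>I. f i * d i)"
    for I :: "nat set" and f d
    using that
  proof (induction "card I" arbitrary: I f)
    case 0
    then show ?case using comp_ring.zero by auto
  next
    case (Suc n)
    define x where "x = (\<Sum>i\<in>I. f i * d i)"
    \<comment> \<open>The extra index None carries the coefficient 1, so that g itself is scaled
      into the local ring together with the products g f i.\<close>
    have "\<exists>g\<in>F. g \<noteq> 0 \<and> (\<forall>i\<in>insert None (Some ` I). g * (case i of None \<Rightarrow> 1 | Some i \<Rightarrow> f i) \<in> Oc) \<and>
      (\<exists>i\<in>insert None (Some ` I). \<phi> (g * (case i of None \<Rightarrow> 1 | Some i \<Rightarrow> f i)) \<noteq> 0)"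
      by (rule scaling) (use Suc.prems subring_1[OF FR] in auto)
    then obtain g where g: "g \<in> F" "g \<noteq> 0" "g \<in> Oc" "\<forall>i\<in>I. g * f i \<in> Oc"
      "\<phi> g \<noteq> 0 \<or> (\<exists>i\<in>I. \<phi> (g * f i) \<noteq> 0)" by auto
    have gx: "g * x = (\<Sum>i\<in>I. (g * f i) * d i)" by (simp add: x_def sum_distrib_left mult.assoc)
    have gxO: "g * x \<in> comp_ring Oc D"
      unfolding gx using g Suc.prems by (intro comp_ring_sum comp_ring_prod) auto
    have Phi_gx: "\<Phi> (g * x) = (\<Sum>i\<in>I. \<phi> (g * f i) * d i)"
    proof -
      have "g * f i \<in> Oc \<and> d i \<in> kb" if "i \<in> I" for i using g(4) Suc.prems(2) D that by blast
      then show ?thesis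
        unfolding gx by (simp add: residue.ext_sum comp_ring_prod residue.ext_prod)
    qed
    show ?case
    proof (cases "\<phi> g = 0")
      case False
      have "x = inverse g * (g * x)" using g by simp
      also have "\<dots> \<in> comp_ring Oc D"
        by (rule subring_mult[OF R subsetD[OF comp_ring_left[OF O_ring DR] O_unit[OF g(3) False]] gxO])
      finally show ?thesis by (simp add: x_def)
    next
      case True
      then obtain d0 where d0: "d0 \<in> I" "\<phi> (g * f d0) \<noteq> 0" using g(5) by blast
      show ?thesis
      proof (cases "\<Phi> (g * x) = 0")
        case True
        \<comment> \<open>The vanishing residue is a relation over k among the \<open>d i\<close> in
          which \<open>d d0\<close> has a nonzero coefficient; solving for it shortens the
          representation.\<close>
        define m where "m = (\<lambda>i. - (\<phi> (g * f i) / \<phi> (g * f d0)))"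
        have mk: "m i \<in> k" if "i \<in> I" for i
          using g(4) d0 that phi_in by (auto simp: m_def intro!: subring_uminus[OF kR] subfield_divide[OF k])
        have "\<phi> (g * f d0) * d d0 + (\<Sum>i\<in>I - {d0}. \<phi> (g * f i) * d i) = 0"
          using True Phi_gx Suc.prems(1) d0(1) by (simp add: sum.remove)
        then have "d d0 = - (\<Sum>i\<in>I - {d0}. \<phi> (g * f i) * d i) / \<phi> (g * f d0)"
          using d0(2) by (simp add: field_simps add_eq_0_iff2)
        also have "\<dots> = (\<Sum>i\<in>I - {d0}. m i * d i)"
          by (simp add: m_def sum_negf[symmetric] sum_divide_distrib)
        finally have dd: "d d0 = (\<Sum>i\<in>I - {d0}. m i * d i)" .
        have x': "x = (\<Sum>i\<in>I - {d0}. (f i + m i * f d0) * d i)"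
        proof -
          have "x = f d0 * d d0 + (\<Sum>i\<in>I - {d0}. f i * d i)"
            unfolding x_def using Suc.prems(1) d0(1) by (simp add: sum.remove)
          then show ?thesis by (simp add: dd sum_distrib_left sum.distrib[symmetric] algebra_simps)
        qed
        have mF: "f i + m i * f d0 \<in> F" if "i \<in> I - {d0}" for i
          using that Suc.prems(2) d0(1) mk V by (auto intro!: subring_add[OF FR] subring_mult[OF FR])
        have "(\<Sum>i\<in>I - {d0}. (f i + m i * f d0) * d i) \<in> comp_ring Oc D"
          using Suc.hyps(2) Suc.prems d0(1) mF x' unfolding x_def by (intro Suc.hyps(1)) auto
        then show ?thesis using x' by (simp add: x_def)
      next
        case False
        obtain p where p: "lead_coeff p = 1" "coeffs_in (comp_ring Oc D) p" "poly p x = 0"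
          using Suc.prems(3) unfolding integral_over_def x_def by blast
        define r where "r = Polynomial.degree p"
        have cO: "Polynomial.coeff p i \<in> comp_ring Oc D" for i using p(2) by (simp add: coeffs_in_def)
        have gO: "g \<in> comp_ring Oc D" using comp_ring_left[OF O_ring DR] g(3) by auto
        \<comment> \<open>The factor g^r turns the equation for x into one for g x whose lower
          coefficients all contain a positive power of g, and g has residue 0.\<close>
        have "0 = g ^ r * poly p x" using p(3) by simp
        also have "\<dots> = (\<Sum>i\<le>r. Polynomial.coeff p i * g ^ (r - i) * (g * x) ^ i)"
          unfolding poly_altdef sum_distrib_left r_def[symmetric]
        proof (rule sum.cong[OF refl])
          fix i assume "i \<in> {..r}"
          then have "g ^ r = g ^ (r - i) * g ^ i" by (simp add: power_add[symmetric])
          then show "g ^ r * (Polynomial.coeff p i * x ^ i) = Polynomial.coeff p i * g ^ (r - i) * (g * x) ^ i"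
            by (simp only: power_mult_distrib mult_ac)
        qed
        also have "\<dots> = (\<Sum>i<r. Polynomial.coeff p i * g ^ (r - i) * (g * x) ^ i) + (g * x) ^ r"
          using p(1) by (simp add: lessThan_Suc_atMost[symmetric] r_def)
        finally have eq: "(g * x) ^ r = - (\<Sum>i<r. Polynomial.coeff p i * g ^ (r - i) * (g * x) ^ i)"
          by (simp add: eq_neg_iff_add_eq_0 add.commute)
        have RR: "subring_set (comp_ring Oc kb)" by (rule subring_comp_ring[OF O_ring kbR])
        have Pe: "ring_endo (comp_ring Oc kb) \<Phi>" if "kb \<subseteq> comp_ring Oc kb"
          unfolding ring_endo_def
          using residue.ext_add residue.ext_mult ext_in_subfield[OF kb(1) kb(2) order_refl] that by auto
        note Pe = Pe[OF comp_ring_right[OF O_ring kbR]]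
        have mem: "Polynomial.coeff p i * g ^ (r - i) * (g * x) ^ i \<in> comp_ring Oc kb" for i
          by (rule subring_mult[OF RR subring_mult[OF RR _ subring_power[OF RR]] subring_power[OF RR]])
            (use cO gO gxO sub in auto)
        have "\<Phi> (Polynomial.coeff p i * g ^ (r - i) * (g * x) ^ i) = 0" if "i < r" for i
        proof -
          have gg: "\<Phi> g = 0" using residue.ext_left[OF g(3)] True by simp
          have "\<Phi> (g ^ (r - i)) = 0"
            using endo_power[OF RR Pe, of g "r - i"] gO sub gg that by auto
          moreover have "Polynomial.coeff p i \<in> comp_ring Oc kb" "g ^ (r - i) \<in> comp_ring Oc kb"
            "(g * x) ^ i \<in> comp_ring Oc kb"
            using cO gO gxO sub by (auto intro: subring_power[OF RR])
          ultimately show ?thesis by (simp add: residue.ext_mult subring_mult[OF RR])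
        qed
        then have "\<Phi> ((g * x) ^ r) = 0"
          unfolding eq using mem
          by (subst residue.ext_uminus) (auto simp: residue.ext_sum intro!: comp_ring_sum)
        then have "\<Phi> (g * x) ^ r = 0"
          using endo_power[OF RR Pe, of "g * x" r] gxO sub by auto
        then show ?thesis using False by simp
      qed
    qed
  qed
  note main = this
  obtain n :: nat and f d where fd: "\<forall>i<n. f i \<in> F \<and> d i \<in> D" "x = (\<Sum>i<n. f i * d i)"
    by (rule comp_ring_family[OF x])
  show ?thesis using main[of "{..<n}" f d] fd int by simp
qed

end

text \<open>In the local ring the axiom says that \<pi> is not a product of two nonunits; clearing
  denominators produces the factor b outside P.\<close>

locale unramified_rat_point = rat_point +
  assumes unramified: "\<And>x y b. x \<in> P \<Longrightarrow> y \<in> P \<Longrightarrow> b \<in> F \<Longrightarrow> integral_over V b \<Longrightarrow> b \<notin> P \<Longrightarrow> \<pi> * b \<noteq> x * y"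
begin

text \<open>If x / \<pi> were not in the valuation ring, then \<pi> / x would lie in the maximal
  ideal, and \<pi> = x (\<pi> / x) would be a product of two nonunits.\<close>

lemma uniformizer: assumes "x \<in> Oc" "\<phi> x = 0" shows "x / \<pi> \<in> Oc"
proof (rule ccontr)
  assume no: "x / \<pi> \<notin> Oc"
  have xF: "x / \<pi> \<in> F" using assms(1) O_sub_F \<pi>(1) V subfield_divide[OF F] by blast
  have z: "\<pi> / x \<in> Oc" "\<phi> (\<pi> / x) = 0" using O_valuation[OF xF no] by auto
  have x0: "x \<noteq> 0" using no subring_0[OF O_ring] by auto
  obtain u b where u: "u \<in> A" "b \<in> A" "b \<notin> P" "x = u / b" using O_elim[OF assms(1)] by blast
  obtain u' b' where u': "u' \<in> A" "b' \<in> A" "b' \<notin> P" "\<pi> / x = u' / b'" using O_elim[OF z(1)] by blast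
  have uP: "u \<in> P" "u' \<in> P" using O_frac(3)[OF u(1-3)] O_frac(3)[OF u'(1-3)] assms z u u' by auto
  have nz: "b \<noteq> 0" "b' \<noteq> 0" using u u' P_0 by auto
  have "\<pi> = x * (\<pi> / x)" using x0 by simp
  also have "\<dots> = x * (u' / b')" by (simp only: u'(4))
  also have "\<dots> = (u * u') / (b * b')" by (simp only: u(4) times_divide_times_eq)
  finally have "\<pi> * (b * b') = u * u'" using nz by (simp add: eq_divide_eq)
  moreover have "b * b' \<notin> P" "b * b' \<in> A" using P_primeA u u' subring_mult[OF A] by blast+
  ultimately show False using unramified[OF uP, of "b * b'"] by (auto simp: A_def)
qed

text \<open>The lowest nonzero coefficient of an equation for x is a multiple of x. Divisibility of
  x by all powers of \<pi> would pass to this element of V, whose order at the point is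
  finite.\<close>

lemma archimedean: assumes x: "x \<in> F" and all: "\<And>n. x / \<pi> ^ n \<in> Oc" shows "x = 0"
proof (rule ccontr)
  assume x0: "x \<noteq> 0"
  obtain n :: nat and a where na: "(\<forall>i. a i \<in> V) \<and> (\<Sum>i\<le>n. a i * x ^ i) = 0 \<and> (\<exists>i\<le>n. a i \<noteq> 0)"
    using algebraic[OF x] by (elim exE) (rule that)
  note a = na[THEN conjunct1] na[THEN conjunct2, THEN conjunct1] na[THEN conjunct2, THEN conjunct2]
  define j where "j = (LEAST i. a i \<noteq> 0)"
  have j: "a j \<noteq> 0" "j \<le> n" "\<And>i. i < j \<Longrightarrow> a i = 0"
  proof -
    obtain i where i: "i \<le> n" "a i \<noteq> 0" using a by blast
    show "a j \<noteq> 0" unfolding j_def using i(2) by (rule LeastI)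
    show "j \<le> n" unfolding j_def using i Least_le[of "\<lambda>i. a i \<noteq> 0" i] by simp
    show "a i = 0" if "i < j" for i using not_less_Least that unfolding j_def by blast
  qed
  have "(\<Sum>i\<le>n. a i * x ^ i) = (\<Sum>i\<in>{j..n}. a i * x ^ i)"
    using j by (intro sum.mono_neutral_right) auto
  also have "\<dots> = x ^ j * (\<Sum>i\<in>{j..n}. a i * x ^ (i - j))"
    unfolding sum_distrib_left by (rule sum.cong) (auto simp: mult.left_commute power_add[symmetric])
  finally have "(\<Sum>i\<in>{j..n}. a i * x ^ (i - j)) = 0" using a(2) x0 by simp
  then have "a j + (\<Sum>i\<in>{Suc j..n}. a i * x ^ (i - j)) = 0"
    using j(2) by (simp add: sum.atLeast_Suc_atMost)
  moreover have "(\<Sum>i\<in>{Suc j..n}. a i * x ^ (i - j)) = x * (\<Sum>i\<in>{Suc j..n}. a i * x ^ (i - Suc j))"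
    unfolding sum_distrib_left
  proof (rule sum.cong[OF refl])
    fix i assume "i \<in> {Suc j..n}"
    then have "i - j = Suc (i - Suc j)" by auto
    then show "a i * x ^ (i - j) = x * (a i * x ^ (i - Suc j))" by (simp only: power_Suc mult.left_commute)
  qed
  ultimately have aj: "a j = x * (- (\<Sum>i\<in>{Suc j..n}. a i * x ^ (i - Suc j)))"
    by (simp add: add_eq_0_iff2)
  obtain e w where w: "w \<in> V" "w \<notin> P" "a j = \<pi> ^ e * w" using V_order[of "a j"] a(1) j(1) by blast
  have VO: "V \<subseteq> Oc" using VA AO by blast
  have xO: "x \<in> Oc" using all[of 0] by simp
  \<comment> \<open>The coefficient is \<pi>^e w. Dividing x by one power more than e makes w /
    \<pi> integral, although w lies outside P.\<close>
  have "w / \<pi> = (x / \<pi> ^ Suc e) * (- (\<Sum>i\<in>{Suc j..n}. a i * x ^ (i - Suc j)))"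
    using w(3) aj \<pi>(3) by (simp add: field_simps)
  also have "\<dots> \<in> Oc"
    using all[of "Suc e"] a(1) VO xO
    by (intro subring_mult[OF O_ring] subring_uminus[OF O_ring] subring_sum[OF O_ring]) (auto intro: subring_power[OF O_ring])
  finally have wO: "w / \<pi> \<in> Oc" .
  have "w = \<pi> * (w / \<pi>)" using \<pi>(3) by simp
  then have "\<phi> w = \<phi> \<pi> * \<phi> (w / \<pi>)" using phi_mult[OF subsetD[OF VO \<pi>(1)] wO] by (simp only:)
  also have "\<phi> \<pi> = 0" using phi_A \<pi> VA by blast
  finally show False using phi_A[of w] w VA by auto
qed

text \<open>Write u = \<phi> u + \<pi> v. Both the constant and \<pi> are fixed, so \<sigma> u - u =
  \<pi> (\<sigma> v - v), and repetition makes the difference divisible by every power of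
  \<pi>.\<close>

lemma fixes_residue_imp_id:
  assumes \<sigma>: "ring_endo F \<sigma>" and \<sigma>V: "\<And>v. v \<in> V \<Longrightarrow> \<sigma> v = v"
    and res: "\<And>u. u \<in> A \<Longrightarrow> \<phi> (\<sigma> u) = \<phi> u" and x: "x \<in> F"
  shows "\<sigma> x = x"
proof -
  have \<sigma>A: "\<sigma> u \<in> A" if uA: "u \<in> A" for u
  proof -
    obtain p where p: "lead_coeff p = 1" "coeffs_in V p" "poly p u = 0"
      using uA by (auto simp: A_def integral_over_def)
    have "poly p (\<sigma> u) = \<sigma> (poly p u)"
      using p that V \<sigma>V AF coeffs_in_mono[OF p(2) V(3)]
      by (intro endo_poly_fixed[OF FR \<sigma>, symmetric]) (auto simp: coeffs_in_def)
    then show ?thesis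
      using p endo_0[OF FR \<sigma>] endo_in[OF FR \<sigma>] that by (auto simp: A_def integral_over_def)
  qed
  have \<sigma>Oc: "\<sigma> u \<in> Oc" if uO: "u \<in> Oc" for u
  proof -
    obtain a b where ab: "a \<in> A" "b \<in> A" "b \<notin> P" "u = a / b" using O_elim[OF uO] by blast
    have "\<sigma> u = \<sigma> a / \<sigma> b"
    proof -
      have "a \<in> F" "b \<in> F" using ab AF by auto
      then show ?thesis
        using endo_mult[OF FR \<sigma>, of a "inverse b"] endo_inverse[OF FR \<sigma> F, of b] subfield_inverse[OF F, of b]
        by (simp add: ab(4) field_class.field_divide_inverse)
    qed
    moreover have "\<sigma> b \<notin> P" using res[OF ab(2)] phi_A ab \<sigma>A by metis
    ultimately show ?thesis using O_frac(1) \<sigma>A ab by simp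
  qed
  have step: "(\<sigma> u - u) / \<pi> ^ n \<in> Oc" if "u \<in> Oc" for u n
    using that
  proof (induction n arbitrary: u)
    case 0
    then show ?case using \<sigma>Oc subring_diff[OF O_ring] by simp
  next
    case (Suc n)
    define v where "v = (u - \<phi> u) / \<pi>"
    have c: "\<phi> u \<in> k" "\<phi> u \<in> Oc" using phi_in Suc.prems kO by auto
    have vO: "v \<in> Oc"
      unfolding v_def using Suc.prems c phi_k
      by (intro uniformizer) (auto simp: endo_diff[OF O_ring phi_endo] subring_diff[OF O_ring])
    have u: "u = \<phi> u + \<pi> * v" using \<pi>(3) by (simp add: v_def)
    have "\<sigma> u = \<phi> u + \<pi> * \<sigma> v"
    proof -
      have "\<phi> u \<in> F" "\<pi> \<in> F" "v \<in> F" using c vO O_sub_F V \<pi>(1) by auto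
      moreover have "\<sigma> (\<phi> u) = \<phi> u" "\<sigma> \<pi> = \<pi>" using \<sigma>V c V \<pi>(1) by auto
      ultimately show ?thesis
        by (subst u) (simp add: endo_add[OF FR \<sigma>] endo_mult[OF FR \<sigma>] subring_mult[OF FR])
    qed
    then have "\<sigma> u - u = \<pi> * (\<sigma> v - v)" using u by (simp add: algebra_simps)
    then have "(\<sigma> u - u) / \<pi> ^ Suc n = (\<sigma> v - v) / \<pi> ^ n" using \<pi>(3) by simp
    then show ?case using Suc.IH[OF vO] by simp
  qed
  have idO: "\<sigma> u = u" if "u \<in> Oc" for u
    using archimedean[of "\<sigma> u - u"] step[OF that] that O_sub_F endo_in[OF FR \<sigma>] subring_diff[OF FR] by auto
  show ?thesis
  proof (cases "x \<in> Oc")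
    case False
    then have "inverse x \<in> Oc" using O_valuation[OF x] by blast
    then have "\<sigma> (inverse x) = inverse x" by (rule idO)
    then show ?thesis using endo_inverse[OF FR \<sigma> F x] by simp
  qed (rule idO)
qed

end


section \<open>Product actions\<close>

text \<open>The fixed fields K0 and D0 may differ; k is a common subfield. This covers E with its
  Galois group as well as kbar with the trivial group, where D = D0, as the geometric statement
  requires. The axiom \<open>field_above\<close> stands for algebraicity over K0.\<close>

locale two_act = a: gal_act G F K0 aF + b: gal_act H D D0 aD
  for G :: "('g, 'm) monoid_scheme" and F K0 :: "'a::field set" and aF :: "'g \<Rightarrow> 'a \<Rightarrow> 'a"
    and H :: "('h, 'n) monoid_scheme" and D D0 :: "'a::field set" and aD :: "'h \<Rightarrow> 'a \<Rightarrow> 'a" +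
  fixes k :: "'a set"
  assumes k: "subfield_set k" and kK0: "k \<subseteq> K0" and kD0: "k \<subseteq> D0"
    and ld: "lin_disjoint k F D"
    and field_above: "\<And>R. subring_set R \<Longrightarrow> K0 \<subseteq> R \<Longrightarrow> subfield_set R"
begin

definition M where "M = comp_ring F D"
definition act2 where "act2 gh = hom_pair.ext F D (aF (fst gh)) (aD (snd gh))"

lemma kF: "k \<subseteq> F" and kD: "k \<subseteq> D"
  using kK0 kD0 a.K_subset b.K_subset by auto

lemma hp: "g \<in> carrier G \<Longrightarrow> h \<in> carrier H \<Longrightarrow> hom_pair k F D (aF g) (aD h)"
  by unfold_locales
    (use k ld a.LR b.LR kF kD endo_add[OF a.LR a.endo] endo_mult[OF a.LR a.endo]
      endo_add[OF b.LR b.endo] endo_mult[OF b.LR b.endo] a.act_K b.act_K kK0 kD0 in auto)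

lemma FM: "F \<subseteq> M" and DM: "D \<subseteq> M"
  using comp_ring_left[OF a.LR b.LR] comp_ring_right[OF a.LR b.LR] by (auto simp: M_def)

lemma M_ring: "subring_set M" unfolding M_def by (rule subring_comp_ring[OF a.LR b.LR])

lemma M_field: "subfield_set M"
  using field_above[OF M_ring] FM a.K_subset by auto

context
  fixes g h assumes gh: "g \<in> carrier G" "h \<in> carrier H"
begin

interpretation hom_pair k F D "aF g" "aD h" by (rule hp[OF gh])

lemma act2_prod: "x \<in> F \<Longrightarrow> y \<in> D \<Longrightarrow> act2 (g, h) (x * y) = aF g x * aD h y"
  and act2_left: "x \<in> F \<Longrightarrow> act2 (g, h) x = aF g x"
  and act2_right: "y \<in> D \<Longrightarrow> act2 (g, h) y = aD h y"
  by (simp_all add: act2_def ext_prod ext_left ext_right)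

lemma act2_endo: "ring_endo M (act2 (g, h))"
  unfolding ring_endo_def act2_def fst_conv snd_conv
  using ext_in[of F D] a.act_in[OF gh(1)] b.act_in[OF gh(2)] ext_add ext_mult ext_1
  by (auto simp: M_def image_subset_iff)

end

lemma act2_comp:
  assumes "g \<in> carrier G" "h \<in> carrier H" "g' \<in> carrier G" "h' \<in> carrier H" "x \<in> M"
  shows "act2 (g \<otimes>\<^bsub>G\<^esub> g', h \<otimes>\<^bsub>H\<^esub> h') x = act2 (g, h) (act2 (g', h') x)"
proof -
  note e = act2_endo[OF assms(1,2)] act2_endo[OF assms(3,4)]
    act2_endo[OF a.m_closed[OF assms(1,3)] b.m_closed[OF assms(2,4)]]
  have "x \<in> comp_ring F D" using assms(5) by (simp add: M_def)
  then show ?thesis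
  proof induction
    case zero
    show ?case using endo_0[OF M_ring e(1)] endo_0[OF M_ring e(2)] endo_0[OF M_ring e(3)] by simp
  next
    case (step y z x)
    have m: "y * z \<in> M" "x \<in> M" "aF g' y * aD h' z \<in> M" "act2 (g', h') x \<in> M"
      using step assms endo_in[OF M_ring e(2)] a.act_in b.act_in by (auto simp: M_def intro: comp_ring_prod)
    show ?case
      using step assms m e
      by (simp add: endo_add[OF M_ring] act2_prod a.act_comp b.act_comp a.act_in b.act_in)
  qed
qed

lemma act2_one: "x \<in> M \<Longrightarrow> act2 (\<one>\<^bsub>G\<^esub>, \<one>\<^bsub>H\<^esub>) x = x"
proof -
  note e = act2_endo[OF a.one_closed b.one_closed]
  assume "x \<in> M"
  then have "x \<in> comp_ring F D" by (simp add: M_def)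
  then show ?thesis
  proof induction
    case zero
    then show ?case using endo_0[OF M_ring e] by simp
  next
    case (step y z x)
    then have "y * z \<in> M" "x \<in> M" by (auto simp: M_def intro: comp_ring_prod)
    then show ?case
      using step by (simp add: endo_add[OF M_ring e] act2_prod a.act_one b.act_one)
  qed
qed

text \<open>For the harder inclusion let w and e have trace 1, and let T z be the trace of z w e
  over the product group. Since T (f d) = tr(f w) tr(d e), the values of T lie in the compositum of
  the fixed fields, while T x = x T 1 = x for invariant x.\<close>

lemma fixed_M:
  "comp_ring K0 D0 = {x \<in> M. \<forall>gh\<in>carrier (G \<times>\<times> H). act2 gh x = x}" (is "?l = ?r")
proof
  show "?l \<subseteq> ?r"
  proof
    fix x assume "x \<in> comp_ring K0 D0"
    then show "x \<in> ?r"
    proof induction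
      case zero
      then show ?case using subring_0[OF M_ring] endo_0[OF M_ring act2_endo] by auto
    next
      case (step y z x)
      have yz: "y \<in> F" "z \<in> D" "y * z \<in> M" using step a.K_subset b.K_subset
        by (auto simp: M_def intro!: comp_ring_prod)
      then show ?case
        using step a.act_K b.act_K subring_add[OF M_ring]
        by (auto simp: endo_add[OF M_ring act2_endo] act2_prod)
    qed
  qed
  show "?r \<subseteq> ?l"
  proof
    fix x assume x: "x \<in> ?r"
    obtain w where w: "w \<in> F" "a.tr w = 1" by (rule a.tr_eq_1)
    obtain e where e: "e \<in> D" "b.tr e = 1" by (rule b.tr_eq_1)
    have we: "w * e \<in> M" using w e by (auto simp: M_def intro: comp_ring_prod)
    define T where "T z = (\<Sum>g\<in>carrier G. \<Sum>h\<in>carrier H. act2 (g, h) (z * (w * e)))" for z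
    have Tp: "T (f * d) = a.tr (f * w) * b.tr (d * e)" if "f \<in> F" "d \<in> D" for f d
    proof -
      have "act2 (g, h) (f * d * (w * e)) = aF g (f * w) * aD h (d * e)"
        if "g \<in> carrier G" "h \<in> carrier H" for g h
        using act2_prod[OF that, of "f * w" "d * e"] \<open>f \<in> F\<close> \<open>d \<in> D\<close> w e
          subring_mult[OF a.LR] subring_mult[OF b.LR] by (simp add: mult_ac)
      then show ?thesis by (simp add: T_def a.tr_def b.tr_def sum_product)
    qed
    have Tin: "T z \<in> comp_ring K0 D0" if "z \<in> comp_ring F D" for z
      using that
    proof induction
      case zero
      then show ?case using endo_0[OF M_ring act2_endo] by (simp add: T_def comp_ring.zero)
    next
      case (step f d z)
      have mem: "f * d * (w * e) \<in> M" "z * (w * e) \<in> M"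
        using step we by (auto simp: M_def[symmetric] intro!: subring_mult[OF M_ring _ we])
          (auto simp: M_def intro: comp_ring_prod)
      have "T (f * d + z) = T (f * d) + T z"
        unfolding T_def sum.distrib[symmetric]
        by (intro sum.cong refl) (use mem in \<open>simp add: distrib_right endo_add[OF M_ring act2_endo]\<close>)
      moreover have "T (f * d) \<in> comp_ring K0 D0"
        unfolding Tp[OF step(1,2)] using a.tr_in b.tr_in step w e subring_mult[OF a.LR] subring_mult[OF b.LR]
        by (intro comp_ring_prod) auto
      ultimately show ?case using step comp_ring_add by simp
    qed
    have "T x = x * T 1"
      unfolding T_def sum_distrib_left
      by (intro sum.cong refl) (use x we in \<open>auto simp: endo_mult[OF M_ring act2_endo]\<close>)
    also have "T 1 = 1"
      using Tp[OF subring_1[OF a.LR] subring_1[OF b.LR]] w e by simp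
    finally have "T x = x" by simp
    then show "x \<in> ?l" using Tin[of x] x by (simp add: M_def)
  qed
qed

sublocale prod: gal_act "G \<times>\<times> H" M "comp_ring K0 D0" act2
proof (rule gal_act.intro)
  show "group (G \<times>\<times> H)" by (rule DirProd_group[OF a.grp b.grp])
  show "finite (carrier (G \<times>\<times> H))" using a.fin b.fin by simp
  show "ring_endo M (act2 g)" if "g \<in> carrier (G \<times>\<times> H)" for g
    using that act2_endo by (cases g) auto
  show "act2 (g \<otimes>\<^bsub>G \<times>\<times> H\<^esub> h) x = act2 g (act2 h x)"
    if "g \<in> carrier (G \<times>\<times> H)" "h \<in> carrier (G \<times>\<times> H)" "x \<in> M" for g h x
    using that act2_comp by (cases g; cases h) auto
  show "\<exists>x\<in>M. act2 g x \<noteq> x" if g: "g \<in> carrier (G \<times>\<times> H)" "g \<noteq> \<one>\<^bsub>G \<times>\<times> H\<^esub>" for g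
  proof -
    obtain g1 g2 where g12: "g = (g1, g2)" "g1 \<in> carrier G" "g2 \<in> carrier H" using g(1) by auto
    show ?thesis
    proof (cases "g1 = \<one>\<^bsub>G\<^esub>")
      case False
      then obtain x where "x \<in> F" "aF g1 x \<noteq> x" using a.faithful[OF g12(2)] by blast
      then show ?thesis using FM act2_left[OF g12(2,3), of x] g12(1) by (intro bexI[of _ x]) auto
    next
      case True
      then have "g2 \<noteq> \<one>\<^bsub>H\<^esub>" using g(2) g12(1) by auto
      then obtain x where "x \<in> D" "aD g2 x \<noteq> x" using b.faithful[OF g12(3)] by blast
      then show ?thesis using DM act2_right[OF g12(2,3), of x] g12(1) by (intro bexI[of _ x]) auto
    qed
  qed
qed (use M_field act2_one fixed_M in auto)

end


section \<open>The twisted field\<close>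

text \<open>\<open>H\<close> acts on \<open>F\<close> as a subgroup of \<open>G = Gal(F/k(T))\<close> and on \<open>E\<close> as \<open>Gal(E/k)\<close>; the twisted
  field is the fixed field of the diagonal in \<open>G \<times> H\<close> acting on \<open>F E\<close>.\<close>

locale twist = unramified_rat_point k kb V F P \<pi> +
  two: two_act G F K0 aF "G\<lparr>carrier := H\<rparr>" E k aE k
  for k kb V F P :: "'a::field set" and \<pi> and G :: "('g, 'm) monoid_scheme" (structure)
    and K0 and aF :: "'g \<Rightarrow> 'a \<Rightarrow> 'a" and H E and aE :: "'g \<Rightarrow> 'a \<Rightarrow> 'a" +
  assumes E_kb: "E \<subseteq> kb" and VK0: "V \<subseteq> K0" and sub: "subgroup H G"
    and normal: "\<And>x. x \<in> K0 \<Longrightarrow> integral_over V x \<Longrightarrow> x \<in> V"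
    and V_P: "\<And>v. v \<in> V \<Longrightarrow> v \<in> P \<Longrightarrow> v / \<pi> \<in> V"
    and center: "\<And>z. z \<in> carrier G \<Longrightarrow> (\<And>x. x \<in> carrier G \<Longrightarrow> z \<otimes> x = x \<otimes> z) \<Longrightarrow> z = \<one>"
begin

abbreviation M where "M \<equiv> two.M"
abbreviation act where "act \<equiv> two.act2"
abbreviation \<Gamma> where "\<Gamma> \<equiv> G \<times>\<times> (G\<lparr>carrier := H\<rparr>)"

lemma E: "subfield_set E" "k \<subseteq> E" using two.b.L two.kD by auto
lemmas ER = two.b.LR
lemma HG: "h \<in> H \<Longrightarrow> h \<in> carrier G" using subgroup.mem_carrier[OF sub] .
lemma H1: "\<one> \<in> H" using subgroup.one_closed[OF sub] .
lemma Hm: "h \<in> H \<Longrightarrow> h' \<in> H \<Longrightarrow> h \<otimes> h' \<in> H" using subgroup.m_closed[OF sub] .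
lemma comp_K0_k: "comp_ring K0 k = K0"
  using comp_ring_subset[OF subfield_imp_subring[OF two.a.subfield_K] order_refl two.kK0]
    comp_ring_left[OF subfield_imp_subring[OF two.a.subfield_K] kR] by blast

lemma prod_act: "gal_act \<Gamma> M K0 act"
  using two.prod.gal_act_axioms by (simp add: comp_K0_k)

lemma K0M: "K0 \<subseteq> M" using two.FM two.a.K_subset by blast

lemma act_K0: "g \<in> carrier G \<Longrightarrow> h \<in> H \<Longrightarrow> x \<in> K0 \<Longrightarrow> act (g, h) x = x"
  using two.prod.act_K[of "(g, h)" x] by (simp add: comp_K0_k)

lemma act_comp: "g \<in> carrier G \<Longrightarrow> h \<in> H \<Longrightarrow> g' \<in> carrier G \<Longrightarrow> h' \<in> H \<Longrightarrow> x \<in> M \<Longrightarrow>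
    act (g, h) (act (g', h') x) = act (g \<otimes> g', h \<otimes> h') x"
  using two.act2_comp[of g h g' h' x] by simp

lemma act_endo: "g \<in> carrier G \<Longrightarrow> h \<in> H \<Longrightarrow> ring_endo M (act (g, h))"
  using two.act2_endo by simp

lemma act_M: "g \<in> carrier G \<Longrightarrow> h \<in> H \<Longrightarrow> x \<in> M \<Longrightarrow> act (g, h) x \<in> M"
  using endo_in[OF two.M_ring act_endo] .

definition \<E> where "\<E> = {x \<in> M. \<forall>h\<in>H. act (h, h) x = x}"

lemma EM: "\<E> \<subseteq> M" by (auto simp: \<E>_def)

lemma K0E: "K0 \<subseteq> \<E>" using K0M act_K0 HG by (auto simp: \<E>_def)

lemma E_ring: "subring_set \<E>"
proof -
  have "x - y \<in> \<E> \<and> x * y \<in> \<E>" if "x \<in> \<E>" "y \<in> \<E>" for x y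
    using that subring_diff[OF two.M_ring, of x y] subring_mult[OF two.M_ring, of x y]
    by (auto simp: \<E>_def endo_diff[OF two.M_ring act_endo[OF HG]] endo_mult[OF two.M_ring act_endo[OF HG]])
  then show ?thesis using K0E subring_1[OF subfield_imp_subring[OF two.a.subfield_K]]
    by (auto simp: subring_set_def)
qed

lemma E_field: "subfield_set \<E>" using two.field_above[OF E_ring K0E] .

lemma diag_sum:
  assumes "x \<in> M" shows "(\<Sum>h\<in>H. act (h, h) x) \<in> \<E>"
proof -
  have "act (h', h') (\<Sum>h\<in>H. act (h, h) x) = (\<Sum>h\<in>H. act (h, h) x)" if h': "h' \<in> H" for h'
  proof -
    have "act (h', h') (\<Sum>h\<in>H. act (h, h) x) = (\<Sum>h\<in>H. act (h' \<otimes> h, h' \<otimes> h) x)"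
      using assms h' by (subst endo_sum[OF two.M_ring act_endo]) (auto simp: HG act_M act_comp)
    also have "\<dots> = (\<Sum>h\<in>H. act (h, h) x)"
      using sum.reindex_bij_betw[OF two.b.bij_left_mult, of h' "\<lambda>h. act (h, h) x"] h' by simp
    finally show ?thesis .
  qed
  then show ?thesis using assms by (auto simp: \<E>_def HG act_M intro: subring_sum[OF two.M_ring])
qed

text \<open>Dedekind's independence of automorphisms, applied to the trace over the diagonal.\<close>

lemma fixes_E_imp_diag:
  assumes g: "g \<in> carrier G" "h \<in> H" and fx: "\<And>x. x \<in> \<E> \<Longrightarrow> act (g, h) x = x"
  shows "g = h"
proof (rule ccontr)
  assume ne: "g \<noteq> h"
  interpret pr: gal_act \<Gamma> M K0 act by (rule prod_act)
  define U where "U = (\<lambda>h. (h, h)) ` H"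
  define W where "W = (\<lambda>u. (g \<otimes> u, h \<otimes> u)) ` H"
  \<comment> \<open>The trace over the diagonal U agrees with its translate by (g, h), which is the
    sum over the coset W. So c, the difference of the two indicator functions, gives a relation; the
    neutral element lies in U, and it lies in W only if g = h.\<close>
  define c where "c = (\<lambda>d. (if d \<in> U then 1 else 0) - (if d \<in> W then 1 else (0::'a)))"
  have UW: "U \<subseteq> carrier \<Gamma>" "W \<subseteq> carrier \<Gamma>" using g HG Hm by (auto simp: U_def W_def)
  have "(\<Sum>d\<in>carrier \<Gamma>. c d * act d x) = 0" if x: "x \<in> M" for x
  proof -
    have "(\<Sum>d\<in>carrier \<Gamma>. c d * act d x) =
        (\<Sum>d\<in>carrier \<Gamma>. if d \<in> U then act d x else 0) - (\<Sum>d\<in>carrier \<Gamma>. if d \<in> W then act d x else 0)"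
      unfolding sum_subtractf[symmetric] by (rule sum.cong) (auto simp: c_def)
    also have "\<dots> = (\<Sum>d\<in>U. act d x) - (\<Sum>d\<in>W. act d x)"
      using UW pr.fin by (simp add: sum.If_cases Int_absorb1)
    also have "(\<Sum>d\<in>U. act d x) = (\<Sum>u\<in>H. act (u, u) x)"
      unfolding U_def by (subst sum.reindex) (auto simp: inj_on_def)
    also have "(\<Sum>d\<in>W. act d x) = (\<Sum>u\<in>H. act (g \<otimes> u, h \<otimes> u) x)"
      unfolding W_def using g HG by (subst sum.reindex) (auto simp: inj_on_def)
    also have "\<dots> = act (g, h) (\<Sum>u\<in>H. act (u, u) x)"
      using g HG x by (subst endo_sum[OF two.M_ring act_endo]) (auto simp: act_M act_comp)
    also have "\<dots> = (\<Sum>u\<in>H. act (u, u) x)" using fx diag_sum[OF x] by blast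
    finally show ?thesis by simp
  qed
  then have "c \<one>\<^bsub>\<Gamma>\<^esub> = 0" by (rule pr.independence_at_one)
  moreover have "\<one>\<^bsub>\<Gamma>\<^esub> \<in> U" using H1 by (auto simp: U_def)
  moreover have "\<one>\<^bsub>\<Gamma>\<^esub> \<notin> W"
  proof
    assume "\<one>\<^bsub>\<Gamma>\<^esub> \<in> W"
    then obtain u where u: "u \<in> H" "\<one> = g \<otimes> u" "\<one> = h \<otimes> u" by (auto simp: W_def)
    then have "g \<otimes> u = h \<otimes> u" by simp
    then show False using ne two.a.r_cancel[of u g h] u(1) g HG by auto
  qed
  ultimately show False by (simp add: c_def)
qed

lemma V_comp: "comp_ring Oc D \<supseteq> V" if "subring_set D"
  using comp_ring_left[OF O_ring that] VA AO by blast

text \<open>A constant in the compositum is integral over the local ring extended by E, hence lies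
  in that ring. Its residue is then an element of E, and a constant is its own residue.\<close>

lemma M_int_kb: "M \<inter> kb = E"
proof
  show "E \<subseteq> M \<inter> kb" using E_kb two.DM by auto
  show "M \<inter> kb \<subseteq> E"
  proof
    fix x assume x: "x \<in> M \<inter> kb"
    have kc: "k \<subseteq> comp_ring Oc E" using V_comp[OF ER] V by blast
    have "x \<in> comp_ring Oc E"
      by (rule integral_in_comp_ring[OF E E_kb])
        (use x kb_integral integral_over_mono[OF _ kc] in \<open>auto simp: two.M_def\<close>)
    then have "\<Phi> x \<in> E" by (rule ext_in_subfield[OF E E_kb])
    then show "x \<in> E" using residue.ext_right x by simp
  qed
qed

lemma E_int_kb: "\<E> \<inter> kb = k"
proof
  show "k \<subseteq> \<E> \<inter> kb" using two.kK0 K0E kb by blast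
  show "\<E> \<inter> kb \<subseteq> k"
  proof
    fix x assume x: "x \<in> \<E> \<inter> kb"
    then have xE: "x \<in> E" using M_int_kb EM by blast
    have "aE h x = x" if "h \<in> H" for h
      using x that two.act2_right[of h h x] xE HG by (auto simp: \<E>_def)
    then show "x \<in> k" using two.b.fixed xE by auto
  qed
qed

text \<open>A pair (g, h) that is trivial on E has h = 1, and one that is trivial on \<E> is
  diagonal, so the two fields together separate the product group.\<close>

lemma M_le_compositum:
  assumes R: "subring_set R" "\<E> \<subseteq> R" "E \<subseteq> R"
  shows "M \<subseteq> R"
proof -
  interpret pr: gal_act \<Gamma> M K0 act by (rule prod_act)
  have "R \<inter> M = M"
  proof (rule pr.separating_subring_eq)
    show "subring_set (R \<inter> M)" by (rule subring_set_Int[OF R(1) two.M_ring])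
    show "K0 \<subseteq> R \<inter> M" using R K0E EM by blast
    fix d assume d: "d \<in> carrier \<Gamma>" "d \<noteq> \<one>\<^bsub>\<Gamma>\<^esub>"
    then obtain g h where gh: "d = (g, h)" "g \<in> carrier G" "h \<in> H" by auto
    show "\<exists>y\<in>R \<inter> M. act d y \<noteq> y"
    proof (cases "h = \<one>")
      case False
      then obtain y where "y \<in> E" "aE h y \<noteq> y" using two.b.faithful[of h] gh by auto
      then show ?thesis using two.act2_right[of g h y] gh R two.DM by (intro bexI[of _ y]) auto
    next
      case True
      then have "g \<noteq> h" using d gh by auto
      then show ?thesis using fixes_E_imp_diag[OF gh(2,3)] gh(1) R EM by blast
    qed
  qed auto
  then show ?thesis by blast
qed

text \<open>If (g, h) is trivial on the stable intersection, then so are its conjugates under G x 1,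
  and each of them is diagonal. Thus s^-1 g s = h for all s, so g = h is central.\<close>

lemma M_le_stable:
  assumes R: "subring_set R" "\<E> \<subseteq> R"
    and stable: "\<And>x g h. x \<in> R \<inter> M \<Longrightarrow> g \<in> carrier G \<Longrightarrow> h \<in> H \<Longrightarrow> act (g, h) x \<in> R"
  shows "M \<subseteq> R"
proof -
  interpret pr: gal_act \<Gamma> M K0 act by (rule prod_act)
  have "R \<inter> M = M"
  proof (rule pr.separating_subring_eq)
    show "subring_set (R \<inter> M)" by (rule subring_set_Int[OF R(1) two.M_ring])
    show "K0 \<subseteq> R \<inter> M" using R K0E EM by blast
    fix d assume d: "d \<in> carrier \<Gamma>" "d \<noteq> \<one>\<^bsub>\<Gamma>\<^esub>"
    then obtain g h where gh: "d = (g, h)" "g \<in> carrier G" "h \<in> H" by auto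
    show "\<exists>y\<in>R \<inter> M. act d y \<noteq> y"
    proof (rule ccontr)
      assume fx: "\<not> ?thesis"
      have conj: "inv s \<otimes> g \<otimes> s = h" if s: "s \<in> carrier G" for s
      proof (rule fixes_E_imp_diag)
        fix x assume x: "x \<in> \<E>"
        have sx: "act (s, \<one>) x \<in> R \<inter> M" using stable[of x s \<one>] x R EM s H1 act_M by auto
        have "act (inv s \<otimes> g \<otimes> s, h) x = act (inv s, \<one>) (act (g, h) (act (s, \<one>) x))"
          using x EM s gh H1 HG by (auto simp: act_comp act_M two.a.m_assoc subsetD)
        also have "\<dots> = act (inv s, \<one>) (act (s, \<one>) x)" using fx sx gh(1) by simp
        also have "\<dots> = act (\<one>, \<one>) x" using x EM s H1 by (auto simp: act_comp subsetD)
        also have "\<dots> = x" using two.act2_one x EM by auto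
        finally show "act (inv s \<otimes> g \<otimes> s, h) x = x" .
      qed (use s gh in auto)
      have gh': "g = h" using conj[OF two.a.one_closed] gh by simp
      have "g \<otimes> s = s \<otimes> g" if s: "s \<in> carrier G" for s
      proof -
        have "s \<otimes> (inv s \<otimes> g \<otimes> s) = s \<otimes> g" using conj[OF s] gh' by simp
        then show ?thesis using s gh(2) by (simp add: two.a.m_assoc[symmetric])
      qed
      then have "g = \<one>" using center gh(2) by blast
      then show False using d(2) gh(1) gh' by simp
    qed
  qed auto
  then show ?thesis by blast
qed

end


section \<open>The residue map of the compositum at P\<close>

context twist
begin

lemma aF_one: "x \<in> F \<Longrightarrow> aF \<one> x = x" using two.a.act_one .
lemma aE_one: "x \<in> E \<Longrightarrow> aE \<one> x = x" using two.b.act_one by simp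

lemma OE: "comp_ring Oc E \<subseteq> comp_ring Oc kb" using comp_ring_mono[OF order_refl E_kb] .
lemma OE_ring: "subring_set (comp_ring Oc E)" using subring_comp_ring[OF O_ring ER] .
lemma OE_M: "comp_ring Oc E \<subseteq> M" using comp_ring_mono[OF O_sub_F order_refl] by (simp add: two.M_def)
lemma Phi_OE: "x \<in> comp_ring Oc E \<Longrightarrow> \<Phi> x \<in> E" by (rule ext_in_subfield[OF E E_kb])
lemma Phi_add: "x \<in> comp_ring Oc E \<Longrightarrow> y \<in> comp_ring Oc E \<Longrightarrow> \<Phi> (x + y) = \<Phi> x + \<Phi> y"
  using residue.ext_add OE by blast
lemma Phi_mult: "x \<in> comp_ring Oc E \<Longrightarrow> y \<in> comp_ring Oc E \<Longrightarrow> \<Phi> (x * y) = \<Phi> x * \<Phi> y"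
  using residue.ext_mult OE by blast
lemma Phi_sum: "(\<And>i. i \<in> I \<Longrightarrow> f i \<in> comp_ring Oc E) \<Longrightarrow> \<Phi> (sum f I) = (\<Sum>i\<in>I. \<Phi> (f i))"
  by (rule residue.ext_sum) (use OE in auto)
lemma Phi_E: "x \<in> E \<Longrightarrow> \<Phi> x = x" using residue.ext_right E_kb by blast
lemma Phi_O: "x \<in> Oc \<Longrightarrow> \<Phi> x = \<phi> x" using residue.ext_left by blast
lemma E_OE: "E \<subseteq> comp_ring Oc E" by (rule comp_ring_right[OF O_ring ER])
lemma O_OE: "Oc \<subseteq> comp_ring Oc E" by (rule comp_ring_left[OF O_ring ER])

text \<open>The pairs (1, h) leave F, and with it the point P, in place and move the constants
  alone, so they act on residues through \<open>aE h\<close>.\<close>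

lemma act_const:
  assumes "x \<in> comp_ring Oc E" "h \<in> H"
  shows "act (\<one>, h) x \<in> comp_ring Oc E \<and> \<Phi> (act (\<one>, h) x) = aE h (\<Phi> x)"
  using assms(1)
proof induction
  case zero
  show ?case using endo_0[OF two.M_ring act_endo[OF two.a.one_closed assms(2)]]
    endo_0[OF ER two.b.endo] assms(2) by (simp add: comp_ring.zero)
next
  case (step a c x)
  have e: "ring_endo E (aE h)" using two.b.endo assms(2) by simp
  have m: "a \<in> F" "a * c \<in> M" "x \<in> M" "aE h c \<in> E" "a * c \<in> comp_ring Oc E" "a * aE h c \<in> comp_ring Oc E"
    using step O_sub_F OE_M endo_in[OF ER e] by (auto intro!: comp_ring_prod)
  have 1: "act (\<one>, h) (a * c + x) = a * aE h c + act (\<one>, h) x"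
    using m step assms(2) two.act2_prod[of \<one> h a c]
    by (simp add: endo_add[OF two.M_ring act_endo] aF_one)
  have p: "\<Phi> (a * b) = \<phi> a * b" if "b \<in> E" for b
    using residue.ext_prod step(1) that E_kb by auto
  have pk: "\<phi> a \<in> E" "aE h (\<phi> a) = \<phi> a"
    using phi_in[OF step(1)] E two.b.act_K assms(2) by auto
  have "\<Phi> (act (\<one>, h) (a * c + x)) = \<phi> a * aE h c + aE h (\<Phi> x)"
    unfolding 1 using m step p by (simp add: Phi_add)
  also have "\<dots> = aE h (\<Phi> (a * c + x))"
    using m step p pk Phi_OE[OF step(3)]
    by (simp add: Phi_add endo_add[OF ER e] endo_mult[OF ER e] subring_mult[OF ER])
  finally show ?case unfolding 1 using m step comp_ring_add by blast
qed

text \<open>A dual basis of E over k gives each y coordinates t (y z) in F, where t is the trace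
  over 1 x H, and these coordinates are scaled as in F.\<close>

lemma scaling_M:
  assumes "finite S" "\<forall>c\<in>S. y c \<in> M" "\<exists>c\<in>S. y c \<noteq> 0"
  shows "\<exists>g\<in>F. (\<forall>c\<in>S. g * y c \<in> comp_ring Oc E) \<and> (\<exists>c\<in>S. \<Phi> (g * y c) \<noteq> 0)"
proof -
  obtain ps where ps: "set ps \<subseteq> E \<times> E" "\<And>e. e \<in> E \<Longrightarrow> e = (\<Sum>(z, u)\<leftarrow>ps. two.b.tr (e * z) * u)"
    using two.b.dual_basis[OF ER order_refl two.b.faithful] by blast
  define n where "n = length ps"
  define z where "z i = fst (ps ! i)" for i
  define u where "u i = snd (ps ! i)" for i
  have zu: "z i \<in> E" "u i \<in> E" if "i < n" for i
  proof -
    have "ps ! i \<in> E \<times> E" using ps(1) nth_mem[of i ps] that by (auto simp: n_def)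
    then show "z i \<in> E" "u i \<in> E" by (auto simp: z_def u_def mem_Times_iff)
  qed
  have dual: "e = (\<Sum>i<n. two.b.tr (e * z i) * u i)" if "e \<in> E" for e
    using ps(2)[OF that] by (simp add: sum_list_sum_nth n_def z_def u_def case_prod_beta atLeast0LessThan)
  define t where "t x = (\<Sum>h\<in>H. act (\<one>, h) x)" for x
  have t_add: "t (a + b) = t a + t b" if "a \<in> M" "b \<in> M" for a b
    using that by (simp add: t_def endo_add[OF two.M_ring act_endo] sum.distrib)
  have t_prod: "t (f * e) = f * two.b.tr e" if "f \<in> F" "e \<in> E" for f e
    using that by (simp add: t_def two.b.tr_def two.act2_prod aF_one sum_distrib_left)
  have exp: "t (x * e) \<in> F \<and> x = (\<Sum>i<n. t (x * z i) * u i)" if "x \<in> comp_ring F E" "e \<in> E" for x e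
    using that
  proof (induction arbitrary: e)
    case zero
    then show ?case using t_prod[of 0 e] subring_0[OF FR] by simp
  next
    case (step f c x)
    have mem: "f * c * b \<in> M" "x * b \<in> M" if "b \<in> E" for b
      using step that two.FM two.DM by (auto simp: two.M_def[symmetric] intro!: subring_mult[OF two.M_ring])
    have tt: "t ((f * c + x) * b) = f * two.b.tr (c * b) + t (x * b)" if "b \<in> E" for b
      using t_add[OF mem[OF that]] t_prod[OF step(1), of "c * b"] step that
      by (simp add: distrib_right mult.assoc subring_mult[OF ER])
    have "two.b.tr (c * e) \<in> F"
      using two.b.tr_in[of "c * e"] step subring_mult[OF ER] V by auto
    then have "t ((f * c + x) * e) \<in> F"
      using tt[OF step.prems] step subring_closed[OF FR] by simp
    moreover have "f * c + x = (\<Sum>i<n. t ((f * c + x) * z i) * u i)"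
    proof -
      have "(\<Sum>i<n. t ((f * c + x) * z i) * u i) = (\<Sum>i<n. f * (two.b.tr (c * z i) * u i) + t (x * z i) * u i)"
      proof (rule sum.cong[OF refl])
        fix i assume "i \<in> {..<n}"
        then show "t ((f * c + x) * z i) * u i = f * (two.b.tr (c * z i) * u i) + t (x * z i) * u i"
          using tt[of "z i"] zu by (simp add: distrib_right[of "f * two.b.tr (c * z i)"] mult.assoc)
      qed
      also have "\<dots> = f * (\<Sum>i<n. two.b.tr (c * z i) * u i) + (\<Sum>i<n. t (x * z i) * u i)"
        by (simp add: sum.distrib sum_distrib_left)
      also have "\<dots> = f * c + x" using dual[OF step(2)] step(4)[OF step.prems] by simp
      finally show ?thesis by simp
    qed
    ultimately show ?case by blast
  qed
  have yM: "y c \<in> comp_ring F E" if "c \<in> S" for c using assms(2) that by (auto simp: two.M_def)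
  have "\<exists>g\<in>F. g \<noteq> 0 \<and> (\<forall>p\<in>S \<times> {..<n}. g * t (y (fst p) * z (snd p)) \<in> Oc) \<and>
      (\<exists>p\<in>S \<times> {..<n}. \<phi> (g * t (y (fst p) * z (snd p))) \<noteq> 0)"
  proof (rule scaling)
    show "\<forall>p\<in>S \<times> {..<n}. t (y (fst p) * z (snd p)) \<in> F" using exp yM zu by auto
    obtain c where c: "c \<in> S" "y c \<noteq> 0" using assms(3) by blast
    then have "y c = (\<Sum>i<n. t (y c * z i) * u i)" using exp[OF yM subring_0[OF ER]] by blast
    then obtain i where "i < n" "t (y c * z i) \<noteq> 0"
      using c(2) by (metis (no_types, lifting) lessThan_iff mult_zero_left sum.neutral)
    then show "\<exists>p\<in>S \<times> {..<n}. t (y (fst p) * z (snd p)) \<noteq> 0" using c(1) by force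
  qed (use assms in simp)
  then obtain g c0 i0 where g: "g \<in> F" "\<And>c i. c \<in> S \<Longrightarrow> i < n \<Longrightarrow> g * t (y c * z i) \<in> Oc"
    "c0 \<in> S" "i0 < n" "\<phi> (g * t (y c0 * z i0)) \<noteq> 0" by auto
  have gy: "g * y c \<in> comp_ring Oc E" if "c \<in> S" for c
  proof -
    have "y c = (\<Sum>i<n. t (y c * z i) * u i)" using exp[OF yM[OF that] subring_0[OF ER]] by blast
    then have "g * y c = g * (\<Sum>i<n. t (y c * z i) * u i)" by simp
    also have "\<dots> = (\<Sum>i<n. (g * t (y c * z i)) * u i)" by (simp add: sum_distrib_left mult.assoc)
    also have "\<dots> \<in> comp_ring Oc E" using g(2) that zu by (intro comp_ring_sum comp_ring_prod) auto
    finally show ?thesis .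
  qed
  \<comment> \<open>If g y had residue 0 at c0, so would its multiple by \<open>z i0\<close> and the
    trace of that multiple over 1 x H, which acts on residues. But this trace is the scaled
    coordinate with nonzero residue.\<close>
  have "\<Phi> (g * y c0) \<noteq> 0"
  proof
    assume 0: "\<Phi> (g * y c0) = 0"
    let ?w = "g * y c0 * z i0"
    have w: "?w \<in> comp_ring Oc E" using gy[OF g(3)] zu[OF g(4)] E_OE subring_mult[OF OE_ring] by blast
    have "g * t (y c0 * z i0) = t ?w"
      unfolding t_def sum_distrib_left
    proof (rule sum.cong[OF refl])
      fix h assume h: "h \<in> H"
      have "g \<in> M" "y c0 * z i0 \<in> M"
        using g zu assms(2) two.FM two.DM by (auto intro!: subring_mult[OF two.M_ring])
      then show "g * act (\<one>, h) (y c0 * z i0) = act (\<one>, h) ?w"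
        using h g(1) two.act2_left[of \<one> h g]
        by (simp add: mult.assoc endo_mult[OF two.M_ring act_endo] aF_one)
    qed
    then have "\<phi> (g * t (y c0 * z i0)) = \<Phi> (t ?w)" using Phi_O[OF g(2)[OF g(3,4)]] by simp
    also have "\<dots> = (\<Sum>h\<in>H. aE h (\<Phi> ?w))"
      unfolding t_def using act_const[OF w] by (subst Phi_sum) auto
    also have "\<Phi> ?w = 0"
      using 0 gy[OF g(3)] zu[OF g(4)] E_OE by (subst Phi_mult) auto
    finally show False using g(5) endo_0[OF ER two.b.endo] by simp
  qed
  then show ?thesis using g gy by blast
qed

text \<open>Scaling and reducing as for F, now with residues in E. The map \<Phi> is multiplicative
  and the identity on constants, so the reduced relation vanishes directly.\<close>

lemma lin_disjoint_M_kb: "lin_disjoint E M kb"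
  unfolding lin_disjoint_def
proof (intro allI impI)
  fix S y assume S: "finite S" "S \<subseteq> kb" "\<forall>c\<in>S. y c \<in> M" "(\<Sum>c\<in>S. y c * c) = 0" "\<exists>c\<in>S. y c \<noteq> 0"
  obtain g where g: "\<forall>c\<in>S. g * y c \<in> comp_ring Oc E" "\<exists>c\<in>S. \<Phi> (g * y c) \<noteq> 0"
    using scaling_M[OF S(1,3,5)] by blast
  have RR: "subring_set (comp_ring Oc kb)" by (rule subring_comp_ring[OF O_ring kbR])
  have m: "g * y c \<in> comp_ring Oc kb" "c \<in> comp_ring Oc kb" "\<Phi> c = c" if "c \<in> S" for c
    using g(1) OE S(2) comp_ring_right[OF O_ring kbR] residue.ext_right that by auto
  have "0 = \<Phi> (g * (\<Sum>c\<in>S. y c * c))" using S(4) by simp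
  also have "g * (\<Sum>c\<in>S. y c * c) = (\<Sum>c\<in>S. (g * y c) * c)" by (simp add: sum_distrib_left mult.assoc)
  also have "\<Phi> \<dots> = (\<Sum>c\<in>S. \<Phi> (g * y c) * c)"
    using m subring_mult[OF RR] by (simp add: residue.ext_sum residue.ext_mult)
  finally show "\<exists>l. (\<forall>c\<in>S. l c \<in> E) \<and> (\<exists>c\<in>S. l c \<noteq> 0) \<and> (\<Sum>c\<in>S. l c * c) = 0"
    using g Phi_OE by (intro exI[of _ "\<lambda>c. \<Phi> (g * y c)"]) auto
qed

text \<open>With the roles exchanged in the preceding disjointness, a relation over kbar among
  elements of \<E> yields one over E. The diagonal fixes these elements, so its trace acts on the
  coefficients alone and moves them into k.\<close>

lemma lin_disjoint_E_kb: "lin_disjoint k \<E> kb"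
proof -
  have ld: "lin_disjoint E kb M"
    by (rule lin_disjoint_sym[OF E(1) lin_disjoint_M_kb two.M_ring two.DM])
  have "lin_disjoint k kb \<E>"
    unfolding lin_disjoint_def
  proof (intro allI impI)
    fix S y assume S: "finite S" "S \<subseteq> \<E>" "\<forall>c\<in>S. y c \<in> kb" "(\<Sum>c\<in>S. y c * c) = 0" "\<exists>c\<in>S. y c \<noteq> 0"
    obtain a where a: "\<forall>c\<in>S. a c \<in> E" "\<exists>c\<in>S. a c \<noteq> 0" "(\<Sum>c\<in>S. a c * c) = 0"
      using ld[unfolded lin_disjoint_def, rule_format, of S y] S EM by blast
    obtain c0 where c0: "c0 \<in> S" "a c0 \<noteq> 0" using a(2) by blast
    obtain w where w: "w \<in> E" "two.b.tr w = 1" by (rule two.b.tr_eq_1)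
    \<comment> \<open>This factor makes the traced coefficient at c0 equal to tr w = 1, which keeps
      the new relation nontrivial.\<close>
    define e where "e = w / a c0"
    have eE: "e \<in> E" using w a c0 subfield_divide[OF E(1)] by (simp add: e_def)
    define l where "l c = two.b.tr (a c * e)" for c
    have ae: "a c * e \<in> E" if "c \<in> S" for c using a(1) eE that subring_mult[OF ER] by blast
    have "l c0 = 1" using c0 w by (simp add: l_def e_def)
    then have "\<exists>c\<in>S. l c \<noteq> 0" using c0(1) by (intro bexI[of _ c0]) auto
    moreover have "l c \<in> k" if "c \<in> S" for c unfolding l_def using two.b.tr_in[OF ae[OF that]] .
    moreover have "(\<Sum>c\<in>S. l c * c) = 0"
    proof -
      have mM: "a c * e * c \<in> M" "a c * e \<in> M" "c \<in> M" "c \<in> \<E>" if "c \<in> S" for c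
        using ae[OF that] S(2) EM two.DM that by (auto intro!: subring_mult[OF two.M_ring, of "a c * e"])
      have "act (h, h) (a c * e * c) = aE h (a c * e) * c" if "c \<in> S" "h \<in> H" for c h
        using mM[OF that(1)] ae[OF that(1)] that(2) HG two.act2_right[of h h "a c * e"]
        by (simp add: endo_mult[OF two.M_ring act_endo] \<E>_def)
      then have "(\<Sum>c\<in>S. l c * c) = (\<Sum>c\<in>S. \<Sum>h\<in>H. act (h, h) (a c * e * c))"
        by (simp add: l_def two.b.tr_def sum_distrib_right)
      also have "\<dots> = (\<Sum>h\<in>H. \<Sum>c\<in>S. act (h, h) (a c * e * c))" by (rule sum.swap)
      also have "\<dots> = (\<Sum>h\<in>H. act (h, h) (\<Sum>c\<in>S. a c * e * c))"
        by (rule sum.cong[OF refl], subst endo_sum[OF two.M_ring act_endo]) (auto simp: HG mM)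
      also have "(\<Sum>c\<in>S. a c * e * c) = e * (\<Sum>c\<in>S. a c * c)"
        by (simp add: sum_distrib_left mult_ac)
      finally show ?thesis using a(3) endo_0[OF two.M_ring act_endo] HG by simp
    qed
    ultimately show "\<exists>l. (\<forall>c\<in>S. l c \<in> k) \<and> (\<exists>c\<in>S. l c \<noteq> 0) \<and> (\<Sum>c\<in>S. l c * c) = 0"
      by (intro exI[of _ l]) auto
  qed
  then show ?thesis by (rule lin_disjoint_sym[OF k _ kbR kb(2)])
qed


section \<open>Integral elements of the compositum\<close>

definition B where "B = {x \<in> M. integral_over V x}"

lemma B_ring: "subring_set B"
proof -
  have "B = M \<inter> {x. integral_over V x}" by (auto simp: B_def)
  then show ?thesis using subring_set_Int[OF two.M_ring subring_integral[OF V(1)]] by simp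
qed

lemma BM: "B \<subseteq> M" by (auto simp: B_def)
lemma AB: "A \<subseteq> B" using two.FM by (auto simp: A_def B_def)
lemma VB: "V \<subseteq> B" using VA AB by blast
lemma EB: "E \<subseteq> B" using two.DM kb_integral integral_over_mono[OF _ V(2)] E_kb by (auto simp: B_def)

text \<open>This puts the integral elements into the domain of the residue map \<Phi>.\<close>

lemma B_OE: "B \<subseteq> comp_ring Oc E"
proof
  fix x assume "x \<in> B"
  then show "x \<in> comp_ring Oc E"
    using integral_in_comp_ring[OF E E_kb, of x] integral_over_mono[OF _ V_comp[OF ER]]
    by (auto simp: B_def two.M_def)
qed

lemma act_B: assumes "g \<in> carrier G" "h \<in> H" "x \<in> B" shows "act (g, h) x \<in> B"
proof -
  obtain p where p: "lead_coeff p = 1" "coeffs_in V p" "poly p x = 0"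
    using assms(3) by (auto simp: B_def integral_over_def)
  have xM: "x \<in> M" using assms(3) by (simp add: B_def)
  have c: "Polynomial.coeff p i \<in> V" for i using p(2) by (simp add: coeffs_in_def)
  have "poly p (act (g, h) x) = act (g, h) (poly p x)"
    using c VK0 K0M act_K0[OF assms(1,2)] xM
    by (intro endo_poly_fixed[OF two.M_ring act_endo[OF assms(1,2)], symmetric]) (auto simp: coeffs_in_def)
  then show ?thesis
    using p endo_0[OF two.M_ring act_endo[OF assms(1,2)]] act_M[OF assms(1,2) xM]
    by (auto simp: B_def integral_over_def)
qed

lemma B_K0: "x \<in> B \<Longrightarrow> x \<in> K0 \<Longrightarrow> x \<in> V" using normal by (auto simp: B_def)

lemma Phi_V: "v \<in> V \<Longrightarrow> \<Phi> v = \<phi> v" using Phi_O VA AO by blast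

lemma V_div_pi: "v \<in> V \<Longrightarrow> \<phi> v = 0 \<Longrightarrow> v / \<pi> \<in> V" using V_P phi_A VA by blast

lemma Phi_act: assumes "g \<in> carrier G" "h \<in> H" "x \<in> B"
  shows "\<Phi> (act (g, h) x) = aE h (\<Phi> (act (g, \<one>) x))"
proof -
  have "act (g, h) x = act (\<one>, h) (act (g, \<one>) x)"
    using assms H1 BM HG by (auto simp: act_comp subsetD)
  then show ?thesis using act_const[of "act (g, \<one>) x" h] act_B[OF assms(1) H1 assms(3)] B_OE assms(2) by auto
qed

lemma Phi_B_endo: "ring_endo (comp_ring Oc E) \<Phi>"
  unfolding ring_endo_def using Phi_add Phi_mult Phi_OE E_OE by auto

text \<open>The absence of ramification enters here: an automorphism of F over k(T) that preserved
  all residues at P would be the identity.\<close>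

lemma residue_separates:
  assumes "g \<in> carrier G" "g \<noteq> \<one>" shows "\<exists>y\<in>A. \<phi> (aF g y) \<noteq> \<phi> y"
proof (rule ccontr)
  assume "\<not> ?thesis"
  then have "aF g x = x" if "x \<in> F" for x
    using fixes_residue_imp_id[OF two.a.endo[OF assms(1)] _ _ that] two.a.act_K[OF assms(1)] VK0 by blast
  then show False using two.a.faithful[OF assms] by blast
qed

lemma aF_A: "g \<in> carrier G \<Longrightarrow> x \<in> A \<Longrightarrow> aF g x \<in> A"
  using act_B[of g \<one> x] H1 AB two.act2_left[of g \<one> x] AF two.a.act_in[of g x]
  by (auto simp: A_def B_def)

text \<open>The residue maps \<open>\<phi> \<circ> g\<close> are distinct, hence have distinct kernels.\<close>

lemma residue_idempotent:
  "\<exists>u\<in>A. \<forall>g\<in>carrier G. \<phi> (aF g u) = (if g = \<one> then 1 else 0)"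
proof -
  have "\<forall>g\<in>carrier G - {\<one>}. \<exists>y. y \<in> A \<and> \<phi> (aF g y) \<noteq> \<phi> y" using residue_separates by blast
  then obtain y where "\<forall>g\<in>carrier G - {\<one>}. y g \<in> A \<and> \<phi> (aF g (y g)) \<noteq> \<phi> (y g)"
    by (rule bchoice[THEN exE])
  then have y: "y g \<in> A" "\<phi> (aF g (y g)) \<noteq> \<phi> (y g)" if "g \<in> carrier G - {\<one>}" for g using that by auto
  let ?D = "carrier G - {\<one>}"
  define c where "c g = \<phi> (aF g (y g))" for g
  have cA: "c g \<in> k" "c g \<in> A" if "g \<in> ?D" for g
  proof -
    have "aF g (y g) \<in> Oc" using aF_A[of g "y g"] y[OF that] that AO by auto
    then show "c g \<in> k" unfolding c_def by (rule phi_in)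
    then show "c g \<in> A" using kA by blast
  qed
  \<comment> \<open>The factor at g has residue 0 after g is applied, and nonzero residue at the
    neutral element. The product of all factors therefore has nonzero residue only there, and it
    remains to scale that value to 1.\<close>
  define f where "f g = y g - c g" for g
  have fA: "f g \<in> A" if "g \<in> ?D" for g using y cA that subring_diff[OF A] by (simp add: f_def)
  define v where "v = (\<Prod>g\<in>?D. f g)"
  have prod_phi: "\<phi> (aF s (\<Prod>g\<in>T. f g)) = (\<Prod>g\<in>T. \<phi> (aF s (f g))) \<and> (\<Prod>g\<in>T. f g) \<in> A"
    if "finite T" "T \<subseteq> ?D" "s \<in> carrier G" for T s
    using that
  proof (induction T rule: finite_induct)
    case empty
    then show ?case using endo_1[OF FR two.a.endo] endo_1[OF O_ring phi_endo] subring_1[OF A] by simp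
  next
    case (insert g T)
    then have "f g \<in> A" "(\<Prod>g\<in>T. f g) \<in> A" using fA by auto
    then show ?case
      using insert AF AO aF_A by (simp add: endo_mult[OF FR two.a.endo] phi_mult subring_mult[OF A] subsetD)
  qed
  have vA: "v \<in> A" using prod_phi[of ?D \<one>] two.a.fin by (simp add: v_def)
  have aFf: "\<phi> (aF s (f g)) = \<phi> (aF s (y g)) - c g" if "s \<in> carrier G" "g \<in> ?D" for s g
  proof -
    have "c g \<in> K0" "c g \<in> F" "y g \<in> F" using cA that two.kK0 two.a.K_subset y AF by auto
    then have "aF s (f g) = aF s (y g) - c g"
      using that two.a.act_K by (simp add: f_def endo_diff[OF FR two.a.endo])
    then show ?thesis
      using aF_A[OF that(1)] y[OF that(2)] cA[OF that(2)] AO phi_k endo_diff[OF O_ring phi_endo]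
      by (simp add: subsetD)
  qed
  have zero: "\<phi> (aF s v) = 0" if "s \<in> ?D" for s
  proof -
    have "\<phi> (aF s (f s)) = 0" using aFf[of s s] that by (simp add: c_def)
    then show ?thesis using prod_phi[of ?D s] that two.a.fin by (auto simp: v_def)
  qed
  have nz: "\<phi> v \<noteq> 0"
  proof -
    have "\<phi> (aF \<one> (f g)) \<noteq> 0" if "g \<in> ?D" for g
      using aFf[OF two.a.one_closed that] y[OF that] aF_one AF by (auto simp: c_def)
    then show ?thesis
      using prod_phi[of ?D \<one>] two.a.fin vA AF aF_one by (auto simp: v_def subsetD)
  qed
  define d where "d = inverse (\<phi> v)"
  have d: "d \<in> k" "d \<in> A" "d \<in> K0"
  proof -
    have "\<phi> v \<in> k" using phi_in vA AO by blast
    then show "d \<in> k" using subfield_inverse[OF k] by (simp add: d_def)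
    then show "d \<in> A" "d \<in> K0" using kA two.kK0 by auto
  qed
  show ?thesis
  proof (intro bexI[of _ "d * v"] ballI)
    show "d * v \<in> A" using d vA subring_mult[OF A] by blast
    fix g assume g: "g \<in> carrier G"
    have "aF g (d * v) = d * aF g v" using d vA AF g two.a.act_K two.a.K_subset
      by (auto simp: endo_mult[OF FR two.a.endo] subsetD)
    then have "\<phi> (aF g (d * v)) = d * \<phi> (aF g v)"
      using d aF_A[OF g vA] AO phi_k by (simp add: phi_mult subsetD)
    then show "\<phi> (aF g (d * v)) = (if g = \<one> then 1 else 0)"
      using zero[of g] g nz aF_one[of v] vA AF by (auto simp: d_def subsetD)
  qed
qed

text \<open>Differences y - d(y) of nonzero residue give a list of pairs whose coordinate d at 1 has
  nonzero residue, and the trace expansion makes d x / \<pi> integral. The same argument makes all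
  g(d) x / \<pi> integral, and an integral combination of the g(d) with residue 1 completes the
  division by \<pi>.\<close>

lemma kernel_of_residues:
  assumes x: "x \<in> B" and zero: "\<And>g h. g \<in> carrier G \<Longrightarrow> h \<in> H \<Longrightarrow> \<Phi> (act (g, h) x) = 0"
  shows "x / \<pi> \<in> B"
proof -
  interpret pr: gal_act \<Gamma> M K0 act by (rule prod_act)
  let ?D = "carrier \<Gamma> - {\<one>\<^bsub>\<Gamma>\<^esub>}"
  have actB: "act d b \<in> B" if "d \<in> carrier \<Gamma>" "b \<in> B" for d b using act_B that by auto
  have B_OE': "b \<in> comp_ring Oc E" if "b \<in> B" for b using B_OE that by blast
  \<comment> \<open>Either component of d can separate residues: a nontrivial g does so on A because
    P is unramified, and otherwise h does so on the constants E.\<close>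
  have "\<forall>d\<in>?D. \<exists>y. y \<in> B \<and> \<Phi> (act d y) \<noteq> \<Phi> y"
  proof
    fix d assume d: "d \<in> ?D"
    then obtain g h where gh: "d = (g, h)" "g \<in> carrier G" "h \<in> H" by auto
    show "\<exists>y. y \<in> B \<and> \<Phi> (act d y) \<noteq> \<Phi> y"
    proof (cases "g = \<one>")
      case False
      then obtain y where y: "y \<in> A" "\<phi> (aF g y) \<noteq> \<phi> y" using residue_separates gh by blast
      then have "act d y = aF g y" using gh AF two.act2_left[of g h y] by auto
      then show ?thesis using y Phi_O aF_A[OF gh(2)] AO AB by (intro exI[of _ y]) (auto simp: subsetD)
    next
      case True
      then have "h \<noteq> \<one>" using d gh by auto
      then obtain y where y: "y \<in> E" "aE h y \<noteq> y" using two.b.faithful[of h] gh by auto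
      then have "act d y = aE h y" "aE h y \<in> E" using gh two.act2_right[of g h y] two.b.act_in[of h y] by auto
      then show ?thesis using y Phi_E EB by (intro exI[of _ y]) (auto simp: subsetD)
    qed
  qed
  then obtain y where y: "\<forall>d\<in>?D. y d \<in> B \<and> \<Phi> (act d (y d)) \<noteq> \<Phi> (y d)"
    by (rule bchoice[THEN exE])
  have "\<exists>ps. set ps \<subseteq> B \<times> B \<and>
      (\<forall>g\<in>carrier \<Gamma>. pr.pairing ps g = (\<Prod>d\<in>?D. act g (y d) - act d (y d)))"
    by (rule pr.coordinates[OF B_ring BM B_ring order_refl]) (use pr.fin y actB in auto)
  then obtain ps where ps: "set ps \<subseteq> B \<times> B"
    "\<forall>g\<in>carrier \<Gamma>. pr.pairing ps g = (\<Prod>d\<in>?D. act g (y d) - act d (y d))" by (elim exE conjE)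
  define d where "d = pr.pairing ps \<one>\<^bsub>\<Gamma>\<^esub>"
  have pz: "pr.pairing ps g = 0" if "g \<in> carrier \<Gamma>" "g \<noteq> \<one>\<^bsub>\<Gamma>\<^esub>" for g
  proof -
    have "(\<Prod>d\<in>?D. act g (y d) - act d (y d)) = 0" using pr.fin that by (intro prod_zero) auto
    then show ?thesis using bspec[OF ps(2) that(1)] by (simp only:)
  qed
  have d_eq: "d = (\<Prod>d\<in>?D. y d - act d (y d))"
  proof -
    have "d = (\<Prod>d\<in>?D. act \<one>\<^bsub>\<Gamma>\<^esub> (y d) - act d (y d))" using ps(2) two.prod.one_closed by (simp only: d_def)
    also have "\<dots> = (\<Prod>d\<in>?D. y d - act d (y d))"
      by (rule prod.cong[OF refl]) (use y BM pr.act_one in auto)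
    finally show ?thesis .
  qed
  have dB: "d \<in> B" unfolding d_eq using y actB by (intro subring_prod[OF B_ring] subring_diff[OF B_ring]) auto
  have "\<Phi> (\<Prod>d\<in>T. y d - act d (y d)) \<noteq> 0 \<and> (\<Prod>d\<in>T. y d - act d (y d)) \<in> B"
    if "finite T" "T \<subseteq> ?D" for T
    using that
  proof (induction T rule: finite_induct)
    case empty
    then show ?case using endo_1[OF OE_ring Phi_B_endo] subring_1[OF B_ring] by simp
  next
    case (insert d T)
    have yd: "y d \<in> B" "act d (y d) \<in> B" "\<Phi> (act d (y d)) \<noteq> \<Phi> (y d)" using y insert.prems actB by auto
    then have f: "y d - act d (y d) \<in> B" "\<Phi> (y d - act d (y d)) \<noteq> 0"
      using endo_diff[OF OE_ring Phi_B_endo] B_OE' subring_diff[OF B_ring] by auto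
    then show ?case
      using insert B_OE' by (simp add: Phi_mult subring_mult[OF B_ring])
  qed
  then have Phid: "\<Phi> d \<noteq> 0" unfolding d_eq using pr.fin by blast
  have trV: "pr.tr b \<in> V" if b: "b \<in> B" for b
  proof -
    have "pr.tr b \<in> B" unfolding pr.tr_def using actB b by (intro subring_sum[OF B_ring]) auto
    then show ?thesis using B_K0 pr.tr_in b BM by blast
  qed
  have Phi_tr: "\<Phi> (pr.tr b) = (\<Sum>g\<in>carrier \<Gamma>. \<Phi> (act g b))" if b: "b \<in> B" for b
    unfolding pr.tr_def using actB b B_OE' by (intro Phi_sum) auto
  \<comment> \<open>The traces tr (x' z) lie in V, and their residues are sums over the group of
    products with a vanishing factor. They are divisible by \<pi>, and so is their combination d
    x'.\<close>
  have step: "d * x' / \<pi> \<in> B"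
    if x': "x' \<in> B" and z': "\<And>g. g \<in> carrier \<Gamma> \<Longrightarrow> \<Phi> (act g x') = 0" for x'
  proof -
    have "(\<Sum>(z, u)\<leftarrow>qs. pr.tr (x' * z) * u) / \<pi> \<in> B" if "set qs \<subseteq> B \<times> B" for qs
      using that
    proof (induction qs)
      case Nil
      then show ?case using subring_0[OF B_ring] by simp
    next
      case (Cons q qs)
      obtain z u where q: "q = (z, u)" "z \<in> B" "u \<in> B" using Cons.prems by (cases q) auto
      have xz: "x' * z \<in> B" using x' q subring_mult[OF B_ring] by blast
      have "\<Phi> (act g (x' * z)) = 0" if "g \<in> carrier \<Gamma>" for g
      proof -
        have "act g (x' * z) = act g x' * act g z"
          using endo_mult[OF two.M_ring pr.endo[OF that]] x' q BM by blast
        then show ?thesis using z'[OF that] actB[OF that] x' q B_OE' by (simp add: Phi_mult)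
      qed
      then have "\<Phi> (pr.tr (x' * z)) = 0" using Phi_tr[OF xz] by simp
      then have "pr.tr (x' * z) / \<pi> \<in> V" using V_div_pi trV[OF xz] Phi_V by simp
      then have "pr.tr (x' * z) / \<pi> * u \<in> B" using VB q subring_mult[OF B_ring] by blast
      then have "pr.tr (x' * z) / \<pi> * u + (\<Sum>(z, u)\<leftarrow>qs. pr.tr (x' * z) * u) / \<pi> \<in> B"
        using Cons by (intro subring_add[OF B_ring]) auto
      then show ?case by (simp add: q(1) add_divide_distrib)
    qed
    moreover have "d * x' = (\<Sum>(z, u)\<leftarrow>ps. pr.tr (x' * z) * u)"
      unfolding d_def using ps(1) BM x' by (intro pr.pairing_dual pz) auto
    ultimately show ?thesis using ps(1) by simp
  qed
  \<comment> \<open>The residues of the conjugate g^-1 x vanish too; the step is applied to it and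
    the result is moved back by g, which fixes \<pi>.\<close>
  have conj: "act g d * x / \<pi> \<in> B" if g: "g \<in> carrier \<Gamma>" for g
  proof -
    let ?x = "act (inv\<^bsub>\<Gamma>\<^esub> g) x"
    have gi: "inv\<^bsub>\<Gamma>\<^esub> g \<in> carrier \<Gamma>" using two.prod.inv_closed[OF g] .
    have xM: "x \<in> M" using x BM by blast
    have b: "d * ?x / \<pi> \<in> B"
    proof (rule step)
      show "?x \<in> B" using actB[OF gi x] .
      fix s assume s: "s \<in> carrier \<Gamma>"
      have "act s ?x = act (s \<otimes>\<^bsub>\<Gamma>\<^esub> inv\<^bsub>\<Gamma>\<^esub> g) x" using pr.act_comp[OF s gi xM] by simp
      moreover obtain s1 s2 where "s \<otimes>\<^bsub>\<Gamma>\<^esub> inv\<^bsub>\<Gamma>\<^esub> g = (s1, s2)" "s1 \<in> carrier G" "s2 \<in> H"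
        using two.prod.m_closed[OF s gi] by auto
      ultimately show "\<Phi> (act s ?x) = 0" using zero by simp
    qed
    have \<pi>K: "\<pi> \<in> K0" "\<pi> \<in> M" "act g \<pi> = \<pi>" using \<pi>(1) VK0 K0M pr.act_K[OF g] by auto
    have "d * ?x = \<pi> * (d * ?x / \<pi>)" using \<pi>(3) by simp
    then have "act g (d * ?x) = \<pi> * act g (d * ?x / \<pi>)"
      using endo_mult[OF two.M_ring pr.endo[OF g], of \<pi> "d * ?x / \<pi>"] \<pi>K b BM by auto
    moreover have "act g (d * ?x) = act g d * x"
      using endo_mult[OF two.M_ring pr.endo[OF g], of d ?x] dB actB[OF gi x] BM pr.act_inv(1)[OF g xM] by auto
    ultimately have "act g d * x / \<pi> = act g (d * ?x / \<pi>)" using \<pi>(3) by simp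
    then show ?thesis using actB[OF g b] by simp
  qed
  obtain u where u0: "u \<in> A" "\<forall>g\<in>carrier G. \<phi> (aF g u) = (if g = \<one> then 1 else 0)"
    using residue_idempotent by blast
  note u = u0(1) bspec[OF u0(2)]
  obtain e0 where e0: "e0 \<in> E" "two.b.tr e0 = 1" by (rule two.b.tr_eq_1)
  \<comment> \<open>The weight w = u e has residues concentrated at g = 1 by the choice of u, and e
    is normalized so that the trace of \<open>\<Phi> d * e\<close> is 1. Hence r = tr (d w) is an
    element of V with residue 1.\<close>
  define e where "e = inverse (\<Phi> d) * e0"
  have PdE: "\<Phi> d \<in> E" using Phi_OE B_OE' dB by blast
  have eE: "e \<in> E" using e0 PdE subfield_inverse[OF E(1)] subring_mult[OF ER] by (simp add: e_def)
  define w where "w = u * e"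
  have wB: "w \<in> B" unfolding w_def by (rule subring_mult[OF B_ring subsetD[OF AB u(1)] subsetD[OF EB eE]])
  define r where "r = pr.tr (d * w)"
  have dwB: "d * w \<in> B" using dB wB subring_mult[OF B_ring] by blast
  have rV: "r \<in> V" using trV[OF dwB] by (simp add: r_def)
  have "\<Phi> r = (\<Sum>g\<in>carrier \<Gamma>. \<Phi> (act g (d * w)))" unfolding r_def by (rule Phi_tr[OF dwB])
  also have "\<dots> = (\<Sum>g\<in>carrier G. \<Sum>h\<in>H. \<Phi> (act (g, h) (d * w)))"
    by (simp add: sum.cartesian_product)
  also have "\<dots> = (\<Sum>g\<in>carrier G. \<Sum>h\<in>H. if g = \<one> then aE h (\<Phi> d) * aE h e else 0)"
  proof (intro sum.cong refl)
    fix g h assume gh: "g \<in> carrier G" "h \<in> H"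
    have "act (g, h) (d * w) = act (g, h) d * (aF g u * aE h e)"
    proof -
      have "d \<in> M" "w \<in> M" "u \<in> F" using dB wB BM u(1) AF by auto
      then show ?thesis
        using gh eE two.act2_prod[of g h u e] endo_mult[OF two.M_ring act_endo[OF gh], of d w]
        by (simp add: w_def)
    qed
    moreover have mm: "act (g, h) d \<in> comp_ring Oc E" "aF g u \<in> Oc" "aE h e \<in> E"
      using gh act_B dB B_OE aF_A u AO two.b.act_in eE by auto
    ultimately have "\<Phi> (act (g, h) (d * w)) = \<Phi> (act (g, h) d) * (\<phi> (aF g u) * aE h e)"
      using O_OE E_OE subring_mult[OF OE_ring] by (simp add: Phi_mult Phi_O Phi_E subsetD)
    then show "\<Phi> (act (g, h) (d * w)) = (if g = \<one> then aE h (\<Phi> d) * aE h e else 0)"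
      using u(2)[OF gh(1)] act_const[OF B_OE'[OF dB] gh(2)] by simp
  qed
  also have "\<dots> = (\<Sum>h\<in>H. aE h (\<Phi> d) * aE h e)"
    using two.a.fin by (subst sum.swap) (simp add: sum.delta)
  also have "\<dots> = two.b.tr (\<Phi> d * e)"
    using PdE eE by (simp add: two.b.tr_def endo_mult[OF ER two.b.endo])
  also have "\<dots> = 1" using e0 Phid by (simp add: e_def mult.assoc[symmetric])
  finally have "\<phi> r = 1" using Phi_V[OF rV] by simp
  \<comment> \<open>Since r has residue 1, it differs from 1 by a multiple of \<pi> in V, and x /
    \<pi> splits into (1 - r) x / \<pi> and r x / \<pi>.\<close>
  then have "(1 - r) / \<pi> \<in> V"
    using rV subring_1[OF V(1)] VA AO endo_diff[OF O_ring phi_endo, of 1 r] endo_1[OF O_ring phi_endo]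
    by (intro V_div_pi subring_diff[OF V(1)]) auto
  then have "(1 - r) / \<pi> * x \<in> B" using VB x subring_mult[OF B_ring] by blast
  moreover have "r * x / \<pi> \<in> B"
  proof -
    have "r * x / \<pi> = (\<Sum>g\<in>carrier \<Gamma>. act g w * (act g d * x / \<pi>))"
      unfolding r_def pr.tr_def sum_distrib_right sum_divide_distrib
      by (rule sum.cong[OF refl]) (use dB wB BM in \<open>auto simp: endo_mult[OF two.M_ring pr.endo] subsetD\<close>)
    also have "\<dots> \<in> B" using conj actB wB by (intro subring_sum[OF B_ring] subring_mult[OF B_ring]) auto
    finally show ?thesis .
  qed
  ultimately have "(1 - r) / \<pi> * x + r * x / \<pi> \<in> B" by (rule subring_add[OF B_ring])
  moreover have "(1 - r) / \<pi> * x + r * x / \<pi> = x / \<pi>" using \<pi>(3) by (simp add: field_simps)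
  ultimately show ?thesis by simp
qed

section \<open>Residue maps of the twisted field\<close>

definition U where "U = {x \<in> \<E>. integral_over V x}"

lemma U_eq: "U = \<E> \<inter> B" using EM by (auto simp: U_def B_def)

lemma U_ring: "subring_set U" unfolding U_eq by (rule subring_set_Int[OF E_ring B_ring])

text \<open>The inverse makes these maps depend on right cosets: on U, the map
  \<open>\<psi> (h \<otimes> r)\<close> is \<open>\<psi> r\<close> followed by
  \<open>aE h\<close>.\<close>

definition \<psi> where "\<psi> r x = \<Phi> (act (inv r, \<one>) x)"

lemma psi_endo:
  assumes "r \<in> carrier G" "x \<in> U" "y \<in> U"
  shows "\<psi> r (x + y) = \<psi> r x + \<psi> r y" "\<psi> r (x * y) = \<psi> r x * \<psi> r y" "\<psi> r x \<in> E"
proof -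
  have m: "x \<in> M" "y \<in> M" "act (inv r, \<one>) x \<in> comp_ring Oc E" "act (inv r, \<one>) y \<in> comp_ring Oc E"
    using assms act_B H1 B_OE BM by (auto simp: U_eq)
  then show "\<psi> r (x + y) = \<psi> r x + \<psi> r y" "\<psi> r (x * y) = \<psi> r x * \<psi> r y" "\<psi> r x \<in> E"
    using assms(1) H1 Phi_OE
    by (simp_all add: \<psi>_def endo_add[OF two.M_ring act_endo] endo_mult[OF two.M_ring act_endo] Phi_add Phi_mult)
qed

lemma VU: "V \<subseteq> U" using VK0 K0E VB by (auto simp: U_eq)

lemma psi_V: "r \<in> carrier G \<Longrightarrow> v \<in> V \<Longrightarrow> \<psi> r v = \<phi> v"
  using act_K0[of "inv r" \<one> v] H1 VK0 Phi_V by (auto simp: \<psi>_def)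

text \<open>Invariance under the diagonal turns the residue of (g, h) x into a conjugate over k of
  some \<open>\<psi> r x\<close> with r in T, so all residues of x vanish.\<close>

lemma psi_kernel:
  assumes T: "T \<subseteq> carrier G" "\<And>g. g \<in> carrier G \<Longrightarrow> \<exists>r\<in>T. \<exists>h\<in>H. g = h \<otimes> r"
    and x: "x \<in> U" and zero: "\<And>r. r \<in> T \<Longrightarrow> \<psi> r x = 0"
  shows "x / \<pi> \<in> U"
proof -
  have xB: "x \<in> B" "x \<in> M" and xE: "\<And>h. h \<in> H \<Longrightarrow> act (h, h) x = x"
    using x BM by (auto simp: U_eq \<E>_def)
  have "\<Phi> (act (g, h) x) = 0" if g: "g \<in> carrier G" and h: "h \<in> H" for g h
  proof -
    obtain r h' where r: "r \<in> T" "h' \<in> H" "inv g = h' \<otimes> r" using T(2)[of "inv g"] g by auto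
    have rG: "r \<in> carrier G" "h' \<in> carrier G" using r T HG by auto
    have "g = inv (h' \<otimes> r)" using r(3) g by (metis two.a.inv_inv)
    then have gr: "g = inv r \<otimes> inv h'" using rG by (simp add: two.a.inv_mult_group)
    have "act (g, \<one>) x = act (g, \<one>) (act (h', h') x)" using xE[OF r(2)] by simp
    also have "\<dots> = act (inv r, h') x"
      using g rG r(2) H1 xB(2) gr by (simp add: act_comp two.a.m_assoc)
    finally have "\<Phi> (act (g, \<one>) x) = aE h' (\<psi> r x)"
      using Phi_act[of "inv r" h' x] rG r(2) xB by (simp add: \<psi>_def)
    also have "\<dots> = 0" using zero[OF r(1)] endo_0[OF ER two.b.endo] r(2) by simp
    finally show ?thesis using Phi_act[OF g h xB(1)] endo_0[OF ER two.b.endo] h by simp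
  qed
  then have "x / \<pi> \<in> B" by (rule kernel_of_residues[OF xB(1)])
  moreover have "x / \<pi> \<in> \<E>"
    using x \<pi>(1) VK0 K0E subfield_divide[OF E_field] by (auto simp: U_eq)
  ultimately show ?thesis by (simp add: U_eq)
qed

text \<open>The element u, whose residue is 1 at the neutral element and 0 elsewhere, places the
  value \<open>v r\<close> at the conjugate r. The diagonal sum makes the result invariant, and at s
  all terms other than h = 1, r = s have residue 0.\<close>

lemma psi_surj:
  assumes T: "finite T" "T \<subseteq> carrier G" "\<And>r r' h. r \<in> T \<Longrightarrow> r' \<in> T \<Longrightarrow> h \<in> H \<Longrightarrow> r' = h \<otimes> r \<Longrightarrow> r' = r"
    and v: "\<And>r. r \<in> T \<Longrightarrow> v r \<in> E"
  shows "\<exists>x\<in>U. \<forall>r\<in>T. \<psi> r x = v r"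
proof -
  obtain u where u0: "u \<in> A" "\<forall>g\<in>carrier G. \<phi> (aF g u) = (if g = \<one> then 1 else 0)"
    using residue_idempotent by blast
  note u = u0(1) bspec[OF u0(2)]
  define y where "y = (\<Sum>r\<in>T. act (r, \<one>) (u * v r))"
  have uvB: "u * v r \<in> B" "u * v r \<in> M" if "r \<in> T" for r
    using u(1) v[OF that] AB EB subring_mult[OF B_ring] BM by blast+
  have TG: "r \<in> carrier G" if "r \<in> T" for r using T that by auto
  have yB: "y \<in> B" unfolding y_def using uvB act_B H1 TG by (intro subring_sum[OF B_ring]) auto
  define x where "x = (\<Sum>h\<in>H. act (h, h) y)"
  have "x \<in> \<E>" unfolding x_def using diag_sum yB BM by blast
  moreover have "x \<in> B" unfolding x_def using act_B yB HG by (intro subring_sum[OF B_ring]) auto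
  moreover have "\<psi> s x = v s" if s: "s \<in> T" for s
  proof -
    have yM: "act (h, h) y \<in> M" if "h \<in> H" for h using act_M HG yB BM that by blast
    have "act (inv s, \<one>) x = (\<Sum>h\<in>H. act (inv s \<otimes> h, h) y)"
      unfolding x_def using s TG H1 yM yB BM
      by (subst endo_sum[OF two.M_ring act_endo]) (auto simp: act_comp HG subsetD)
    also have "\<dots> = (\<Sum>h\<in>H. \<Sum>r\<in>T. act (inv s \<otimes> h \<otimes> r, h) (u * v r))"
    proof (rule sum.cong[OF refl])
      fix h assume h: "h \<in> H"
      have "act (inv s \<otimes> h, h) y = (\<Sum>r\<in>T. act (inv s \<otimes> h, h) (act (r, \<one>) (u * v r)))"
        unfolding y_def using uvB act_M H1 TG s h HG
        by (intro endo_sum[OF two.M_ring act_endo]) auto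
      also have "\<dots> = (\<Sum>r\<in>T. act (inv s \<otimes> h \<otimes> r, h) (u * v r))"
        by (rule sum.cong[OF refl]) (use uvB H1 TG s h HG in \<open>simp add: act_comp\<close>)
      finally show "act (inv s \<otimes> h, h) y = (\<Sum>r\<in>T. act (inv s \<otimes> h \<otimes> r, h) (u * v r))" .
    qed
    also have "\<dots> = (\<Sum>h\<in>H. \<Sum>r\<in>T. aF (inv s \<otimes> h \<otimes> r) u * aE h (v r))"
      by (intro sum.cong refl two.act2_prod) (use TG s HG u AF v in auto)
    finally have eq: "act (inv s, \<one>) x = (\<Sum>h\<in>H. \<Sum>r\<in>T. aF (inv s \<otimes> h \<otimes> r) u * aE h (v r))" .
    have mem: "aF (inv s \<otimes> h \<otimes> r) u \<in> Oc" "aE h (v r) \<in> E" if "h \<in> H" "r \<in> T" for h r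
      using aF_A[OF _ u(1), of "inv s \<otimes> h \<otimes> r"] TG s HG that AO two.b.act_in v by auto
    have mem2: "aF (inv s \<otimes> h \<otimes> r) u * aE h (v r) \<in> comp_ring Oc E" if "h \<in> H" "r \<in> T" for h r
      using mem[OF that] by (rule comp_ring_prod)
    have "\<psi> s x = (\<Sum>h\<in>H. \<Sum>r\<in>T. \<Phi> (aF (inv s \<otimes> h \<otimes> r) u * aE h (v r)))"
      unfolding \<psi>_def eq using mem2 by (simp add: Phi_sum comp_ring_sum)
    also have "\<dots> = (\<Sum>h\<in>H. \<Sum>r\<in>T. if h = \<one> \<and> r = s then v s else 0)"
    proof (intro sum.cong refl)
      fix h r assume hr: "h \<in> H" "r \<in> T"
      have "\<Phi> (aF (inv s \<otimes> h \<otimes> r) u * aE h (v r)) = \<phi> (aF (inv s \<otimes> h \<otimes> r) u) * aE h (v r)"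
        using mem[OF hr] E_kb by (intro residue.ext_prod) auto
      also have "\<dots> = (if inv s \<otimes> h \<otimes> r = \<one> then aE h (v r) else 0)"
        using u(2)[of "inv s \<otimes> h \<otimes> r"] hr s TG HG by simp
      \<comment> \<open>The equation says s = h r, so s and r lie in one coset and coincide.\<close>
      also have "inv s \<otimes> h \<otimes> r = \<one> \<longleftrightarrow> h = \<one> \<and> r = s"
      proof
        assume "inv s \<otimes> h \<otimes> r = \<one>"
        then have "s = h \<otimes> r"
          using hr s TG HG
          by (metis two.a.inv_closed two.a.inv_equality two.a.inv_inv two.a.m_assoc two.a.m_closed two.a.inv_comm)
        then have "s = r" "s = h \<otimes> r" using T(3)[OF hr(2) s hr(1)] by auto
        then show "h = \<one> \<and> r = s" using hr TG HG two.a.l_cancel_one'[of r h] by (auto dest: sym)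
      next
        assume "h = \<one> \<and> r = s"
        then show "inv s \<otimes> h \<otimes> r = \<one>" using s TG by simp
      qed
      finally show "\<Phi> (aF (inv s \<otimes> h \<otimes> r) u * aE h (v r)) = (if h = \<one> \<and> r = s then v s else 0)"
        using aE_one v s by auto
    qed
    also have "\<dots> = (\<Sum>h\<in>H. if h = \<one> then v s else 0)"
      using s T(1) by (intro sum.cong refl) (auto simp: sum.delta)
    also have "\<dots> = v s" using H1 two.b.fin by simp
    finally show ?thesis .
  qed
  ultimately show ?thesis unfolding U_eq by blast
qed

end


section \<open>Subrings as structures\<close>

abbreviation sring :: "'a::field set \<Rightarrow> 'a ring" where
  "sring S \<equiv> ring_of_type_algebra\<lparr>carrier := S\<rparr>"

lemma ring_of_type_algebra_simps [simp]:
  "carrier (ring_of_type_algebra :: 'a::field ring) = UNIV"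
  "monoid.mult ring_of_type_algebra x y = (x * y :: 'a::field)"
  "one ring_of_type_algebra = (1 :: 'a::field)"
  "ring.zero ring_of_type_algebra = (0 :: 'a::field)"
  "add ring_of_type_algebra x y = (x + y :: 'a::field)"
  by (simp_all add: ring_of_type_algebra_def)

lemma sring_UNIV: "ring_of_type_algebra = sring UNIV"
  by (simp add: ring_of_type_algebra_def)

lemma cring_sring: assumes "subring_set S" shows "cring (sring S)"
proof (rule cringI)
  show "abelian_group (sring S)"
    by (rule abelian_groupI)
      (use assms subring_closed[OF assms] in \<open>auto simp: algebra_simps intro!: bexI[of _ "- _"]\<close>)
  show "Group.comm_monoid (sring S)"
    by (rule comm_monoidI) (use subring_closed[OF assms] in \<open>auto simp: algebra_simps\<close>)
qed (auto simp: algebra_simps)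

lemma ring_sring: "subring_set S \<Longrightarrow> ring (sring S)"
  using cring_sring cring.axioms(1) by blast

lemma a_inv_sring: assumes "subring_set S" "x \<in> S" shows "a_inv (sring S) x = - x"
proof -
  interpret cring "sring S" by (rule cring_sring[OF assms(1)])
  show ?thesis
    using minus_equality[of "- x" x] assms subring_uminus[OF assms(1)] by simp
qed

lemma field_sring: assumes "subfield_set S" shows "field (sring S)"
proof (rule cring.cring_fieldI2)
  show "cring (sring S)" by (rule cring_sring[OF subfield_imp_subring[OF assms]])
  show "\<exists>b\<in>carrier (sring S). a \<otimes>\<^bsub>sring S\<^esub> b = \<one>\<^bsub>sring S\<^esub>"
    if "a \<in> carrier (sring S)" "a \<noteq> \<zero>\<^bsub>sring S\<^esub>" for a
    using that subfield_inverse[OF assms, of a] by (intro bexI[of _ "inverse a"]) auto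
qed simp

lemma subfield_set_if_field: assumes "field (sring S)" shows "subfield_set S"
proof -
  interpret field "sring S" by fact
  have neg: "- x \<in> S" if "x \<in> S" for x
  proof -
    have "a_inv (sring S) x \<in> S" "x + a_inv (sring S) x = 0"
      using a_inv_closed[of x] r_neg[of x] that by simp_all
    then have "a_inv (sring S) x = - x" by (simp add: eq_neg_iff_add_eq_0 add.commute)
    then show ?thesis using \<open>a_inv (sring S) x \<in> S\<close> by simp
  qed
  have "x - y \<in> S \<and> x * y \<in> S" if "x \<in> S" "y \<in> S" for x y
    using a_closed[of x "- y"] m_closed[of x y] that neg by simp
  moreover have "inverse x \<in> S" if "x \<in> S" for x
  proof (cases "x = 0")
    case False
    then have "m_inv (sring S) x \<in> S" "x * m_inv (sring S) x = 1"
      using field_Units that Units_inv_closed[of x] Units_r_inv[of x] by auto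
    moreover from this(2) have "m_inv (sring S) x = inverse x"
      using False by (simp add: field_simps)
    ultimately show ?thesis by simp
  qed (use that in simp)
  ultimately show ?thesis using one_closed by (auto simp: subfield_set_def subring_set_def)
qed

lemma subfield_sring:
  assumes "subfield_set K" "subring_set S" "K \<subseteq> S" shows "subfield K (sring S)"
proof -
  interpret ring "sring S" by (rule ring_sring[OF assms(2)])
  show ?thesis using subfield_iff(1)[of K] field_sring[OF assms(1)] assms(3) by simp
qed

lemma subfield_set_if_subfield:
  assumes "subfield K (ring_of_type_algebra :: 'a::field ring)" shows "subfield_set K"
proof -
  interpret ring "ring_of_type_algebra :: 'a ring" by (rule ring_from_type_algebra)
  show ?thesis using subfield_iff(2)[OF assms] by (intro subfield_set_if_field) simp
qed

text \<open>The coordinate functions come from a dual basis, with t x z = tr (x z); the right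
  entries then span.\<close>

lemma finite_dimension_sring:
  assumes K: "subfield_set K" and L: "subring_set L" "K \<subseteq> L" and S: "subring_set S" "L \<subseteq> S"
    and ps: "set ps \<subseteq> Z \<times> L" "\<And>x. x \<in> L \<Longrightarrow> x = (\<Sum>(z, u)\<leftarrow>ps. t x z * u)"
    "\<And>x z. x \<in> L \<Longrightarrow> z \<in> Z \<Longrightarrow> t x z \<in> K"
  shows "ring.finite_dimension (sring S) K L"
proof -
  interpret ring "sring S" by (rule ring_sring[OF S(1)])
  have sub: "subfield K (sring S)" using subfield_sring[OF K S(1)] L S by auto
  have us: "set (map snd ps) \<subseteq> L" using ps(1) by auto
  have "Span K (map snd ps) = L"
  proof
    have "combine Ks us \<in> L" if "set Ks \<subseteq> K" "set us \<subseteq> L" for Ks us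
      using that
      by (induction Ks us rule: combine.induct)
        (use L in \<open>auto intro!: subring_add[OF L(1)] subring_mult[OF L(1)] subring_0[OF L(1)]\<close>)
    then show "Span K (map snd ps) \<subseteq> L"
      using Span_eq_combine_set[OF sub, of "map snd ps"] us S by auto
    show "L \<subseteq> Span K (map snd ps)"
    proof
      fix x assume x: "x \<in> L"
      have "combine (map (\<lambda>(z, u). t x z) qs) (map snd qs) = (\<Sum>(z, u)\<leftarrow>qs. t x z * u)" for qs
        by (induction qs) auto
      then have "combine (map (\<lambda>(z, u). t x z) ps) (map snd ps) = x" using ps(2)[OF x] by simp
      moreover have "set (map (\<lambda>(z, u). t x z) ps) \<subseteq> K" using ps(1,3) x by auto
      ultimately have "x \<in> {combine Ks (map snd ps) |Ks. set Ks \<subseteq> K}"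
        by (intro CollectI exI[of _ "map (\<lambda>(z, u). t x z) ps"]) simp
      moreover have "Span K (map snd ps) = {combine Ks (map snd ps) |Ks. set Ks \<subseteq> K}"
        by (rule Span_eq_combine_set[OF sub]) (use us S in auto)
      ultimately show "x \<in> Span K (map snd ps)" by blast
    qed
  qed
  then show ?thesis using Span_finite_dimension[OF sub, of "map snd ps"] us S by auto
qed

section \<open>Galois groups\<close>

lemma mem_gal_group:
  "\<sigma> \<in> carrier (gal_group R K) \<longleftrightarrow>
    \<sigma> \<in> extensional (carrier R) \<and> bij_betw \<sigma> (carrier R) (carrier R) \<and> \<sigma> \<in> ring_hom R R \<and> (\<forall>x\<in>K. \<sigma> x = x)"
  by (auto simp: gal_group_def Bij_def)

lemma gal_group_mult:
  "\<sigma> \<in> carrier (gal_group R K) \<Longrightarrow> \<tau> \<in> carrier (gal_group R K) \<Longrightarrow>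
    \<sigma> \<otimes>\<^bsub>gal_group R K\<^esub> \<tau> = compose (carrier R) \<sigma> \<tau>"
  by (auto simp: gal_group_def BijGroup_def)

lemma ring_hom_sring_endo: "\<sigma> \<in> ring_hom (sring L) (sring L) \<longleftrightarrow> ring_endo L \<sigma>"
  by (auto simp: ring_hom_def ring_endo_def)

lemma gal_group_compose:
  assumes L: "subring_set L" and K: "K \<subseteq> L"
    and "\<sigma> \<in> carrier (gal_group (sring L) K)" "\<tau> \<in> carrier (gal_group (sring L) K)"
  shows "compose L \<sigma> \<tau> \<in> carrier (gal_group (sring L) K)"
proof -
  have st: "bij_betw \<sigma> L L" "ring_endo L \<sigma>" "\<forall>x\<in>K. \<sigma> x = x" "bij_betw \<tau> L L" "ring_endo L \<tau>" "\<forall>x\<in>K. \<tau> x = x"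
    using assms(3,4) by (simp_all add: mem_gal_group ring_hom_sring_endo)
  have "bij_betw (compose L \<sigma> \<tau>) L L" using st bij_betw_compose by blast
  moreover have "ring_endo L (compose L \<sigma> \<tau>)"
    using st by (auto simp: ring_endo_def compose_def subring_closed[OF L])
  ultimately show ?thesis
    using st K by (auto simp: mem_gal_group ring_hom_sring_endo compose_def)
qed

text \<open>The action is the inverse of the given isomorphism. The second conclusion, that the
  group provides every automorphism over K, serves later to determine the automorphisms over
  kbar(T).\<close>

lemma gal_act_of_galois:
  assumes G: "group G" "finite (carrier G)" and gal: "galois_extension (sring L) K"
    and iso: "gal_group (sring L) K \<cong> G"
  obtains act where "gal_act G L K act"
    "\<And>\<sigma>. ring_endo L \<sigma> \<Longrightarrow> bij_betw \<sigma> L L \<Longrightarrow> (\<And>x. x \<in> K \<Longrightarrow> \<sigma> x = x) \<Longrightarrow>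
      \<exists>g\<in>carrier G. \<forall>x\<in>L. act g x = \<sigma> x"
proof -
  interpret group G by fact
  let ?R = "gal_group (sring L) K"
  have L: "subfield_set L" using gal subfield_set_if_field by (auto simp: galois_extension_def)
  note LR = subfield_imp_subring[OF L]
  have Kfix: "K = {x \<in> L. \<forall>\<sigma>\<in>carrier ?R. \<sigma> x = x}" using gal by (auto simp: galois_extension_def)
  obtain f where f: "f \<in> hom ?R G" "bij_betw f (carrier ?R) (carrier G)"
    using iso by (auto simp: is_iso_def iso_def)
  have mem: "\<sigma> \<in> carrier ?R \<longleftrightarrow> \<sigma> \<in> extensional L \<and> bij_betw \<sigma> L L \<and> ring_endo L \<sigma> \<and> (\<forall>x\<in>K. \<sigma> x = x)" for \<sigma>
    by (simp add: mem_gal_group ring_hom_sring_endo)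
  have "K \<subseteq> L" using Kfix by blast
  note comp = gal_group_compose[OF LR this]
  define act where "act = inv_into (carrier ?R) f"
  have act: "act g \<in> carrier ?R" "f (act g) = g" if "g \<in> carrier G" for g
    using f(2) that unfolding act_def by (metis bij_betw_def inv_into_into, metis bij_betw_inv_into_right)
  have inj: "\<sigma> = \<tau>" if "\<sigma> \<in> carrier ?R" "\<tau> \<in> carrier ?R" "f \<sigma> = f \<tau>" for \<sigma> \<tau>
    using f(2) that by (auto simp: bij_betw_def inj_on_def)
  have act_mult: "act (g \<otimes>\<^bsub>G\<^esub> h) = compose L (act g) (act h)" if "g \<in> carrier G" "h \<in> carrier G" for g h
  proof (rule inj)
    have "f (compose L (act g) (act h)) = f (act g) \<otimes>\<^bsub>G\<^esub> f (act h)"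
      using hom_mult[OF f(1) act(1)[OF that(1)] act(1)[OF that(2)]]
        gal_group_mult[OF act(1)[OF that(1)] act(1)[OF that(2)]] by simp
    then show "f (act (g \<otimes>\<^bsub>G\<^esub> h)) = f (compose L (act g) (act h))" using act that by simp
  qed (use act comp that in auto)
  have bij: "bij_betw (act g) L L" "act g \<in> extensional L" "ring_endo L (act g)" "\<forall>x\<in>K. act g x = x"
    if "g \<in> carrier G" for g
    using act(1)[OF that] mem by auto
  \<comment> \<open>The neutral element acts as an idempotent injection, hence as the
    identity.\<close>
  have one: "act \<one>\<^bsub>G\<^esub> x = x" if x: "x \<in> L" for x
  proof -
    have "act \<one>\<^bsub>G\<^esub> x \<in> L" using endo_in[OF LR bij(3)[OF one_closed] x] .
    moreover have "act \<one>\<^bsub>G\<^esub> (act \<one>\<^bsub>G\<^esub> x) = act \<one>\<^bsub>G\<^esub> x"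
      using act_mult[OF one_closed one_closed] x by (metis compose_eq l_one one_closed)
    ultimately show ?thesis using bij(1)[OF one_closed] x by (auto simp: bij_betw_def inj_on_def)
  qed
  have "gal_act G L K act"
  proof (rule gal_act.intro)
    show "act (g \<otimes>\<^bsub>G\<^esub> h) x = act g (act h x)"
      if "g \<in> carrier G" "h \<in> carrier G" "x \<in> L" for g h x
      using act_mult[OF that(1,2)] that(3) by (simp add: compose_eq)
    show "K = {x \<in> L. \<forall>g\<in>carrier G. act g x = x}"
    proof (subst Kfix, intro Collect_cong conj_cong refl)
      fix x assume x: "x \<in> L"
      show "(\<forall>\<sigma>\<in>carrier ?R. \<sigma> x = x) \<longleftrightarrow> (\<forall>g\<in>carrier G. act g x = x)"
        using act(1) f inv_into_f_f[of f "carrier ?R"]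
        by (metis act_def bij_betw_def bij_betwE)
    qed
    show "\<exists>x\<in>L. act g x \<noteq> x" if "g \<in> carrier G" "g \<noteq> \<one>\<^bsub>G\<^esub>" for g
    proof (rule ccontr)
      assume "\<not> ?thesis"
      then have "act g x = act \<one>\<^bsub>G\<^esub> x" if "x \<in> L" for x using one that by simp
      then have "act g = act \<one>\<^bsub>G\<^esub>" using bij(2)[OF that(1)] bij(2)[OF one_closed]
        by (intro extensionalityI[of _ L]) auto
      then show False using act(2)[OF that(1)] act(2)[OF one_closed] that(2) by simp
    qed
  qed (use G L bij one in auto)
  moreover have "\<exists>g\<in>carrier G. \<forall>x\<in>L. act g x = \<sigma> x"
    if \<sigma>: "ring_endo L \<sigma>" "bij_betw \<sigma> L L" "\<And>x. x \<in> K \<Longrightarrow> \<sigma> x = x" for \<sigma>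
  proof -
    \<comment> \<open>Members of the Galois group are extensional functions, so \<sigma> is first
      restricted to L.\<close>
    have "restrict \<sigma> L \<in> carrier ?R"
      using \<sigma> Kfix bij_betw_cong[of L "restrict \<sigma> L" \<sigma> L]
      by (auto simp: mem ring_endo_def subring_closed[OF LR])
    then have "f (restrict \<sigma> L) \<in> carrier G" "act (f (restrict \<sigma> L)) = restrict \<sigma> L"
      using f by (auto simp: act_def bij_betw_def)
    then show ?thesis by (metis restrict_apply')
  qed
  ultimately show ?thesis by (rule that)
qed

lemma field_of_ring_iso:
  fixes R :: "'b ring"
  assumes R: "ring R" and L: "subfield_set L" and \<theta>: "\<theta> \<in> ring_iso R (sring L)"
  shows "field R"
proof -
  let ?\<eta> = "inv_into (carrier R) \<theta>"
  have \<eta>: "?\<eta> \<in> ring_iso (sring L) R" by (rule ring_iso_set_sym[OF R \<theta>])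
  interpret \<eta>: ring_hom_ring "sring L" R ?\<eta>
    using \<eta> R ring_sring[OF subfield_imp_subring[OF L]] by (intro ring_hom_ringI2) (auto simp: ring_iso_def)
  have "field (R\<lparr>zero := ?\<eta> \<zero>\<^bsub>sring L\<^esub>\<rparr>)"
    by (rule field.ring_iso_imp_img_field[OF field_sring[OF L] \<eta>])
  moreover have "R\<lparr>zero := ?\<eta> \<zero>\<^bsub>sring L\<^esub>\<rparr> = R" using \<eta>.hom_zero by simp
  ultimately show ?thesis by simp
qed

text \<open>An action on a subfield of the ambient type is carried to an isomorphic ring R. The
  applications are the tensor product with kbar and, along the identity map, F E itself.\<close>

locale gal_transport = gal_act G L K act
  for G :: "('g, 'm) monoid_scheme" (structure) and L K :: "'a::field set" and act +
  fixes R :: "'b ring" and \<theta> :: "'b \<Rightarrow> 'a" and K' :: "'b set"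
  assumes R: "ring R" and \<theta>: "\<theta> \<in> ring_iso R (sring L)"
    and K': "K' \<subseteq> carrier R" "\<theta> ` K' = K"
begin

interpretation R: ring R by (rule R)

abbreviation \<eta> where "\<eta> \<equiv> inv_into (carrier R) \<theta>"

lemma \<eta>: "\<eta> \<in> ring_iso (sring L) R" by (rule ring_iso_set_sym[OF R \<theta>])

lemma \<theta>_bij: "bij_betw \<theta> (carrier R) L" using \<theta> by (simp add: ring_iso_def)

lemma \<eta>_in: "x \<in> L \<Longrightarrow> \<eta> x \<in> carrier R" and \<theta>_in: "y \<in> carrier R \<Longrightarrow> \<theta> y \<in> L"
  and \<theta>\<eta>: "x \<in> L \<Longrightarrow> \<theta> (\<eta> x) = x" and \<eta>\<theta>: "y \<in> carrier R \<Longrightarrow> \<eta> (\<theta> y) = y"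
  using \<theta>_bij by (auto simp: bij_betw_def f_inv_into_f inv_into_into)

lemma \<theta>_add: "x \<in> carrier R \<Longrightarrow> y \<in> carrier R \<Longrightarrow> \<theta> (x \<oplus>\<^bsub>R\<^esub> y) = \<theta> x + \<theta> y"
  and \<theta>_mult: "x \<in> carrier R \<Longrightarrow> y \<in> carrier R \<Longrightarrow> \<theta> (x \<otimes>\<^bsub>R\<^esub> y) = \<theta> x * \<theta> y"
  and \<theta>_one: "\<theta> \<one>\<^bsub>R\<^esub> = 1"
  using \<theta> by (auto simp: ring_iso_def ring_hom_def)

lemma \<eta>_add: "x \<in> L \<Longrightarrow> y \<in> L \<Longrightarrow> \<eta> (x + y) = \<eta> x \<oplus>\<^bsub>R\<^esub> \<eta> y"
  and \<eta>_mult: "x \<in> L \<Longrightarrow> y \<in> L \<Longrightarrow> \<eta> (x * y) = \<eta> x \<otimes>\<^bsub>R\<^esub> \<eta> y"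
  and \<eta>_one: "\<eta> 1 = \<one>\<^bsub>R\<^esub>"
  using \<eta> by (auto simp: ring_iso_def ring_hom_def)

definition lift where "lift g = restrict (\<lambda>x. \<eta> (act g (\<theta> x))) (carrier R)"

lemma lift_in: assumes g: "g \<in> carrier G" shows "lift g \<in> carrier (gal_group R K')"
proof -
  have "bij_betw (act g) L L"
    using g act_inj_on[OF g] act_in[OF g] act_inv(1)[OF g] act_in[OF inv_closed[OF g]]
    by (intro bij_betwI[of _ _ _ "act (inv g)"]) (auto simp: act_inv)
  then have "bij_betw (\<eta> \<circ> (act g \<circ> \<theta>)) (carrier R) (carrier R)"
    using \<theta>_bij \<eta> by (intro bij_betw_trans[of _ _ L]) (auto simp: ring_iso_def intro: bij_betw_trans)
  then have "bij_betw (lift g) (carrier R) (carrier R)"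
    by (subst bij_betw_cong[of _ _ "\<eta> \<circ> (act g \<circ> \<theta>)"]) (auto simp: lift_def)
  moreover have "lift g \<in> ring_hom R R"
    by (rule ring_hom_memI)
      (auto simp: lift_def \<theta>_in \<eta>_in act_in[OF g] \<theta>_add \<theta>_mult \<theta>_one endo_add[OF LR endo[OF g]]
        endo_mult[OF LR endo[OF g]] endo_1[OF LR endo[OF g]] \<eta>_add \<eta>_mult \<eta>_one)
  moreover have "lift g x = x" if "x \<in> K'" for x
    using that K' act_K[OF g, of "\<theta> x"] \<eta>\<theta>[of x] by (auto simp: lift_def)
  ultimately show ?thesis by (simp add: mem_gal_group lift_def)
qed

lemma lift_apply: "x \<in> carrier R \<Longrightarrow> g \<in> carrier G \<Longrightarrow> \<theta> (lift g x) = act g (\<theta> x)"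
  by (simp add: lift_def \<theta>\<eta> act_in \<theta>_in)

lemma galois: "galois_extension R K'"
proof -
  interpret \<eta>: ring_hom_ring "sring L" R \<eta>
    using \<eta> R ring_sring[OF LR] by (intro ring_hom_ringI2) (auto simp: ring_iso_def)
  have fR: "field R" by (rule field_of_ring_iso[OF R L \<theta>])
  have K'_eq: "K' = \<eta> ` K"
  proof -
    have "\<eta> ` K = (\<lambda>x. \<eta> (\<theta> x)) ` K'" unfolding K'(2)[symmetric] image_image ..
    also have "\<dots> = (\<lambda>x. x) ` K'" by (rule image_cong[OF refl]) (use K'(1) \<eta>\<theta> in blast)
    finally show ?thesis by simp
  qed
  have subK: "subfield K (sring L)" by (rule subfield_sring[OF subfield_K LR K_subset])
  have nz: "\<one>\<^bsub>R\<^esub> \<noteq> \<zero>\<^bsub>R\<^esub>" using domain.one_not_zero[OF field.axioms(1)[OF fR]] .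
  have subK': "subfield K' R" unfolding K'_eq by (rule \<eta>.img_is_subfield(2)[OF subK nz])
  have "ring.finite_dimension R K' (carrier R)"
  proof -
    obtain ps where ps: "set ps \<subseteq> L \<times> L" "\<And>x. x \<in> L \<Longrightarrow> x = (\<Sum>(z, u)\<leftarrow>ps. tr (x * z) * u)"
      using dual_basis[OF LR order_refl faithful] by blast
    have "ring.finite_dimension (sring L) K L"
      by (rule finite_dimension_sring[OF subfield_K LR K_subset LR order_refl ps])
        (auto intro: tr_in subring_mult[OF LR])
    then obtain n where n: "ring.dimension (sring L) n K L"
      unfolding ring.finite_dimension_def[OF ring_sring[OF LR]] by blast
    obtain Us where Us': "set Us \<subseteq> carrier (sring L)" "ring.Span (sring L) K Us = L"
      using ring.exists_base[OF ring_sring[OF LR] subK n] by blast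
    have Us: "set Us \<subseteq> L" using Us'(1) by simp
    have "R.Span K' (map \<eta> Us) = \<eta> ` L"
    proof -
      have "R.Span (\<eta> ` K) (map \<eta> Us) = \<eta> ` ring.Span (sring L) K Us"
        by (rule \<eta>.Span_hom) (use K_subset Us in auto)
      then show ?thesis unfolding K'_eq Us'(2) .
    qed
    also have "\<dots> = carrier R" using \<eta> by (auto simp: ring_iso_def bij_betw_def)
    finally have "R.Span K' (map \<eta> Us) = carrier R" .
    moreover have "set (map \<eta> Us) \<subseteq> carrier R" using Us \<eta>_in by auto
    ultimately show ?thesis
      using R.Span_finite_dimension[OF subK', of "map \<eta> Us"] by (simp only:)
  qed
  moreover have "{x \<in> carrier R. \<forall>\<sigma>\<in>carrier (gal_group R K'). \<sigma> x = x} = K'"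
  proof (intro equalityI subsetI)
    fix x assume x: "x \<in> {x \<in> carrier R. \<forall>\<sigma>\<in>carrier (gal_group R K'). \<sigma> x = x}"
    then have "act g (\<theta> x) = \<theta> x" if "g \<in> carrier G" for g
      using lift_apply[OF _ that] lift_in[OF that] by force
    then have "\<theta> x \<in> K" using x \<theta>_in by (auto simp: fixed)
    then show "x \<in> K'" using x \<eta>\<theta>[of x] unfolding K'_eq by force
  next
    fix x assume "x \<in> K'"
    then show "x \<in> {x \<in> carrier R. \<forall>\<sigma>\<in>carrier (gal_group R K'). \<sigma> x = x}"
      using K' by (auto simp: mem_gal_group)
  qed
  ultimately show ?thesis using fR subK' by (simp add: galois_extension_def)
qed

text \<open>Faithfulness embeds the group into the automorphisms over K'; \<open>full\<close> makes
  this embedding surjective.\<close>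

lemma gal_group_iso:
  assumes full: "\<And>\<sigma>. ring_endo L \<sigma> \<Longrightarrow> bij_betw \<sigma> L L \<Longrightarrow> (\<And>x. x \<in> K \<Longrightarrow> \<sigma> x = x) \<Longrightarrow>
      \<exists>g\<in>carrier G. \<forall>x\<in>L. act g x = \<sigma> x"
  shows "gal_group R K' \<cong> G"
proof -
  have "lift \<in> hom G (gal_group R K')"
  proof (rule homI)
    fix g h assume gh: "g \<in> carrier G" "h \<in> carrier G"
    have "lift (g \<otimes> h) = compose (carrier R) (lift g) (lift h)"
      by (rule ext) (use gh in \<open>auto simp: lift_def compose_def act_comp \<theta>\<eta> \<theta>_in \<eta>_in act_in\<close>)
    then show "lift (g \<otimes> h) = lift g \<otimes>\<^bsub>gal_group R K'\<^esub> lift h"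
      using gal_group_mult[OF lift_in[OF gh(1)] lift_in[OF gh(2)]] by simp
  qed (rule lift_in)
  moreover have "bij_betw lift (carrier G) (carrier (gal_group R K'))"
    unfolding bij_betw_def
  proof
    show "inj_on lift (carrier G)"
    proof (rule inj_onI)
      fix g h assume gh: "g \<in> carrier G" "h \<in> carrier G" "lift g = lift h"
      have eq: "act g x = act h x" if x: "x \<in> L" for x
        using lift_apply[OF \<eta>_in[OF x] gh(1)] lift_apply[OF \<eta>_in[OF x] gh(2)] gh(3) \<theta>\<eta>[OF x] by simp
      have "act (inv h \<otimes> g) x = x" if x: "x \<in> L" for x
        using act_comp[of "inv h" g x] act_inv(2)[OF gh(2) x] eq[OF x] gh x by simp
      then have "inv h \<otimes> g = \<one>" using faithful[of "inv h \<otimes> g"] gh by auto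
      then show "g = h" using gh by (metis inv_closed inv_equality inv_inv)
    qed
    show "lift ` carrier G = carrier (gal_group R K')"
    proof (intro equalityI subsetI)
      fix \<sigma> assume "\<sigma> \<in> carrier (gal_group R K')"
      then have \<sigma>: "\<sigma> \<in> extensional (carrier R)" "bij_betw \<sigma> (carrier R) (carrier R)"
        "\<sigma> \<in> ring_hom R R" "\<forall>x\<in>K'. \<sigma> x = x" by (auto simp: mem_gal_group)
      define \<rho> where "\<rho> = \<theta> \<circ> (\<sigma> \<circ> \<eta>)"
      have "bij_betw \<rho> L L"
        unfolding \<rho>_def using \<theta>_bij \<eta> \<sigma>(2)
        by (intro bij_betw_trans[of _ _ "carrier R"]) (auto simp: ring_iso_def intro: bij_betw_trans)
      moreover have "ring_endo L \<rho>"
        unfolding ring_endo_def \<rho>_def using ring_hom_memE[OF \<sigma>(3)]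
        by (auto simp: \<eta>_in \<theta>_in \<eta>_add \<eta>_mult \<eta>_one \<theta>_add \<theta>_mult \<theta>_one)
      moreover have "\<rho> x = x" if xK: "x \<in> K" for x
      proof -
        have "x \<in> \<theta> ` K'" using xK K'(2) by simp
        then obtain y where "y \<in> K'" "x = \<theta> y" by blast
        then show ?thesis using \<sigma>(4) K'(1) \<eta>\<theta>[of y] by (auto simp: \<rho>_def)
      qed
      ultimately obtain g where g: "g \<in> carrier G" "\<forall>x\<in>L. act g x = \<rho> x" using full by blast
      have "lift g = \<sigma>"
      proof (rule extensionalityI[OF _ \<sigma>(1)])
        show "lift g \<in> extensional (carrier R)" by (simp add: lift_def)
        fix x assume x: "x \<in> carrier R"
        then have "\<sigma> x \<in> carrier R" using ring_hom_memE(1)[OF \<sigma>(3)] by blast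
        then show "lift g x = \<sigma> x" using g(2) \<theta>_in[OF x] x by (simp add: lift_def \<rho>_def \<eta>\<theta>)
      qed
      then show "\<sigma> \<in> lift ` carrier G" using g(1) by blast
    qed (use lift_in in auto)
  qed
  ultimately have "G \<cong> gal_group R K'" by (auto simp: is_iso_def iso_def)
  then show ?thesis by (rule iso_sym)
qed

end


section \<open>Tensor products\<close>

definition frag_eval :: "('p \<Rightarrow> 'c::comm_ring_1) \<Rightarrow> ('p \<Rightarrow>\<^sub>0 int) \<Rightarrow> 'c" where
  "frag_eval \<beta> x = (\<Sum>p\<in>Poly_Mapping.keys x. of_int (Poly_Mapping.lookup x p) * \<beta> p)"

lemma frag_eval_superset:
  assumes "finite S" "Poly_Mapping.keys x \<subseteq> S"
  shows "frag_eval \<beta> x = (\<Sum>p\<in>S. of_int (Poly_Mapping.lookup x p) * \<beta> p)"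
  unfolding frag_eval_def
  by (rule sum.mono_neutral_left) (use assms in \<open>auto simp: in_keys_iff\<close>)

lemma frag_eval_0 [simp]: "frag_eval \<beta> 0 = 0" by (simp add: frag_eval_def)

lemma frag_eval_of [simp]: "frag_eval \<beta> (frag_of p) = \<beta> p"
  by (simp add: frag_eval_def)

lemma frag_eval_diff: "frag_eval \<beta> (x - y) = frag_eval \<beta> x - frag_eval \<beta> y"
proof -
  let ?S = "Poly_Mapping.keys x \<union> Poly_Mapping.keys y"
  have "frag_eval \<beta> (x - y) = (\<Sum>p\<in>?S. of_int (Poly_Mapping.lookup (x - y) p) * \<beta> p)"
    by (rule frag_eval_superset) (use keys_diff[of x y] in auto)
  also have "\<dots> = (\<Sum>p\<in>?S. of_int (Poly_Mapping.lookup x p) * \<beta> p) - (\<Sum>p\<in>?S. of_int (Poly_Mapping.lookup y p) * \<beta> p)"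
    by (simp add: lookup_minus left_diff_distrib sum_subtractf)
  also have "\<dots> = frag_eval \<beta> x - frag_eval \<beta> y"
    using frag_eval_superset[of ?S x \<beta>] frag_eval_superset[of ?S y \<beta>] by simp
  finally show ?thesis .
qed

lemma frag_eval_add: "frag_eval \<beta> (x + y) = frag_eval \<beta> x + frag_eval \<beta> y"
  using frag_eval_diff[of \<beta> "x + y" y] by simp

lemma frag_eval_in:
  assumes "subring_set S" "Poly_Mapping.keys x \<subseteq> D" "\<And>p. p \<in> D \<Longrightarrow> \<beta> p \<in> S"
  shows "frag_eval \<beta> x \<in> S"
  using assms(2)
  by (induction x rule: frag_induction)
    (use assms(3) in \<open>auto simp: frag_eval_diff subring_0[OF assms(1)] subring_diff[OF assms(1)]\<close>)

lemma frag_cmul_diff_right: "frag_cmul c (a - b) = frag_cmul c a - frag_cmul c b"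
  by (rule poly_mapping_eqI) (simp add: lookup_minus right_diff_distrib)

lemma frag_extend_fun_diff: "frag_extend (\<lambda>p. f p - g p) x = frag_extend f x - frag_extend g x"
  by (simp add: frag_extend_def sum_subtractf frag_cmul_diff_right)

lemma frag_extend_zero: "frag_extend (\<lambda>p. 0) x = 0"
  by (simp add: frag_extend_def)

locale free_pair =
  fixes A :: "('a, 'm) ring_scheme" and B :: "('b, 'n) ring_scheme"
  assumes A: "cring A" and B: "cring B"
begin

interpretation A: cring A by (rule A)
interpretation B: cring B by (rule B)

abbreviation R where "R \<equiv> free_pair_ring A B"
abbreviation D where "D \<equiv> carrier A \<times> carrier B"

definition pmul :: "'a \<times> 'b \<Rightarrow> 'a \<times> 'b \<Rightarrow> 'a \<times> 'b" where
  "pmul p q = (fst p \<otimes>\<^bsub>A\<^esub> fst q, snd p \<otimes>\<^bsub>B\<^esub> snd q)"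

definition mul where "mul x y = frag_extend (\<lambda>p. frag_extend (\<lambda>q. frag_of (pmul p q)) y) x"

lemma R_simps [simp]:
  "carrier R = {x. Poly_Mapping.keys x \<subseteq> D}" "monoid.mult R x y = mul x y"
  "one R = frag_of (\<one>\<^bsub>A\<^esub>, \<one>\<^bsub>B\<^esub>)" "ring.zero R = 0" "add R x y = x + y"
  by (simp_all add: free_pair_ring_def mul_def pmul_def case_prod_beta')

lemma mul_of [simp]: "mul (frag_of p) (frag_of q) = frag_of (pmul p q)"
  by (simp add: mul_def)

lemma mul_diff_left: "mul (x - x') y = mul x y - mul x' y"
  by (simp add: mul_def frag_extend_diff)

lemma mul_diff_right: "mul x (y - y') = mul x y - mul x y'"
  by (simp add: mul_def frag_extend_diff frag_extend_fun_diff)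

lemma mul_0 [simp]: "mul 0 y = 0" "mul x 0 = 0"
  by (simp_all add: mul_def frag_extend_zero)

lemma mul_add_left: "mul (x + x') y = mul x y + mul x' y"
  using mul_diff_left[of "x + x'" x' y] by simp

lemma keys_mul: assumes "Poly_Mapping.keys x \<subseteq> D" "Poly_Mapping.keys y \<subseteq> D"
  shows "Poly_Mapping.keys (mul x y) \<subseteq> D"
proof -
  have *: "Poly_Mapping.keys (mul (frag_of p) y) \<subseteq> D" if p: "p \<in> D" for p
    using assms(2)
    by (induction y rule: frag_induction)
      (use p in \<open>auto simp: mul_diff_right pmul_def dest!: subsetD[OF keys_diff]\<close>)
  show ?thesis
    using assms(1)
  proof (induction x rule: frag_induction)
    case (one p)
    then show ?case by (rule *)
  next
    case (diff a b)
    then show ?case using keys_diff[of "mul a y" "mul b y"] by (auto simp: mul_diff_left)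
  qed simp
qed

lemma mul_comm: assumes "Poly_Mapping.keys x \<subseteq> D" "Poly_Mapping.keys y \<subseteq> D"
  shows "mul x y = mul y x"
proof -
  have *: "mul (frag_of p) y = mul y (frag_of p)" if p: "p \<in> D" for p
    using assms(2)
    by (induction y rule: frag_induction)
      (use p in \<open>auto simp: mul_diff_right mul_diff_left pmul_def A.m_comm B.m_comm\<close>)
  show ?thesis
    using assms(1) by (induction x rule: frag_induction) (auto simp: mul_diff_left mul_diff_right *)
qed

lemma mul_assoc:
  assumes "Poly_Mapping.keys x \<subseteq> D" "Poly_Mapping.keys y \<subseteq> D" "Poly_Mapping.keys z \<subseteq> D"
  shows "mul (mul x y) z = mul x (mul y z)"
proof -
  have 1: "mul (frag_of (pmul p q)) z = mul (frag_of p) (mul (frag_of q) z)" if pq: "p \<in> D" "q \<in> D" for p q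
    using assms(3)
    by (induction z rule: frag_induction)
      (use pq in \<open>auto simp: mul_diff_right pmul_def A.m_assoc B.m_assoc\<close>)
  have 2: "mul (mul (frag_of p) y) z = mul (frag_of p) (mul y z)" if p: "p \<in> D" for p
    using assms(2)
    by (induction y rule: frag_induction) (use p 1 in \<open>auto simp: mul_diff_right mul_diff_left\<close>)
  show ?thesis
    using assms(1) by (induction x rule: frag_induction) (auto simp: mul_diff_left 2)
qed

lemma mul_one: assumes "Poly_Mapping.keys x \<subseteq> D"
  shows "mul (frag_of (\<one>\<^bsub>A\<^esub>, \<one>\<^bsub>B\<^esub>)) x = x"
  using assms by (induction x rule: frag_induction) (auto simp: mul_diff_right pmul_def)

lemma cring_R: "cring R"
proof (rule cringI)
  show "abelian_group R"
  proof (rule abelian_groupI)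
    show "\<exists>y\<in>carrier R. y \<oplus>\<^bsub>R\<^esub> x = \<zero>\<^bsub>R\<^esub>" if "x \<in> carrier R" for x
      using that by (intro bexI[of _ "- x"]) auto
    show "x \<oplus>\<^bsub>R\<^esub> y \<in> carrier R" if "x \<in> carrier R" "y \<in> carrier R" for x y
      using that keys_add[of x y] by auto
  qed (auto simp: add_ac)
  show "Group.comm_monoid R"
    by (rule comm_monoidI) (auto simp: keys_mul mul_one mul_assoc intro: mul_comm dest: subsetD[OF keys_mul])
qed (simp add: mul_add_left)

lemma a_inv_R: assumes "x \<in> carrier R" shows "a_inv R x = - x"
proof -
  interpret cring R by (rule cring_R)
  show ?thesis using minus_equality[of "- x" x] assms by simp
qed

lemma frag_eval_mul:
  assumes \<beta>: "\<And>p q. p \<in> D \<Longrightarrow> q \<in> D \<Longrightarrow> \<beta> (pmul p q) = \<beta> p * \<beta> q"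
    and "Poly_Mapping.keys x \<subseteq> D" "Poly_Mapping.keys y \<subseteq> D"
  shows "frag_eval \<beta> (mul x y) = frag_eval \<beta> x * frag_eval \<beta> y"
proof -
  have *: "frag_eval \<beta> (mul (frag_of p) y) = \<beta> p * frag_eval \<beta> y" if p: "p \<in> D" for p
    using assms(3)
    by (induction y rule: frag_induction)
      (use p in \<open>auto simp: \<beta> mul_diff_right frag_eval_diff right_diff_distrib\<close>)
  show ?thesis
    using assms(2)
    by (induction x rule: frag_induction) (auto simp: * mul_diff_left frag_eval_diff left_diff_distrib)
qed

end

locale tensor = free_pair A B for A :: "('a, 'm) ring_scheme" and B :: "('b, 'n) ring_scheme" +
  fixes C :: "('r, 'l) ring_scheme" and f :: "'r \<Rightarrow> 'a" and g :: "'r \<Rightarrow> 'b"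
  assumes f: "\<And>r. r \<in> carrier C \<Longrightarrow> f r \<in> carrier A" and g: "\<And>r. r \<in> carrier C \<Longrightarrow> g r \<in> carrier B"
begin

interpretation A: cring A by (rule A)
interpretation B: cring B by (rule B)
interpretation R: cring R by (rule cring_R)

abbreviation J where "J \<equiv> tensor_ideal C A B f g"

definition relations where
  "relations = {frag_of (a \<oplus>\<^bsub>A\<^esub> a', b) - frag_of (a, b) - frag_of (a', b) |a a' b.
         a \<in> carrier A \<and> a' \<in> carrier A \<and> b \<in> carrier B} \<union>
      {frag_of (a, b \<oplus>\<^bsub>B\<^esub> b') - frag_of (a, b) - frag_of (a, b') |a b b'.
         a \<in> carrier A \<and> b \<in> carrier B \<and> b' \<in> carrier B} \<union>
      {frag_of (f r \<otimes>\<^bsub>A\<^esub> a, b) - frag_of (a, g r \<otimes>\<^bsub>B\<^esub> b) |r a b.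
         r \<in> carrier C \<and> a \<in> carrier A \<and> b \<in> carrier B}"

lemma J_eq: "J = genideal R relations" by (simp add: tensor_ideal_def relations_def)

lemma relations_carrier: "relations \<subseteq> carrier R"
proof -
  have *: "x \<in> carrier R \<Longrightarrow> y \<in> carrier R \<Longrightarrow> x - y \<in> carrier R" for x y
    using keys_diff[of x y] by auto
  have fo: "frag_of (a, b) \<in> carrier R" if "a \<in> carrier A" "b \<in> carrier B" for a b using that by simp
  show ?thesis unfolding relations_def by (auto intro!: * fo A.m_closed B.m_closed f g simp del: R_simps(1))
qed

lemma J_ideal: "ideal J R" unfolding J_eq by (rule R.genideal_ideal[OF relations_carrier])

lemma relations_J: "relations \<subseteq> J" unfolding J_eq by (rule R.genideal_self[OF relations_carrier])

lemma J_carrier: "J \<subseteq> carrier R"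
  using additive_subgroup.a_subset[OF ideal.axioms(1)[OF J_ideal]] .

lemma J_0: "0 \<in> J"
  using additive_subgroup.zero_closed[OF ideal.axioms(1)[OF J_ideal]] by simp

lemma J_add: "x \<in> J \<Longrightarrow> y \<in> J \<Longrightarrow> x + y \<in> J"
  using additive_subgroup.a_closed[OF ideal.axioms(1)[OF J_ideal], of x y] by simp

lemma J_diff: "x \<in> J \<Longrightarrow> y \<in> J \<Longrightarrow> x - y \<in> J"
proof -
  assume xy: "x \<in> J" "y \<in> J"
  then have "a_inv R y \<in> J" using additive_subgroup.a_inv_closed[OF ideal.axioms(1)[OF J_ideal]] by blast
  then have "- y \<in> J" using a_inv_R J_carrier xy by auto
  then show ?thesis using J_add[OF xy(1)] by fastforce
qed

lemma J_rel1: "a \<in> carrier A \<Longrightarrow> a' \<in> carrier A \<Longrightarrow> b \<in> carrier B \<Longrightarrow>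
    frag_of (a \<oplus>\<^bsub>A\<^esub> a', b) - frag_of (a, b) - frag_of (a', b) \<in> J"
  by (rule subsetD[OF relations_J]) (unfold relations_def, blast)

lemma J_rel2: "a \<in> carrier A \<Longrightarrow> b \<in> carrier B \<Longrightarrow> b' \<in> carrier B \<Longrightarrow>
    frag_of (a, b \<oplus>\<^bsub>B\<^esub> b') - frag_of (a, b) - frag_of (a, b') \<in> J"
  by (rule subsetD[OF relations_J]) (unfold relations_def, blast)

lemma J_rel3: "r \<in> carrier C \<Longrightarrow> a \<in> carrier A \<Longrightarrow> b \<in> carrier B \<Longrightarrow>
    frag_of (f r \<otimes>\<^bsub>A\<^esub> a, b) - frag_of (a, g r \<otimes>\<^bsub>B\<^esub> b) \<in> J"
  by (rule subsetD[OF relations_J]) (unfold relations_def, blast)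

lemma J_zero_left: "b \<in> carrier B \<Longrightarrow> frag_of (\<zero>\<^bsub>A\<^esub>, b) \<in> J"
  using J_diff[OF J_0 J_rel1[of "\<zero>\<^bsub>A\<^esub>" "\<zero>\<^bsub>A\<^esub>" b]] by simp

lemma J_zero_right: "a \<in> carrier A \<Longrightarrow> frag_of (a, \<zero>\<^bsub>B\<^esub>) \<in> J"
  using J_diff[OF J_0 J_rel2[of a "\<zero>\<^bsub>B\<^esub>" "\<zero>\<^bsub>B\<^esub>"]] by simp

text \<open>Integer coefficients disappear modulo the relations: multiples become repeated entries,
  and a minus sign moves into the first factor.\<close>

lemma sum_of_pure_tensors:
  assumes "x \<in> carrier R"
  shows "\<exists>ps. set ps \<subseteq> D \<and> x - (\<Sum>p\<leftarrow>ps. frag_of p) \<in> J"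
proof -
  have neg: "\<exists>qs. set qs \<subseteq> D \<and> - (\<Sum>p\<leftarrow>ps. frag_of p) - (\<Sum>p\<leftarrow>qs. frag_of p) \<in> J" if "set ps \<subseteq> D" for ps
    using that
  proof (induction ps)
    case Nil
    then show ?case using J_0 by (intro exI[of _ "[]"]) simp
  next
    case (Cons p ps)
    then obtain qs where qs: "set qs \<subseteq> D" "- (\<Sum>p\<leftarrow>ps. frag_of p) - (\<Sum>p\<leftarrow>qs. frag_of p) \<in> J" by auto
    obtain a b where p: "p = (a, b)" "a \<in> carrier A" "b \<in> carrier B" using Cons.prems by (cases p) auto
    let ?q = "(\<ominus>\<^bsub>A\<^esub> a, b)"
    have "frag_of (\<zero>\<^bsub>A\<^esub>, b) - frag_of p - frag_of ?q \<in> J"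
      using J_rel1[of a "\<ominus>\<^bsub>A\<^esub> a" b] p by (simp add: A.r_neg)
    then have "frag_of (\<zero>\<^bsub>A\<^esub>, b) - frag_of p - frag_of ?q - frag_of (\<zero>\<^bsub>A\<^esub>, b) \<in> J"
      using J_diff J_zero_left p by blast
    then have "(frag_of (\<zero>\<^bsub>A\<^esub>, b) - frag_of p - frag_of ?q - frag_of (\<zero>\<^bsub>A\<^esub>, b)) +
        (- (\<Sum>p\<leftarrow>ps. frag_of p) - (\<Sum>p\<leftarrow>qs. frag_of p)) \<in> J"
      using J_add qs(2) by blast
    then show ?case
      using qs(1) p by (intro exI[of _ "?q # qs"]) (simp add: algebra_simps)
  qed
  have "Poly_Mapping.keys x \<subseteq> D" using assms by simp
  then show ?thesis
  proof (induction x rule: frag_induction)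
    case zero
    then show ?case using J_0 by (intro exI[of _ "[]"]) simp
  next
    case (one p)
    then show ?case using J_0 by (intro exI[of _ "[p]"]) auto
  next
    case (diff x y)
    from diff(1) obtain ps where ps: "set ps \<subseteq> D" "x - (\<Sum>p\<leftarrow>ps. frag_of p) \<in> J"
      by (elim exE conjE) (rule that)
    from diff(2) obtain qs where qs: "set qs \<subseteq> D" "y - (\<Sum>p\<leftarrow>qs. frag_of p) \<in> J"
      by (elim exE conjE) (rule that)
    from neg[OF qs(1)] obtain rs where rs: "set rs \<subseteq> D" "- (\<Sum>p\<leftarrow>qs. frag_of p) - (\<Sum>p\<leftarrow>rs. frag_of p) \<in> J"
      by (elim exE conjE) (rule that)
    have "((x - (\<Sum>p\<leftarrow>ps. frag_of p)) - (y - (\<Sum>p\<leftarrow>qs. frag_of p))) +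
       (- (\<Sum>p\<leftarrow>qs. frag_of p) - (\<Sum>p\<leftarrow>rs. frag_of p)) \<in> J"
      by (intro J_add J_diff ps(2) qs(2) rs(2))
    moreover have "((x - (\<Sum>p\<leftarrow>ps. frag_of p)) - (y - (\<Sum>p\<leftarrow>qs. frag_of p))) +
       (- (\<Sum>p\<leftarrow>qs. frag_of p) - (\<Sum>p\<leftarrow>rs. frag_of p)) = x - y - (\<Sum>p\<leftarrow>ps @ rs. frag_of p)"
      by (simp add: algebra_simps)
    ultimately show ?case using ps(1) rs(1) by (intro exI[of _ "ps @ rs"]) simp
  qed
qed

text \<open>The first isomorphism theorem, with the kernel tested on sums of pure tensors alone,
  since every element is congruent to such a sum modulo the relations.\<close>

lemma tensor_iso:
  assumes S: "ring S" and h: "h \<in> ring_hom R S" and surj: "h ` carrier R = carrier S"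
    and rel: "\<And>x. x \<in> relations \<Longrightarrow> h x = \<zero>\<^bsub>S\<^esub>"
    and ker: "\<And>ps. set ps \<subseteq> D \<Longrightarrow> h (\<Sum>p\<leftarrow>ps. frag_of p) = \<zero>\<^bsub>S\<^esub> \<Longrightarrow> (\<Sum>p\<leftarrow>ps. frag_of p) \<in> J"
  shows "\<exists>\<theta>\<in>ring_iso (tensor_ring C A B f g) S. \<forall>a\<in>carrier A. \<forall>b\<in>carrier B.
    \<theta> (pure_tensor C A B f g a b) = h (frag_of (a, b))"
proof -
  interpret h: ring_hom_ring R S h using R.ring_axioms S h by (rule ring_hom_ringI2)
  have "relations \<subseteq> a_kernel R S h"
    unfolding a_kernel_def' using rel relations_carrier by blast
  then have J_ker: "J \<subseteq> a_kernel R S h" unfolding J_eq by (rule R.genideal_minimal[OF h.kernel_is_ideal])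
  have kerJ: "a_kernel R S h = J"
  proof
    show "a_kernel R S h \<subseteq> J"
    proof
      fix x assume "x \<in> a_kernel R S h"
      then have x: "x \<in> carrier R" "h x = \<zero>\<^bsub>S\<^esub>" unfolding a_kernel_def' by blast+
      from sum_of_pure_tensors[OF x(1)] obtain ps where
        ps: "set ps \<subseteq> D" "x - (\<Sum>p\<leftarrow>ps. frag_of p) \<in> J" by (elim exE conjE) (rule that)
      let ?s = "\<Sum>p\<leftarrow>ps. frag_of p"
      have d: "x - ?s \<in> carrier R" "h (x - ?s) = \<zero>\<^bsub>S\<^esub>"
        using ps(2) J_ker unfolding a_kernel_def' by blast+
      have "Poly_Mapping.keys (x - (x - ?s)) \<subseteq> D"
        using keys_diff[of x "x - ?s"] x(1) d(1) by auto
      then have s: "?s \<in> carrier R" by simp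
      have "h x = h (x - ?s) \<oplus>\<^bsub>S\<^esub> h ?s" using h.hom_add[OF d(1) s] by simp
      then have "h ?s = \<zero>\<^bsub>S\<^esub>" using x(2) d(2) h.hom_closed[OF s] by simp
      then have sJ: "?s \<in> J" by (rule ker[OF ps(1)])
      show "x \<in> J" using J_add[OF ps(2) sJ] by simp
    qed
  qed (rule J_ker)
  have "(\<lambda>x. the_elem (h ` x)) \<in> ring_iso (tensor_ring C A B f g) S"
    using h.FactRing_iso_set[OF surj] unfolding kerJ tensor_ring_def .
  moreover have "the_elem (h ` pure_tensor C A B f g a b) = h (frag_of (a, b))"
    if "a \<in> carrier A" "b \<in> carrier B" for a b
  proof -
    have "frag_of (a, b) \<in> carrier R" using that by simp
    from h.the_elem_simp[OF this] show ?thesis unfolding kerJ pure_tensor_def .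
  qed
  ultimately show ?thesis by (intro bexI[of _ "\<lambda>x. the_elem (h ` x)"] ballI)
qed

lemma ring_tensor: "ring (tensor_ring C A B f g)"
  unfolding tensor_ring_def using ideal.quotient_is_ring[OF J_ideal] .

lemma pure_tensor_carrier: "a \<in> carrier A \<Longrightarrow> b \<in> carrier B \<Longrightarrow>
    pure_tensor C A B f g a b \<in> carrier (tensor_ring C A B f g)"
  unfolding pure_tensor_def tensor_ring_def FactRing_def
  using R.a_rcosetsI[OF J_carrier, of "frag_of (a, b)"] by simp

end

section \<open>Powers of a field as a direct product\<close>

lemma RDirProd_list_Cons:
  assumes "x \<in> carrier R" "y \<in> carrier R" "xs \<in> carrier (RDirProd_list Rs)" "ys \<in> carrier (RDirProd_list Rs)"
  shows "(x # xs) \<otimes>\<^bsub>RDirProd_list (R # Rs)\<^esub> (y # ys) = (x \<otimes>\<^bsub>R\<^esub> y) # (xs \<otimes>\<^bsub>RDirProd_list Rs\<^esub> ys)"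
    "(x # xs) \<oplus>\<^bsub>RDirProd_list (R # Rs)\<^esub> (y # ys) = (x \<oplus>\<^bsub>R\<^esub> y) # (xs \<oplus>\<^bsub>RDirProd_list Rs\<^esub> ys)"
proof -
  note h = RDirProd_list_hom1[of R Rs]
  have "(x, xs) \<in> carrier (RDirProd R (RDirProd_list Rs))" "(y, ys) \<in> carrier (RDirProd R (RDirProd_list Rs))"
    using assms by (simp_all add: RDirProd_carrier)
  from ring_hom_memE(2,3)[OF h this]
  show "(x # xs) \<otimes>\<^bsub>RDirProd_list (R # Rs)\<^esub> (y # ys) = (x \<otimes>\<^bsub>R\<^esub> y) # (xs \<otimes>\<^bsub>RDirProd_list Rs\<^esub> ys)"
    "(x # xs) \<oplus>\<^bsub>RDirProd_list (R # Rs)\<^esub> (y # ys) = (x \<oplus>\<^bsub>R\<^esub> y) # (xs \<oplus>\<^bsub>RDirProd_list Rs\<^esub> ys)"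
    by (simp_all add: RDirProd_def DirProd_def monoid.defs)
qed

context
  fixes E :: "'a::field set"
begin

abbreviation power_ring where "power_ring n \<equiv> RDirProd_list (replicate n (sring E))"

lemma power_ring_carrier: "carrier (power_ring n) = {xs. length xs = n \<and> set xs \<subseteq> E}"
proof (induction n)
  case 0
  then show ?case by (auto simp: monoid.defs)
next
  case (Suc n)
  have "carrier (power_ring (Suc n)) = (\<lambda>(x, xs). x # xs) ` (E \<times> {xs. length xs = n \<and> set xs \<subseteq> E})"
    using RDirProd_list_carrier[of "sring E" "replicate n (sring E)"] Suc by simp
  also have "\<dots> = {xs. length xs = Suc n \<and> set xs \<subseteq> E}"
    by (auto simp: length_Suc_conv image_iff)
  finally show ?case .
qed

lemma power_ring_ops:
  assumes "length xs = n" "length ys = n" "set xs \<subseteq> E" "set ys \<subseteq> E"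
  shows "xs \<otimes>\<^bsub>power_ring n\<^esub> ys = map2 (*) xs ys" "xs \<oplus>\<^bsub>power_ring n\<^esub> ys = map2 (+) xs ys"
  using assms
proof (induction n arbitrary: xs ys)
  case 0
  { case 1 then show ?case by (simp add: monoid.defs) }
  { case 2 then show ?case by (simp add: monoid.defs) }
next
  case (Suc n)
  { case 1
    then obtain x xs' y ys' where "xs = x # xs'" "ys = y # ys'" by (metis length_Suc_conv)
    then show ?case using 1 Suc RDirProd_list_Cons(1)[of x "sring E" y xs' "replicate n (sring E)" ys']
      by (simp add: power_ring_carrier) }
  { case 2
    then obtain x xs' y ys' where "xs = x # xs'" "ys = y # ys'" by (metis length_Suc_conv)
    then show ?case using 2 Suc RDirProd_list_Cons(2)[of x "sring E" y xs' "replicate n (sring E)" ys']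
      by (simp add: power_ring_carrier) }
qed

lemma power_ring_one: "\<one>\<^bsub>power_ring n\<^esub> = replicate n 1"
  and power_ring_zero: "\<zero>\<^bsub>power_ring n\<^esub> = replicate n 0"
  unfolding RDirProd_list_one RDirProd_list_zero by (induction n) auto

lemma ring_power_ring: "subring_set E \<Longrightarrow> ring (power_ring n)"
  by (rule RDirProd_list_is_ring) (simp add: ring_sring)

end


section \<open>The rational function field\<close>

text \<open>After powers of x are cancelled, the equation reads a + x q(x) = 0 with a nonzero, and
  the inverse of x is -q(x) / a.\<close>

lemma inverse_in_subring:
  fixes x :: "'a::field"
  assumes K: "subfield_set K" and R: "subring_set R" "K \<subseteq> R" "x \<in> R"
    and p: "coeffs_in K p" "p \<noteq> 0" "poly p x = 0"
  shows "inverse x \<in> R"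
proof (cases "x = 0")
  case True
  then show ?thesis using R by simp
next
  case False
  show ?thesis
    using p
  proof (induction p rule: pCons_induct)
    case (pCons a p)
    have ck: "a \<in> K" "coeffs_in K p"
      using pCons.prems(1) by (force simp: coeffs_in_def coeff_pCons split: nat.splits)+
    show ?case
    proof (cases "a = 0")
      case True
      then have "p \<noteq> 0" "poly p x = 0" using pCons.prems False by auto
      then show ?thesis using pCons.IH ck by blast
    next
      case a: False
      have "a + x * poly p x = 0" using pCons.prems by simp
      then have "x * poly p x = - a" by (simp add: eq_neg_iff_add_eq_0 add.commute)
      then have "x * (- poly p x / a) = 1" using a by simp
      then have "inverse x = - poly p x * inverse a"
        by (metis inverse_unique field_class.field_divide_inverse)
      moreover have "poly p x \<in> R" using poly_in_subring[OF R(1) coeffs_in_mono[OF ck(2) R(2)] R(3)] .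
      moreover have "inverse a \<in> R" using subfield_inverse[OF K ck(1)] R by blast
      ultimately show ?thesis using R(1) by (simp add: subring_mult subring_uminus)
    qed
  qed simp
qed

lemma const_fun_simps [simp]:
  "const_fun 0 = 0" "const_fun 1 = 1" "const_fun (a + b) = const_fun a + const_fun b"
  "const_fun (a * b) = const_fun a * const_fun b" "const_fun (a - b) = const_fun a - const_fun b"
  "const_fun (- a) = - const_fun a"
proof -
  have m: "[:a * b:] = [:a:] * [:b:]" by simp
  have "[:a + b:] = [:a:] + [:b:]" "[:a - b:] = [:a:] - [:b:]" "[:- a:] = - [:a:]" by simp_all
  then show "const_fun (a + b) = const_fun a + const_fun b" "const_fun (a - b) = const_fun a - const_fun b"
    "const_fun (- a) = - const_fun a"
    unfolding const_fun_def by (metis to_fract_add to_ac_add, metis to_fract_diff to_ac_diff, metis to_fract_uminus to_ac_minus)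
  show "const_fun (a * b) = const_fun a * const_fun b"
    unfolding const_fun_def m by (metis to_fract_mult to_ac_mult)
  show "const_fun 0 = 0" "const_fun 1 = 1"
    by (simp_all add: const_fun_def one_pCons[symmetric])
qed

lemma const_fun_eq_0_iff [simp]: "const_fun a = 0 \<longleftrightarrow> a = 0"
  by (simp add: const_fun_def)

lemma const_fun_inverse: "const_fun (inverse a) = inverse (const_fun a)"
proof (cases "a = 0")
  case False
  then have "const_fun a * const_fun (inverse a) = 1" by (metis const_fun_simps(2,4) right_inverse)
  then show ?thesis by (metis inverse_unique)
qed simp

lemma subfield_base_field: "subfield_set (base_field :: 'k::field ratfun_closure set)"
proof -
  have "x - y \<in> base_field \<and> x * y \<in> base_field \<and> inverse x \<in> base_field"
    if "x \<in> base_field" "y \<in> base_field" for x y :: "'k ratfun_closure"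
    using that unfolding base_field_def
    by (auto simp: const_fun_simps[symmetric] const_fun_inverse[symmetric] simp del: const_fun_simps)
  moreover have "1 \<in> (base_field :: 'k ratfun_closure set)"
    unfolding base_field_def by (rule range_eqI[of _ _ 1]) simp
  ultimately show ?thesis by (auto simp: subfield_set_def subring_set_def)
qed

lemma subfield_ratfun_field: "subfield_set (ratfun_field :: 'k::field ratfun_closure set)"
proof -
  have "x - y \<in> ratfun_field \<and> x * y \<in> ratfun_field \<and> inverse x \<in> ratfun_field"
    if "x \<in> ratfun_field" "y \<in> ratfun_field" for x y :: "'k ratfun_closure"
    using that unfolding ratfun_field_def
    by (auto simp: to_ac_diff[symmetric] to_ac_mult[symmetric] to_ac_inverse[symmetric]
        simp del: to_ac_diff to_ac_mult to_ac_inverse)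
  moreover have "1 \<in> (ratfun_field :: 'k ratfun_closure set)"
    unfolding ratfun_field_def by (rule range_eqI[of _ _ 1]) simp
  ultimately show ?thesis by (auto simp: subfield_set_def subring_set_def)
qed

lemma base_field_subset: "base_field \<subseteq> ratfun_field"
  by (auto simp: base_field_def ratfun_field_def const_fun_def)

lemma base_closure_eq: "base_closure = {x. integral_over base_field x}"
proof (intro equalityI subsetI CollectI)
  fix x assume "x \<in> base_closure"
  then obtain p where p: "p \<noteq> 0" "coeffs_in base_field p" "poly p x = 0"
    by (auto simp: base_closure_def coeffs_in_def)
  let ?q = "smult (inverse (lead_coeff p)) p"
  have "inverse (lead_coeff p) \<in> base_field"
    by (rule subfield_inverse[OF subfield_base_field]) (use p(2) in \<open>simp add: coeffs_in_def\<close>)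
  then have "coeffs_in base_field ?q"
    by (intro coeffs_in_smult[OF subfield_imp_subring[OF subfield_base_field]] p)
  moreover have "lead_coeff ?q = 1" "poly ?q x = 0" using p by (simp_all add: lead_coeff_smult)
  ultimately show "integral_over base_field x" unfolding integral_over_def by blast
next
  fix x assume "x \<in> {x. integral_over base_field x}"
  then obtain p where p: "lead_coeff p = 1" "coeffs_in base_field p" "poly p x = 0"
    by (auto simp: integral_over_def)
  then have "p \<noteq> 0" by auto
  then show "x \<in> base_closure"
    using p unfolding base_closure_def coeffs_in_def by (intro CollectI exI[of _ p] conjI)
qed

lemma base_field_closure: "base_field \<subseteq> base_closure"
  unfolding base_closure_eq using integral_over_self[OF subfield_imp_subring[OF subfield_base_field]] by blast

lemma subfield_base_closure: "subfield_set (base_closure :: 'k::field ratfun_closure set)"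
proof -
  have R: "subring_set (base_closure :: 'k ratfun_closure set)"
    unfolding base_closure_eq by (rule subring_integral[OF subfield_imp_subring[OF subfield_base_field]])
  have "inverse x \<in> base_closure" if x: "x \<in> base_closure" for x :: "'k ratfun_closure"
  proof -
    obtain p where "p \<noteq> 0" "coeffs_in base_field p" "poly p x = 0"
      using x by (auto simp: base_closure_def coeffs_in_def)
    then show ?thesis
      using inverse_in_subring[OF subfield_base_field R base_field_closure x] by blast
  qed
  then show ?thesis using R by (simp add: subfield_set_def)
qed

lemma algebraic_over_ratfun_field:
  fixes x :: "'k::field ratfun_closure"
  obtains p where "coeffs_in ratfun_field p" "p \<noteq> 0" "poly p x = 0"
proof -
  obtain p :: "'k poly fract poly" where p: "p \<noteq> 0" "poly (map_poly to_ac p) x = 0"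
    using alg_closure_algebraic[of x] by blast
  have "coeffs_in ratfun_field (map_poly to_ac p)"
    by (auto simp: coeffs_in_def ratfun_field_def coeff_map_poly)
  moreover have "map_poly to_ac p \<noteq> 0" using p(1) by (simp add: map_poly_eq_0_iff)
  ultimately show ?thesis using that p(2) by blast
qed

lemma field_above_ratfun_field:
  fixes R :: "'k::field ratfun_closure set"
  assumes "subring_set R" "ratfun_field \<subseteq> R" shows "subfield_set R"
proof -
  have "inverse x \<in> R" if x: "x \<in> R" for x
  proof -
    obtain p where "coeffs_in ratfun_field p" "p \<noteq> 0" "poly p x = 0"
      by (rule algebraic_over_ratfun_field)
    then show ?thesis using inverse_in_subring[OF subfield_ratfun_field assms x] by blast
  qed
  then show ?thesis using assms(1) by (simp add: subfield_set_def)
qed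

lemma const_poly_of_coeffs:
  assumes "coeffs_in base_field q"
  obtains p where "q = map_poly const_fun p"
proof -
  have "\<exists>p. q = map_poly const_fun p"
    using assms
  proof (induction q rule: pCons_induct)
    case 0
    show ?case by (rule exI[of _ 0]) simp
  next
    case (pCons a q)
    have "a \<in> base_field" "coeffs_in base_field q"
      using pCons.prems by (force simp: coeffs_in_def coeff_pCons split: nat.splits)+
    then obtain b p where "a = const_fun b" "q = map_poly const_fun p"
      using pCons.IH by (auto simp: base_field_def)
    then show ?case by (intro exI[of _ "pCons b p"]) (simp add: map_poly_pCons)
  qed
  then show ?thesis using that by blast
qed

lemma coeffs_in_const_poly: "coeffs_in base_field (map_poly const_fun p)"
  by (auto simp: coeffs_in_def coeff_map_poly base_field_def)

definition const_eval :: "'k::field ratfun_closure \<Rightarrow> 'k poly \<Rightarrow> 'k ratfun_closure" where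
  "const_eval y p = poly (map_poly const_fun p) y"

lemma const_eval_simps [simp]:
  "const_eval y 0 = 0" "const_eval y 1 = 1" "const_eval y (pCons a p) = const_fun a + y * const_eval y p"
  "const_eval y (p + q) = const_eval y p + const_eval y q"
  "const_eval y (p - q) = const_eval y p - const_eval y q"
proof -
  have "map_poly const_fun (p + q) = map_poly const_fun p + map_poly const_fun q"
    "map_poly const_fun (p - q) = map_poly const_fun p - map_poly const_fun q"
    by (simp_all add: Polynomial.poly_eq_iff coeff_map_poly)
  then show "const_eval y (p + q) = const_eval y p + const_eval y q"
    "const_eval y (p - q) = const_eval y p - const_eval y q"
    by (simp_all add: const_eval_def)
qed (simp_all add: const_eval_def map_poly_pCons map_poly_1')

lemma const_eval_mult [simp]: "const_eval y (p * q) = const_eval y p * const_eval y q"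
proof (induction p)
  case (pCons a p)
  have "const_eval y (smult a q) = const_fun a * const_eval y q"
    by (induction q) (auto simp: algebra_simps)
  then show ?case using pCons by (simp add: algebra_simps)
qed simp

lemma const_eval_power [simp]: "const_eval y (p ^ n) = const_eval y p ^ n"
  by (induction n) auto

lemma const_eval_var: "const_eval ratfun_var p = to_ac (to_fract p)"
proof (induction p)
  case (pCons a p)
  have "to_ac (to_fract (pCons a p)) = to_ac (to_fract ([:a:] + [:0, 1:] * p))" by simp
  also have "\<dots> = const_fun a + ratfun_var * to_ac (to_fract p)"
    unfolding const_fun_def ratfun_var_def by (simp only: to_fract_add to_fract_mult to_ac_add to_ac_mult)
  finally show ?case using pCons by simp
qed simp

lemma ratfun_var_nz: "ratfun_var \<noteq> 0"
  by (simp add: ratfun_var_def)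

text \<open>The coordinate is transcendental over k. At infinity the reflected polynomial turns an
  equation for 1/T into one for T.\<close>

lemma const_eval_coordinate_eq_0: "const_eval (coordinate t) p = 0 \<Longrightarrow> p = 0"
proof (cases t)
  case (Affine a)
  then show "const_eval (coordinate t) p = 0 \<Longrightarrow> p = 0" by (simp add: const_eval_var)
next
  case Infinity
  assume "const_eval (coordinate t) p = 0"
  then have z: "poly (map_poly const_fun p) (inverse ratfun_var) = 0" using Infinity by (simp add: const_eval_def)
  let ?q = "reflect_poly (map_poly const_fun p)"
  have "poly ?q ratfun_var = 0"
    using poly_reflect_poly_nz[OF ratfun_var_nz, of "map_poly const_fun p"] z by simp
  moreover have "coeffs_in base_field ?q"
    using coeffs_in_const_poly[of p] subring_0[OF subfield_imp_subring[OF subfield_base_field]]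
    by (auto simp: coeffs_in_def coeff_reflect_poly)
  then obtain r where r: "?q = map_poly const_fun r" by (rule const_poly_of_coeffs)
  ultimately have "const_eval ratfun_var r = 0" by (simp add: const_eval_def)
  then have "?q = 0" using r by (simp add: const_eval_var)
  then show "p = 0" by (simp add: map_poly_eq_0_iff)
qed

section \<open>Coordinate rings of the affine charts\<close>

lemma chart_eq: "chart C t = {poly p (coordinate t) |p. coeffs_in C p}"
  by (simp add: chart_def coeffs_in_def)

lemma chart_base_field: "chart base_field t = range (const_eval (coordinate t))"
proof (intro equalityI subsetI)
  fix x assume "x \<in> chart base_field t"
  then obtain p where p: "coeffs_in base_field p" "x = poly p (coordinate t)" by (auto simp: chart_eq)
  obtain q where "p = map_poly const_fun q" using const_poly_of_coeffs[OF p(1)] by blast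
  then show "x \<in> range (const_eval (coordinate t))" using p(2) by (auto simp: const_eval_def)
next
  fix x assume "x \<in> range (const_eval (coordinate t))"
  then show "x \<in> chart base_field t" using coeffs_in_const_poly by (auto simp: chart_eq const_eval_def)
qed

lemma subring_chart: assumes "subring_set C" shows "subring_set (chart C t)"
proof -
  have "x - y \<in> chart C t \<and> x * y \<in> chart C t" if xy: "x \<in> chart C t" "y \<in> chart C t" for x y
  proof -
    obtain p q where pq: "coeffs_in C p" "x = poly p (coordinate t)" "coeffs_in C q" "y = poly q (coordinate t)"
      using xy by (auto simp: chart_eq)
    have "x - y = poly (p - q) (coordinate t)" "x * y = poly (p * q) (coordinate t)" using pq by simp_all
    moreover have "poly r (coordinate t) \<in> chart C t" if "coeffs_in C r" for r
      unfolding chart_eq by (intro CollectI exI[of _ r] conjI refl that)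
    ultimately show ?thesis
      using coeffs_in_diff[OF assms pq(1,3)] coeffs_in_mult[OF assms pq(1,3)] by (simp only: simp_thms)
  qed
  moreover have "1 \<in> chart C t"
    unfolding chart_eq by (rule CollectI, rule exI[of _ 1]) (simp add: coeffs_in_1[OF assms])
  ultimately show ?thesis unfolding subring_set_def by blast
qed

lemma chart_const: assumes "subring_set C" shows "C \<subseteq> chart C t"
proof
  fix c assume "c \<in> C"
  then show "c \<in> chart C t"
    unfolding chart_eq using assms
    by (intro CollectI exI[of _ "[:c:]"]) (simp add: coeffs_in_pCons coeffs_in_0)
qed

lemma coordinate_chart: assumes "subring_set C" shows "coordinate t \<in> chart C t"
  unfolding chart_eq using assms
  by (intro CollectI exI[of _ "[:0, 1:]"]) (simp add: coeffs_in_pCons coeffs_in_0 subring_0 subring_1)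

lemma chart_subset: assumes "subring_set R" "C \<subseteq> R" "coordinate t \<in> R" shows "chart C t \<subseteq> R"
  using poly_in_subring[OF assms(1) coeffs_in_mono[OF _ assms(2)] assms(3)] by (auto simp: chart_eq)

lemma chart_mono: "C \<subseteq> D \<Longrightarrow> chart C t \<subseteq> chart D t"
  unfolding chart_eq by (intro subsetI, elim CollectE exE conjE, intro CollectI exI conjI)
    (assumption, rule coeffs_in_mono)

lemma coordinate_ratfun: "coordinate t \<in> ratfun_field"
proof -
  have v: "ratfun_var \<in> ratfun_field" by (simp add: ratfun_var_def ratfun_field_def)
  show ?thesis using v subfield_inverse[OF subfield_ratfun_field v] by (cases t) auto
qed

lemma chart_ratfun: "chart base_field t \<subseteq> ratfun_field"
  by (rule chart_subset[OF subfield_imp_subring[OF subfield_ratfun_field] base_field_subset coordinate_ratfun])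

lemma ratfun_field_subset:
  fixes R :: "'k::field ratfun_closure set"
  assumes R: "subfield_set R" "base_field \<subseteq> R" "ratfun_var \<in> R"
  shows "ratfun_field \<subseteq> R"
proof
  fix x :: "'k ratfun_closure" assume "x \<in> ratfun_field"
  then obtain z where z: "x = to_ac z" by (auto simp: ratfun_field_def)
  obtain p q where pq: "z = Fract p q" "q \<noteq> 0" by (cases z) auto
  have "z = to_fract p / to_fract q" using pq by (simp add: to_fract_def)
  then have "x = const_eval ratfun_var p / const_eval ratfun_var q"
    by (simp add: z const_eval_var)
  moreover have "const_eval ratfun_var r \<in> R" for r
    unfolding const_eval_def
    by (rule poly_in_subring[OF subfield_imp_subring[OF R(1)] coeffs_in_mono[OF coeffs_in_const_poly R(2)] R(3)])
  ultimately show "x \<in> R" using subfield_divide[OF R(1)] by simp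
qed

lemma ratfun_field_fractions:
  assumes "x \<in> ratfun_field"
  obtains u v where "u \<in> chart base_field t" "v \<in> chart base_field t" "v \<noteq> 0" "x = u / v"
proof -
  let ?V = "chart base_field t"
  note V = subring_chart[OF subfield_imp_subring[OF subfield_base_field], of t]
  define R where "R = {u / v |u v. u \<in> ?V \<and> v \<in> ?V \<and> v \<noteq> 0}"
  have RI: "u / v \<in> R" if "u \<in> ?V" "v \<in> ?V" "v \<noteq> 0" for u v using that by (auto simp: R_def)
  have VR: "?V \<subseteq> R" using RI[OF _ subring_1[OF V]] by fastforce
  have "x - y \<in> R \<and> x * y \<in> R \<and> inverse x \<in> R" if xy: "x \<in> R" "y \<in> R" for x y
  proof -
    obtain a b c d where ab: "x = a / b" "y = c / d" "a \<in> ?V" "b \<in> ?V" "c \<in> ?V" "d \<in> ?V" "b \<noteq> 0" "d \<noteq> 0"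
      using xy by (auto simp: R_def)
    have "x - y = (a * d - c * b) / (b * d)" using ab by (simp add: field_simps)
    moreover have "x * y = (a * c) / (b * d)" using ab by simp
    moreover have "inverse x \<in> R"
    proof (cases "a = 0")
      case True
      then show ?thesis using ab VR subring_0[OF V] by auto
    next
      case False
      then show ?thesis using RI[of b a] ab by simp
    qed
    ultimately show ?thesis using ab RI by (simp add: subring_diff[OF V] subring_mult[OF V])
  qed
  then have R: "subfield_set R" using VR subring_1[OF V] by (auto simp: subfield_set_def subring_set_def)
  have "ratfun_var \<in> R"
  proof -
    have "coordinate t \<in> R" using VR coordinate_chart[OF subfield_imp_subring[OF subfield_base_field]] by blast
    then show ?thesis using subfield_inverse[OF R, of "coordinate t"] by (cases t) auto
  qed
  moreover have "base_field \<subseteq> R" using VR chart_const[OF subfield_imp_subring[OF subfield_base_field]] by blast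
  ultimately have "ratfun_field \<subseteq> R" using ratfun_field_subset[OF R] by blast
  then show ?thesis using assms that by (auto simp: R_def)
qed

text \<open>The conductor of \<open>V[x]\<close> in \<open>V\<close> is a principal ideal stable under multiplication by \<open>x\<close>.\<close>

lemma chart_normal:
  assumes x: "x \<in> ratfun_field" and int: "integral_over (chart base_field t) x"
  shows "x \<in> chart base_field t"
proof -
  let ?V = "chart base_field t" and ?e = "const_eval (coordinate t)"
  note V = subring_chart[OF subfield_imp_subring[OF subfield_base_field], of t]
  obtain u v where uv: "u \<in> ?V" "v \<in> ?V" "v \<noteq> 0" "x = u / v"
    by (rule ratfun_field_fractions[OF x])
  obtain p where p: "lead_coeff p = 1" "coeffs_in ?V p" "poly p x = 0"
    using int by (auto simp: integral_over_def)
  define n where "n = Polynomial.degree p"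
  define c where "c = Polynomial.coeff p"
  have cV: "c i \<in> ?V" for i using p(2) by (simp add: coeffs_in_def c_def)
  have xn: "x ^ n = - (\<Sum>i<n. c i * x ^ i)"
  proof -
    have "0 = (\<Sum>i\<le>n. c i * x ^ i)" using p(3) by (simp add: poly_altdef n_def c_def)
    also have "\<dots> = (\<Sum>i<n. c i * x ^ i) + x ^ n"
      using p(1) by (simp add: lessThan_Suc_atMost[symmetric] n_def c_def)
    finally show ?thesis by (simp add: eq_neg_iff_add_eq_0 add.commute)
  qed
  \<comment> \<open>The conductor, read as an ideal of polynomials over k. It contains the n-th
    power of a denominator of x, because powers of x from the n-th on reduce to lower ones.\<close>
  define I where "I = {q. \<forall>i. ?e q * x ^ i \<in> ?V}"
  have vI: "v ^ n * x ^ i \<in> ?V" for i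
  proof (induction i rule: less_induct)
    case (less i)
    show ?case
    proof (cases "i < n")
      case True
      then have "v ^ n = v ^ (n - i) * v ^ i" by (simp add: power_add[symmetric])
      then have "v ^ n * x ^ i = v ^ (n - i) * u ^ i"
        using uv by (simp add: power_divide)
      then show ?thesis using uv by (simp add: subring_mult[OF V] subring_power[OF V])
    next
      case False
      then have "x ^ i = x ^ (i - n) * x ^ n" by (simp add: power_add[symmetric])
      then have "v ^ n * x ^ i = (\<Sum>j<n. - c j * (v ^ n * x ^ (i - n + j)))"
        unfolding xn by (simp add: sum_distrib_left sum_negf power_add mult_ac)
      also have "\<dots> \<in> ?V"
      proof (rule subring_sum[OF V])
        fix j assume "j \<in> {..<n}"
        then have "v ^ n * x ^ (i - n + j) \<in> ?V" using False by (intro less) auto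
        then show "- c j * (v ^ n * x ^ (i - n + j)) \<in> ?V"
          by (rule subring_mult[OF V subring_uminus[OF V cV]])
      qed
      finally show ?thesis .
    qed
  qed
  obtain q0 where q0: "v = ?e q0" using uv(2) by (auto simp: chart_base_field)
  have q0I: "q0 ^ n \<in> I \<and> q0 ^ n \<noteq> 0" using vI uv(3) q0 by (auto simp: I_def)
  \<comment> \<open>A nonzero member of least degree generates the conductor.\<close>
  obtain d where d0: "(d \<in> I \<and> d \<noteq> 0) \<and>
      (\<forall>d'. d' \<in> I \<and> d' \<noteq> 0 \<longrightarrow> Polynomial.degree d \<le> Polynomial.degree d')"
    using ex_has_least_nat[of "\<lambda>d. d \<in> I \<and> d \<noteq> 0", OF q0I, of Polynomial.degree] by (rule exE)
  have d: "d \<in> I" "d \<noteq> 0" using d0 by auto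
  have dI: "?e d * x ^ i \<in> ?V" for i using d(1) unfolding I_def by (rule CollectE) (erule spec)
  have "?e d * x ^ 1 \<in> ?V" by (rule dI)
  then obtain w where w: "?e d * x = ?e w" by (auto simp: chart_base_field)
  have wI: "?e w * x ^ i \<in> ?V" for i
  proof -
    have "?e w * x ^ i = ?e d * x ^ Suc i" by (simp add: w[symmetric] mult.assoc)
    then show ?thesis using dI[of "Suc i"] by (simp only:)
  qed
  \<comment> \<open>The product of d and x lies in the conductor again, as w. Division with
    remainder by the generator shows that d divides w, and the quotient is x.\<close>
  have "w mod d \<in> I"
    unfolding I_def
  proof (intro CollectI allI)
    fix i
    have "w mod d = w - (w div d) * d" by (simp add: minus_div_mult_eq_mod)
    then have "?e (w mod d) * x ^ i = ?e w * x ^ i - ?e (w div d) * (?e d * x ^ i)"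
      by (simp add: left_diff_distrib mult.assoc)
    moreover have "?e d * x ^ i \<in> ?V" by (rule dI)
    moreover have "?e (w div d) \<in> ?V" by (auto simp: chart_base_field)
    ultimately show "?e (w mod d) * x ^ i \<in> ?V"
      using wI by (simp add: subring_diff[OF V] subring_mult[OF V])
  qed
  then have "w mod d = 0" using d(2) d0 degree_mod_less[OF d(2), of w] by (metis not_less)
  then have "w = (w div d) * d" by (metis add.right_neutral div_mult_mod_eq)
  then have "?e d * x = ?e (w div d) * ?e d" unfolding w by (metis const_eval_mult)
  moreover have "?e d \<noteq> 0" using const_eval_coordinate_eq_0 d(2) by blast
  ultimately have "x = ?e (w div d)" by simp
  then show ?thesis by (auto simp: chart_base_field)
qed

text \<open>The product D of the denominators of all coefficients clears an equation over
  k(T).\<close>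

lemma algebraic_over_chart:
  "\<exists>n a. (\<forall>i. a i \<in> chart base_field t) \<and> (\<Sum>i\<le>n. a i * x ^ i) = 0 \<and> (\<exists>i\<le>(n::nat). a i \<noteq> 0)"
proof -
  let ?V = "chart base_field t"
  note V = subring_chart[OF subfield_imp_subring[OF subfield_base_field], of t]
  obtain p where p: "coeffs_in ratfun_field p" "p \<noteq> 0" "poly p x = 0"
    by (rule algebraic_over_ratfun_field)
  have "\<forall>i. \<exists>uv. fst uv \<in> ?V \<and> snd uv \<in> ?V \<and> snd uv \<noteq> 0 \<and> Polynomial.coeff p i = fst uv / snd uv"
  proof
    fix i
    obtain u v where "u \<in> ?V" "v \<in> ?V" "v \<noteq> 0" "Polynomial.coeff p i = u / v"
      using ratfun_field_fractions[of "Polynomial.coeff p i" t] p(1) by (auto simp: coeffs_in_def)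
    then show "\<exists>uv. fst uv \<in> ?V \<and> snd uv \<in> ?V \<and> snd uv \<noteq> 0 \<and> Polynomial.coeff p i = fst uv / snd uv"
      by (intro exI[of _ "(u, v)"]) simp
  qed
  from choice[OF this] obtain uv where
    uv: "\<forall>i. fst (uv i) \<in> ?V \<and> snd (uv i) \<in> ?V \<and> snd (uv i) \<noteq> 0 \<and> Polynomial.coeff p i = fst (uv i) / snd (uv i)" ..
  define n where "n = Polynomial.degree p"
  define D where "D = (\<Prod>i\<le>n. snd (uv i))"
  define a where "a i = (if i \<le> n then D * Polynomial.coeff p i else 0)" for i
  have D0: "D \<noteq> 0" using uv by (simp add: D_def)
  have "a i \<in> ?V" for i
  proof (cases "i \<le> n")
    case True
    have "D = snd (uv i) * (\<Prod>j\<in>{..n} - {i}. snd (uv j))"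
      unfolding D_def using True by (subst prod.remove[of _ i]) auto
    then have "a i = fst (uv i) * (\<Prod>j\<in>{..n} - {i}. snd (uv j))"
      using uv True by (simp add: a_def)
    then show ?thesis using uv by (auto intro!: subring_mult[OF V] subring_prod[OF V])
  qed (simp add: a_def subring_0[OF V])
  moreover have "(\<Sum>i\<le>n. a i * x ^ i) = D * poly p x"
    by (simp add: a_def poly_altdef n_def sum_distrib_left mult.assoc)
  moreover have "a n \<noteq> 0" using D0 p(2) by (simp add: a_def n_def)
  ultimately show ?thesis using p(3) by (intro exI[of _ n] exI[of _ a]) auto
qed

text \<open>The value of the chosen coordinate at the point: at infinity the coordinate is 1/T,
  which vanishes there.\<close>

definition point_value :: "'k::field proj_line \<Rightarrow> 'k" where
  "point_value t = (case t of Affine a \<Rightarrow> a | Infinity \<Rightarrow> 0)"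

lemma uniformizer_eq: "uniformizer t = coordinate t - const_fun (point_value t)"
  by (cases t) (simp_all add: point_value_def)

lemma point_ideal_eq: "point_ideal C t = {v * uniformizer t |v. v \<in> chart C t}"
  by (auto simp: point_ideal_def cgenideal_def)

lemma uniformizer_chart:
  assumes "subring_set C" "base_field \<subseteq> C" shows "uniformizer t \<in> chart C t"
  unfolding uniformizer_eq using assms
  by (intro subring_diff[OF subring_chart] coordinate_chart subsetD[OF chart_const]) (auto simp: base_field_def)

lemma uniformizer_eval: "uniformizer t = const_eval (coordinate t) [:- point_value t, 1:]"
  by (simp add: uniformizer_eq)

lemma uniformizer_nz: "uniformizer t \<noteq> 0"
  unfolding uniformizer_eval using const_eval_coordinate_eq_0[of t "[:- point_value t, 1:]"] by auto

text \<open>The exponent is the order of the polynomial at the point value; the cofactor is not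
  divisible by the linear factor and so lies outside the ideal of the point.\<close>

lemma chart_order:
  assumes "v \<in> chart base_field t" "v \<noteq> 0"
  obtains n w where "w \<in> chart base_field t" "w \<notin> point_ideal base_field t" "v = uniformizer t ^ n * w"
proof -
  let ?e = "const_eval (coordinate t)" and ?l = "[:- point_value t, 1:]"
  obtain p where p: "v = ?e p" using assms(1) by (auto simp: chart_base_field)
  then have "p \<noteq> 0" using assms(2) by auto
  then obtain q where q: "p = ?l ^ order (point_value t) p * q" "\<not> ?l dvd q"
    using order_decomp by blast
  have "?e q \<notin> point_ideal base_field t"
  proof
    assume "?e q \<in> point_ideal base_field t"
    then obtain r where "?e q = ?e r * ?e ?l"
      by (auto simp: point_ideal_eq chart_base_field uniformizer_eval simp del: const_eval_simps)
    then have "?e (q - r * ?l) = 0" by (simp only: const_eval_simps(5) const_eval_mult diff_self)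
    then have "q - r * ?l = 0" by (rule const_eval_coordinate_eq_0)
    then have "q = ?l * r" by (simp add: mult.commute)
    then show False using q(2) by (metis dvd_triv_left)
  qed
  moreover have "v = uniformizer t ^ order (point_value t) p * ?e q"
    unfolding p by (subst q(1)) (simp add: uniformizer_eval del: const_eval_simps(3))
  ultimately show ?thesis using that[of "?e q"] by (auto simp: chart_base_field)
qed


section \<open>Rational points\<close>

lemma primeideal_sringD:
  assumes A: "subring_set A" and P: "primeideal P (sring A)"
  shows "P \<subseteq> A" "\<And>x y. x \<in> P \<Longrightarrow> y \<in> P \<Longrightarrow> x - y \<in> P" "\<And>x y. x \<in> A \<Longrightarrow> y \<in> P \<Longrightarrow> x * y \<in> P"
    "1 \<notin> P" "\<And>x y. x \<in> A \<Longrightarrow> y \<in> A \<Longrightarrow> x * y \<in> P \<Longrightarrow> x \<in> P \<or> y \<in> P"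
proof -
  interpret primeideal P "sring A" by (rule P)
  show PA: "P \<subseteq> A" using a_subset by simp
  show "x - y \<in> P" if xy: "x \<in> P" "y \<in> P" for x y
  proof -
    have "a_inv (sring A) y \<in> P"
      using subgroup.m_inv_closed[OF a_subgroup xy(2)] by (simp add: a_inv_def)
    moreover have "a_inv (sring A) y = - y" by (rule a_inv_sring[OF A]) (use PA xy in auto)
    ultimately have "- y \<in> P" by simp
    then show ?thesis using subgroup.m_closed[OF a_subgroup xy(1), of "- y"] by simp
  qed
  show "x * y \<in> P" if "x \<in> A" "y \<in> P" for x y using I_l_closed[OF that(2), of x] that by simp
  show "1 \<notin> P" using one_imp_carrier I_notcarr by auto
  show "x \<in> P \<or> y \<in> P" if "x \<in> A" "y \<in> A" "x * y \<in> P" for x y using I_prime[of x y] that by simp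
qed

lemma ideal_sringI:
  assumes A: "subring_set A" and P: "P \<subseteq> A" "0 \<in> P" "\<And>x y. x \<in> P \<Longrightarrow> y \<in> P \<Longrightarrow> x - y \<in> P"
    "\<And>x y. x \<in> A \<Longrightarrow> y \<in> P \<Longrightarrow> x * y \<in> P"
  shows "ideal P (sring A)"
proof -
  interpret A: cring "sring A" by (rule cring_sring[OF A])
  have neg: "- x \<in> P" if "x \<in> P" for x using P(3)[OF P(2) that] by simp
  have add: "x + y \<in> P" if "x \<in> P" "y \<in> P" for x y using P(3)[OF that(1) neg[OF that(2)]] by simp
  have sub: "subgroup P (add_monoid (sring A))"
  proof (rule A.add.subgroupI)
    show "\<ominus>\<^bsub>sring A\<^esub> a \<in> P" if "a \<in> P" for a
      using a_inv_sring[OF A, of a] neg[OF that] P(1) that by auto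
  qed (use P add in auto)
  have "x * y \<in> P" if "x \<in> P" "y \<in> A" for x y
    using P(4)[OF that(2,1)] by (simp add: mult.commute)
  then show ?thesis
    by (intro idealI[OF A.ring_axioms sub]) (use P(4) in auto)
qed

lemma cover_chart_eq: "cover_chart C L t = {x \<in> L. integral_over (chart C t) x}"
  by (auto simp: cover_chart_def integral_closure_def integral_over_def coeffs_in_def)

lemma rat_point_of_rational_point:
  assumes F: "subfield_set F" "ratfun_field \<subseteq> F" and P: "(t, P) \<in> rational_points F"
  shows "rat_point base_field base_closure (chart base_field t) F P (uniformizer t)"
    and "P \<inter> chart base_field t = point_ideal base_field t"
proof -
  let ?V = "chart base_field t"
  note kR = subfield_imp_subring[OF subfield_base_field]
  note V = subring_chart[OF kR, of t]
  have VF: "?V \<subseteq> F" using chart_ratfun F by blast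
  let ?A = "{x \<in> F. integral_over ?V x}"
  have "?A = F \<inter> {x. integral_over ?V x}" by auto
  then have A: "subring_set ?A"
    using subring_set_Int[OF subfield_imp_subring[OF F(1)] subring_integral[OF V]] by simp
  have prime: "primeideal P (sring ?A)" and res: "\<forall>u\<in>?A. \<exists>c\<in>base_field. u - c \<in> P"
    and PV: "P \<inter> ?V = point_ideal base_field t"
    using P by (auto simp: rational_points_def points_above_def cover_chart_eq)
  show "P \<inter> ?V = point_ideal base_field t" by (rule PV)
  note D = primeideal_sringD[OF A prime]
  have pi: "uniformizer t \<in> ?V" "uniformizer t \<in> point_ideal base_field t"
    using uniformizer_chart[OF kR] subring_1[OF V] by (auto simp: point_ideal_eq intro: exI[of _ 1])
  show "rat_point base_field base_closure ?V F P (uniformizer t)"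
  proof (rule rat_point.intro)
    show "integral_over base_field x" if "x \<in> base_closure" for x
      using that by (simp add: base_closure_eq)
    show "uniformizer t \<in> P" using pi(2) PV by blast
    show "\<exists>n w. w \<in> ?V \<and> w \<notin> P \<and> v = uniformizer t ^ n * w" if v: "v \<in> ?V" "v \<noteq> 0" for v
    proof -
      obtain n w where "w \<in> ?V" "w \<notin> point_ideal base_field t" "v = uniformizer t ^ n * w"
        by (rule chart_order[OF v])
      then show ?thesis using PV by blast
    qed
    show "\<exists>n a. (\<forall>i. a i \<in> ?V) \<and> (\<Sum>i\<le>n. a i * x ^ i) = 0 \<and> (\<exists>i\<le>(n::nat). a i \<noteq> 0)" for x
      by (rule algebraic_over_chart)
    show "P \<subseteq> ?A" by (rule D(1))
    show "x - y \<in> P" if "x \<in> P" "y \<in> P" for x y using D(2) that by blast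
    show "1 \<notin> P" by (rule D(4))
    show "x * y \<in> P" if "x \<in> F" "integral_over ?V x" "y \<in> P" for x y using D(3)[of x y] that by blast
    show "x \<in> P \<or> y \<in> P" if "x \<in> F" "integral_over ?V x" "y \<in> F" "integral_over ?V y" "x * y \<in> P" for x y
      using D(5)[of x y] that by blast
    show "\<exists>c\<in>base_field. x - c \<in> P" if "x \<in> F" "integral_over ?V x" for x using res that by blast
  qed (use subfield_base_field subfield_base_closure base_field_closure F V VF pi uniformizer_nz
      chart_const[OF kR, of t] in auto)
qed

lemma generate_field_compositum:
  assumes "subfield_set (comp_ring A C)" "A \<subseteq> comp_ring A C" "C \<subseteq> comp_ring A C"
  shows "generate_field ring_of_type_algebra (A \<union> C) = comp_ring A C"
proof -
  interpret field "ring_of_type_algebra :: 'a ring" by (rule field_from_type_algebra)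
  have "subfield (comp_ring A C) (ring_of_type_algebra :: 'a ring)"
    using subfield_sring[OF assms(1), of UNIV] by (simp add: sring_UNIV[symmetric] subring_set_def)
  then show ?thesis
  proof (rule generate_fieldI[symmetric, rotated])
    show "comp_ring A C \<subseteq> I" if "subfield I ring_of_type_algebra" "A \<union> C \<subseteq> I" for I
      using comp_ring_subset[OF subfield_imp_subring[OF subfield_set_if_subfield[OF that(1)]]] that(2) by blast
  qed (use assms in auto)
qed

lemma generate_field_closure:
  assumes F: "subfield_set F" "ratfun_field \<subseteq> F"
  shows "generate_field ring_of_type_algebra (F \<union> base_closure) = comp_ring F base_closure"
    and "subfield_set (comp_ring F base_closure)"
proof -
  note R = subfield_imp_subring[OF F(1)] subfield_imp_subring[OF subfield_base_closure]
  show *: "subfield_set (comp_ring F base_closure)"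
    using field_above_ratfun_field[OF subring_comp_ring[OF R]] comp_ring_left[OF R] F(2) by blast
  show "generate_field ring_of_type_algebra (F \<union> base_closure) = comp_ring F base_closure"
    by (rule generate_field_compositum[OF * comp_ring_left[OF R] comp_ring_right[OF R]])
qed

lemma branch_point_eq:
  assumes F: "subfield_set F" "ratfun_field \<subseteq> F"
  shows "branch_point F t \<longleftrightarrow>
     (\<exists>P\<in>points_above base_closure (comp_ring F base_closure) t.
        point_ideal base_closure t \<subseteq>
          ideal_prod (sring (cover_chart base_closure (comp_ring F base_closure) t)) P P)"
  by (simp add: branch_point_def generate_field_closure(1)[OF F] Let_def)

text \<open>Suppose that \<pi> b is a product of two elements of P with b outside P. As b is
  congruent to a nonzero constant, \<pi> lies in Q^2 for the geometric point Q above P, and t is a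
  branch point.\<close>

lemma unramified_rat_point_of_rational_point:
  fixes F :: "'k::field ratfun_closure set"
  assumes F: "subfield_set F" "ratfun_field \<subseteq> F" and P: "(t, P) \<in> rational_points F"
    and nb: "\<not> branch_point F t"
  shows "unramified_rat_point base_field base_closure (chart base_field t) F P (uniformizer t)"
proof -
  interpret rat_point base_field base_closure "chart base_field t" F P "uniformizer t"
    by (rule rat_point_of_rational_point(1)[OF F P])
  let ?V = "chart base_field t" and ?W = "chart (base_closure :: 'k ratfun_closure set) t"
  let ?L = "comp_ring F base_closure" and ?\<pi> = "uniformizer t"
  have L: "subring_set ?L" by (rule subring_comp_ring[OF FR kbR])
  have OO: "subring_set (comp_ring Oc base_closure)" by (rule subring_comp_ring[OF O_ring kbR])
  have W: "subring_set ?W" by (rule subring_chart[OF kbR])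
  have VO: "?V \<subseteq> Oc" using VA AO by blast
  have yV: "coordinate t \<in> ?V" by (rule coordinate_chart[OF kR])
  have WO: "?W \<subseteq> comp_ring Oc base_closure"
    by (rule chart_subset[OF OO]) (use comp_ring_left[OF O_ring kbR] comp_ring_right[OF O_ring kbR] VO yV in auto)
  have WL: "?W \<subseteq> ?L" using WO comp_ring_mono[OF O_sub_F order_refl] by blast
  define Ab where "Ab = {x \<in> ?L. integral_over ?W x}"
  have "Ab = ?L \<inter> {x. integral_over ?W x}" by (auto simp: Ab_def)
  then have Ab: "subring_set Ab" using subring_set_Int[OF L subring_integral[OF W]] by simp
  have AbO: "Ab \<subseteq> comp_ring Oc base_closure"
  proof
    fix x assume "x \<in> Ab"
    then show "x \<in> comp_ring Oc base_closure"
      using integral_in_comp_ring[OF kb order_refl, of x] integral_over_mono[OF _ WO]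
      by (auto simp: Ab_def)
  qed
  have AAb: "A \<subseteq> Ab"
    using comp_ring_left[OF FR kbR] integral_over_mono[OF _ chart_mono[OF kb(2)]] by (auto simp: A_def Ab_def)
  have WAb: "?W \<subseteq> Ab" using WL integral_over_self[OF W] by (auto simp: Ab_def)
  \<comment> \<open>The geometric point above P, as the kernel of the extended residue map on the
    integral closure over kbar.\<close>
  define Q where "Q = {z \<in> Ab. \<Phi> z = 0}"
  have QI: "z \<in> Q" if "z \<in> Ab" "\<Phi> z = 0" for z using that by (simp add: Q_def)
  have ext: "\<Phi> (x - y) = \<Phi> x - \<Phi> y" "\<Phi> (x * y) = \<Phi> x * \<Phi> y" if "x \<in> Ab" "y \<in> Ab" for x y
    using residue.ext_diff residue.ext_mult AbO that by blast+
  have QAb: "Q \<subseteq> Ab" by (auto simp: Q_def)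
  have Qmult: "x * y \<in> Q" if "x \<in> Ab" "y \<in> Q" for x y
    using that ext[of x y] subring_mult[OF Ab] by (auto simp: Q_def)
  have ideal: "ideal Q (sring Ab)"
    by (rule ideal_sringI[OF Ab QAb _ _ Qmult])
      (use ext subring_diff[OF Ab] subring_0[OF Ab] in \<open>auto simp: Q_def\<close>)
  have prime: "primeideal Q (sring Ab)"
  proof (rule primeidealI[OF ideal cring_sring[OF Ab]])
    have "1 \<notin> Q" by (simp add: Q_def)
    then show "carrier (sring Ab) \<noteq> Q" using subring_1[OF Ab] by auto
    show "a \<in> Q \<or> b \<in> Q"
      if "a \<in> carrier (sring Ab)" "b \<in> carrier (sring Ab)" "a \<otimes>\<^bsub>sring Ab\<^esub> b \<in> Q" for a b
      using that ext[of a b] by (auto simp: Q_def)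
  qed
  have PQ: "P \<subseteq> Q"
  proof
    fix x assume x: "x \<in> P"
    then have "x \<in> A" using PA by blast
    moreover from this have "\<Phi> x = 0" using residue.ext_left[of x] AO phi_A x by auto
    ultimately show "x \<in> Q" using AAb QI by blast
  qed
  have Qpt: "Q \<inter> ?W = point_ideal base_closure t"
  proof
    show "point_ideal base_closure t \<subseteq> Q \<inter> ?W"
    proof
      fix x assume "x \<in> point_ideal base_closure t"
      then obtain v where v: "v \<in> ?W" "x = v * ?\<pi>" by (auto simp: point_ideal_eq)
      have "?\<pi> \<in> Q" "?\<pi> \<in> ?W" using PQ \<pi>(2) chart_mono[OF kb(2)] \<pi>(1) by auto
      then show "x \<in> Q \<inter> ?W" using v Qmult WAb subring_mult[OF W] by auto
    qed
    show "Q \<inter> ?W \<subseteq> point_ideal base_closure t"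
    proof
      fix x assume x: "x \<in> Q \<inter> ?W"
      then obtain p where p: "coeffs_in base_closure p" "x = poly p (coordinate t)" by (auto simp: chart_eq)
      let ?a = "const_fun (point_value t)"
      have ak: "?a \<in> base_field" by (simp add: base_field_def)
      have aW: "?a \<in> ?W" using ak kb chart_const[OF kbR] by blast
      \<comment> \<open>Division by the linear factor leaves the constant remainder p(a). Both x and
        the multiple of \<pi> have residue 0, and a constant is its own residue, so the remainder is
        0.\<close>
      have "p = synthetic_div p ?a * [:- ?a, 1:] + [:poly p ?a:]"
        using synthetic_div_correct'[of ?a p] by (simp add: mult.commute)
      then have "poly p (coordinate t) = poly (synthetic_div p ?a * [:- ?a, 1:] + [:poly p ?a:]) (coordinate t)"
        by simp
      then have eq: "x = poly (synthetic_div p ?a) (coordinate t) * ?\<pi> + poly p ?a"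
        using p(2) by (simp add: uniformizer_eq algebra_simps)
      have "coeffs_in base_closure (synthetic_div p ?a)" and pa: "poly p ?a \<in> base_closure"
      proof -
        show "poly p ?a \<in> base_closure" by (rule poly_in_subring[OF kbR p(1)]) (use ak kb in auto)
        show "coeffs_in base_closure (synthetic_div p ?a)"
          using p(1)
        proof (induction p rule: pCons_induct)
          case 0
          then show ?case by simp
        next
          case (pCons b q)
          have bq: "coeffs_in base_closure q"
            using pCons.prems by (force simp: coeffs_in_def coeff_pCons split: nat.splits)
          have "poly q ?a \<in> base_closure" by (rule poly_in_subring[OF kbR bq]) (use ak kb in auto)
          then show ?case using pCons.IH[OF bq] by (simp add: coeffs_in_pCons[OF kbR])
        qed
      qed
      then have sW: "poly (synthetic_div p ?a) (coordinate t) \<in> ?W" by (auto simp: chart_eq)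
      have piQ: "?\<pi> \<in> Q" using PQ \<pi>(2) by blast
      then have sQ: "poly (synthetic_div p ?a) (coordinate t) * ?\<pi> \<in> Q" using Qmult sW WAb by blast
      have "poly p ?a = x - poly (synthetic_div p ?a) (coordinate t) * ?\<pi>" using eq by simp
      then have "\<Phi> (poly p ?a) = 0" using ext(1)[of x] x sQ QAb by (auto simp: Q_def)
      then have "poly p ?a = 0" using residue.ext_right[OF pa] by simp
      then show "x \<in> point_ideal base_closure t" using eq sW by (auto simp: point_ideal_eq)
    qed
  qed
  have above: "Q \<in> points_above base_closure ?L t"
    using prime Qpt by (simp add: points_above_def cover_chart_eq Ab_def)
  show ?thesis
  proof (unfold_locales)
    fix x y b assume xy: "x \<in> P" "y \<in> P" and b: "b \<in> F" "integral_over ?V b" "b \<notin> P"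
    show "?\<pi> * b \<noteq> x * y"
    proof
      assume eq: "?\<pi> * b = x * y"
      obtain c where c: "c \<in> base_field" "b - c \<in> P" using residue[OF b(1,2)] by blast
      have c0: "c \<noteq> 0" using c b(3) by auto
      have cW: "inverse c \<in> ?W" using c(1) subfield_inverse[OF k] kb chart_const[OF kbR] by blast
      have "point_ideal base_closure t \<subseteq> ideal_prod (sring Ab) Q Q"
      proof
        fix z assume "z \<in> point_ideal base_closure t"
        then obtain v where v: "v \<in> ?W" "z = v * ?\<pi>" by (auto simp: point_ideal_eq)
        define w where "w = v * inverse c"
        have w: "w \<in> Ab" using v cW subring_mult[OF W] WAb by (auto simp: w_def)
        have mem: "w * x \<in> Q" "y \<in> Q" "- w * ?\<pi> \<in> Q" "b - c \<in> Q"
          using w xy PQ c \<pi>(2) Qmult subring_uminus[OF Ab] by blast+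
        have "z = w * (c * ?\<pi>)" using v(2) c0 by (simp add: w_def)
        \<comment> \<open>From \<pi> b = x y it follows that c \<pi> = x y - \<pi> (b - c), a
          combination of products of two elements of Q.\<close>
        also have "\<dots> = w * (x * y) - w * (?\<pi> * (b - c))" unfolding eq[symmetric] by (simp add: algebra_simps)
        also have "\<dots> = (w * x) * y + (- w * ?\<pi>) * (b - c)" by (simp add: algebra_simps)
        also have "\<dots> \<in> ideal_prod (sring Ab) Q Q"
          using ideal_prod.sum[OF ideal_prod.prod[OF mem(1,2), of "sring Ab"] ideal_prod.prod[OF mem(3,4), of "sring Ab"]]
          by simp
        finally show "z \<in> ideal_prod (sring Ab) Q Q" .
      qed
      then have "branch_point F t"
        unfolding branch_point_eq[OF assms(1,2)]
        by (intro bexI[OF _ above]) (simp add: cover_chart_eq Ab_def)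
      then show False using nb by blast
    qed
  qed
qed


section \<open>Properties of the twisted field\<close>

text \<open>By \<open>full\<close> the group G is the whole automorphism group of F over k(T); the
  automorphisms of F kbar over kbar(T) are found by restriction to F.\<close>

locale ratfun_twist = twist base_field base_closure "chart base_field t" F P "uniformizer t" G ratfun_field aF H E aE
  for t :: "'k::field proj_line" and F P :: "'k ratfun_closure set"
    and G :: "('g, 'm) monoid_scheme" (structure) and aF H E aE +
  assumes not_branch: "\<not> branch_point F t"
    and residue_ideal: "P \<inter> chart base_field t = point_ideal base_field t"
    and full: "\<And>\<sigma>. ring_endo F \<sigma> \<Longrightarrow> bij_betw \<sigma> F F \<Longrightarrow> (\<And>x. x \<in> ratfun_field \<Longrightarrow> \<sigma> x = x) \<Longrightarrow>
      \<exists>g\<in>carrier G. \<forall>x\<in>F. aF g x = \<sigma> x"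
begin

abbreviation L where "L \<equiv> comp_ring F base_closure"

text \<open>The compositum of \<E> with kbar contains E, and \<E> and E together generate F
  E.\<close>

lemma EF_compositum: "comp_ring \<E> base_closure = L"
proof
  have L: "subring_set L" "F \<subseteq> L" "base_closure \<subseteq> L"
    using subring_comp_ring[OF FR kbR] comp_ring_left[OF FR kbR] comp_ring_right[OF FR kbR] by auto
  have "M \<subseteq> L" using comp_ring_mono[OF order_refl E_kb] by (simp add: two.M_def)
  then show "comp_ring \<E> base_closure \<subseteq> L" using comp_ring_subset[OF L(1) _ L(3)] EM by blast
  have R: "subring_set (comp_ring \<E> base_closure)" "\<E> \<subseteq> comp_ring \<E> base_closure" "base_closure \<subseteq> comp_ring \<E> base_closure"
    using subring_comp_ring[OF E_ring kbR] comp_ring_left[OF E_ring kbR] comp_ring_right[OF E_ring kbR] by auto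
  have "M \<subseteq> comp_ring \<E> base_closure" using M_le_compositum[OF R(1,2)] R(3) E_kb by blast
  then show "L \<subseteq> comp_ring \<E> base_closure" using comp_ring_subset[OF R(1) _ R(3)] two.FM by blast
qed

lemma finite_extension_E: "finite_extension \<E>"
proof -
  interpret pr: gal_act \<Gamma> M ratfun_field act by (rule prod_act)
  let ?R = "ring_of_type_algebra :: 'k ratfun_closure ring"
  interpret R: ring ?R by (rule ring_from_type_algebra)
  have U: "subring_set (UNIV :: 'k ratfun_closure set)" by (simp add: subring_set_def)
  have sub: "subfield \<E> ?R" "subfield ratfun_field ?R"
    using subfield_sring[OF E_field U] subfield_sring[OF pr.subfield_K U] by (simp_all add: sring_UNIV[symmetric])
  obtain ps where ps: "set ps \<subseteq> M \<times> M" "\<And>x. x \<in> M \<Longrightarrow> x = (\<Sum>(z, u)\<leftarrow>ps. pr.tr (x * z) * u)"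
    using pr.dual_basis[OF two.M_ring order_refl pr.faithful] by blast
  have "ring.finite_dimension (sring UNIV) ratfun_field M"
    by (rule finite_dimension_sring[OF pr.subfield_K two.M_ring K0M U _ ps])
      (auto intro: pr.tr_in subring_mult[OF two.M_ring])
  then have M: "R.finite_dimension ratfun_field M" by (simp only: sring_UNIV[symmetric])
  have "subalgebra ratfun_field \<E> ?R"
  proof (rule subalgebra.intro)
    show "subgroup \<E> (add_monoid ?R)"
      using subring.axioms(1)[OF subfieldE(1)[OF sub(1)]] .
    show "subalgebra_axioms ratfun_field \<E> ?R"
      by (rule subalgebra_axioms.intro) (use K0E subring_mult[OF E_ring] in auto)
  qed
  then have "R.finite_dimension ratfun_field \<E>"
    using R.subalbegra_incl_imp_finite_dimension[OF sub(2) M _ EM] by blast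
  then show ?thesis using sub K0E by (simp add: finite_extension_def)
qed

lemma k_regular_E: "k_regular \<E>"
proof -
  interpret pr: gal_act \<Gamma> M ratfun_field act by (rule prod_act)
  have "separable_over ratfun_field x" if "x \<in> \<E>" for x
  proof -
    have xM: "x \<in> M" using that EM by blast
    obtain p where "coeffs_in ratfun_field p" "Polynomial.rsquarefree p"
      "\<And>y. poly p y = 0 \<longleftrightarrow> (\<exists>g\<in>carrier \<Gamma>. y = act g x)"
      using pr.orbit_poly[OF xM] by metis
    moreover have "\<one>\<^bsub>\<Gamma>\<^esub> \<in> carrier \<Gamma>" "x = act \<one>\<^bsub>\<Gamma>\<^esub> x" using two.prod.one_closed pr.act_one[OF xM] by simp_all
    ultimately show ?thesis unfolding separable_over_def coeffs_in_def by metis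
  qed
  then show ?thesis using finite_extension_E E_int_kb by (simp add: k_regular_def)
qed

lemma FK: "ratfun_field \<subseteq> F" using two.a.K_subset .

text \<open>Branch points are defined through the compositum with kbar, which is the same for both
  fields.\<close>

lemma not_branch_E: "\<not> branch_point \<E> t"
  using not_branch by (simp add: branch_point_eq[OF E_field K0E] branch_point_eq[OF F FK] EF_compositum)

text \<open>Let R be Galois over k(T) and contain \<E>. For x in both R and F E, the conjugates of x
  inside R are the roots of a polynomial over k(T), so each (g, h) sends x to one of them. Hence the
  intersection is stable under G x H.\<close>

lemma galois_closure_E: "galois_closure \<E> \<inter> base_closure = E"
proof -
  interpret pr: gal_act \<Gamma> M ratfun_field act by (rule prod_act)
  interpret gt: gal_transport \<Gamma> M ratfun_field act "sring M" "\<lambda>x. x" ratfun_field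
  proof (intro gal_transport.intro gal_transport_axioms.intro prod_act ring_sring[OF two.M_ring])
    show "(\<lambda>x. x) \<in> ring_iso (sring M) (sring M)"
      by (simp add: ring_iso_def ring_hom_def bij_betw_def)
  qed (use K0M in auto)
  have "M \<subseteq> R" if R: "\<E> \<subseteq> R" "galois_extension (sring R) ratfun_field" for R
  proof (rule M_le_stable)
    have Rf: "subfield_set R" using R(2) subfield_set_if_field by (auto simp: galois_extension_def)
    then show RR: "subring_set R" by (rule subfield_imp_subring)
    have KR: "ratfun_field \<subseteq> R" using R(1) K0E by blast
    let ?S = "carrier (gal_group (sring R) ratfun_field)"
    have fixR: "ratfun_field = {x \<in> R. \<forall>\<sigma>\<in>?S. \<sigma> x = x}" using R(2) by (auto simp: galois_extension_def)
    have mem: "\<sigma> \<in> ?S \<Longrightarrow> bij_betw \<sigma> R R \<and> ring_endo R \<sigma> \<and> (\<forall>x\<in>ratfun_field. \<sigma> x = x)" for \<sigma>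
      by (simp add: mem_gal_group ring_hom_sring_endo)
    fix x g h assume x: "x \<in> R \<inter> M" and gh: "g \<in> carrier G" "h \<in> H"
    \<comment> \<open>This set of conjugates is finite because its members are roots of the orbit
      polynomial of x under G x H.\<close>
    define Y where "Y = insert x ((\<lambda>\<sigma>. \<sigma> x) ` ?S)"
    obtain p where p: "coeffs_in ratfun_field p" "\<And>y. poly p y = 0 \<longleftrightarrow> (\<exists>d\<in>carrier \<Gamma>. y = act d x)"
      using pr.orbit_poly[of x] x by (metis IntD2)
    have px: "poly p x = 0" using p(2) two.prod.one_closed pr.act_one x by (metis IntD2)
    have root: "poly p (\<sigma> x) = 0" if s: "\<sigma> \<in> ?S" for \<sigma>
    proof -
      have "\<sigma> (poly p x) = poly p (\<sigma> x)"
        using mem[OF s] p(1) KR x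
        by (intro endo_poly_fixed[OF RR]) (auto simp: coeffs_in_def)
      moreover have "ring_endo R \<sigma>" using mem[OF s] by blast
      ultimately show ?thesis using px endo_0[OF RR] by metis
    qed
    have "Y \<subseteq> {y. \<exists>d\<in>carrier \<Gamma>. y = act d x}" using root px p(2) by (auto simp: Y_def)
    moreover have "{y. \<exists>d\<in>carrier \<Gamma>. y = act d x} = (\<lambda>d. act d x) ` carrier \<Gamma>" by auto
    ultimately have fin: "finite Y" using pr.fin finite_subset by fastforce
    have YR: "Y \<subseteq> R" using mem endo_in[OF RR] x by (auto simp: Y_def)
    have perm: "\<sigma> ` Y = Y" "inj_on \<sigma> Y" if s: "\<sigma> \<in> ?S" for \<sigma>
    proof -
      have "\<sigma> (\<tau> x) \<in> Y" if "\<tau> \<in> ?S" for \<tau>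
      proof -
        have "compose R \<sigma> \<tau> \<in> ?S" by (rule gal_group_compose[OF RR KR s that])
        moreover have "compose R \<sigma> \<tau> x = \<sigma> (\<tau> x)" using x by (simp add: compose_def)
        ultimately show ?thesis unfolding Y_def by (metis image_eqI insertI2)
      qed
      then have "\<sigma> ` Y \<subseteq> Y" using s by (auto simp: Y_def)
      moreover show inj: "inj_on \<sigma> Y" using mem[OF s] YR by (meson bij_betw_imp_inj_on inj_on_subset)
      ultimately show "\<sigma> ` Y = Y" using fin by (simp add: card_image card_subset_eq)
    qed
    let ?q = "\<Prod>y\<in>Y. [:- y, 1:]"
    have "Polynomial.coeff ?q i \<in> ratfun_field" for i
    proof (subst fixR, intro CollectI conjI ballI)
      have e: "ring_endo R (\<lambda>x. x)" by (simp add: ring_endo_def)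
      show "Polynomial.coeff ?q i \<in> R"
        using endo_root_poly[OF RR e fin YR] by (simp add: coeffs_in_def)
      show "\<sigma> (Polynomial.coeff ?q i) = Polynomial.coeff ?q i" if "\<sigma> \<in> ?S" for \<sigma>
        using endo_root_poly_fixed[OF RR _ fin YR perm[OF that]] mem[OF that] by blast
    qed
    then have c: "Polynomial.coeff ?q i \<in> ratfun_field" for i .
    have "act (g, h) (poly ?q x) = poly ?q (act (g, h) x)"
      using c K0M act_K0[OF gh] x
      by (intro endo_poly_fixed[OF two.M_ring act_endo[OF gh]]) (auto simp: coeffs_in_def)
    moreover have "poly ?q x = 0" using poly_root_poly[OF fin, of x] by (simp add: Y_def)
    ultimately have "poly ?q (act (g, h) x) = 0" using endo_0[OF two.M_ring act_endo[OF gh]] by simp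
    then have "act (g, h) x \<in> Y" using poly_root_poly[OF fin] by blast
    then show "act (g, h) x \<in> R" using YR by blast
  qed (use R in auto)
  then have "galois_closure \<E> = M"
    unfolding galois_closure_def using gt.galois EM by blast
  then show ?thesis using M_int_kb by simp
qed

text \<open>Multiplication maps the tensor product of \<E> and kbar onto F kbar, injectively by
  linear disjointness, and sends the copy of kbar(T) to the compositum of k(T) and kbar. On F kbar
  the group G acts through its product with a trivial group.\<close>

lemma geometrically_galois_E: "geometrically_galois \<E> G"
proof -
  let ?K = "comp_ring ratfun_field base_closure :: 'k ratfun_closure set"
  have LR: "subring_set L" by (rule subring_comp_ring[OF FR kbR])
  have Lf: "subfield_set L" by (rule generate_field_closure(2)[OF F FK])
  interpret T: tensor "sring \<E>" "sring base_closure" "sring base_field" id id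
    by (intro tensor.intro free_pair.intro tensor_axioms.intro cring_sring[OF E_ring] cring_sring[OF kbR])
      (use two.kK0 K0E kb in auto)
  let ?\<beta> = "\<lambda>p :: 'k ratfun_closure \<times> 'k ratfun_closure. fst p * snd p"
  let ?h = "frag_eval ?\<beta>"
  have \<beta>L: "?\<beta> p \<in> L" if "p \<in> \<E> \<times> base_closure" for p
  proof -
    have "fst p \<in> \<E>" "snd p \<in> base_closure" using that by (auto simp: mem_Times_iff)
    from comp_ring_prod[OF this] show ?thesis unfolding EF_compositum .
  qed
  have "\<exists>\<theta>\<in>ring_iso (tensor_ring (sring base_field) (sring \<E>) (sring base_closure) id id) (sring L).
      \<forall>a\<in>carrier (sring \<E>). \<forall>b\<in>carrier (sring base_closure).
        \<theta> (pure_tensor (sring base_field) (sring \<E>) (sring base_closure) id id a b) = ?h (frag_of (a, b))"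
  proof (rule T.tensor_iso)
    show "ring (sring L)" by (rule ring_sring[OF LR])
    show "?h \<in> ring_hom T.R (sring L)"
    proof (rule ring_hom_memI)
      fix x y assume xy: "x \<in> carrier T.R" "y \<in> carrier T.R"
      show "?h x \<in> carrier (sring L)" using frag_eval_in[OF LR _ \<beta>L] xy(1) by simp
      show "?h (x \<otimes>\<^bsub>T.R\<^esub> y) = ?h x \<otimes>\<^bsub>sring L\<^esub> ?h y"
        using xy by (simp add: T.frag_eval_mul T.pmul_def)
      show "?h (x \<oplus>\<^bsub>T.R\<^esub> y) = ?h x \<oplus>\<^bsub>sring L\<^esub> ?h y" by (simp add: frag_eval_add)
    qed simp
    show "?h ` carrier T.R = carrier (sring L)"
    proof
      show "?h ` carrier T.R \<subseteq> carrier (sring L)" using frag_eval_in[OF LR _ \<beta>L] by auto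
      show "carrier (sring L) \<subseteq> ?h ` carrier T.R"
      proof
        fix z assume "z \<in> carrier (sring L)"
        then have "z \<in> comp_ring \<E> base_closure" by (simp add: EF_compositum)
        then have "\<exists>x. Poly_Mapping.keys x \<subseteq> \<E> \<times> base_closure \<and> ?h x = z"
        proof induction
          case zero
          show ?case by (rule exI[of _ 0]) simp
        next
          case (step a c z)
          then obtain x where x: "Poly_Mapping.keys x \<subseteq> \<E> \<times> base_closure" "?h x = z" by blast
          have "Poly_Mapping.keys (frag_of (a, c) + x) \<subseteq> \<E> \<times> base_closure"
            using keys_add[of "frag_of (a, c)" x] x(1) step(1,2) by auto
          moreover have "?h (frag_of (a, c) + x) = a * c + z" using x(2) by (simp add: frag_eval_add)
          ultimately show ?case by blast
        qed
        then show "z \<in> ?h ` carrier T.R" by auto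
      qed
    qed
    show "?h x = \<zero>\<^bsub>sring L\<^esub>" if "x \<in> T.relations" for x
      using that by (auto simp: T.relations_def frag_eval_diff ring_distribs ac_simps)
    show "(\<Sum>p\<leftarrow>ps. frag_of p) \<in> T.J"
      if ps: "set ps \<subseteq> T.D" "?h (\<Sum>p\<leftarrow>ps. frag_of p) = \<zero>\<^bsub>sring L\<^esub>" for ps
    proof -
      define a where "a i = fst (ps ! i)" for i
      define c where "c i = snd (ps ! i)" for i
      have mem: "\<forall>i\<in>{..<length ps}. a i \<in> \<E> \<and> c i \<in> base_closure"
      proof
        fix i assume "i \<in> {..<length ps}"
        then have "ps ! i \<in> T.D" using ps(1) nth_mem[of i ps] by auto
        then show "a i \<in> \<E> \<and> c i \<in> base_closure" by (auto simp: a_def c_def mem_Times_iff)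
      qed
      have "?h (\<Sum>p\<leftarrow>qs. frag_of p) = (\<Sum>p\<leftarrow>qs. fst p * snd p)" for qs
        by (induction qs) (auto simp: frag_eval_add)
      then have sum0: "(\<Sum>i\<in>{..<length ps}. a i * c i) = 0"
        using ps(2) by (simp add: sum_list_sum_nth a_def c_def atLeast0LessThan)
      have "(\<Sum>i\<in>{..<length ps}. frag_of (a i, c i)) \<in> T.J"
        by (rule lin_disjoint_balanced[OF k lin_disjoint_E_kb E_ring _ kbR kb(2) T.J_0 T.J_diff _ _ _ _ mem sum0])
          (use two.kK0 K0E T.J_rel1 T.J_rel2 T.J_rel3 in auto)
      then show ?thesis by (simp add: sum_list_sum_nth a_def c_def atLeast0LessThan)
    qed
  qed
  then obtain \<theta> where \<theta>: "\<theta> \<in> ring_iso (geometric_ring \<E>) (sring L)"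
    "\<And>a b. a \<in> \<E> \<Longrightarrow> b \<in> base_closure \<Longrightarrow> \<theta> (geometric_tensor \<E> a b) = a * b"
    by (auto simp: geometric_ring_def)
  have ringG: "ring (geometric_ring \<E>)" unfolding geometric_ring_def by (rule T.ring_tensor)
  interpret GR: field "geometric_ring \<E>" by (rule field_of_ring_iso[OF ringG Lf \<theta>(1)])
  let ?S = "insert (geometric_tensor \<E> ratfun_var 1) (geometric_tensor \<E> 1 ` base_closure)"
  have var: "ratfun_var \<in> ratfun_field" by (simp add: ratfun_var_def ratfun_field_def)
  have pt: "geometric_tensor \<E> a b \<in> carrier (geometric_ring \<E>)" if "a \<in> \<E>" "b \<in> base_closure" for a b
    using T.pure_tensor_carrier that by (simp add: geometric_ring_def)
  have S: "?S \<subseteq> carrier (geometric_ring \<E>)"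
    using pt var K0E subring_1[OF E_ring] subring_1[OF kbR] by auto
  note KR = subfield_imp_subring[OF subfield_ratfun_field]
  have Kf: "subfield_set ?K"
    using field_above_ratfun_field[OF subring_comp_ring[OF KR kbR] comp_ring_left[OF KR kbR]] .
  interpret th: ring_hom_ring "geometric_ring \<E>" "sring L" \<theta>
    using \<theta>(1) GR.ring_axioms ring_sring[OF LR] by (intro ring_hom_ringI2) (auto simp: ring_iso_def)
  have \<theta>_inj: "x = y" if "x \<in> carrier (geometric_ring \<E>)" "y \<in> carrier (geometric_ring \<E>)" "\<theta> x = \<theta> y" for x y
    using \<theta>(1) that by (auto simp: ring_iso_def bij_betw_def inj_on_def)
  have \<theta>_uminus: "\<theta> (\<ominus>\<^bsub>geometric_ring \<E>\<^esub> x) = - \<theta> x" if "x \<in> carrier (geometric_ring \<E>)" for x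
    using th.hom_a_inv[OF that] a_inv_sring[OF LR] th.hom_closed[OF that] by simp
  have \<theta>_inv: "\<theta> (inv\<^bsub>geometric_ring \<E>\<^esub> x) = inverse (\<theta> x)"
    if x: "x \<in> carrier (geometric_ring \<E>)" "x \<noteq> \<zero>\<^bsub>geometric_ring \<E>\<^esub>" for x
  proof -
    have u: "x \<in> Units (geometric_ring \<E>)" using x GR.field_Units by blast
    have "\<theta> x * \<theta> (inv\<^bsub>geometric_ring \<E>\<^esub> x) = 1"
      using th.hom_mult[OF x(1) GR.Units_inv_closed[OF u]] GR.Units_r_inv[OF u] th.hom_one by simp
    then show ?thesis by (metis inverse_unique)
  qed
  have base: "\<theta> ` geometric_base \<E> = ?K"
  proof
    note gen = GR.generate_field_in_carrier[OF S]
    show "\<theta> ` geometric_base \<E> \<subseteq> ?K"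
    proof (rule image_subsetI)
      fix x assume "x \<in> geometric_base \<E>"
      then have "x \<in> generate_field (geometric_ring \<E>) ?S" by (simp add: geometric_base_def)
      then show "\<theta> x \<in> ?K"
      proof induction
        case one
        then show ?case using th.hom_one subring_1[OF subfield_imp_subring[OF Kf]] by simp
      next
        case (incl h)
        have "ratfun_var \<in> \<E>" "ratfun_var \<in> ?K" using var K0E comp_ring_left[OF KR kbR] by blast+
        moreover have "c \<in> ?K" if "c \<in> base_closure" for c using that comp_ring_right[OF KR kbR] by blast
        ultimately show ?case using incl \<theta>(2) subring_1[OF E_ring] subring_1[OF kbR] by auto
      next
        case (a_inv h)
        then show ?case using \<theta>_uminus gen subring_uminus[OF subfield_imp_subring[OF Kf]] by simp
      next
        case (m_inv h)
        then show ?case using \<theta>_inv gen subfield_inverse[OF Kf] by simp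
      next
        case (eng_add h1 h2)
        then show ?case using th.hom_add gen subring_add[OF subfield_imp_subring[OF Kf]] by simp
      next
        case (eng_mult h1 h2)
        then show ?case using th.hom_mult gen subring_mult[OF subfield_imp_subring[OF Kf]] by simp
      qed
    qed
    \<comment> \<open>For the other inclusion, the image of the generated subfield is a field that
      contains T and kbar.\<close>
    define W where "W = \<theta> ` generate_field (geometric_ring \<E>) ?S"
    have "x - y \<in> W \<and> x * y \<in> W \<and> inverse x \<in> W" if xy: "x \<in> W" "y \<in> W" for x y
    proof -
      obtain u v where uv: "u \<in> generate_field (geometric_ring \<E>) ?S" "x = \<theta> u"
        "v \<in> generate_field (geometric_ring \<E>) ?S" "y = \<theta> v" using xy by (auto simp: W_def)
      have c: "u \<in> carrier (geometric_ring \<E>)" "v \<in> carrier (geometric_ring \<E>)" using gen uv by auto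
      have "x - y = \<theta> (u \<oplus>\<^bsub>geometric_ring \<E>\<^esub> (\<ominus>\<^bsub>geometric_ring \<E>\<^esub> v))"
        using th.hom_add[OF c(1) GR.a_inv_closed[OF c(2)]] \<theta>_uminus[OF c(2)] uv by simp
      moreover have "x * y = \<theta> (u \<otimes>\<^bsub>geometric_ring \<E>\<^esub> v)" using th.hom_mult[OF c] uv by simp
      moreover have "inverse x \<in> W"
      proof (cases "u = \<zero>\<^bsub>geometric_ring \<E>\<^esub>")
        case True
        then show ?thesis using xy(1) uv(2) th.hom_zero by simp
      next
        case False
        have "inverse x = \<theta> (inv\<^bsub>geometric_ring \<E>\<^esub> u)" using \<theta>_inv[OF c(1) False] uv(2) by simp
        then show ?thesis using generate_field.m_inv[OF uv(1) False] by (simp add: W_def)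
      qed
      ultimately show ?thesis
        using uv by (auto simp: W_def intro!: imageI generate_field.eng_add generate_field.eng_mult generate_field.a_inv)
    qed
    moreover have "1 \<in> W" using th.hom_one generate_field.one[of "geometric_ring \<E>" ?S] by (force simp: W_def)
    ultimately have Wf: "subfield_set W" by (auto simp: subfield_set_def subring_set_def)
    have inW: "\<theta> x \<in> W" if "x \<in> ?S" for x using that generate_field.incl[of x ?S] by (auto simp: W_def)
    have kbW: "base_closure \<subseteq> W"
    proof
      fix c :: "'k ratfun_closure" assume "c \<in> base_closure"
      then show "c \<in> W" using inW[of "geometric_tensor \<E> 1 c"] \<theta>(2)[OF subring_1[OF E_ring]] by simp
    qed
    moreover have "ratfun_var \<in> W"
      using inW[of "geometric_tensor \<E> ratfun_var 1"] \<theta>(2)[of ratfun_var 1] var K0E subring_1[OF kbR] by auto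
    ultimately have "ratfun_field \<subseteq> W" using ratfun_field_subset[OF Wf] kb(2) by blast
    then have "?K \<subseteq> W" using comp_ring_subset[OF subfield_imp_subring[OF Wf] _ kbW] by blast
    then show "?K \<subseteq> \<theta> ` geometric_base \<E>" by (simp add: W_def geometric_base_def)
  qed
  \<comment> \<open>With kbar and the trivial group as second factor, the product action extends G
    to F kbar by the identity on constants.\<close>
  let ?T = "G\<lparr>carrier := {\<one>}\<rparr>"
  have triv: "subgroup {\<one>} G" by (rule two.a.triv_subgroup)
  interpret kba: gal_act ?T "base_closure :: 'k ratfun_closure set" base_closure "\<lambda>_ x. x"
    by (rule gal_act.intro)
      (use subgroup.subgroup_is_group[OF triv two.a.grp] kb in \<open>auto simp: ring_endo_def\<close>)
  interpret tk: two_act G F ratfun_field aF ?T base_closure base_closure "\<lambda>_ x. x" base_field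
    by unfold_locales (use k two.kK0 kb lin_disjoint_F_kb two.field_above in auto)
  have tkM: "tk.M = L" by (simp add: tk.M_def)
  interpret gt: gal_transport "G \<times>\<times> ?T" tk.M ?K tk.act2 "geometric_ring \<E>" \<theta> "geometric_base \<E>"
  proof (intro gal_transport.intro gal_transport_axioms.intro ringG)
    show "gal_act (G \<times>\<times> ?T) tk.M ?K tk.act2" by (rule tk.prod.gal_act_axioms)
    show "geometric_base \<E> \<subseteq> carrier (geometric_ring \<E>)"
      using GR.generate_field_in_carrier[OF S] by (auto simp: geometric_base_def)
  qed (use \<theta>(1) tkM base in auto)
  have "gal_group (geometric_ring \<E>) (geometric_base \<E>) \<cong> G \<times>\<times> ?T"
  proof (rule gt.gal_group_iso)
    fix \<sigma> assume s: "ring_endo tk.M \<sigma>" "bij_betw \<sigma> tk.M tk.M" "\<And>x. x \<in> ?K \<Longrightarrow> \<sigma> x = x"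
    note tkR = tk.M_ring
    have sK: "\<sigma> x = x" if "x \<in> ratfun_field \<or> x \<in> base_closure" for x
      using s(3) comp_ring_left[OF KR kbR] comp_ring_right[OF KR kbR] that by blast
    \<comment> \<open>An automorphism over kbar(T) sends x in F to a root of the orbit polynomial of
      x, so it maps F to itself.\<close>
    have orb: "\<exists>g\<in>carrier G. \<sigma> x = aF g x" if x: "x \<in> F" for x
    proof -
      obtain p where p: "coeffs_in ratfun_field p" "\<And>y. poly p y = 0 \<longleftrightarrow> (\<exists>g\<in>carrier G. y = aF g x)"
        using two.a.orbit_poly[OF x] by metis
      have px: "poly p x = 0" using p(2) two.a.act_one[OF x] two.a.one_closed by metis
      have "\<sigma> (poly p x) = poly p (\<sigma> x)"
        using p(1) sK FK tk.FM x by (intro endo_poly_fixed[OF tkR s(1)]) (auto simp: coeffs_in_def)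
      then have "poly p (\<sigma> x) = 0" using px endo_0[OF tkR s(1)] by simp
      then show ?thesis using p(2) by blast
    qed
    have sF: "\<sigma> x \<in> F" if "x \<in> F" for x using orb[OF that] two.a.act_in that by force
    have inj: "inj_on \<sigma> F" using s(2) tk.FM by (meson bij_betw_imp_inj_on inj_on_subset)
    have "bij_betw \<sigma> F F"
      unfolding bij_betw_def
    proof (intro conjI equalityI subsetI)
      fix y assume y: "y \<in> F"
      define Y where "Y = (\<lambda>g. aF g y) ` carrier G"
      have "y \<in> Y" unfolding Y_def
        by (rule image_eqI[where x = "\<one>"]) (simp_all add: two.a.act_one[OF y])
      then have Y: "finite Y" "Y \<subseteq> F" "y \<in> Y" using two.a.fin two.a.act_in y by (auto simp: Y_def)
      \<comment> \<open>For surjectivity on F: the finite orbit of y is mapped injectively into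
        itself, hence onto itself.\<close>
      have "\<sigma> ` Y \<subseteq> Y"
      proof
        fix z assume "z \<in> \<sigma> ` Y"
        then obtain g where g: "g \<in> carrier G" "z = \<sigma> (aF g y)" by (auto simp: Y_def)
        obtain h where h: "h \<in> carrier G" "\<sigma> (aF g y) = aF h (aF g y)" using orb two.a.act_in[OF g(1) y] by blast
        then have "z = aF (h \<otimes> g) y" using g two.a.act_comp[OF h(1) g(1) y] by simp
        then show "z \<in> Y" using g h by (auto simp: Y_def)
      qed
      moreover have "inj_on \<sigma> Y" using inj Y(2) inj_on_subset by blast
      ultimately have "\<sigma> ` Y = Y" using Y(1) by (simp add: card_image card_subset_eq)
      then show "y \<in> \<sigma> ` F" using Y by blast
    qed (use inj sF in auto)
    moreover have "ring_endo F \<sigma>"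
      using s(1) sF tk.FM unfolding ring_endo_def by blast
    ultimately obtain g where g: "g \<in> carrier G" "\<forall>x\<in>F. aF g x = \<sigma> x" using full sK by blast
    have g1: "(g, \<one>) \<in> carrier (G \<times>\<times> ?T)" using g(1) by simp
    have one: "\<one> \<in> carrier ?T" by simp
    have e: "ring_endo tk.M (tk.act2 (g, \<one>))" using tk.act2_endo[OF g(1) one] .
    have "tk.act2 (g, \<one>) x = \<sigma> x" if "x \<in> comp_ring F base_closure" for x
      using that
    proof induction
      case zero
      then show ?case using endo_0[OF tkR e] endo_0[OF tkR s(1)] by simp
    next
      case (step a c x)
      have m: "a \<in> tk.M" "c \<in> tk.M" "a * c \<in> tk.M" "x \<in> tk.M"
        using step tk.FM tk.DM tkM comp_ring_prod by auto
      then show ?case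
        using step g(2) sK[of c] tk.act2_prod[OF g(1) one, of a c]
        by (simp add: endo_add[OF tkR e] endo_add[OF tkR s(1)] endo_mult[OF tkR s(1)])
    qed
    then show "\<exists>g\<in>carrier (G \<times>\<times> ?T). \<forall>x\<in>tk.M. tk.act2 g x = \<sigma> x" using g1 tkM by blast
  qed
  moreover have "fst \<in> iso (G \<times>\<times> ?T) G"
    by (auto simp: iso_def hom_def bij_betw_def inj_on_def image_iff)
  then have "G \<times>\<times> ?T \<cong> G" by (rule is_isoI)
  ultimately have "gal_group (geometric_ring \<E>) (geometric_base \<E>) \<cong> G" by (rule iso_trans)
  then show ?thesis using finite_extension_E gt.galois by (simp add: geometrically_galois_def)
qed

section \<open>The specialization at the point\<close>

lemma transversal:
  obtains T where "finite T" "T \<subseteq> carrier G" "card T = card (rcosets H)"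
    "\<And>g. g \<in> carrier G \<Longrightarrow> \<exists>r\<in>T. \<exists>h\<in>H. g = h \<otimes> r"
    "\<And>r r' h. r \<in> T \<Longrightarrow> r' \<in> T \<Longrightarrow> h \<in> H \<Longrightarrow> r' = h \<otimes> r \<Longrightarrow> r' = r"
proof -
  define q where "q c = (SOME r. r \<in> carrier G \<and> c = H #> r)" for c
  have q: "q c \<in> carrier G" "c = H #> q c" if "c \<in> rcosets H" for c
  proof -
    have "\<exists>r. r \<in> carrier G \<and> c = H #> r" using that by (auto simp: RCOSETS_def)
    then have "q c \<in> carrier G \<and> c = H #> q c" unfolding q_def by (rule someI_ex)
    then show "q c \<in> carrier G" "c = H #> q c" by auto
  qed
  let ?T = "q ` (rcosets H)"
  have "finite (rcosets H)" using two.a.fin by (auto simp: RCOSETS_def)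
  moreover have "inj_on q (rcosets H)" by (rule inj_onI) (metis q(2))
  moreover have "\<exists>r\<in>?T. \<exists>h\<in>H. g = h \<otimes> r" if g: "g \<in> carrier G" for g
  proof -
    have c: "H #> g \<in> rcosets H" using g by (auto simp: RCOSETS_def)
    have "g \<in> H #> g" using g H1 by (auto simp: r_coset_def intro!: bexI[of _ \<one>])
    then have "g \<in> H #> q (H #> g)" using q(2)[OF c] by simp
    then show ?thesis using c by (auto simp: r_coset_def)
  qed
  moreover have "r' = r" if r: "r \<in> ?T" "r' \<in> ?T" "h \<in> H" "r' = h \<otimes> r" for r r' h
  proof -
    obtain c c' where c: "c \<in> rcosets H" "r = q c" "c' \<in> rcosets H" "r' = q c'" using r by auto
    have rG: "r \<in> carrier G" using q(1) c by auto
    have "r' \<in> H #> r" using r(3,4) by (auto simp: r_coset_def)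
    then have "H #> r = H #> r'" using two.a.repr_independence[OF _ rG sub] by blast
    then have "c = c'" using q(2)[OF c(1)] q(2)[OF c(3)] c by simp
    then show ?thesis using c by simp
  qed
  ultimately show ?thesis
    by (intro that[of ?T]) (use q(1) in \<open>auto simp: card_image\<close>)
qed

text \<open>A pure tensor is sent to its residues under the \<open>\<psi> r\<close>, with one factor
  E for each right coset. For the kernel, every element is congruent to some w tensor 1; if the
  residues of w vanish, then w = \<pi> w', and w tensor 1 equals w' tensor the class of \<pi>, which
  is 0.\<close>

lemma specializes_E: "specializes_to_power \<E> t E (card (rcosets H))"
proof -
  let ?V = "chart base_field t" and ?I = "point_ideal base_field t" and ?\<pi> = "uniformizer t"
  note VR = V(1)
  have IV: "?I = {v \<in> ?V. \<phi> v = 0}"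
    using residue_ideal phi_A VA by blast
  obtain T where T: "finite T" "T \<subseteq> carrier G" "card T = card (rcosets H)"
    "\<And>g. g \<in> carrier G \<Longrightarrow> \<exists>r\<in>T. \<exists>h\<in>H. g = h \<otimes> r"
    "\<And>r r' h. r \<in> T \<Longrightarrow> r' \<in> T \<Longrightarrow> h \<in> H \<Longrightarrow> r' = h \<otimes> r \<Longrightarrow> r' = r"
    by (rule transversal) (rule that)
  obtain rs where rs: "set rs = T" "distinct rs" using finite_distinct_list[OF T(1)] by blast
  define n where "n = length rs"
  have n: "n = card (rcosets H)" using rs T(3) distinct_card[of rs] by (simp add: n_def)
  have rsG: "r \<in> carrier G" if "r \<in> set rs" for r using that rs T(2) by auto
  have VO: "?V \<subseteq> Oc" using VA AO by blast
  have phi_hom: "\<phi> \<in> ring_hom (sring ?V) (sring base_field)"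
    using phi_in phi_add phi_mult phi_k[OF subring_1[OF kR]] subsetD[OF VO] by (auto simp: ring_hom_def)
  interpret ph: ring_hom_ring "sring ?V" "sring base_field" \<phi>
    by (rule ring_hom_ringI2[OF ring_sring[OF VR] ring_sring[OF kR] phi_hom])
  have ker: "a_kernel (sring ?V) (sring base_field) \<phi> = ?I"
    unfolding a_kernel_def' IV by simp
  have I_ideal: "ideal ?I (sring ?V)" using ph.kernel_is_ideal unfolding ker .
  interpret I: ideal ?I "sring ?V" by (rule I_ideal)
  have cringB: "cring (residue_ring t)"
    unfolding residue_ring_def by (rule I.quotient_is_cring[OF cring_sring[OF VR]])
  interpret B: cring "residue_ring t" by (rule cringB)
  have rm_hom: "residue_map t \<in> ring_hom (sring ?V) (residue_ring t)"
    unfolding residue_map_def[abs_def] residue_ring_def by (rule I.rcos_ring_hom)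
  have rm_surj: "\<exists>v\<in>?V. b = residue_map t v" if "b \<in> carrier (residue_ring t)" for b
    using that by (auto simp: residue_ring_def FactRing_def A_RCOSETS_def' residue_map_def)
  \<comment> \<open>This identifies the residue ring with k: a coset is sent to the common value of
    \<phi> on it.\<close>
  define val where "val b = the_elem (\<phi> ` b)" for b
  have val: "val (residue_map t v) = \<phi> v" if "v \<in> ?V" for v
    using ph.the_elem_simp[of v] that unfolding ker by (simp add: val_def residue_map_def)
  note rm = ring_hom_memE[OF rm_hom]
  have val_add: "val (b \<oplus>\<^bsub>residue_ring t\<^esub> b') = val b + val b'"
    and val_mult: "val (b \<otimes>\<^bsub>residue_ring t\<^esub> b') = val b * val b'"
    and val_k: "val b \<in> base_field"
    if bb: "b \<in> carrier (residue_ring t)" "b' \<in> carrier (residue_ring t)" for b b'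
  proof -
    obtain v v' where v: "v \<in> ?V" "b = residue_map t v" "v' \<in> ?V" "b' = residue_map t v'"
      using rm_surj bb by blast
    then have "b \<oplus>\<^bsub>residue_ring t\<^esub> b' = residue_map t (v + v')" "b \<otimes>\<^bsub>residue_ring t\<^esub> b' = residue_map t (v * v')"
      using rm(2)[of v v'] rm(3)[of v v'] by simp_all
    then show "val (b \<oplus>\<^bsub>residue_ring t\<^esub> b') = val b + val b'" "val (b \<otimes>\<^bsub>residue_ring t\<^esub> b') = val b * val b'"
      "val b \<in> base_field"
      using v val VO subring_add[OF VR] subring_mult[OF VR] phi_in by (auto simp: phi_add phi_mult subsetD)
  qed
  have one: "\<one>\<^bsub>residue_ring t\<^esub> = residue_map t 1" using rm(4) by simp
  have val_one: "val \<one>\<^bsub>residue_ring t\<^esub> = 1"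
    unfolding one using val[OF subring_1[OF VR]] phi_k[OF subring_1[OF kR]] by simp
  have U_cc: "cover_chart base_field \<E> t = U" by (simp add: cover_chart_eq U_def)
  interpret T: tensor "sring U" "residue_ring t" "sring ?V" id "residue_map t"
    by (intro tensor.intro free_pair.intro tensor_axioms.intro cring_sring[OF U_ring] cringB)
      (use VU rm(1) in auto)
  define \<beta> where "\<beta> r p = \<psi> r (fst p) * val (snd p)" for r p
  define h where "h x = map (\<lambda>r. frag_eval (\<beta> r) x) rs" for x
  have \<beta>E: "\<beta> r p \<in> E" if "r \<in> set rs" "p \<in> T.D" for r p
  proof -
    have p: "fst p \<in> U" "snd p \<in> carrier (residue_ring t)" using that(2) by auto
    have "val (snd p) \<in> E" using val_k[OF p(2) p(2)] E by blast
    then show ?thesis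
      unfolding \<beta>_def using subring_mult[OF ER psi_endo(3)[OF rsG[OF that(1)] p(1) p(1)]] by simp
  qed
  have psi_0: "\<psi> r 0 = 0" if "r \<in> set rs" for r
    using psi_V[OF rsG[OF that] subring_0[OF VR]] endo_0[OF O_ring phi_endo] by simp
  have hE: "length (h x) = n \<and> set (h x) \<subseteq> E" if "x \<in> carrier T.R" for x
    using frag_eval_in[OF ER, of x T.D] \<beta>E that by (auto simp: h_def n_def)
  have "\<exists>\<theta>\<in>ring_iso (tensor_ring (sring ?V) (sring U) (residue_ring t) id (residue_map t)) (power_ring E n).
      \<forall>a\<in>carrier (sring U). \<forall>b\<in>carrier (residue_ring t).
        \<theta> (pure_tensor (sring ?V) (sring U) (residue_ring t) id (residue_map t) a b) = h (frag_of (a, b))"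
  proof (rule T.tensor_iso)
    show "ring (power_ring E n)" by (rule ring_power_ring[OF ER])
    show "h \<in> ring_hom T.R (power_ring E n)"
    proof (rule ring_hom_memI)
      fix x y assume xy: "x \<in> carrier T.R" "y \<in> carrier T.R"
      show "h x \<in> carrier (power_ring E n)" using hE[OF xy(1)] by (simp add: power_ring_carrier)
      have "frag_eval (\<beta> r) (T.mul x y) = frag_eval (\<beta> r) x * frag_eval (\<beta> r) y" if r: "r \<in> set rs" for r
        using xy psi_endo(2)[OF rsG[OF r]] val_mult
        by (intro T.frag_eval_mul) (auto simp: \<beta>_def T.pmul_def)
      then have "h (T.mul x y) = map2 (*) (h x) (h y)"
        by (simp add: h_def map2_map_map)
      then show "h (x \<otimes>\<^bsub>T.R\<^esub> y) = h x \<otimes>\<^bsub>power_ring E n\<^esub> h y"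
        using hE[OF xy(1)] hE[OF xy(2)] by (simp add: power_ring_ops)
      have "h (x + y) = map2 (+) (h x) (h y)"
        by (simp add: h_def map2_map_map frag_eval_add)
      then show "h (x \<oplus>\<^bsub>T.R\<^esub> y) = h x \<oplus>\<^bsub>power_ring E n\<^esub> h y"
        using hE[OF xy(1)] hE[OF xy(2)] by (simp add: power_ring_ops)
    next
      have "\<beta> r (1, \<one>\<^bsub>residue_ring t\<^esub>) = 1" if "r \<in> set rs" for r
        using psi_V[OF rsG[OF that] subring_1[OF VR]] val_one phi_k[OF subring_1[OF kR]] by (simp add: \<beta>_def)
      then have "h \<one>\<^bsub>T.R\<^esub> = map (\<lambda>r. 1) rs" by (simp add: h_def)
      then show "h \<one>\<^bsub>T.R\<^esub> = \<one>\<^bsub>power_ring E n\<^esub>"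
        unfolding power_ring_one n_def map_replicate_const .
    qed
    show "h ` carrier T.R = carrier (power_ring E n)"
    proof
      show "h ` carrier T.R \<subseteq> carrier (power_ring E n)"
        unfolding power_ring_carrier using hE by blast
      show "carrier (power_ring E n) \<subseteq> h ` carrier T.R"
      proof
        fix vs assume "vs \<in> carrier (power_ring E n)"
        then have vs: "length vs = length rs" "set vs \<subseteq> E" by (auto simp: power_ring_carrier n_def)
        \<comment> \<open>Since rs has no repetitions, a list of values can be read as a function on
          T.\<close>
        define v where "v r = the (map_of (zip rs vs) r)" for r
        have v: "map v rs = vs"
          using vs(1) rs(2) by (intro nth_equalityI) (auto simp: v_def map_of_zip_nth)
        have "\<exists>x\<in>U. \<forall>r\<in>T. \<psi> r x = v r"
          by (rule psi_surj[OF T(1,2,5)]) (use v vs rs in auto)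
        then obtain x where x: "x \<in> U" "\<forall>r\<in>T. \<psi> r x = v r" by blast
        have "h (frag_of (x, \<one>\<^bsub>residue_ring t\<^esub>)) = vs"
          using x(2) rs(1) v val_one by (auto simp: h_def \<beta>_def)
        then show "vs \<in> h ` carrier T.R" using x(1) by (intro image_eqI[of _ _ "frag_of (x, \<one>\<^bsub>residue_ring t\<^esub>)"]) auto
      qed
    qed
    have zero: "\<zero>\<^bsub>power_ring E n\<^esub> = map (\<lambda>r. 0) rs"
      by (simp add: power_ring_zero n_def map_replicate_const)
    show "h x = \<zero>\<^bsub>power_ring E n\<^esub>" if x: "x \<in> T.relations" for x
    proof -
      have "frag_eval (\<beta> r) x = 0" if r: "r \<in> set rs" for r
        using x psi_endo(1,2)[OF rsG[OF r]] val_add val_mult psi_V[OF rsG[OF r]] val VU rm(1)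
        by (auto simp: T.relations_def frag_eval_diff \<beta>_def ring_distribs ac_simps subsetD)
      then show ?thesis by (simp add: zero h_def)
    qed
    show "(\<Sum>p\<leftarrow>ps. frag_of p) \<in> T.J"
      if ps: "set ps \<subseteq> T.D" "h (\<Sum>p\<leftarrow>ps. frag_of p) = \<zero>\<^bsub>power_ring E n\<^esub>" for ps
    proof -
      \<comment> \<open>Every b in the residue ring is the class of some v in V, so u tensor b is v
        u tensor 1, and a sum of such tensors collapses to a single w tensor 1.\<close>
      have "\<exists>w\<in>U. (\<Sum>p\<leftarrow>qs. frag_of p) - frag_of (w, \<one>\<^bsub>residue_ring t\<^esub>) \<in> T.J \<and>
          (\<forall>r\<in>set rs. frag_eval (\<beta> r) (\<Sum>p\<leftarrow>qs. frag_of p) = \<psi> r w)" if "set qs \<subseteq> T.D" for qs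
        using that
      proof (induction qs)
        case Nil
        have "0 - frag_of (0, \<one>\<^bsub>residue_ring t\<^esub>) \<in> T.J"
          using T.J_diff[OF T.J_0 T.J_zero_left[OF B.one_closed]] by simp
        then have "(\<Sum>p\<leftarrow>[]. frag_of p) - frag_of (0, \<one>\<^bsub>residue_ring t\<^esub>) \<in> T.J"
          by (simp only: list.map sum_list.Nil)
        moreover have "\<forall>r\<in>set rs. frag_eval (\<beta> r) (\<Sum>p\<leftarrow>[]. frag_of p) = \<psi> r 0" using psi_0 by simp
        ultimately show ?case using subring_0[OF U_ring] by blast
      next
        case (Cons p qs)
        have "set qs \<subseteq> T.D" using Cons.prems by simp
        from Cons.IH[OF this] obtain w where w:
          "w \<in> U" "(\<Sum>p\<leftarrow>qs. frag_of p) - frag_of (w, \<one>\<^bsub>residue_ring t\<^esub>) \<in> T.J"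
          "\<forall>r\<in>set rs. frag_eval (\<beta> r) (\<Sum>p\<leftarrow>qs. frag_of p) = \<psi> r w" by (elim bexE conjE) (rule that)
        obtain u b where p: "p = (u, b)" "u \<in> U" "b \<in> carrier (residue_ring t)" using Cons.prems by (cases p) auto
        obtain v where v: "v \<in> ?V" "b = residue_map t v" using rm_surj[OF p(3)] by blast
        have vu: "v * u \<in> U" using v p VU subring_mult[OF U_ring] by blast
        have "frag_of (v * u, \<one>\<^bsub>residue_ring t\<^esub>) - frag_of (u, b) \<in> T.J"
          using T.J_rel3[of v u "\<one>\<^bsub>residue_ring t\<^esub>"] v p rm(1)[of v] by simp
        moreover have "frag_of (v * u + w, \<one>\<^bsub>residue_ring t\<^esub>) - frag_of (v * u, \<one>\<^bsub>residue_ring t\<^esub>) -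
            frag_of (w, \<one>\<^bsub>residue_ring t\<^esub>) \<in> T.J"
          using T.J_rel1[of "v * u" w "\<one>\<^bsub>residue_ring t\<^esub>"] vu w(1) by simp
        ultimately have "((\<Sum>p\<leftarrow>qs. frag_of p) - frag_of (w, \<one>\<^bsub>residue_ring t\<^esub>))
            - (frag_of (v * u, \<one>\<^bsub>residue_ring t\<^esub>) - frag_of (u, b))
            - (frag_of (v * u + w, \<one>\<^bsub>residue_ring t\<^esub>) - frag_of (v * u, \<one>\<^bsub>residue_ring t\<^esub>) -
            frag_of (w, \<one>\<^bsub>residue_ring t\<^esub>)) \<in> T.J"
          using w(2) T.J_diff by blast
        then have "(\<Sum>p\<leftarrow>p # qs. frag_of p) - frag_of (v * u + w, \<one>\<^bsub>residue_ring t\<^esub>) \<in> T.J"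
          by (simp add: p(1) algebra_simps)
        moreover have "frag_eval (\<beta> r) (\<Sum>p\<leftarrow>p # qs. frag_of p) = \<psi> r (v * u + w)" if r: "r \<in> set rs" for r
          using w r p(1,2) v psi_endo(1)[OF rsG[OF r] vu w(1)] psi_endo(2)[OF rsG[OF r], of v u] VU
            psi_V[OF rsG[OF r] v(1)] val[OF v(1)]
          by (simp add: frag_eval_add \<beta>_def mult.commute subsetD)
        ultimately show ?case using subring_add[OF U_ring vu w(1)] by blast
      qed
      from this[OF ps(1)] obtain w where w: "w \<in> U" "(\<Sum>p\<leftarrow>ps. frag_of p) - frag_of (w, \<one>\<^bsub>residue_ring t\<^esub>) \<in> T.J"
        "\<forall>r\<in>set rs. frag_eval (\<beta> r) (\<Sum>p\<leftarrow>ps. frag_of p) = \<psi> r w" by (elim bexE conjE) (rule that)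
      have "\<psi> r w = 0" if "r \<in> T" for r
        using ps(2) w(3) that rs(1) unfolding zero h_def by simp
      then have wU: "w / ?\<pi> \<in> U" by (intro psi_kernel[OF T(2,4) w(1)])
      \<comment> \<open>Moving \<pi> across the tensor sign puts its class, which is 0, into the
        second factor.\<close>
      have "frag_of (?\<pi> * (w / ?\<pi>), \<one>\<^bsub>residue_ring t\<^esub>) - frag_of (w / ?\<pi>, residue_map t ?\<pi>) \<in> T.J"
        using T.J_rel3[of ?\<pi> "w / ?\<pi>" "\<one>\<^bsub>residue_ring t\<^esub>"] \<pi>(1) wU rm(1)[of ?\<pi>] by simp
      moreover have "residue_map t ?\<pi> = \<zero>\<^bsub>residue_ring t\<^esub>"
      proof -
        have "?\<pi> \<in> ?I" using residue_ideal \<pi> by blast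
        then show ?thesis
          using I.a_rcos_const[of ?\<pi>] by (simp add: residue_map_def residue_ring_def FactRing_def)
      qed
      ultimately have "frag_of (w, \<one>\<^bsub>residue_ring t\<^esub>) - frag_of (w / ?\<pi>, \<zero>\<^bsub>residue_ring t\<^esub>) \<in> T.J"
        using \<pi>(3) by simp
      moreover have "frag_of (w / ?\<pi>, \<zero>\<^bsub>residue_ring t\<^esub>) \<in> T.J"
        using T.J_zero_right[of "w / ?\<pi>"] wU by simp
      ultimately have "frag_of (w, \<one>\<^bsub>residue_ring t\<^esub>) - frag_of (w / ?\<pi>, \<zero>\<^bsub>residue_ring t\<^esub>) +
          frag_of (w / ?\<pi>, \<zero>\<^bsub>residue_ring t\<^esub>) \<in> T.J" by (rule T.J_add)
      then have "frag_of (w, \<one>\<^bsub>residue_ring t\<^esub>) \<in> T.J" by simp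
      from T.J_add[OF w(2) this] show ?thesis by simp
    qed
  qed
  then obtain \<theta> where \<theta>: "\<theta> \<in> ring_iso (specialization \<E> t) (power_ring E n)"
    "\<forall>a\<in>U. \<forall>b\<in>carrier (residue_ring t).
      \<theta> (pure_tensor (sring ?V) (sring U) (residue_ring t) id (residue_map t) a b) = h (frag_of (a, b))"
    by (auto simp: specialization_def U_cc)
  have "\<theta> (specialization_scalar \<E> t c) = replicate n c" if c: "c \<in> base_field" for c
  proof -
    have cV: "c \<in> ?V" using c V(2) by blast
    have "\<theta> (specialization_scalar \<E> t c) = h (frag_of (c, \<one>\<^bsub>residue_ring t\<^esub>))"
      using \<theta>(2) cV VU by (auto simp: specialization_scalar_def U_cc)
    also have "\<dots> = map (\<lambda>r. c) rs"
      using psi_V[OF rsG cV] phi_k[OF c] val_one by (simp add: h_def \<beta>_def)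
    finally show ?thesis by (simp add: map_replicate_const n_def)
  qed
  then show ?thesis
    unfolding specializes_to_power_def n[symmetric] using k_regular_E not_branch_E \<theta>(1) by blast
qed

end


theorem theorem3p7:
  fixes G :: "('g, 'm) monoid_scheme"
    and F E :: "'k::field ratfun_closure set"
    and P :: "'k cover_point"
    and H :: "'g set"
  assumes "group G" and "finite (carrier G)"
    and trivial_center: "{z \<in> carrier G. \<forall>x\<in>carrier G. z \<otimes>\<^bsub>G\<^esub> x = x \<otimes>\<^bsub>G\<^esub> z} = {\<one>\<^bsub>G\<^esub>}"
    and "k_regular F"
    and "galois_extension (sub_ring F) ratfun_field"
    and "gal_group (sub_ring F) ratfun_field \<cong> G"
    and "P \<in> unramified_rational_points F"
    and "subgroup H G"
    and "galois_extension (sub_ring E) base_field"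
    and "gal_group (sub_ring E) base_field \<cong> G\<lparr>carrier := H\<rparr>"
  shows "\<exists>\<E>. geometrically_galois \<E> G \<and>
             specializes_to_power \<E> (cover_map P) E (card (rcosets\<^bsub>G\<^esub> H)) \<and>
             galois_closure \<E> \<inter> base_closure = E"
proof -
  obtain t Q where P: "P = (t, Q)" by (cases P)
  have F: "subfield_set F" "ratfun_field \<subseteq> F"
    using \<open>k_regular F\<close> subfield_set_if_subfield by (auto simp: k_regular_def finite_extension_def)
  have Q: "(t, Q) \<in> rational_points F" and nb: "\<not> branch_point F t"
    using \<open>P \<in> unramified_rational_points F\<close> by (simp_all add: unramified_rational_points_def cover_map_def P)
  note residue_ideal = rat_point_of_rational_point(2)[OF F Q]
  interpret unramified_rat_point base_field base_closure "chart base_field t" F Q "uniformizer t"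
    by (rule unramified_rat_point_of_rational_point[OF F Q nb])
  have Hgrp: "group (G\<lparr>carrier := H\<rparr>)"
    using subgroup.subgroup_is_group[OF \<open>subgroup H G\<close> \<open>group G\<close>] .
  have Hfin: "finite (carrier (G\<lparr>carrier := H\<rparr>))"
    using finite_subset[OF subgroup.subset[OF \<open>subgroup H G\<close>] \<open>finite (carrier G)\<close>] by simp
  obtain aF where aF: "gal_act G F ratfun_field aF"
    and full: "\<And>\<sigma>. ring_endo F \<sigma> \<Longrightarrow> bij_betw \<sigma> F F \<Longrightarrow> (\<And>x. x \<in> ratfun_field \<Longrightarrow> \<sigma> x = x) \<Longrightarrow>
      \<exists>g\<in>carrier G. \<forall>x\<in>F. aF g x = \<sigma> x"
    using gal_act_of_galois[OF assms(1,2,5,6)] by (metis (no_types, lifting))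
  obtain aE where aE: "gal_act (G\<lparr>carrier := H\<rparr>) E base_field aE"
    using gal_act_of_galois[OF Hgrp Hfin assms(9,10)] by (metis (no_types, lifting))
  interpret e: gal_act "G\<lparr>carrier := H\<rparr>" E base_field aE by (rule aE)
  \<comment> \<open>An element of E is a root of its monic orbit polynomial over k, hence lies in
    kbar.\<close>
  have E_kb: "E \<subseteq> base_closure"
  proof
    fix x assume x: "x \<in> E"
    obtain p where p: "coeffs_in base_field p" "lead_coeff p = 1"
      "\<And>y. poly p y = 0 \<longleftrightarrow> (\<exists>g\<in>carrier (G\<lparr>carrier := H\<rparr>). y = aE g x)"
      by (rule e.orbit_poly[OF x]) (rule that)
    have "poly p x = 0" using p(3) e.act_one[OF x] e.one_closed by metis
    then show "x \<in> base_closure" using p(1,2) by (auto simp: base_closure_eq integral_over_def)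
  qed
  interpret ratfun_twist t F Q G aF H E aE
  proof (intro ratfun_twist.intro twist.intro two_act.intro two_act_axioms.intro twist_axioms.intro
      ratfun_twist_axioms.intro)
    show "lin_disjoint base_field F E" by (rule lin_disjoint_mono[OF lin_disjoint_F_kb order_refl E_kb])
    show "subfield_set R" if "subring_set R" "ratfun_field \<subseteq> R" for R :: "'k ratfun_closure set"
      by (rule field_above_ratfun_field[OF that])
    show "v / uniformizer t \<in> chart base_field t" if v: "v \<in> chart base_field t" "v \<in> Q" for v
    proof -
      obtain w where "w \<in> chart base_field t" "v = w * uniformizer t"
        using v residue_ideal by (auto simp: point_ideal_eq)
      then show ?thesis using uniformizer_nz[of t] by simp
    qed
    show "z = \<one>\<^bsub>G\<^esub>" if "z \<in> carrier G" "\<And>x. x \<in> carrier G \<Longrightarrow> z \<otimes>\<^bsub>G\<^esub> x = x \<otimes>\<^bsub>G\<^esub> z" for z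
      using that trivial_center by blast
  qed (fact unramified_rat_point_axioms aF aE subfield_base_field base_field_subset order_refl E_kb
      chart_ratfun assms(8) chart_normal nb residue_ideal full)+
  show ?thesis
    using geometrically_galois_E specializes_E galois_closure_E by (auto simp: P cover_map_def)
qed

end
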